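(* Let $n\ge 1$ and $\sigma\in B_n$. If $\psi(\widehat{\sigma})\ne0$ in $\mathrm{Kh}(\widehat\sigma)$ and $\psi(m(\widehat{\sigma}))\ne0$ in $\mathrm{Kh}(m(\widehat\sigma))$, where $\psi$ is Plamenevskaya's invariant and $m(\widehat\sigma)$ is the mirror of the closed braid $\widehat\sigma$, then $\sigma$ is the trivial braid $\mathbb{1}\in B_n$.
   Context: $B_n$ is the $n$-strand braid group with Artin generators $\sigma_1,\dots,\sigma_{n-1}$, where $\sigma_i$ is a positive half twist (positive crossing) between strands $i$ and $i+1$; $\widehat{\sigma}$ is the closure of $\sigma$, oriented as a closed braid. The mirror $m(\sigma)\in B_n$ is the braid obtained from a word for $\sigma$ by replacing each letter $\sigma_i^{\pm1}$ with $\sigma_i^{\mp1}$ (keeping the order of the letters), and $m(\widehat{\sigma})$ is the closed braid $\widehat{m(\sigma)}$. Coefficients are in $\mathbb{F}=\mathbb{Z}/2\mathbb{Z}$. Plamenevskaya's invariant. For $\sigma\in B_n$, let $D$ be the closed braid diagram of $\widehat{\sigma}$ given by a word for $\sigma$, and let $\mathrm{CKh}(D)$ be the Khovanov complex: generated over $\mathbb{F}$ by complete resolutions of $D$ (for a positive crossing the $0$-resolution is the oriented one, for a negative crossing the $1$-resolution is) with each circle labeled $v_+$ or $v_-$; the differential is the sum over all changes of one $0$-resolution to a $1$-resolution of the merge maps ($v_+\otimes v_+\mapsto v_+$, $v_+\otimes v_-,\,v_-\otimes v_+\mapsto v_-$, $v_-\otimes v_-\mapsto 0$) and split maps ($v_+\mapsto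 v_+\otimes v_-+v_-\otimes v_+$, $v_-\mapsto v_-\otimes v_-$). The generator given by the oriented (braid-like) resolution, consisting of $n$ concentric circles, with all circles labeled $v_-$, is a cycle, and $\psi(\widehat{\sigma})\in\mathrm{Kh}(\widehat{\sigma})$ is its homology class. It is an invariant of the transverse link represented by the closed braid $\widehat\sigma$; in particular whether it vanishes depends only on the conjugacy class of $\sigma$. *)

theory Defs
  imports "HOL-Algebra.Coset" "HOL-Library.Z2" "HOL-Library.FuncSet"
begin

section \<open>The braid group\<close>

text \<open>The letter \<open>(i, True)\<close> is the Artin generator \<open>\<sigma>\<^sub>i\<close> (a positive crossing between the
  strands \<open>i\<close> and \<open>i + 1\<close>), and \<open>(i, False)\<close> is its inverse.\<close>

type_synonym braid_word = "(nat \<times> bool) list"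

definition braid_words :: "nat \<Rightarrow> braid_word set" where
  "braid_words n = lists ({1..<n} \<times> UNIV)"

inductive braid_eq :: "nat \<Rightarrow> braid_word \<Rightarrow> braid_word \<Rightarrow> bool" for n where
  refl: "w \<in> braid_words n \<Longrightarrow> braid_eq n w w"
| sym: "braid_eq n u v \<Longrightarrow> braid_eq n v u"
| trans: "braid_eq n u v \<Longrightarrow> braid_eq n v w \<Longrightarrow> braid_eq n u w"
| append: "braid_eq n u u' \<Longrightarrow> braid_eq n v v' \<Longrightarrow> braid_eq n (u @ v) (u' @ v')"
| cancel: "i \<in> {1..<n} \<Longrightarrow> braid_eq n [(i, e), (i, \<not> e)] []"
| commute: "i \<in> {1..<n} \<Longrightarrow> j \<in> {1..<n} \<Longrightarrow> i + 2 \<le> j \<Longrightarrow>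
    braid_eq n [(i, True), (j, True)] [(j, True), (i, True)]"
| braid: "i \<in> {1..<n} \<Longrightarrow> i + 1 \<in> {1..<n} \<Longrightarrow>
    braid_eq n [(i, True), (i + 1, True), (i, True)] [(i + 1, True), (i, True), (i + 1, True)]"

definition braid_of :: "nat \<Rightarrow> braid_word \<Rightarrow> braid_word set" where
  "braid_of n w = {v. braid_eq n w v}"

definition braid_group :: "nat \<Rightarrow> braid_word set monoid" where
  "braid_group n =
    \<lparr>carrier = braid_of n ` braid_words n,
     mult = (\<lambda>\<sigma> \<tau>. \<Union>u\<in>\<sigma>. \<Union>v\<in>\<tau>. braid_of n (u @ v)),
     one = braid_of n []\<rparr>"

definition mirror_word :: "braid_word \<Rightarrow> braid_word" where
  "mirror_word w = map (\<lambda>(i, e). (i, \<not> e)) w"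

text \<open>The image of a class of words is again a class; see \<open>mirror_braid_of\<close> below.\<close>

definition mirror_braid :: "braid_word set \<Rightarrow> braid_word set" where
  "mirror_braid \<sigma> = mirror_word ` \<sigma>"

lemma mirror_word_mirror_word [simp]: "mirror_word (mirror_word w) = w"
  by (induction w) (auto simp: mirror_word_def)

lemma mirror_word_in [simp]: "mirror_word w \<in> braid_words n \<longleftrightarrow> w \<in> braid_words n"
  by (induction w) (auto simp: mirror_word_def braid_words_def)

lemma rev_in_braid_words [simp]: "rev w \<in> braid_words n \<longleftrightarrow> w \<in> braid_words n"
  by (simp add: braid_words_def in_lists_conv_set)

lemma braid_eq_words: "braid_eq n u v \<Longrightarrow> u \<in> braid_words n \<and> v \<in> braid_words n"
  by (induction rule: braid_eq.induct) (auto simp: braid_words_def)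

lemma braid_of_eq_iff:
  "u \<in> braid_words n \<Longrightarrow> braid_of n u = braid_of n v \<longleftrightarrow> braid_eq n u v"
  unfolding braid_of_def by (auto intro: braid_eq.intros)

lemma braid_of_mult:
  assumes "u \<in> braid_words n" "v \<in> braid_words n"
  shows "braid_of n u \<otimes>\<^bsub>braid_group n\<^esub> braid_of n v = braid_of n (u @ v)"
proof -
  have "braid_of n (u' @ v') = braid_of n (u @ v)" if "braid_eq n u u'" "braid_eq n v v'" for u' v'
    using that unfolding braid_of_def by (blast intro: braid_eq.intros)
  then show ?thesis
    using assms unfolding braid_group_def by (auto simp: braid_of_def intro: braid_eq.refl)
qed

lemma braid_eq_inverse:
  "w \<in> braid_words n \<Longrightarrow> braid_eq n (rev (mirror_word w) @ w) []"
proof (induction w)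
  case Nil
  then show ?case by (simp add: mirror_word_def braid_eq.refl)
next
  case (Cons x w)
  obtain i e where x: "x = (i, e)" by (cases x)
  have i: "i \<in> {1..<n}" and w: "w \<in> braid_words n"
    using Cons.prems by (auto simp: x braid_words_def)
  have m: "rev (mirror_word w) \<in> braid_words n"
    using w by simp
  have "braid_eq n ([(i, \<not> e), (i, e)] @ w) ([] @ w)"
    using braid_eq.cancel[OF i, of "\<not> e"] w by (intro braid_eq.append braid_eq.refl) auto
  then have "braid_eq n (rev (mirror_word w) @ [(i, \<not> e), (i, e)] @ w) (rev (mirror_word w) @ w)"
    using braid_eq.append[OF braid_eq.refl[OF m]] by simp
  then show ?case
    using Cons.IH[OF w] by (auto simp: x mirror_word_def intro: braid_eq.trans)
qed

lemma braid_group_group: "group (braid_group n)"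
proof (rule groupI)
  fix x y assume "x \<in> carrier (braid_group n)" "y \<in> carrier (braid_group n)"
  then obtain u v where *: "u \<in> braid_words n" "v \<in> braid_words n"
    and **: "x = braid_of n u" "y = braid_of n v"
    by (auto simp: braid_group_def)
  have "u @ v \<in> braid_words n"
    using * by (auto simp: braid_words_def)
  then have "braid_of n (u @ v) \<in> carrier (braid_group n)"
    by (auto simp: braid_group_def)
  then show "x \<otimes>\<^bsub>braid_group n\<^esub> y \<in> carrier (braid_group n)"
    using * by (simp add: ** braid_of_mult)
next
  show "\<one>\<^bsub>braid_group n\<^esub> \<in> carrier (braid_group n)"
    by (auto simp: braid_group_def braid_words_def)
next
  fix x y z
  assume "x \<in> carrier (braid_group n)" "y \<in> carrier (braid_group n)" "z \<in> carrier (braid_group n)"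
  then obtain u v w where *: "u \<in> braid_words n" "v \<in> braid_words n" "w \<in> braid_words n"
    and **: "x = braid_of n u" "y = braid_of n v" "z = braid_of n w"
    by (auto simp: braid_group_def)
  have "u @ v \<in> braid_words n" "v @ w \<in> braid_words n"
    using * by (auto simp: braid_words_def)
  then show "x \<otimes>\<^bsub>braid_group n\<^esub> y \<otimes>\<^bsub>braid_group n\<^esub> z
      = x \<otimes>\<^bsub>braid_group n\<^esub> (y \<otimes>\<^bsub>braid_group n\<^esub> z)"
    using * by (simp add: ** braid_of_mult)
next
  fix x assume "x \<in> carrier (braid_group n)"
  then obtain u where *: "u \<in> braid_words n" "x = braid_of n u"
    by (auto simp: braid_group_def)
  have one: "\<one>\<^bsub>braid_group n\<^esub> = braid_of n []" "[] \<in> braid_words n"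
    by (auto simp: braid_group_def braid_words_def)
  show "\<one>\<^bsub>braid_group n\<^esub> \<otimes>\<^bsub>braid_group n\<^esub> x = x"
    using * one by (simp add: braid_of_mult)
  have m: "rev (mirror_word u) \<in> braid_words n"
    using * by simp
  then have "braid_of n (rev (mirror_word u)) \<otimes>\<^bsub>braid_group n\<^esub> x = \<one>\<^bsub>braid_group n\<^esub>"
    using * braid_eq_inverse[OF *(1)] braid_eq_words
    by (auto simp: braid_of_mult one braid_of_eq_iff)
  moreover have "braid_of n (rev (mirror_word u)) \<in> carrier (braid_group n)"
    using m by (auto simp: braid_group_def)
  ultimately show "\<exists>y\<in>carrier (braid_group n). y \<otimes>\<^bsub>braid_group n\<^esub> x = \<one>\<^bsub>braid_group n\<^esub>"
    by blast
qed

lemma mirror_word_append: "mirror_word (u @ v) = mirror_word u @ mirror_word v"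
  by (simp add: mirror_word_def)

lemma braid_eq_invert:
  assumes "braid_eq n u v"
  shows "braid_eq n (rev (mirror_word u)) (rev (mirror_word v))"
proof -
  let ?i = "\<lambda>w. rev (mirror_word w)"
  have iw: "?i w \<in> braid_words n" if "w \<in> braid_words n" for w
    using that by simp
  have uv: "u \<in> braid_words n" "v \<in> braid_words n"
    using braid_eq_words[OF assms] by auto
  have ii: "?i (?i w) = w" for w
    by (induction w) (auto simp: mirror_word_def)
  have "braid_eq n (?i u @ (v @ ?i v)) (?i u @ [])"
    using braid_eq_inverse[OF iw[OF uv(2)]] iw[OF uv(1)]
    by (intro braid_eq.append braid_eq.refl) (auto simp: ii)
  moreover have "braid_eq n ((?i u @ u) @ ?i v) ([] @ ?i v)"
    using braid_eq_inverse[OF uv(1)] iw[OF uv(2)] by (intro braid_eq.append braid_eq.refl) auto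
  moreover have "braid_eq n (?i u @ (u @ ?i v)) (?i u @ (v @ ?i v))"
    using assms iw uv by (intro braid_eq.append braid_eq.refl) auto
  ultimately show ?thesis
    by simp (meson braid_eq.sym braid_eq.trans)
qed

lemma braid_eq_mirror_word:
  "braid_eq n u v \<Longrightarrow> braid_eq n (mirror_word u) (mirror_word v)"
proof (induction rule: braid_eq.induct)
  case (cancel i e)
  show ?case using braid_eq.cancel[OF cancel, of "\<not> e"] by (simp add: mirror_word_def)
next
  case (commute i j)
  show ?case
    using braid_eq.sym[OF braid_eq_invert[OF braid_eq.commute[OF commute]]]
    by (simp add: mirror_word_def)
next
  case (braid i)
  show ?case
    using braid_eq_invert[OF braid_eq.braid[OF braid]] by (simp add: mirror_word_def)
qed (auto simp: mirror_word_append intro: braid_eq.intros)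

lemma mirror_braid_of: "mirror_braid (braid_of n w) = braid_of n (mirror_word w)"
proof
  show "mirror_braid (braid_of n w) \<subseteq> braid_of n (mirror_word w)"
    by (auto simp: mirror_braid_def braid_of_def braid_eq_mirror_word)
  show "braid_of n (mirror_word w) \<subseteq> mirror_braid (braid_of n w)"
  proof
    fix v assume "v \<in> braid_of n (mirror_word w)"
    then have "braid_eq n w (mirror_word v)"
      using braid_eq_mirror_word[of n "mirror_word w" v] by (simp add: braid_of_def)
    then show "v \<in> mirror_braid (braid_of n w)"
      unfolding mirror_braid_def braid_of_def
      by (metis image_eqI mem_Collect_eq mirror_word_mirror_word)
  qed
qed

section \<open>Resolutions of a closed braid diagram\<close>

text \<open>For a word \<open>w\<close> of length \<open>k\<close>, the diagram of the closure is cut at the levels \<open>0, \<dots>, k\<close>;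
  the point \<open>(t, p)\<close> lies on level \<open>t\<close> in position \<open>p\<close>, and the crossing \<open>w ! t\<close> lies between the
  levels \<open>t\<close> and \<open>t + 1\<close>. A resolution is given by the set of its \<open>1\<close>-resolved crossings, and
  each of its circles is represented by the set of the points on it.\<close>

type_synonym point = "nat \<times> nat"
type_synonym circle = "point set"

definition points :: "nat \<Rightarrow> braid_word \<Rightarrow> point set" where
  "points n w = {0..length w} \<times> {1..n}"

definition oriented_at :: "braid_word \<Rightarrow> nat set \<Rightarrow> nat \<Rightarrow> bool" where
  "oriented_at w s t \<longleftrightarrow> (if snd (w ! t) then t \<notin> s else t \<in> s)"

definition level_arcs :: "nat \<Rightarrow> braid_word \<Rightarrow> nat set \<Rightarrow> nat \<Rightarrow> (point \<times> point) set" where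
  "level_arcs n w s t =
    (let i = fst (w ! t) in
      if oriented_at w s t then {((t, p), (Suc t, p)) | p. p \<in> {1..n}}
      else {((t, p), (Suc t, p)) | p. p \<in> {1..n} - {i, i + 1}} \<union>
           {((t, i), (t, i + 1)), ((Suc t, i), (Suc t, i + 1))})"

definition closure_arcs :: "nat \<Rightarrow> braid_word \<Rightarrow> (point \<times> point) set" where
  "closure_arcs n w = {((length w, p), (0, p)) | p. p \<in> {1..n}}"

definition arcs :: "nat \<Rightarrow> braid_word \<Rightarrow> nat set \<Rightarrow> (point \<times> point) set" where
  "arcs n w s = closure_arcs n w \<union> (\<Union>t<length w. level_arcs n w s t)"

definition circles :: "nat \<Rightarrow> braid_word \<Rightarrow> nat set \<Rightarrow> circle set" where
  "circles n w s = points n w // (arcs n w s \<union> (arcs n w s)\<inverse>)\<^sup>*"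

section \<open>Khovanov homology over the field with two elements\<close>

datatype label = Vplus | Vminus

type_synonym generator = "nat set \<times> (circle \<Rightarrow> label)"
type_synonym chain = "generator \<Rightarrow> bit"

definition generators :: "nat \<Rightarrow> braid_word \<Rightarrow> generator set" where
  "generators n w = (SIGMA s:Pow {..<length w}. circles n w s \<rightarrow>\<^sub>E UNIV)"

text \<open>\<open>merge_term a b c\<close>: the basis vector \<open>c\<close> occurs in the image of \<open>a \<otimes> b\<close> under the merge map.
  \<open>split_term a b c\<close>: the basis vector \<open>b \<otimes> c\<close> occurs in the image of \<open>a\<close> under the split map.\<close>

definition merge_term :: "label \<Rightarrow> label \<Rightarrow> label \<Rightarrow> bool" where
  "merge_term a b c \<longleftrightarrow>
    (a, b, c) \<in> {(Vplus, Vplus, Vplus), (Vplus, Vminus, Vminus), (Vminus, Vplus, Vminus)}"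

definition split_term :: "label \<Rightarrow> label \<Rightarrow> label \<Rightarrow> bool" where
  "split_term a b c \<longleftrightarrow>
    (a, b, c) \<in> {(Vplus, Vplus, Vminus), (Vplus, Vminus, Vplus), (Vminus, Vminus, Vminus)}"

text \<open>Circles that do not meet the changed crossing have the same point set in both resolutions,
  so the circles to be merged or split are those that belong to only one of the resolutions.\<close>

definition diff_term :: "nat \<Rightarrow> braid_word \<Rightarrow> generator \<Rightarrow> generator \<Rightarrow> bool" where
  "diff_term n w = (\<lambda>(s, l) (s', l').
    let X = circles n w s; Y = circles n w s' in
      (\<exists>t<length w. t \<notin> s \<and> s' = insert t s) \<and>
      (\<forall>C\<in>X \<inter> Y. l' C = l C) \<and>
      ((\<exists>A B C. A \<noteq> B \<and> X - Y = {A, B} \<and> Y - X = {C} \<and> merge_term (l A) (l B) (l' C)) \<or>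
       (\<exists>A B C. B \<noteq> C \<and> X - Y = {A} \<and> Y - X = {B, C} \<and> split_term (l A) (l' B) (l' C))))"

definition CKh :: "nat \<Rightarrow> braid_word \<Rightarrow> chain monoid" where
  "CKh n w =
    \<lparr>carrier = {f. \<forall>x. x \<notin> generators n w \<longrightarrow> f x = 0},
     mult = (\<lambda>f g x. f x + g x),
     one = (\<lambda>x. 0)\<rparr>"

definition diff :: "nat \<Rightarrow> braid_word \<Rightarrow> chain \<Rightarrow> chain" where
  "diff n w f =
    (\<lambda>y. if y \<in> generators n w then \<Sum>x | x \<in> generators n w \<and> diff_term n w x y. f x else 0)"

definition cycles :: "nat \<Rightarrow> braid_word \<Rightarrow> chain set" where
  "cycles n w = kernel (CKh n w) (CKh n w) (diff n w)"

definition boundaries :: "nat \<Rightarrow> braid_word \<Rightarrow> chain set" where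
  "boundaries n w = diff n w ` carrier (CKh n w)"

text \<open>The groups are written multiplicatively, so the zero class is \<open>\<one>\<^bsub>Kh n w\<^esub>\<close>.\<close>

definition Kh :: "nat \<Rightarrow> braid_word \<Rightarrow> chain set monoid" where
  "Kh n w = (CKh n w)\<lparr>carrier := cycles n w\<rparr> Mod boundaries n w"

section \<open>Plamenevskaya's invariant\<close>

definition psi_generator :: "nat \<Rightarrow> braid_word \<Rightarrow> generator" where
  "psi_generator n w =
    (let s = {t. t < length w \<and> \<not> snd (w ! t)} in (s, \<lambda>C\<in>circles n w s. Vminus))"

definition psi_cycle :: "nat \<Rightarrow> braid_word \<Rightarrow> chain" where
  "psi_cycle n w = (\<lambda>x. if x = psi_generator n w then 1 else 0)"

definition psi :: "nat \<Rightarrow> braid_word \<Rightarrow> chain set" where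
  "psi n w = boundaries n w #>\<^bsub>CKh n w\<^esub> psi_cycle n w"

end

theory Submission
  imports Defs "HOL-Library.Poly_Mapping" "HOL-Library.Multiset" "HOL-Combinatorics.Orbits"
begin

text \<open>By Dehornoy's theorem, which is obtained from the Hurwitz action of the braid group on tuples of
  conjugates in a free group, every nontrivial braid has a word in which some \<open>\<sigma>\<^sub>i\<close> occurs with one sign
  only. If all these occurrences are negative, then \<open>\<psi>\<close> is the boundary of a chain at the resolution
  obtained from the oriented one by changing a single negative crossing \<open>\<sigma>\<^sub>i\<inverse>\<close>; if they are positive, the
  same holds for the mirror. So one of the two invariants vanishes unless the braid is trivial.

  To compare different words for a braid, chains are written as polynomials over the field with two
  elements whose variables are the points of the diagram: a circle labeled \<open>v\<^sub>-\<close> contributes one of its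
  points, a circle labeled \<open>v\<^sub>+\<close> the factor \<open>1\<close>. Modulo squares and differences of points on a
  common circle, the edge maps are the multiplications by \<open>1\<close> (merge) and by the sum of the two points
  at the crossing (split). In this form, the vanishing of \<open>\<psi>\<close> is transported along the braid
  relations by Gaussian elimination.\<close>

section \<open>Free groups\<close>

text \<open>Only one implication is needed: if \<psi> is a boundary for one word of a braid, it is a
  boundary for every other word. So no isomorphism between the homology groups of different words is
  built. The property carried along is the existence of a polynomial primitive of \<psi>
  (\<open>word_vanishes\<close>), and only at the last word is it turned into a chain
  (\<open>psi_trivial\<close>). The obstacle is that a circle, being a set of points, changes with
  the word even far from the move; a polynomial in the points names no circle, and a move only
  renames points. For the existence of the one-signed word, the first entry of the Hurwitz image of
  a braid is watched. If its conjugating word begins with the first free generator, braids in which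
  \<sigma>_1 occurs only positively straighten it; if not, the same holds for the mirror braid; if
  it is straight already, faithfulness of the action reduces the problem to one strand less. That an
  edge of the cube always merges or splits comes from a coherent orientation of all arcs, which
  makes the circles cycles of a permutation and a change of resolution a transposition.\<close>

type_synonym letter = "nat \<times> bool"

definition flip :: "letter \<Rightarrow> letter" where
  "flip a = (fst a, \<not> snd a)"

lemma flip_flip [simp]: "flip (flip a) = a"
  by (simp add: flip_def)

lemma flip_neq [simp]: "flip a \<noteq> a" "a \<noteq> flip a"
  by (auto simp: flip_def prod_eq_iff)

lemma flip_eq_iff [simp]: "flip a = flip b \<longleftrightarrow> a = b"
  by (metis flip_flip)

lemma flip_Pair [simp]: "flip (i, e) = (i, \<not> e)"
  by (simp add: flip_def)

definition reduced :: "letter list \<Rightarrow> bool" where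
  "reduced w \<longleftrightarrow> successively (\<lambda>a b. b \<noteq> flip a) w"

lemma reduced_Nil [simp]: "reduced []"
  by (simp add: reduced_def)

lemma reduced_Cons: "reduced (a # w) \<longleftrightarrow> w = [] \<or> hd w \<noteq> flip a \<and> reduced w"
  by (simp add: reduced_def successively_Cons)

lemma reduced_append:
  "reduced (u @ v) \<longleftrightarrow> reduced u \<and> reduced v \<and> (u = [] \<or> v = [] \<or> hd v \<noteq> flip (last u))"
  by (auto simp: reduced_def successively_append_iff)

definition inv_word :: "letter list \<Rightarrow> letter list" where
  "inv_word w = rev (map flip w)"

lemma inv_word_simps [simp]:
  "inv_word [] = []" "inv_word (a # w) = inv_word w @ [flip a]"
  "inv_word (u @ v) = inv_word v @ inv_word u" "inv_word (inv_word w) = w"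
  "length (inv_word w) = length w" "inv_word w = [] \<longleftrightarrow> w = []"
  by (simp_all add: inv_word_def rev_map o_def)

lemma hd_inv_word: "w \<noteq> [] \<Longrightarrow> hd (inv_word w) = flip (last w)"
  by (simp add: inv_word_def hd_rev last_map)

lemma last_inv_word: "w \<noteq> [] \<Longrightarrow> last (inv_word w) = flip (hd w)"
  by (simp add: inv_word_def last_rev hd_map)

lemma reduced_inv_word [simp]: "reduced (inv_word w) \<longleftrightarrow> reduced w"
proof (induction w)
  case (Cons a w)
  then show ?case
    by (auto simp: reduced_append reduced_Cons last_inv_word)
qed simp

fun cancel_Cons :: "letter \<Rightarrow> letter list \<Rightarrow> letter list" where
  "cancel_Cons a [] = [a]"
| "cancel_Cons a (b # w) = (if b = flip a then w else a # b # w)"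

abbreviation mult_word :: "letter list \<Rightarrow> letter list \<Rightarrow> letter list" where
  "mult_word u v \<equiv> foldr cancel_Cons u v"

lemma reduced_cancel_Cons: "reduced w \<Longrightarrow> reduced (cancel_Cons a w)"
  by (cases w) (auto simp: reduced_Cons)

lemma reduced_mult_word: "reduced v \<Longrightarrow> reduced (mult_word u v)"
  by (induction u) (auto simp: reduced_cancel_Cons)

lemma cancel_Cons_flip: "reduced w \<Longrightarrow> cancel_Cons a (cancel_Cons (flip a) w) = w"
  by (cases w rule: list.exhaust; cases "tl w") (auto simp: reduced_Cons)

lemma cancel_Cons_flip': "reduced w \<Longrightarrow> cancel_Cons (flip a) (cancel_Cons a w) = w"
  using cancel_Cons_flip[of w "flip a"] by simp

text \<open>Associativity for a single left letter, including the case in which it cancels against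
  the first letter of \<open>v\<close>; the general law follows by induction on the left
  factor.\<close>

lemma mult_word_cancel_Cons:
  "reduced w \<Longrightarrow> mult_word (cancel_Cons a v) w = cancel_Cons a (mult_word v w)"
  by (cases v) (auto simp: cancel_Cons_flip reduced_mult_word)

lemma mult_word_assoc:
  "reduced w \<Longrightarrow> mult_word (mult_word u v) w = mult_word u (mult_word v w)"
  by (induction u) (auto simp: mult_word_cancel_Cons)

lemma mult_word_reduced: "reduced (u @ v) \<Longrightarrow> mult_word u v = u @ v"
proof (induction u)
  case (Cons a u)
  then show ?case
    by (cases "u @ v") (auto simp: reduced_Cons)
qed simp

lemma mult_word_inv_left: "reduced v \<Longrightarrow> mult_word (inv_word u) (mult_word u v) = v"
  by (induction u arbitrary: v) (auto simp: cancel_Cons_flip' reduced_mult_word)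

text \<open>Reduced words are normal forms, so equality in the group is equality of words. The
  operation is written additively because \<open>group_add\<close> is the class of groups without
  commutativity; \<open>g + x - g\<close> is a conjugate.\<close>

typedef free_group = "{w. reduced w}"
  morphisms word_of Abs_free
  by (rule exI[of _ "[]"]) simp

setup_lifting type_definition_free_group

instantiation free_group :: group_add
begin

lift_definition zero_free_group :: free_group is "[]" by simp
lift_definition plus_free_group :: "free_group \<Rightarrow> free_group \<Rightarrow> free_group" is mult_word
  by (rule reduced_mult_word)
lift_definition uminus_free_group :: "free_group \<Rightarrow> free_group" is inv_word by simp
definition minus_free_group :: "free_group \<Rightarrow> free_group \<Rightarrow> free_group" where
  "minus_free_group a b = a + - b"

instance
proof
  fix a b c :: free_group
  show "a + b + c = a + (b + c)"
    by transfer (rule mult_word_assoc)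
  show "0 + a = a"
    by transfer simp
  show "a + 0 = a"
    by transfer (simp add: mult_word_reduced)
  show "- a + a = 0"
    by transfer (metis append_Nil2 mult_word_inv_left mult_word_reduced reduced_Nil)
  show "a + - b = a - b"
    by (simp add: minus_free_group_def)
qed

end

lift_definition gen_free :: "nat \<Rightarrow> free_group" is "\<lambda>i. [(i, True)]"
  by (simp add: reduced_Cons)

text \<open>Turns every expression into a right-nested sum of signed terms, in which adjacent
  inverse terms cancel; this settles identities that hold in every group.\<close>

lemmas group_norm = diff_conv_add_uminus minus_add add.assoc

text \<open>The target group is left open: words are evaluated in free groups, in groups with Artin
  relations and, to count exponents, in the integers.\<close>

definition letter_val :: "('a \<Rightarrow> 'g::group_add) \<Rightarrow> 'a \<times> bool \<Rightarrow> 'g" where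
  "letter_val f a = (if snd a then f (fst a) else - f (fst a))"

definition word_val :: "('a \<Rightarrow> 'g::group_add) \<Rightarrow> ('a \<times> bool) list \<Rightarrow> 'g" where
  "word_val f w = sum_list (map (letter_val f) w)"

lemma word_val_simps [simp]:
  "word_val f [] = 0" "word_val f (a # w) = letter_val f a + word_val f w"
  "word_val f (u @ v) = word_val f u + word_val f v"
  by (simp_all add: word_val_def)

lemma letter_val_flip [simp]: "letter_val f (flip a) = - letter_val f a"
  by (simp add: letter_val_def flip_def)

lemma letter_val_Pair [simp]: "letter_val f (i, True) = f i" "letter_val f (i, False) = - f i"
  by (simp_all add: letter_val_def)

lemma word_val_inv_word [simp]: "word_val f (inv_word w) = - word_val f w"
  by (induction w) (simp_all add: minus_add)

lemma word_val_cancel_Cons: "word_val f (cancel_Cons a w) = letter_val f a + word_val f w"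
  by (cases w) (auto simp: add.assoc[symmetric])

lemma word_val_mult_word: "word_val f (mult_word u v) = word_val f u + word_val f v"
  by (induction u) (auto simp: word_val_cancel_Cons add.assoc)

definition hom_free :: "(nat \<Rightarrow> 'g::group_add) \<Rightarrow> free_group \<Rightarrow> 'g" where
  "hom_free f g = word_val f (word_of g)"

lemma hom_free_add: "hom_free f (g + h) = hom_free f g + hom_free f h"
  by (simp add: hom_free_def plus_free_group.rep_eq word_val_mult_word)

lemma hom_free_0 [simp]: "hom_free f 0 = 0"
  by (simp add: hom_free_def zero_free_group.rep_eq)

lemma hom_free_minus [simp]: "hom_free f (- g) = - hom_free f g"
  by (simp add: hom_free_def uminus_free_group.rep_eq)

lemma hom_free_diff: "hom_free f (g - h) = hom_free f g - hom_free f h"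
  by (metis add_uminus_conv_diff hom_free_add hom_free_minus)

lemma hom_free_gen [simp]: "hom_free f (gen_free i) = f i"
  by (simp add: hom_free_def gen_free.rep_eq)

abbreviation free_val :: "letter list \<Rightarrow> free_group" where
  "free_val \<equiv> word_val gen_free"

lemma hom_free_word_val: "hom_free f (word_val v w) = word_val (\<lambda>i. hom_free f (v i)) w"
  by (induction w) (auto simp: hom_free_add letter_val_def)

lemma word_of_letter: "word_of (letter_val gen_free a) = [a]"
  by (cases a; cases "snd a")
    (auto simp: letter_val_def gen_free.rep_eq uminus_free_group.rep_eq)

lemma word_of_free_val: "word_of (free_val w) = mult_word w []"
  by (induction w) (auto simp: zero_free_group.rep_eq plus_free_group.rep_eq word_of_letter)

lemma word_of_free_val_reduced: "reduced w \<Longrightarrow> word_of (free_val w) = w"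
  using mult_word_reduced[of w "[]"] by (simp add: word_of_free_val)

lemma reduced_word_of [simp]: "reduced (word_of g)"
  using word_of[of g] by simp

lemma free_val_word_of [simp]: "free_val (word_of g) = g"
  by (metis reduced_word_of word_of_free_val_reduced word_of_inject)

lemma free_val_eq_iff: "reduced u \<Longrightarrow> reduced v \<Longrightarrow> free_val u = free_val v \<longleftrightarrow> u = v"
  by (metis word_of_free_val_reduced)

lemma length_cancel_Cons: "length (cancel_Cons a w) \<le> Suc (length w)"
  by (cases w) auto

lemma length_word_of_free_val: "length (word_of (free_val w)) \<le> length w"
  unfolding word_of_free_val
proof (induction w)
  case (Cons a w)
  then show ?case
    using length_cancel_Cons[of a "mult_word w []"] by simp
qed simp

section \<open>Products of conjugates of free generators\<close>

definition conj_word :: "letter list \<Rightarrow> nat \<Rightarrow> letter list" where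
  "conj_word w a = w @ (a, True) # inv_word w"

lemma free_val_conj_word [simp]: "free_val (conj_word w a) = free_val w + gen_free a - free_val w"
  by (simp add: conj_word_def group_norm del: add_uminus_conv_diff)

lemma reduced_conj_word:
  "reduced (conj_word w a) \<longleftrightarrow> reduced w \<and> (w = [] \<or> fst (last w) \<noteq> a)"
  by (cases "w = []")
    (auto simp: conj_word_def reduced_append reduced_Cons hd_inv_word flip_def prod_eq_iff)

lemma conjugate_of_generator:
  fixes g :: free_group
  obtains w where "reduced (conj_word w a)" "g + gen_free a - g = free_val (conj_word w a)"
    "\<And>f :: nat \<Rightarrow> free_group. f a = 0 \<Longrightarrow> hom_free f g = word_val f w"
proof -
  have "\<exists>w. reduced (conj_word w a) \<and> free_val v + gen_free a - free_val v = free_val (conj_word w a) \<and>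
      (\<forall>f :: nat \<Rightarrow> free_group. f a = 0 \<longrightarrow> word_val f v = word_val f w)" if "reduced v" for v
    using that
  proof (induction v rule: rev_induct)
    case Nil
    show ?case by (intro exI[of _ "[]"]) (simp add: reduced_conj_word)
  next
    case (snoc b v)
    show ?case
    proof (cases "fst b = a")
      case True
      have "reduced v"
        using snoc.prems by (simp add: reduced_append)
      moreover have "letter_val gen_free b + gen_free a = gen_free a + letter_val gen_free b"
        using True by (auto simp: letter_val_def)
      then have "letter_val gen_free b + gen_free a - letter_val gen_free b = gen_free a"
        by (metis add_diff_cancel)
      then have "free_val (v @ [b]) + gen_free a - free_val (v @ [b]) = free_val v + gen_free a - free_val v"
        by (metis (no_types, opaque_lifting) add.assoc add_0_right diff_conv_add_uminus minus_add
            word_val_simps)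
      moreover have "word_val f (v @ [b]) = word_val f v" if "f a = 0" for f :: "nat \<Rightarrow> free_group"
        using that True by (auto simp: letter_val_def)
      ultimately show ?thesis
        using snoc.IH by metis
    next
      case False
      then show ?thesis
        using snoc.prems by (intro exI[of _ "v @ [b]"]) (auto simp: reduced_conj_word)
    qed
  qed
  from this[of "word_of g"] show ?thesis
    using that by (auto simp: hom_free_def)
qed

text \<open>All cancellation between the inverse of a reduced word and another reduced word takes
  place inside their common prefix.\<close>

lemma common_prefix:
  obtains c p q where "u = c @ p" "v = c @ q" "p = [] \<or> q = [] \<or> hd p \<noteq> hd q"
proof -
  have "\<exists>c p q. u = c @ p \<and> v = c @ q \<and> (p = [] \<or> q = [] \<or> hd p \<noteq> hd q)"
  proof (induction u arbitrary: v)
    case (Cons a u)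
    show ?case
    proof (cases "v \<noteq> [] \<and> hd v = a")
      case True
      then obtain v' where v: "v = a # v'" by (cases v) auto
      obtain c p q where "u = c @ p \<and> v' = c @ q \<and> (p = [] \<or> q = [] \<or> hd p \<noteq> hd q)"
        using Cons.IH by blast
      then show ?thesis by (intro exI[of _ "a # c"] exI[of _ p] exI[of _ q]) (simp add: v)
    next
      case False
      then show ?thesis
        by (intro exI[of _ "[]"] exI[of _ "a # u"] exI[of _ v]) auto
    qed
  qed simp
  then show ?thesis using that by blast
qed

definition arc :: "letter list \<times> nat \<Rightarrow> free_group" where
  "arc p = free_val (conj_word (fst p) (snd p))"

text \<open>No Hurwitz move between \<open>p\<close> and \<open>q\<close> shortens one of them.\<close>

definition irreducible_pair :: "letter list \<times> nat \<Rightarrow> letter list \<times> nat \<Rightarrow> bool" where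
  "irreducible_pair p q \<longleftrightarrow>
    \<not> (\<exists>u. fst q = fst p @ (snd p, False) # u) \<and> \<not> (\<exists>u. fst p = fst q @ (snd q, True) # u)"

text \<open>In an irreducible product no central letter of a conjugate is ever cancelled: after
  removal of the common prefix, the word between two neighbouring central letters neither begins
  with the inverse of the left one nor ends with the inverse of the right one, and that is
  irreducibility. So the first conjugator survives as a prefix, and the tail is at least as long as
  this conjugator plus the number of the other factors.\<close>

lemma irreducible_product:
  assumes "successively irreducible_pair ((w, a) # ps)"
    and "\<forall>(v, b)\<in>set ((w, a) # ps). reduced (conj_word v b)"
  obtains t where "reduced (w @ (a, True) # t)" "length w + length ps \<le> length t"
    "free_val t = - free_val w + sum_list (map arc ps)"
proof -
  \<comment> \<open>\<open>c\<close> is \<open>t\<close> without the central letters. Its parts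
    telescope to the inverse of \<open>w\<close>, so it cannot be shorter than \<open>w\<close>;
    this bounds the length of \<open>t\<close> from below.\<close>
  have "\<exists>t c. reduced ((a, True) # t) \<and> free_val t = - free_val w + sum_list (map arc ps) \<and>
      free_val c = - free_val w \<and> length t = length c + length ps"
    using assms
  proof (induction ps arbitrary: w a)
    case Nil
    then show ?case
      by (intro exI[of _ "inv_word w"]) (auto simp: conj_word_def reduced_append)
  next
    case (Cons p ps)
    obtain w' b where p: "p = (w', b)" by (cases p)
    obtain t c where t: "reduced ((b, True) # t)" "free_val t = - free_val w' + sum_list (map arc ps)"
      "free_val c = - free_val w'" "length t = length c + length ps"
      using Cons.IH[of w' b] Cons.prems by (auto simp: p)
    obtain d x y where d: "w = d @ x" "w' = d @ y" "x = [] \<or> y = [] \<or> hd x \<noteq> hd y"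
      by (rule common_prefix)
    have r: "reduced (d @ x)" "reduced (d @ y)" "d @ x = [] \<or> fst (last (d @ x)) \<noteq> a"
      "d @ y = [] \<or> fst (last (d @ y)) \<noteq> b"
      using Cons.prems(2) by (auto simp: p d reduced_conj_word)
    let ?g = "inv_word x @ y"
    have g: "free_val ?g = - free_val w + free_val w'"
      by (simp add: d group_norm del: add_uminus_conv_diff)
    have "reduced ?g"
      using r d(3) by (auto simp: reduced_append last_inv_word)
    moreover have "hd ?g \<noteq> (a, False)" if "?g \<noteq> []"
    proof (cases "x = []")
      case True
      then show ?thesis
        using Cons.prems(1) that by (cases y) (auto simp: p d irreducible_pair_def)
    next
      case False
      then show ?thesis
        using r(3) by (auto simp: hd_inv_word flip_def prod_eq_iff)
    qed
    moreover have "last ?g \<noteq> (b, False)" if "?g \<noteq> []"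
    proof (cases "y = []")
      case True
      then show ?thesis
        using Cons.prems(1) that by (cases x) (auto simp: p d irreducible_pair_def flip_def prod_eq_iff)
    next
      case False
      then show ?thesis
        using r(4) by auto
    qed
    ultimately have gr: "reduced ?g" "?g \<noteq> [] \<Longrightarrow> hd ?g \<noteq> (a, False)"
      "?g \<noteq> [] \<Longrightarrow> last ?g \<noteq> (b, False)"
      by blast+
    have "reduced ((a, True) # ?g @ (b, True) # t)"
    proof (cases "?g = []")
      case True
      then show ?thesis using t(1) by (simp add: reduced_Cons[of "(a, True)"])
    next
      case False
      then have "(b, True) \<noteq> flip (last ?g)"
        using gr(3) by (metis flip_Pair flip_flip)
      then have "reduced (?g @ (b, True) # t)"
        using gr(1) t(1) by (simp only: reduced_append) simp
      moreover have "hd (?g @ (b, True) # t) = hd ?g"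
        using False by (simp only: hd_append) simp
      ultimately show ?thesis
        using gr(2)[OF False] by (simp only: reduced_Cons[of "(a, True)"] flip_Pair) simp
    qed
    moreover have "free_val (?g @ (b, True) # t) = - free_val w + sum_list (map arc (p # ps))"
      unfolding word_val_simps(3)[of _ ?g] g
      by (simp add: p arc_def t(2) group_norm del: add_uminus_conv_diff)
    moreover have "free_val (?g @ c) = - free_val w"
      unfolding word_val_simps(3)[of _ ?g] g by (simp add: t(3))
    ultimately show ?case
      using t(4) by (intro exI[of _ "?g @ (b, True) # t"] exI[of _ "?g @ c"]) simp
  qed
  then obtain t c where *: "reduced ((a, True) # t)" "free_val t = - free_val w + sum_list (map arc ps)"
      "free_val c = - free_val w" "length t = length c + length ps"
    by blast
  have wa: "reduced (w @ [(a, True)])" "reduced w"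
    using assms(2) by (auto simp: conj_word_def reduced_append reduced_Cons)
  have "length (word_of (- free_val w)) = length w"
    using wa by (simp add: uminus_free_group.rep_eq word_of_free_val_reduced)
  then have "length w \<le> length c"
    using length_word_of_free_val[of c] *(3) by simp
  then show ?thesis
    using * wa by (intro that[of t]) (auto simp: reduced_append)
qed

section \<open>The Hurwitz action\<close>

text \<open>In multiplicative notation \<sigma>_i sends a pair (x, y) to (y, y^-1 x y), and its
  inverse sends it to (x y x^-1, x). Both keep the product x y. The letters of a word act from left
  to right.\<close>

definition hurwitz_move :: "letter \<Rightarrow> (nat \<Rightarrow> 'g::group_add) \<Rightarrow> nat \<Rightarrow> 'g" where
  "hurwitz_move a y = (let i = fst a in
    if snd a then y(i := y (Suc i), Suc i := - y (Suc i) + y i + y (Suc i))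
    else y(i := y i + y (Suc i) - y i, Suc i := y i))"

definition hurwitz :: "(nat \<Rightarrow> 'g::group_add) \<Rightarrow> letter list \<Rightarrow> nat \<Rightarrow> 'g" where
  "hurwitz y w = fold hurwitz_move w y"

lemma hurwitz_simps [simp]:
  "hurwitz y [] = y" "hurwitz y (a # w) = hurwitz (hurwitz_move a y) w"
  "hurwitz y (u @ v) = hurwitz (hurwitz y u) v"
  by (simp_all add: hurwitz_def)

lemma hurwitz_move_flip [simp]: "hurwitz_move (flip a) (hurwitz_move a y) = y"
  by (auto simp: hurwitz_move_def Let_def flip_def group_norm fun_eq_iff simp del: add_uminus_conv_diff)

lemma hurwitz_inv_word [simp]: "hurwitz (hurwitz y w) (inv_word w) = y"
  by (induction w arbitrary: y) simp_all

lemma hurwitz_inv_word' [simp]: "hurwitz (hurwitz y (inv_word w)) w = y"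
  by (metis hurwitz_inv_word inv_word_simps(4))

lemma hurwitz_move_eq:
  assumes "\<And>j. j \<in> {fst a, Suc (fst a)} \<Longrightarrow> z j = y j" "z k = y k"
  shows "hurwitz_move a z k = hurwitz_move a y k"
  using assms by (auto simp: hurwitz_move_def Let_def)

lemma hurwitz_hom:
  assumes "\<And>x y. f (x + y) = f x + f y" "\<And>x. f (- x) = - f x"
  shows "hurwitz (\<lambda>i. f (y i)) w = (\<lambda>i. f (hurwitz y w i))"
proof (induction w arbitrary: y)
  case (Cons a w)
  have "hurwitz_move a (\<lambda>i. f (y i)) = (\<lambda>i. f (hurwitz_move a y i))"
    by (auto simp: hurwitz_move_def Let_def assms diff_conv_add_uminus simp del: add_uminus_conv_diff)
  then show ?case
    using Cons.IH by simp
qed simp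

lemma hurwitz_outside:
  assumes "\<forall>a\<in>set w. i \<notin> {fst a, Suc (fst a)}"
  shows "hurwitz y w i = y i"
  using assms by (induction w arbitrary: y) (auto simp: hurwitz_move_def Let_def)

definition tuple_sum :: "(nat \<Rightarrow> 'g::group_add) \<Rightarrow> nat \<Rightarrow> nat \<Rightarrow> 'g" where
  "tuple_sum y m n = sum_list (map y [m..<Suc n])"

lemma tuple_sum_rec: "m \<le> n \<Longrightarrow> tuple_sum y m n = y m + tuple_sum y (Suc m) n"
  by (simp add: tuple_sum_def upt_rec[of m] del: upt_Suc)

lemma tuple_sum_hurwitz_move:
  assumes "fst a \<in> {m..<n}"
  shows "tuple_sum (hurwitz_move a y) m n = tuple_sum y m n"
proof -
  define i where "i = fst a"
  have i: "m \<le> i" "i < n" using assms by (auto simp: i_def)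
  have "[m..<Suc n] = [m..<i] @ [i..<Suc n]"
    using i upt_add_eq_append[of m i "Suc n - i"] by simp
  also have "[i..<Suc n] = i # Suc i # [Suc (Suc i)..<Suc n]"
    using i by (simp add: upt_rec[of i] upt_rec[of "Suc i"])
  finally have *: "[m..<Suc n] = [m..<i] @ i # Suc i # [Suc (Suc i)..<Suc n]" .
  have "map (hurwitz_move a y) [m..<i] = map y [m..<i]"
    "map (hurwitz_move a y) [Suc (Suc i)..<Suc n] = map y [Suc (Suc i)..<Suc n]"
    by (auto simp: hurwitz_move_def Let_def i_def)
  moreover have "hurwitz_move a y i + hurwitz_move a y (Suc i) = y i + y (Suc i)"
    by (auto simp: hurwitz_move_def Let_def i_def group_norm simp del: add_uminus_conv_diff)
  then have "hurwitz_move a y i + (hurwitz_move a y (Suc i) + z) = y i + (y (Suc i) + z)" for z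
    by (metis add.assoc)
  ultimately show ?thesis
    unfolding tuple_sum_def * by (simp only: map_append list.map sum_list.append sum_list.Cons)
qed

lemma tuple_sum_hurwitz:
  assumes "w \<in> lists ({m..<n} \<times> UNIV)"
  shows "tuple_sum (hurwitz y w) m n = tuple_sum y m n"
  using assms by (induction w arbitrary: y) (auto simp: tuple_sum_hurwitz_move)

section \<open>Tuples of conjugates of generators\<close>

definition conj_gen :: "free_group \<Rightarrow> bool" where
  "conj_gen x \<longleftrightarrow> (\<exists>g a. x = g + gen_free a - g)"

lemma conj_gen_gen [simp]: "conj_gen (gen_free a)"
  unfolding conj_gen_def by (rule exI[of _ 0]) auto

lemma conj_gen_conj:
  assumes "conj_gen x"
  shows "conj_gen (y + x - y)"
proof -
  obtain g a where "x = g + gen_free a - g" using assms by (auto simp: conj_gen_def)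
  then have "y + x - y = (y + g) + gen_free a - (y + g)"
    by (simp add: group_norm del: add_uminus_conv_diff)
  then show ?thesis by (auto simp: conj_gen_def)
qed

lemma conj_gen_conj': "conj_gen x \<Longrightarrow> conj_gen (- y + x + y)"
  using conj_gen_conj[of x "- y"] by simp

lemma conj_gen_hurwitz_move:
  assumes "\<forall>i\<in>{m..n}. conj_gen (y i)" "fst a \<in> {m..<n}"
  shows "\<forall>i\<in>{m..n}. conj_gen (hurwitz_move a y i)"
  using assms by (auto simp: hurwitz_move_def Let_def conj_gen_conj conj_gen_conj')

lemma conj_gen_hurwitz:
  assumes "\<forall>i\<in>{m..n}. conj_gen (y i)" "w \<in> lists ({m..<n} \<times> UNIV)"
  shows "\<forall>i\<in>{m..n}. conj_gen (hurwitz y w i)"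
  using assms
proof (induction w arbitrary: y)
  case (Cons a w)
  then show ?case
    using conj_gen_hurwitz_move[of m n y a] by auto
qed simp

lemma conj_gen_arc:
  assumes "conj_gen x"
  obtains p where "x = arc p" "reduced (conj_word (fst p) (snd p))"
proof -
  obtain g a where "x = g + gen_free a - g" using assms by (auto simp: conj_gen_def)
  then show ?thesis
    using conjugate_of_generator[of a g] that by (metis arc_def fst_conv snd_conv)
qed

lemma arc_conv: "arc (w, a) = free_val w + gen_free a - free_val w"
  by (simp add: arc_def)

lemma length_arc: "reduced (conj_word w a) \<Longrightarrow> length (word_of (arc (w, a))) = 2 * length w + 1"
  unfolding arc_def fst_conv snd_conv word_of_free_val_reduced by (simp add: conj_word_def)

lemma length_arc_le: "length (word_of (arc (w, a))) \<le> 2 * length w + 1"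
  using length_word_of_free_val[of "conj_word w a"] unfolding arc_def
  by (simp add: conj_word_def del: word_val_simps)

lemma successively_upt:
  "(\<And>i. m \<le> i \<Longrightarrow> Suc i < k \<Longrightarrow> P (f i) (f (Suc i))) \<Longrightarrow> successively P (map f [m..<k])"
proof (induction k)
  case (Suc k)
  then show ?case
    by (cases "m < k") (auto simp: successively_append_iff last_map, metis Suc_pred less_Suc_eq_le
        less_nat_zero_code lessI not_gr_zero)
qed simp

text \<open>A tuple of least total length in the orbit is irreducible: for a reducible neighbouring
  pair, one Hurwitz move shortens one entry and merely displaces the other.\<close>

lemma irreducible_tuple:
  assumes "\<forall>i\<in>{m..n}. conj_gen (y i)"
  obtains v ps where "v \<in> lists ({m..<n} \<times> UNIV)" "map (hurwitz y v) [m..<Suc n] = map arc ps"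
    "\<forall>(w, a)\<in>set ps. reduced (conj_word w a)" "successively irreducible_pair ps"
proof -
  define M where "M z = sum_list (map (\<lambda>i. length (word_of (z i))) [m..<Suc n])"
    for z :: "nat \<Rightarrow> free_group"
  obtain v where v: "v \<in> lists ({m..<n} \<times> UNIV)"
    and min: "\<And>u. u \<in> lists ({m..<n} \<times> UNIV) \<Longrightarrow> M (hurwitz y v) \<le> M (hurwitz y u)"
    using ex_has_least_nat[of "\<lambda>v. v \<in> lists ({m..<n} \<times> UNIV)" "[]" "\<lambda>v. M (hurwitz y v)"]
    by auto
  define z where "z = hurwitz y v"
  have cz: "\<forall>i\<in>{m..n}. conj_gen (z i)"
    unfolding z_def by (rule conj_gen_hurwitz[OF assms v])
  then have "\<exists>p. i \<in> {m..n} \<longrightarrow> z i = arc p \<and> reduced (conj_word (fst p) (snd p))" for i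
    by (meson conj_gen_arc)
  then obtain p where p: "\<And>i. i \<in> {m..n} \<Longrightarrow> z i = arc (p i)"
    "\<And>i. i \<in> {m..n} \<Longrightarrow> reduced (conj_word (fst (p i)) (snd (p i)))"
    by metis
  have step: "length (word_of (z i)) + length (word_of (z (Suc i)))
      \<le> length (word_of (hurwitz_move (i, e) z i)) + length (word_of (hurwitz_move (i, e) z (Suc i)))"
    if i: "m \<le> i" "i < n" for i e
  proof -
    have "v @ [(i, e)] \<in> lists ({m..<n} \<times> UNIV)"
      using v i by auto
    from min[OF this] have "M z \<le> M (hurwitz_move (i, e) z)"
      by (simp add: z_def)
    moreover have "[m..<Suc n] = [m..<i] @ [i..<Suc n]"
      using i upt_add_eq_append[of m i "Suc n - i"] by simp
    then have *: "[m..<Suc n] = [m..<i] @ i # Suc i # [Suc (Suc i)..<Suc n]"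
      using i by (simp add: upt_rec[of i] upt_rec[of "Suc i"] del: upt_Suc)
    have "map (\<lambda>j. length (word_of (hurwitz_move (i, e) z j))) [m..<i] = map (\<lambda>j. length (word_of (z j))) [m..<i]"
      "map (\<lambda>j. length (word_of (hurwitz_move (i, e) z j))) [Suc (Suc i)..<Suc n]
        = map (\<lambda>j. length (word_of (z j))) [Suc (Suc i)..<Suc n]"
      by (auto simp: hurwitz_move_def Let_def)
    ultimately show ?thesis
      unfolding M_def * by (simp del: upt_Suc)
  qed
  have "irreducible_pair (p i) (p (Suc i))" if i: "m \<le> i" "i < n" for i
  proof -
    obtain w a w' b where pi: "p i = (w, a)" "p (Suc i) = (w', b)"
      by (cases "p i", cases "p (Suc i)") auto
    have r: "reduced (conj_word w a)" "reduced (conj_word w' b)"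
      using p(2)[of i] p(2)[of "Suc i"] i by (auto simp: pi)
    have z: "z i = arc (w, a)" "z (Suc i) = arc (w', b)"
      using p(1)[of i] p(1)[of "Suc i"] i by (auto simp: pi)
    \<comment> \<open>Conjugation by the left entry removes the letter \<open>(a, False)\<close>
      from the conjugator of the right one, so the move saves two letters.\<close>
    have False if w': "w' = w @ (a, False) # u" for u
    proof -
      have "z i + z (Suc i) - z i = arc (w @ u, b)"
        by (simp add: z arc_conv w' group_norm del: add_uminus_conv_diff)
      then show False
        using step[OF i, of False] length_arc[OF r(2)] length_arc_le[of "w @ u" b]
        by (simp add: hurwitz_move_def z w')
    qed
    moreover have False if w: "w = w' @ (b, True) # u" for u
    proof -
      have "- z (Suc i) + z i + z (Suc i) = arc (w' @ u, a)"
        by (simp add: z arc_conv w group_norm del: add_uminus_conv_diff)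
      then show False
        using step[OF i, of True] length_arc[OF r(1)] length_arc_le[of "w' @ u" a]
        by (simp add: hurwitz_move_def z w)
    qed
    ultimately show ?thesis
      by (auto simp: irreducible_pair_def pi)
  qed
  then have "successively irreducible_pair (map p [m..<Suc n])"
    by (intro successively_upt) auto
  then show ?thesis
    using p by (intro that[of v "map p [m..<Suc n]"] v) (auto simp: z_def split_def simp del: upt_Suc)
qed

definition pos_word :: "nat \<Rightarrow> nat \<Rightarrow> letter list" where
  "pos_word m n = map (\<lambda>i. (i, True)) [m..<n]"

lemma reduced_pos: "\<forall>a\<in>set w. snd a \<Longrightarrow> reduced w"
  by (induction w) (auto simp: reduced_Cons flip_def dest!: hd_in_set)

lemma reduced_pos_word [simp]: "reduced (pos_word m n)"
  by (rule reduced_pos) (auto simp: pos_word_def)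

lemma length_pos_word [simp]: "length (pos_word m n) = n - m"
  by (simp add: pos_word_def)

lemma pos_word_Cons: "m < n \<Longrightarrow> pos_word m n = (m, True) # pos_word (Suc m) n"
  by (simp add: pos_word_def upt_rec[of m])

text \<open>The product is a positive word whose length is the number of factors. The length bound
  for irreducible products leaves no room for a nonempty first conjugator, so the first factor is
  the first generator; induction does the rest.\<close>

lemma irreducible_standard:
  assumes "successively irreducible_pair ps" "\<forall>(w, a)\<in>set ps. reduced (conj_word w a)"
    and "sum_list (map arc ps) = free_val (pos_word m (m + length ps))"
  shows "map arc ps = map gen_free [m..<m + length ps]"
  using assms
proof (induction ps arbitrary: m)
  case (Cons p ps)
  obtain w a where p: "p = (w, a)" by (cases p)
  obtain t where t: "reduced (w @ (a, True) # t)" "length w + length ps \<le> length t"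
    "free_val t = - free_val w + sum_list (map arc ps)"
    using irreducible_product[of w a ps] Cons.prems by (auto simp: p)
  have "free_val (w @ (a, True) # t) = free_val (pos_word m (m + length (p # ps)))"
    using t(3) Cons.prems(3) by (simp add: p arc_conv group_norm del: add_uminus_conv_diff)
  then have *: "w @ (a, True) # t = pos_word m (m + length (p # ps))"
    using t(1) by (subst (asm) free_val_eq_iff) auto
  then have "length (w @ (a, True) # t) = length (p # ps)"
    by simp
  then have "length w = 0"
    using t(2) unfolding length_append length_Cons by linarith
  with * have a: "a = m" "w = []" "t = pos_word (Suc m) (m + length (p # ps))"
    by (auto simp: pos_word_Cons)
  have "map arc ps = map gen_free [Suc m..<Suc m + length ps]"
    using Cons.prems t(3) by (intro Cons.IH) (auto simp: a p successively_Cons)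
  then show ?case
    by (simp add: p a arc_conv upt_rec[of m] del: upt_Suc)
qed simp

lemma pos_word_snoc: "m \<le> n \<Longrightarrow> pos_word m (Suc n) = pos_word m n @ [(n, True)]"
  by (simp add: pos_word_def)

text \<open>Two reduced forms of the product of the later factors are compared: one from
  irreducibility, beginning with \<open>v\<close> and \<open>b\<close> and followed by a long tail,
  the other obtained by bringing the first factor to the other side. Their lengths force
  \<open>v\<close> followed by \<open>b\<close> to be a prefix of \<open>w\<close>. Hence a positive
  \<sigma>_1 replaces the conjugator \<open>w\<close> by its proper prefix \<open>v\<close>.\<close>

lemma first_arc_prefix:
  assumes red: "reduced (conj_word w a)" and w: "w \<noteq> []" "hd w = (0, True)"
    and irr: "successively irreducible_pair ((v, b) # ps)"
    and wf: "\<forall>(v, b)\<in>set ((v, b) # ps). reduced (conj_word v b)"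
    and sum: "arc (w, a) + sum_list (map arc ((v, b) # ps)) = free_val (pos_word 0 (Suc (Suc (length ps))))"
  shows "\<exists>u. w = v @ (b, True) # u"
proof -
  define n where "n = Suc (Suc (length ps))"
  obtain t where t: "reduced (v @ (b, True) # t)" "length v + length ps \<le> length t"
    "free_val t = - free_val v + sum_list (map arc ps)"
    using irreducible_product[OF irr wf] by blast
  \<comment> \<open>\<open>c\<close> is the part of \<open>w\<close> that cancels against the total
    product; it is not empty because both words begin with \<open>(0, True)\<close>.\<close>
  obtain c x r where c: "w = c @ x" "pos_word 0 n = c @ r" "x = [] \<or> r = [] \<or> hd x \<noteq> hd r"
    by (rule common_prefix)
  have c0: "c \<noteq> []"
    using c w by (auto simp: n_def pos_word_Cons)
  have len: "length c + length r = n"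
    using arg_cong[OF c(2), of length] by simp
  have pos: "\<forall>a\<in>set (c @ r). snd a"
    unfolding c(2)[symmetric] by (auto simp: pos_word_def)
  have "free_val (v @ (b, True) # t) = sum_list (map arc ((v, b) # ps))"
    using t(3) by (simp add: arc_conv group_norm del: add_uminus_conv_diff)
  also have "\<dots> = - arc (w, a) + free_val (pos_word 0 n)"
    using sum by (simp add: n_def) (metis minus_add_cancel)
  also have "\<dots> = free_val (w @ (a, False) # inv_word x @ r)"
    unfolding c(2) by (simp add: c(1) arc_conv group_norm del: add_uminus_conv_diff)
  finally have eq: "free_val (v @ (b, True) # t) = free_val (w @ (a, False) # inv_word x @ r)" .
  have rw: "reduced w" "fst (last w) \<noteq> a"
    using red w by (auto simp: reduced_conj_word)
  show ?thesis
  \<comment> \<open>Only in this case does the letter \<open>(a, False)\<close> meet its inverse.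
    The remaining product is then positive and so short that \<open>v\<close> must be empty.\<close>
  proof (cases "x = [] \<and> r \<noteq> [] \<and> hd r = (a, True)")
    case True
    then obtain r' where r: "x = []" "r = (a, True) # r'"
      by (cases r) auto
    have "free_val (v @ (b, True) # t) = free_val (w @ r')"
      using eq r by simp
    moreover have "reduced (w @ r')"
      using pos by (intro reduced_pos) (auto simp: c r)
    ultimately have *: "v @ (b, True) # t = w @ r'"
      using t(1) by (simp add: free_val_eq_iff del: word_val_simps)
    then have "length (v @ (b, True) # t) = length (w @ r')"
      by simp
    then have "length v + length t = length ps"
      using len by (simp add: c r n_def)
    then have "length v = 0"
      using t(2) by linarith
    then have "v = []" by simp
    with * w show ?thesis
      by (cases w) auto
  next
    case False
    have x1: "reduced x" "x \<noteq> [] \<Longrightarrow> fst (last x) \<noteq> a"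
      using rw by (auto simp: c(1) reduced_append)
    have rr: "reduced r"
      using pos by (intro reduced_pos) auto
    have "reduced (inv_word x @ r)"
      using x1 rr c(3) by (auto simp: reduced_append last_inv_word)
    moreover have "hd (inv_word x @ r) \<noteq> (a, True)" if "inv_word x @ r \<noteq> []"
    proof (cases "x = []")
      case True
      then show ?thesis using False that by simp
    next
      case nx: False
      then show ?thesis using x1 by (auto simp: hd_inv_word flip_def)
    qed
    ultimately have "reduced ((a, False) # inv_word x @ r)"
      by (simp only: reduced_Cons[of "(a, False)"] flip_Pair) auto
    moreover have "(a, False) \<noteq> flip (last w)"
      using rw(2) by (auto simp: flip_def)
    ultimately have "reduced (w @ (a, False) # inv_word x @ r)"
      using rw(1) w(1) by (simp only: reduced_append[of w]) simp
    then have *: "v @ (b, True) # t = w @ (a, False) # inv_word x @ r"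
      using eq t(1) by (simp add: free_val_eq_iff del: word_val_simps)
    show ?thesis
    proof (cases "length v < length w")
      case True
      have "take (length w) (v @ (b, True) # t) = w"
        unfolding * by simp
      then show ?thesis
        using True by (auto simp: take_Cons' split: if_splits) metis
    next
      \<comment> \<open>If \<open>v\<close> were longer than \<open>w\<close>, the lower bound on
        the tail would exceed the available length by at least twice the length of
        \<open>c\<close>.\<close>
      case F: False
      have "length w \<noteq> length v"
        using * by auto
      with F have "length w < length v" by simp
      moreover have "length v + 1 + length t = length w + 1 + length x + length r"
        using arg_cong[OF *, of length] by simp
      moreover have "length w = length c + length x"
        by (simp add: c)
      ultimately have "length c = 0"
        using t(2) len unfolding n_def by linarith
      then show ?thesis using c0 by simp
    qed
  qed
qed

text \<open>Strand positions are counted from 1, free generators from 0.\<close>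

abbreviation std_tuple :: "nat \<Rightarrow> free_group" where
  "std_tuple i \<equiv> gen_free (i - Suc 0)"

text \<open>One round makes the entries from the second on irreducible without using \<sigma>_1,
  then applies a single positive \<sigma>_1. The conjugator of the new first entry is a proper
  prefix of \<open>w\<close>: either it is empty and the goal is reached, or it begins with
  \<open>(0, True)\<close> again.\<close>

lemma left_arc_reduction:
  assumes "\<forall>i\<in>{1..n}. conj_gen (y i)" "tuple_sum y 1 n = free_val (pos_word 0 n)" "n \<ge> 1"
    and "y 1 = arc (w, a)" "reduced (conj_word w a)" "w \<noteq> []" "hd w = (0, True)"
  shows "\<exists>v\<in>lists ({1..<n} \<times> UNIV). (1, True) \<in> set v \<and> (1, False) \<notin> set v \<and> hurwitz y v 1 = gen_free 0"
  using assms
proof (induction "length w" arbitrary: w a y rule: less_induct)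
  case less
  \<comment> \<open>On one strand the only entry is the total product, that is, the first generator,
    whose conjugator is empty.\<close>
  have n: "n \<ge> 2"
  proof (rule ccontr)
    assume "\<not> n \<ge> 2"
    then have "n = 1" using less.prems(3) by linarith
    then have "free_val (conj_word w a) = free_val [(0, True)]"
      using less.prems(2,4) by (simp add: tuple_sum_def pos_word_def arc_def)
    then have "conj_word w a = [(0, True)]"
      using less.prems(5) by (subst (asm) free_val_eq_iff) (auto simp: reduced_Cons)
    then show False
      using less.prems(6) by (simp add: conj_word_def append_eq_Cons_conv)
  qed
  have "\<forall>i\<in>{2..n}. conj_gen (y i)"
    using less.prems(1) by auto
  then obtain v1 ps where v1: "v1 \<in> lists ({2..<n} \<times> UNIV)"
    and ps: "map (hurwitz y v1) [2..<Suc n] = map arc ps"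
    "\<forall>(w, a)\<in>set ps. reduced (conj_word w a)" "successively irreducible_pair ps"
    by (rule irreducible_tuple)
  have lps: "length ps = n - 1"
    using arg_cong[OF ps(1), of length] by (simp del: upt_Suc)
  then obtain v b qs where qs: "ps = (v, b) # qs"
    using n by (cases ps) auto
  define z where "z = hurwitz y v1"
  have z1: "z 1 = arc (w, a)"
    unfolding z_def using v1 less.prems(4) by (subst hurwitz_outside) auto
  have v1': "v1 \<in> lists ({1..<n} \<times> UNIV)"
    using v1 by auto
  have "tuple_sum z 1 n = free_val (pos_word 0 n)"
    unfolding z_def by (subst tuple_sum_hurwitz[OF v1']) (rule less.prems(2))
  moreover have "tuple_sum z 1 n = arc (w, a) + sum_list (map arc ((v, b) # qs))"
    using tuple_sum_rec[of 1 n z] n ps(1)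
    z1 by (simp add: tuple_sum_def z_def qs numeral_2_eq_2 del: upt_Suc)
  ultimately have "\<exists>u. w = v @ (b, True) # u"
    using ps lps n less.prems(5-7) by (intro first_arc_prefix[of w a v b qs]) (auto simp: qs)
  then obtain u where u: "w = v @ (b, True) # u" by blast
  define z' where "z' = hurwitz_move (1, True) z"
  have z2: "z 2 = arc (v, b)"
    using ps(1) n by (simp add: qs z_def upt_rec[of 2] del: upt_Suc)
  then have z'1: "z' 1 = arc (v, b)"
    by (simp add: z'_def hurwitz_move_def numeral_2_eq_2)
  have v1s: "v1 @ (1, True) # v2 \<in> lists ({1..<n} \<times> UNIV)" if "v2 \<in> lists ({1..<n} \<times> UNIV)" for v2
    using v1' n that by auto
  have v1n: "(1, False) \<notin> set v1"
    using v1 by auto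
  show ?case
  proof (cases "v = []")
    case True
    then have "b = 0"
      using less.prems(7) u by simp
    then have "hurwitz y (v1 @ [(1, True)]) 1 = gen_free 0"
      using z'1 True by (simp add: z'_def z_def arc_conv)
    then show ?thesis
      using v1s[of "[]"] v1n by (intro bexI[of _ "v1 @ [(1, True)]"]) auto
  next
    case False
    have "\<forall>i\<in>{1..n}. conj_gen (z i)"
      unfolding z_def by (rule conj_gen_hurwitz[OF less.prems(1) v1'])
    then have "\<forall>i\<in>{1..n}. conj_gen (z' i)"
      unfolding z'_def using n by (intro conj_gen_hurwitz_move) auto
    moreover have "tuple_sum z' 1 n = free_val (pos_word 0 n)"
      unfolding z'_def using \<open>tuple_sum z 1 n = free_val (pos_word 0 n)\<close> n
      by (subst tuple_sum_hurwitz_move) auto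
    moreover have "reduced (conj_word v b)" "hd v = (0, True)"
      using ps(2) less.prems(7) u False by (auto simp: qs)
    ultimately obtain v2 where "v2 \<in> lists ({1..<n} \<times> UNIV)" "(1, False) \<notin> set v2"
      "hurwitz z' v2 1 = gen_free 0"
      using less.hyps[of v z' b] z'1 False u less.prems(3) by auto
    then show ?thesis
      using v1s[of v2] v1n by (intro bexI[of _ "v1 @ (1, True) # v2"]) (auto simp: z'_def z_def)
  qed
qed

text \<open>Once the first entry is standard, the product of the others is standard too, and an
  irreducible tuple with that product is standard.\<close>

lemma standard_first_arc:
  assumes "\<forall>i\<in>{1..n}. conj_gen (y i)" "tuple_sum y 1 n = free_val (pos_word 0 n)" "n \<ge> 1"
    and "y 1 = gen_free 0"
  shows "\<exists>v\<in>lists ({2..<n} \<times> UNIV). \<forall>i\<in>{1..n}. hurwitz y v i = std_tuple i"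
proof -
  have "\<forall>i\<in>{2..n}. conj_gen (y i)"
    using assms(1) by auto
  then obtain v ps where v: "v \<in> lists ({2..<n} \<times> UNIV)"
    and ps: "map (hurwitz y v) [2..<Suc n] = map arc ps"
    "\<forall>(w, a)\<in>set ps. reduced (conj_word w a)" "successively irreducible_pair ps"
    by (rule irreducible_tuple)
  have lps: "length ps = n - 1"
    using arg_cong[OF ps(1), of length] by (simp del: upt_Suc)
  have v': "v \<in> lists ({1..<n} \<times> UNIV)"
    using v by auto
  have z1: "hurwitz y v 1 = gen_free 0"
    using v assms(4) by (subst hurwitz_outside) auto
  have "tuple_sum (hurwitz y v) 1 n = free_val (pos_word 0 n)"
    by (subst tuple_sum_hurwitz[OF v']) (rule assms(2))
  moreover have "tuple_sum (hurwitz y v) 1 n = gen_free 0 + sum_list (map arc ps)"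
    using tuple_sum_rec[of 1 n "hurwitz y v"] assms(3) ps(1)
    by (simp add: tuple_sum_def z1[simplified] numeral_2_eq_2 del: upt_Suc)
  ultimately have "sum_list (map arc ps) = free_val (pos_word 1 (1 + length ps))"
    using assms(3) by (simp add: pos_word_Cons lps)
  then have "map arc ps = map gen_free [1..<1 + length ps]"
    by (intro irreducible_standard ps)
  then have *: "map (hurwitz y v) [2..<Suc n] = map gen_free [1..<n]"
    using ps(1) assms(3) by (simp add: lps del: upt_Suc)
  have "hurwitz y v i = std_tuple i" if i: "i \<in> {1..n}" for i
  proof (cases "i = 1")
    case True
    then show ?thesis using z1 by simp
  next
    case False
    then have "i - 2 < length [2..<Suc n]"
      using i unfolding length_upt atLeastAtMost_iff by linarith
    moreover have "Suc (Suc (i - 2)) = i"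
      using i False unfolding atLeastAtMost_iff by linarith
    ultimately have "map (hurwitz y v) [2..<Suc n] ! (i - 2) = hurwitz y v i"
      using i by (subst nth_map) (auto simp del: upt_Suc)
    moreover have "Suc (i - 2) = i - 1"
      using i False unfolding atLeastAtMost_iff by linarith
    then have "map gen_free [1..<n] ! (i - 2) = std_tuple i"
      using i False by (subst nth_map) auto
    ultimately show ?thesis
      using * by simp
  qed
  then show ?thesis using v by blast
qed

text \<open>Inverting all partial products of a tuple exchanges the two kinds of Hurwitz moves.\<close>

definition partial_sum :: "(nat \<Rightarrow> 'g::group_add) \<Rightarrow> nat \<Rightarrow> 'g" where
  "partial_sum y j = tuple_sum y 1 j"

lemma partial_sum_simps [simp]:
  "partial_sum y 0 = 0" "partial_sum y (Suc j) = partial_sum y j + y (Suc j)"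
  by (simp_all add: partial_sum_def tuple_sum_def)

definition mirror_tuple :: "(nat \<Rightarrow> 'g::group_add) \<Rightarrow> nat \<Rightarrow> 'g" where
  "mirror_tuple y i = partial_sum y (i - 1) - partial_sum y i"

lemma partial_sum_hurwitz_move_neq:
  assumes "fst a \<ge> 1" "j \<noteq> fst a"
  shows "partial_sum (hurwitz_move a y) j = partial_sum y j"
proof (cases "fst a < j")
  case True
  then show ?thesis
    unfolding partial_sum_def using assms by (intro tuple_sum_hurwitz_move) auto
next
  case False
  then have "map (hurwitz_move a y) [1..<Suc j] = map y [1..<Suc j]"
    using assms by (auto simp: hurwitz_move_def Let_def simp del: upt_Suc)
  then show ?thesis by (simp only: partial_sum_def tuple_sum_def)
qed

text \<open>Let P_j be the partial products. Then \<sigma>_i changes P_i only, into P_{i-1} P_i^-1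
  P_{i+1}, and its inverse changes P_i into P_{i+1} P_i^-1 P_{i-1}. Inverting all P_j exchanges the
  two formulas.\<close>

lemma mirror_tuple_move:
  assumes "fst a \<ge> 1"
  shows "mirror_tuple (hurwitz_move a y) = hurwitz_move (flip a) (mirror_tuple y)"
proof
  fix k
  obtain i e where a: "a = (Suc i, e)"
    using assms by (cases a; cases "fst a") auto
  let ?y = "hurwitz_move a y"
  have P: "partial_sum ?y j = partial_sum y j" if "j \<noteq> Suc i" for j
    using that by (intro partial_sum_hurwitz_move_neq) (auto simp: a)
  have Pi: "partial_sum ?y (Suc (Suc i)) = partial_sum y (Suc (Suc i))"
    by (intro P) simp
  consider "k = Suc i" | "k = Suc (Suc i)" | "k \<noteq> Suc i" "k \<noteq> Suc (Suc i)" by blast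
  then show "mirror_tuple ?y k = hurwitz_move (flip a) (mirror_tuple y) k"
  proof cases
    case 1
    then show ?thesis
      using P[of i] unfolding mirror_tuple_def
      by (cases e) (simp_all add: a hurwitz_move_def Let_def group_norm del: add_uminus_conv_diff)
  next
    case 2
    then show ?thesis
      using P[of i] Pi unfolding mirror_tuple_def
      by (cases e) (simp_all del: partial_sum_simps(2) add: partial_sum_simps(2)[of y] partial_sum_simps(2)[of _ i] a hurwitz_move_def Let_def group_norm del: add_uminus_conv_diff)
  next
    case 3
    then have "k - 1 \<noteq> Suc i" by auto
    with 3 show ?thesis
      by (cases e) (auto simp: mirror_tuple_def P, auto simp: a hurwitz_move_def Let_def mirror_tuple_def)
  qed
qed

lemma mirror_tuple_hurwitz:
  "\<forall>a\<in>set w. fst a \<ge> 1 \<Longrightarrow> mirror_tuple (hurwitz y w) = hurwitz (mirror_tuple y) (map flip w)"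
  by (induction w arbitrary: y) (simp_all add: mirror_tuple_move)

lemma hurwitz_cong:
  assumes "\<forall>a\<in>set w. fst a \<ge> 1" "\<And>i. i \<ge> 1 \<Longrightarrow> y i = z i" "i \<ge> 1"
  shows "hurwitz y w i = hurwitz z w i"
  using assms
proof (induction w arbitrary: y z)
  case (Cons a w)
  have "hurwitz_move a y j = hurwitz_move a z j" if "j \<ge> 1" for j
    using Cons.prems(1,2) that by (intro hurwitz_move_eq) auto
  then show ?case
    unfolding hurwitz_simps by (intro Cons.IH) (use Cons.prems in auto)
qed simp

text \<open>The action on the free group of a reflection of the punctured disc: the generator
  \<open>j\<close> goes to P_j P_{j+1}^-1, where P_j is the product of the first \<open>j\<close>
  generators.\<close>

abbreviation mirror_hom :: "free_group \<Rightarrow> free_group" where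
  "mirror_hom \<equiv> hom_free (\<lambda>j. mirror_tuple std_tuple (Suc j))"

lemma partial_sum_std: "partial_sum std_tuple j = free_val (pos_word 0 j)"
  by (induction j) (auto simp: pos_word_snoc, simp add: pos_word_def)

text \<open>Moves commute with homomorphisms and with \<open>mirror_tuple\<close>, so mirroring the
  word can be exchanged for mirroring the tuple. The sign arises because the first entry of
  \<open>mirror_tuple y\<close> is the inverse of the first entry of \<open>y\<close>.\<close>

lemma mirror_hom_hurwitz:
  assumes "\<forall>a\<in>set w. fst a \<ge> 1"
  shows "mirror_hom (hurwitz std_tuple (map flip w) 1) = - hurwitz std_tuple w 1"
proof -
  have "mirror_hom (hurwitz std_tuple (map flip w) 1)
      = hurwitz (\<lambda>i. mirror_hom (std_tuple i)) (map flip w) 1"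
    by (subst hurwitz_hom) (auto simp: hom_free_add)
  also have "\<dots> = hurwitz (mirror_tuple std_tuple) (map flip w) 1"
    using assms by (intro hurwitz_cong) (auto simp: flip_def)
  also have "\<dots> = mirror_tuple (hurwitz std_tuple w) 1"
    by (simp add: mirror_tuple_hurwitz[OF assms])
  also have "\<dots> = - hurwitz std_tuple w 1"
    by (simp add: mirror_tuple_def)
  finally show ?thesis .
qed

text \<open>A letter is read as a step from one gap between the punctures to an adjacent one:
  \<open>(i, True)\<close> leads from \<open>i\<close> to \<open>i + 1\<close>, and \<open>(i, False)\<close> from \<open>i + 1\<close> to \<open>i\<close>.\<close>

definition source :: "letter \<Rightarrow> nat" where
  "source a = (if snd a then fst a else Suc (fst a))"

definition target :: "letter \<Rightarrow> nat" where
  "target a = (if snd a then Suc (fst a) else fst a)"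

text \<open>The value 0 on the empty word is the gap at which the image of a word under
  \<open>mirror_hom\<close> ends; so an empty remainder in \<open>mirror_hom_word\<close> still
  starts at the target of the last letter.\<close>

definition start_gap :: "letter list \<Rightarrow> nat" where
  "start_gap z = (if z = [] then 0 else source (hd z))"

definition gap_word :: "nat \<Rightarrow> nat \<Rightarrow> letter list" where
  "gap_word i j = (if i \<le> j then pos_word i j else inv_word (pos_word j i))"

lemma free_val_pos_word: "i \<le> j \<Longrightarrow> free_val (pos_word 0 j) = free_val (pos_word 0 i) + free_val (pos_word i j)"
  using upt_add_eq_append[of 0 i "j - i"] by (simp add: pos_word_def)

lemma free_val_gap_word: "free_val (gap_word i j) = - free_val (pos_word 0 i) + free_val (pos_word 0 j)"
  using free_val_pos_word[of i j] free_val_pos_word[of j i]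
  by (auto simp: gap_word_def group_norm simp del: add_uminus_conv_diff)

lemma hd_pos_word: "i < j \<Longrightarrow> hd (pos_word i j) = (i, True)"
  by (simp add: pos_word_Cons)

lemma pos_word_eq_Nil [simp]: "pos_word i j = [] \<longleftrightarrow> j \<le> i"
  by (auto simp: pos_word_def)

lemma last_pos_word: "i < j \<Longrightarrow> last (pos_word i j) = (j - 1, True)"
  by (simp add: pos_word_def last_map)

lemma start_gap_gap_word: "i \<noteq> j \<Longrightarrow> start_gap (gap_word i j @ z) = i"
  by (auto simp: gap_word_def start_gap_def source_def hd_pos_word hd_append
      hd_inv_word last_pos_word flip_def)

lemma reduced_gap_word_append:
  assumes "reduced z" "start_gap z \<noteq> j" "i \<noteq> j"
  shows "reduced (gap_word i j @ z)"
  using assms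
  by (auto simp: gap_word_def reduced_append last_pos_word last_inv_word hd_pos_word start_gap_def
      source_def flip_def split: if_splits)

text \<open>A letter is sent to the product up to its source times the inverse of the product up to
  its target. The image of a word therefore consists of the product up to the source of the first
  letter and, for consecutive letters, the straight path from the target of one to the source of the
  next. If such a path is empty, reducedness makes the two letters have the same sign, so the image
  goes on in the direction of \<open>a\<close>; in all cases nothing cancels between the
  pieces.\<close>

lemma mirror_hom_word:
  assumes "reduced (a # w)"
  shows "\<exists>z. reduced z \<and> mirror_hom (free_val (a # w)) = free_val (pos_word 0 (source a)) + free_val z \<and>
    (if snd a then start_gap z > source a else start_gap z < source a)"
  using assms
proof (induction w arbitrary: a)
  have h: "mirror_hom (letter_val gen_free a)
      = free_val (pos_word 0 (source a)) - free_val (pos_word 0 (target a))" for a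
    by (auto simp: letter_val_def mirror_tuple_def partial_sum_std source_def target_def
        simp del: partial_sum_simps(2))
  have st: "if snd a then target a > source a else target a < source a" for a
    by (auto simp: source_def target_def)
  {
    case Nil
    have "start_gap (inv_word (pos_word 0 (target a))) = target a"
    proof (cases "target a = 0")
      case False
      then show ?thesis
        using start_gap_gap_word[of "target a" 0 "[]"] by (simp add: gap_word_def)
    qed (simp add: pos_word_def start_gap_def)
    then show ?case
      using st[of a] by (intro exI[of _ "inv_word (pos_word 0 (target a))"]) (simp add: h)
  next
    case (Cons b w)
    obtain z where z: "reduced z"
      "mirror_hom (free_val (b # w)) = free_val (pos_word 0 (source b)) + free_val z"
      "if snd b then start_gap z > source b else start_gap z < source b"
      using Cons.IH[of b] Cons.prems by (auto simp: reduced_Cons)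
    have sz: "start_gap z \<noteq> source b"
      using z(3) by (auto split: if_splits)
    have "mirror_hom (free_val (a # b # w)) = mirror_hom (letter_val gen_free a) + mirror_hom (free_val (b # w))"
      by (simp add: hom_free_add)
    also have "\<dots> = free_val (pos_word 0 (source a)) - free_val (pos_word 0 (target a))
        + (free_val (pos_word 0 (source b)) + free_val z)"
      unfolding h z(2) ..
    also have "\<dots> = free_val (pos_word 0 (source a)) + free_val (gap_word (target a) (source b) @ z)"
      by (simp add: free_val_gap_word group_norm del: add_uminus_conv_diff)
    finally have eq: "mirror_hom (free_val (a # b # w)) = free_val (pos_word 0 (source a))
        + free_val (gap_word (target a) (source b) @ z)" .
    show ?case
    proof (cases "target a = source b")
      case True
      have "b \<noteq> flip a"
        using Cons.prems by (simp add: reduced_Cons)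
      then have "snd b = snd a"
        using True by (cases a; cases b) (auto simp: source_def target_def split: if_splits)
      then show ?thesis
        using z True eq st[of a] by (intro exI[of _ z]) (auto simp: gap_word_def pos_word_def split: if_splits)
    next
      case False
      then show ?thesis
        using eq st[of a] reduced_gap_word_append[OF z(1) sz False] start_gap_gap_word[OF False, of z]
        by (intro exI[of _ "gap_word (target a) (source b) @ z"]) auto
    qed
  }
qed

text \<open>\<open>(0, True)\<close> is the only letter with source 0. Any other first letter of
  \<open>g\<close> contributes a nonempty initial product of generators to the image, and its first
  letter is not cancelled.\<close>

lemma mirror_hom_left:
  assumes "g \<noteq> 0" "hd (word_of g) \<noteq> (0, True)"
  shows "\<exists>u. word_of (mirror_hom g) = (0, True) # u"
proof -
  obtain a w where aw: "word_of g = a # w"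
    using assms(1) by (cases "word_of g") (metis word_of_inverse zero_free_group.abs_eq)
  obtain z where z: "reduced z"
      "mirror_hom (free_val (a # w)) = free_val (pos_word 0 (source a)) + free_val z"
      "start_gap z \<noteq> source a"
    using mirror_hom_word[of a w] reduced_word_of[of g] unfolding aw by (auto split: if_splits)
  have s: "source a > 0"
    using assms(2) aw by (cases a) (auto simp: source_def)
  then have "reduced (gap_word 0 (source a) @ z)"
    using z by (intro reduced_gap_word_append) auto
  moreover have "mirror_hom g = free_val (gap_word 0 (source a) @ z)"
  proof -
    have "free_val (gap_word 0 (source a) @ z) = free_val (pos_word 0 (source a)) + free_val z"
      by (simp add: gap_word_def)
    moreover have "free_val (a # w) = g"
      by (metis aw free_val_word_of)
    ultimately show ?thesis
      using z(2) by (simp only:)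
  qed
  ultimately have "word_of (mirror_hom g) = gap_word 0 (source a) @ z"
    by (metis word_of_free_val_reduced)
  then show ?thesis
    using s by (auto simp: gap_word_def pos_word_Cons)
qed

lemma conj_gen_std: "\<forall>i\<in>{1..n}. conj_gen (std_tuple i)"
  by simp

lemma hd_word_of_arc:
  assumes "reduced (conj_word w a)" "arc (w, a) \<noteq> gen_free 0" "word_of (arc (w, a)) = (0, True) # u"
  shows "w \<noteq> [] \<and> hd w = (0, True)"
  using assms by (cases w) (auto simp: arc_def word_of_free_val_reduced simp del: free_val_conj_word,
      auto simp: conj_word_def)

lemma hd_word_of_minus_arc:
  assumes "reduced (conj_word w a)" "word_of (- arc (w, a)) = (0, True) # u"
  shows "w \<noteq> [] \<and> hd w = (0, True)"
  using assms by (cases w) (auto simp: arc_def word_of_free_val_reduced uminus_free_group.rep_eq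
      simp del: free_val_conj_word, auto simp: conj_word_def)

text \<open>If the conjugator of the first entry \<open>g\<close> begins with
  \<open>(0, True)\<close>, the reduction applies to \<open>w\<close>. If not, it applies to the
  mirror word: were the mirrored entry \<open>g'\<close> not to begin with \<open>(0, True)\<close>
  either, \<open>mirror_hom_left\<close> would make the inverse of \<open>g\<close> begin with this
  letter, and with it the conjugator of \<open>g\<close>.\<close>

lemma one_sided_multiple:
  assumes w: "w \<in> lists ({1..<n} \<times> UNIV)" "n \<ge> 1"
  obtains (stabilizer) "hurwitz std_tuple w 1 = gen_free 0"
  | (left) v where "v \<in> lists ({1..<n} \<times> UNIV)" "(1, True) \<in> set v" "(1, False) \<notin> set v"
      "hurwitz std_tuple (w @ v) 1 = gen_free 0"
  | (right) v where "v \<in> lists ({1..<n} \<times> UNIV)" "(1, True) \<in> set v" "(1, False) \<notin> set v"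
      "hurwitz std_tuple (map flip w @ v) 1 = gen_free 0"
proof -
  have reduce: "\<exists>v\<in>lists ({1..<n} \<times> UNIV). (1, True) \<in> set v \<and> (1, False) \<notin> set v \<and>
      hurwitz std_tuple (u @ v) 1 = gen_free 0"
    if u: "u \<in> lists ({1..<n} \<times> UNIV)" and "hurwitz std_tuple u 1 = arc (x, a)"
      "reduced (conj_word x a)" "x \<noteq> []" "hd x = (0, True)" for u x a
  proof -
    have "tuple_sum (hurwitz std_tuple u) 1 n = free_val (pos_word 0 n)"
      by (subst tuple_sum_hurwitz[OF u]) (rule partial_sum_std[unfolded partial_sum_def])
    then show ?thesis
      using left_arc_reduction[OF conj_gen_hurwitz[OF conj_gen_std u], of x a] that w(2) by auto
  qed
  have mw: "map flip w \<in> lists ({1..<n} \<times> UNIV)"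
    using w(1) unfolding in_lists_conv_set by (fastforce simp: flip_def)
  define g where "g = hurwitz std_tuple w 1"
  define g' where "g' = hurwitz std_tuple (map flip w) 1"
  have "mirror_hom g' = - g"
    unfolding g_def g'_def using w by (intro mirror_hom_hurwitz) auto
  have cg: "conj_gen g" "conj_gen g'"
    unfolding g_def g'_def
    using conj_gen_hurwitz[OF conj_gen_std w(1)] conj_gen_hurwitz[OF conj_gen_std mw] w(2)
    by (auto simp del: in_lists_conv_set)
  obtain x a where x: "g = arc (x, a)" "reduced (conj_word x a)"
    using conj_gen_arc[OF cg(1)] by (metis prod.collapse)
  obtain x' a' where x': "g' = arc (x', a')" "reduced (conj_word x' a')"
    using conj_gen_arc[OF cg(2)] by (metis prod.collapse)
  consider "g = gen_free 0" | "g \<noteq> gen_free 0" "x \<noteq> []" "hd x = (0, True)"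
    | "g \<noteq> gen_free 0" "\<not> (x \<noteq> [] \<and> hd x = (0, True))" by blast
  then show ?thesis
  proof cases
    case 1
    then show ?thesis using stabilizer by (simp add: g_def)
  next
    case 2
    then have "\<exists>v\<in>lists ({1..<n} \<times> UNIV). (1, True) \<in> set v \<and> (1, False) \<notin> set v \<and>
        hurwitz std_tuple (w @ v) 1 = gen_free 0"
      by (intro reduce[OF w(1), of x a] x(2)) (use x(1) in \<open>simp_all add: g_def\<close>)
    then show ?thesis using left by blast
  next
    case 3
    have "hd (word_of g') = (0, True)"
    proof (rule ccontr)
      assume "hd (word_of g') \<noteq> (0, True)"
      moreover have "g' \<noteq> 0"
        using length_arc[OF x'(2)] x'(1) by (auto simp: zero_free_group.rep_eq)
      ultimately obtain u where "word_of (- g) = (0, True) # u"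
        using mirror_hom_left \<open>mirror_hom g' = - g\<close> by metis
      then show False
        using hd_word_of_minus_arc x 3(2) by metis
    qed
    moreover have "word_of g' \<noteq> []"
      using length_arc[OF x'(2)] x'(1) by auto
    ultimately obtain u where "word_of g' = (0, True) # u"
      by (cases "word_of g'") auto
    moreover have "g' \<noteq> gen_free 0"
    proof
      assume "g' = gen_free 0"
      then have "- g = - gen_free 0"
        using \<open>mirror_hom g' = - g\<close> by (simp add: mirror_tuple_def)
      then show False using 3(1) by (simp add: neg_equal_iff_equal)
    qed
    ultimately have "x' \<noteq> []" "hd x' = (0, True)"
      using hd_word_of_arc[OF x'(2)] unfolding x'(1) by blast+
    then have "\<exists>v\<in>lists ({1..<n} \<times> UNIV). (1, True) \<in> set v \<and> (1, False) \<notin> set v \<and>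
        hurwitz std_tuple (map flip w @ v) 1 = gen_free 0"
      by (intro reduce[OF mw, of x' a'] x'(2)) (use x'(1) in \<open>simp_all add: g'_def\<close>)
    then show ?thesis using right by blast
  qed
qed

section \<open>Combing\<close>

text \<open>\<open>strand_word k d\<close> moves the strand \<open>k + d\<close> to the position \<open>k\<close>; \<open>loop_word k d\<close> lets the
  strand \<open>k\<close> run around the strand \<open>k + d + 1\<close>.\<close>

fun strand_word :: "nat \<Rightarrow> nat \<Rightarrow> letter list" where
  "strand_word k 0 = []"
| "strand_word k (Suc d) = (k + d, True) # strand_word k d"

fun loop_word :: "nat \<Rightarrow> nat \<Rightarrow> letter list" where
  "loop_word k 0 = [(k, True), (k, True)]"
| "loop_word k (Suc d) = (k + Suc d, True) # loop_word k d @ [(k + Suc d, False)]"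

text \<open>Substitutes the loops of strand \<open>k\<close> for the letters of a word. Among pure
  braids on the strands from \<open>k\<close> on, these loops generate the kernel of forgetting
  strand \<open>k\<close>.\<close>

definition loops_word :: "nat \<Rightarrow> letter list \<Rightarrow> letter list" where
  "loops_word k f = concat (map (\<lambda>a. if snd a then loop_word k (fst a) else inv_word (loop_word k (fst a))) f)"

lemma loops_word_simps [simp]:
  "loops_word k [] = []" "loops_word k (f @ g) = loops_word k f @ loops_word k g"
  by (simp_all add: loops_word_def)

lemma word_val_loops_word: "word_val s (loops_word k f) = word_val (\<lambda>d. word_val s (loop_word k d)) f"
  by (induction f) (auto simp: loops_word_def letter_val_def)

lemma add_context: "x + y = u + (v :: 'g :: group_add) \<Longrightarrow> x + (y + z) = u + (v + z)"
  by (metis add.assoc)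

lemma commute_minus: "x + y = y + x \<Longrightarrow> - x + y = y + - (x :: 'g :: group_add)"
  by (metis add.assoc add.right_inverse add_0_right minus_add_cancel)

lemma commute_add: "x + y = y + x \<Longrightarrow> x + z = z + x \<Longrightarrow> x + (y + z) = (y + z) + (x :: 'g :: group_add)"
  by (metis add.assoc)

lemma commute_minus': "x + y = y + x \<Longrightarrow> x + - y = - y + (x :: 'g :: group_add)"
  by (metis commute_minus)

lemma intertwine_minus: "x + z = z + y \<Longrightarrow> - x + z = z + - (y :: 'g :: group_add)"
proof -
  assume *: "x + z = z + y"
  have "x + (z + - y) = (z + y) + - y"
    using * by (metis add.assoc)
  then have "x + (z + - y) = z"
    by simp
  then show ?thesis by (metis minus_add_cancel)
qed

text \<open>The relations are imposed on elements of any group, so that the computations below are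
  equations in a group instead of derivations of \<open>braid_eq\<close>.\<close>

locale artin_relations =
  fixes n :: nat and s :: "nat \<Rightarrow> 'g :: group_add"
  assumes far: "1 \<le> i \<Longrightarrow> j < n \<Longrightarrow> i + 2 \<le> j \<Longrightarrow> s i + s j = s j + s i"
    and near: "1 \<le> i \<Longrightarrow> Suc i < n \<Longrightarrow> s i + (s (Suc i) + s i) = s (Suc i) + (s i + s (Suc i))"
begin

context
  fixes k :: nat
  assumes k: "1 \<le> k"
begin

abbreviation "c d \<equiv> word_val s (strand_word k d)"
abbreviation "a d \<equiv> word_val s (loop_word k d)"

lemma a_Suc: "a (Suc d) = s (k + Suc d) + a d - s (k + Suc d)"
  by (simp add: group_norm del: add_uminus_conv_diff)

lemma s_c_far: "k + d < i \<Longrightarrow> i < n \<Longrightarrow> s i + c d = c d + s i"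
proof (induction d)
  case (Suc d)
  have "s i + s (k + d) = s (k + d) + s i"
    using Suc.prems k by (intro far[symmetric]) auto
  then show ?case
    using Suc by (simp add: commute_add)
qed simp

text \<open>The moving strand passes the crossing, which comes out one position further to the
  right: one braid relation where they meet, far commutation elsewhere.\<close>

lemma s_c_shift: "k \<le> i \<Longrightarrow> Suc i < k + d \<Longrightarrow> k + d \<le> n \<Longrightarrow> s i + c d = c d + s (Suc i)"
proof (induction d)
  case (Suc d)
  show ?case
  proof (cases "Suc i < k + d")
    case True
    have "s i + s (k + d) = s (k + d) + s i"
      using Suc.prems True k by (intro far) auto
    then have "s i + (s (k + d) + c d) = s (k + d) + (s i + c d)"
      by (rule add_context)
    then show ?thesis
      using Suc True by (simp add: add.assoc)
  next
    case False
    then have i: "k + d = Suc i" using Suc.prems by simp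
    then obtain d' where d: "d = Suc d'" using Suc.prems by (cases d) auto
    have i': "k + d' = i" using i d by simp
    have "s i + c (Suc d) = s i + (s (Suc i) + s i) + c d'"
      using i i' by (simp add: d add.assoc)
    also have "\<dots> = s (Suc i) + (s i + (s (Suc i) + c d'))"
      using near[of i] k Suc.prems by (simp add: i' add.assoc)
    also have "s (Suc i) + c d' = c d' + s (Suc i)"
      using Suc.prems i' by (intro s_c_far) auto
    finally show ?thesis
      using i i' by (simp add: d add.assoc)
  qed
qed simp

text \<open>Carried along the moving strand, the loop becomes a full twist of two neighbouring
  strands. This is how a letter at the start of the moving strand is traded for a loop.\<close>

lemma c_a: "k + d < n \<Longrightarrow> c d + a d = s (k + d) + (s (k + d) + c d)"
proof (induction d)
  case (Suc d)
  define t t' C A where defs: "t = s (k + d)" "t' = s (k + Suc d)" "C = c d" "A = a d"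
  have C: "t' + C = C + t'"
    unfolding defs using Suc.prems by (intro s_c_far) auto
  have IH: "C + A = t + (t + C)"
    using Suc by (simp add: defs)
  have br: "t + (t' + t) = t' + (t + t')"
    unfolding defs using near[of "k + d"] Suc.prems k by simp
  have br': "t + (t' + (t + z)) = t' + (t + (t' + z))" for z
    using br by (metis add.assoc)
  have "c (Suc d) + a (Suc d) = t + ((C + t') + (A - t'))"
    by (simp add: defs add.assoc)
  also have "\<dots> = t + (t' + (C + A) - t')"
    unfolding C[symmetric] by (simp add: group_norm del: add_uminus_conv_diff)
  also have "\<dots> = t + (t' + t) + (t + (C + - t'))"
    unfolding IH by (simp add: group_norm del: add_uminus_conv_diff)
  also have "C + - t' = - t' + C"
    using C by (metis commute_minus)
  also have "t + (t' + t) + (t + (- t' + C)) = t' + (t' + (t + C))"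
    by (simp add: add.assoc br')
  finally show ?case
    by (simp add: defs)
qed (simp add: add.assoc)

lemma s_a_far: "k + d + 1 < i \<Longrightarrow> i < n \<Longrightarrow> s i + a d = a d + s i"
proof (induction d)
  case 0
  have "s i + s k = s k + s i"
    using 0 k by (intro far[symmetric]) auto
  then show ?case by (simp add: commute_add)
next
  case (Suc d)
  have "s i + s (k + Suc d) = s (k + Suc d) + s i"
    using Suc.prems k by (intro far[symmetric]) auto
  then show ?case
    unfolding a_Suc diff_conv_add_uminus using Suc
    by (intro commute_add commute_minus') auto
qed

lemma s_a_inside: "k < i \<Longrightarrow> i < k + d \<Longrightarrow> k + d < n \<Longrightarrow> s i + a d = a d + s i"
proof (induction d)
  case (Suc d)
  show ?case
  proof (cases "i < k + d")
    case True
    have "s i + s (k + Suc d) = s (k + Suc d) + s i"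
      using Suc.prems k True by (intro far) auto
    then show ?thesis
      unfolding a_Suc diff_conv_add_uminus using Suc True
      by (intro commute_add commute_minus') auto
  next
    case False
    then have i: "i = k + d" using Suc.prems by simp
    then obtain d' where d: "d = Suc d'" using Suc.prems by (cases d) auto
    define t t' A where defs: "t = s i" "t' = s (Suc i)" "A = a d'"
    have tA: "t' + A = A + t'"
      unfolding defs using Suc.prems i d by (intro s_a_far) auto
    have br: "t + (t' + t) = t' + (t + t')"
      unfolding defs using near[of i] Suc.prems k i by simp
    have a: "a (Suc d) = t' + (t + (A + (- t + - t')))"
      by (simp add: defs i d a_Suc group_norm del: add_uminus_conv_diff word_val_simps loop_word.simps)
    have br': "- t + (- t' + t) = t' + (- t + - t')"
    proof -
      have "(t + (t' + t)) + (- t + - t') = t"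
        by (simp add: group_norm del: add_uminus_conv_diff)
      then have "t' + (t + (t' + (- t + - t'))) = t"
        unfolding br by (simp add: add.assoc)
      then show ?thesis
        by (metis minus_add_cancel)
    qed
    have "t + a (Suc d) = (t + (t' + t)) + (A + (- t + - t'))"
      unfolding a by (simp add: add.assoc)
    also have "\<dots> = t' + (t + ((t' + A) + (- t + - t')))"
      unfolding br by (simp add: add.assoc)
    also have "\<dots> = t' + (t + (A + (t' + (- t + - t'))))"
      unfolding tA by (simp add: add.assoc)
    also have "\<dots> = a (Suc d) + t"
      unfolding a br'[symmetric] by (simp add: group_norm del: add_uminus_conv_diff)
    finally show ?thesis by (simp add: defs)
  qed
qed simp

text \<open>The product of the loops around two adjacent strands encloses both, so the crossing of
  these strands commutes with it. Together with \<open>a_Suc\<close> this determines the conjugates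
  of the loops.\<close>

lemma s_a_a: "k + Suc d < n \<Longrightarrow> s (k + Suc d) + (a d + a (Suc d)) = (a d + a (Suc d)) + s (k + Suc d)"
proof (induction d)
  case 0
  define t t' where defs: "t = s k" "t' = s (Suc k)"
  have br: "t + (t' + t) = t' + (t + t')"
    unfolding defs using near[of k] 0 k by simp
  have a: "a 0 + a (Suc 0) + t' = t + (t + (t' + (t + t)))" "a 0 + a (Suc 0) = t + (t + (t' + (t + (t + - t'))))"
    by (simp_all add: defs add.assoc)
  have "t' + (a 0 + a (Suc 0)) = t' + (t + ((t + (t' + t)) + (t + - t')))"
    unfolding a by (simp add: add.assoc)
  also have "\<dots> = (t' + (t + t')) + (t + (t' + (t + - t')))"
    unfolding br by (simp add: add.assoc)
  also have "\<dots> = (t + (t' + t)) + ((t + (t' + t)) + - t')"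
    unfolding br[symmetric] by (simp add: group_norm del: add_uminus_conv_diff)
  also have "\<dots> = (t + (t' + t)) + (t' + t)"
    unfolding br by (simp add: group_norm del: add_uminus_conv_diff)
  also have "\<dots> = t + (t' + (t + t')) + t"
    by (simp add: add.assoc)
  also have "\<dots> = t + (t + (t' + (t + t)))"
    unfolding br[symmetric] by (simp add: add.assoc)
  finally show ?case
    using a by (simp add: defs)
next
  case (Suc d)
  define t t' A B where defs: "t = s (k + Suc d)" "t' = s (k + Suc (Suc d))" "A = a d" "B = a (Suc d)"
  have br: "t + (t' + t) = t' + (t + t')"
    unfolding defs using near[of "k + Suc d"] Suc.prems k by simp
  have IH: "t + (A + B) = (A + B) + t"
    unfolding defs using Suc by simp
  have tA: "t' + A = A + t'"
    unfolding defs using Suc.prems by (intro s_a_far) auto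
  have B: "B = t + A - t" and B': "a (Suc (Suc d)) = t' + B - t'"
    unfolding defs by (rule a_Suc)+
  \<comment> \<open>Conjugation by \<open>u\<close> raises all indices by one: it sends
    \<open>t\<close> to \<open>t'\<close>, \<open>A\<close> to \<open>B\<close> and \<open>B\<close>
    to the next loop. So it carries the induction hypothesis to the claim.\<close>
  define u where "u = t + t'"
  have ut: "u + t - u = t'"
    unfolding u_def using br by (simp add: diff_conv_add_uminus add.assoc minus_add del: add_uminus_conv_diff)
  have uA: "u + A - u = B"
    unfolding u_def B using add_context[OF tA, of "- t'"]
    by (simp add: group_norm del: add_uminus_conv_diff) (metis add.assoc)
  have uB: "u + B - u = a (Suc (Suc d))"
  proof -
    have "u + B - u = (t + (t' + t)) + (A - t) - u"
      unfolding B u_def by (simp add: group_norm del: add_uminus_conv_diff)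
    also have "\<dots> = t' + (t + ((t' + A) - t - u))"
      unfolding br by (simp add: group_norm del: add_uminus_conv_diff)
    also have "\<dots> = t' + (t + (A + (t' - t - u)))"
      unfolding tA by (simp add: group_norm del: add_uminus_conv_diff)
    also have "t' - t - u = - t - t'"
    proof -
      have "- (t' - t - u) = u + t - t'"
        by (simp add: group_norm del: add_uminus_conv_diff)
      also have "\<dots> = t' + t"
        using br by (simp add: u_def add.assoc) (metis add.assoc add_diff_cancel)
      finally show ?thesis
        by (metis minus_minus minus_add diff_conv_add_uminus)
    qed
    finally show ?thesis
      unfolding B' B by (simp add: group_norm del: add_uminus_conv_diff)
  qed
  have conj: "u + (x + y) - u = (u + x - u) + (u + y - u)" for x y
    by (simp add: group_norm del: add_uminus_conv_diff)
  have "u + (t + (A + B)) - u = u + ((A + B) + t) - u"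
    unfolding IH ..
  then show ?case
    unfolding conj uA uB ut by (simp add: defs)
qed

definition "loops = (\<lambda>f. word_val s (loops_word k f)) ` lists ({0..<n - k} \<times> UNIV)"

lemma loopsI: "f \<in> lists ({0..<n - k} \<times> UNIV) \<Longrightarrow> word_val s (loops_word k f) \<in> loops"
  by (simp add: loops_def)

lemma loopsE:
  assumes "x \<in> loops"
  obtains f where "f \<in> lists ({0..<n - k} \<times> UNIV)" "x = word_val s (loops_word k f)"
  using assms by (auto simp: loops_def)

lemma zero_loops: "0 \<in> loops"
  using loopsI[of "[]"] by simp

lemma loops_add: "x \<in> loops \<Longrightarrow> y \<in> loops \<Longrightarrow> x + y \<in> loops"
proof -
  assume "x \<in> loops" "y \<in> loops"
  then obtain f g where "f \<in> lists ({0..<n - k} \<times> UNIV)" "g \<in> lists ({0..<n - k} \<times> UNIV)"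
    "x = word_val s (loops_word k f)" "y = word_val s (loops_word k g)" by (metis loopsE)
  then show ?thesis using loopsI[of "f @ g"] by simp
qed

lemma loops_letter: "d < n - k \<Longrightarrow> a d \<in> loops" "d < n - k \<Longrightarrow> - a d \<in> loops"
  using loopsI[of "[(d, True)]"] loopsI[of "[(d, False)]"] by (simp_all add: loops_word_def)

lemma loops_minus: "x \<in> loops \<Longrightarrow> - x \<in> loops"
proof -
  assume "x \<in> loops"
  then obtain f where f: "f \<in> lists ({0..<n - k} \<times> UNIV)" "x = word_val s (loops_word k f)"
    by (rule loopsE)
  then have "inv_word f \<in> lists ({0..<n - k} \<times> UNIV)"
    unfolding in_lists_conv_set by (fastforce simp: inv_word_def flip_def)
  then show ?thesis
    using loopsI[of "inv_word f"] by (simp add: f word_val_loops_word)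
qed

text \<open>Outside two critical positions the letter commutes with the loop. At the critical
  positions one direction of conjugation turns the loop into a neighbouring loop by
  \<open>a_Suc\<close>, and the other yields a product of loops by \<open>s_a_a\<close>.\<close>

lemma loops_conj_letter:
  assumes "k < i" "i < n" "d < n - k"
  shows "s i + a d - s i \<in> loops \<and> - s i + a d + s i \<in> loops"
proof -
  have comm: ?thesis if "s i + a d = a d + s i"
  proof -
    have "s i + a d - s i = a d" "- s i + a d + s i = a d"
      using that by (simp add: that) (metis add.assoc minus_add_cancel that)
    then show ?thesis using loops_letter assms by simp
  qed
  consider "i = k + Suc d" | "Suc i = k + Suc d" | "i < k + d" | "k + d + 1 < i"
    by linarith
  then show ?thesis
  proof cases
    case 1
    have d: "d < n - k" "Suc d < n - k" using assms 1 by auto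
    have 2: "s i + (a d + a (Suc d)) = (a d + a (Suc d)) + s i"
      using s_a_a[of d] assms 1 by simp
    have 3: "s i + a d - s i = a (Suc d)"
      using 1 a_Suc by simp
    have "- s i + ((s i + a d - s i) + s i) = a d"
      by (simp add: add.assoc)
    then have 4: "- s i + (a (Suc d) + s i) = a d"
      unfolding 3 .
    have "a d + a (Suc d) = - s i + (s i + (a d + a (Suc d)))"
      by simp
    also have "\<dots> = - s i + ((a d + a (Suc d)) + s i)"
      unfolding 2 ..
    also have "\<dots> = (- s i + a d + s i) + (- s i + (a (Suc d) + s i))"
      by (simp add: add.assoc del: word_val_simps loop_word.simps)
    finally have 5: "- s i + a d + s i = a d + a (Suc d) + - a d"
      unfolding 4 by (metis add_diff_cancel diff_conv_add_uminus)
    show ?thesis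
      unfolding 3 5 by (intro conjI loops_add loops_letter d)
  next
    case 2
    then obtain e where e: "d = Suc e" using assms by (cases d) auto
    have d: "e < n - k" "Suc e < n - k" using assms e by auto
    have i: "i = k + Suc e" using 2 e by simp
    have 2: "s i + (a e + a (Suc e)) = (a e + a (Suc e)) + s i"
      using s_a_a[of e] assms i by simp
    have 3: "s i + a e - s i = a (Suc e)"
      using i a_Suc by simp
    have 4: "- s i + a (Suc e) + s i = a e"
      unfolding 3[symmetric] by (simp add: add.assoc)
    have "a e + a (Suc e) = s i + (a e + a (Suc e)) - s i"
      unfolding 2 by simp
    also have "\<dots> = (s i + a e - s i) + (s i + a (Suc e) - s i)"
      by (simp add: group_norm del: add_uminus_conv_diff word_val_simps loop_word.simps)
    finally have 5: "s i + a (Suc e) - s i = - a (Suc e) + (a e + a (Suc e))"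
      unfolding 3 by (metis minus_add_cancel)
    show ?thesis
      unfolding e 4 5 by (intro conjI loops_add loops_letter d)
  next
    case 3
    then show ?thesis using comm s_a_inside assms by simp
  next
    case 4
    then show ?thesis using comm s_a_far assms by simp
  qed
qed

lemma loops_conj:
  assumes "k < i" "i < n" "x \<in> loops"
  shows "s i + x - s i \<in> loops" "- s i + x + s i \<in> loops"
proof -
  obtain f where f: "f \<in> lists ({0..<n - k} \<times> UNIV)" "x = word_val s (loops_word k f)"
    using assms(3) by (rule loopsE)
  have conj: "s i + (u + v) - s i = (s i + u - s i) + (s i + v - s i)"
    "- s i + (u + v) + s i = (- s i + u + s i) + (- s i + v + s i)"
    "s i + - u - s i = - (s i + u - s i)" "- s i + - u + s i = - (- s i + u + s i)" for u v
    by (simp_all add: group_norm del: add_uminus_conv_diff)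
  have "s i + x - s i \<in> loops \<and> - s i + x + s i \<in> loops"
    using f unfolding word_val_loops_word
  proof (induction f arbitrary: x rule: list.induct)
    case (Cons b f)
    have b: "fst b < n - k" using Cons.prems by auto
    have "s i + letter_val a b - s i \<in> loops \<and> - s i + letter_val a b + s i \<in> loops"
      using loops_conj_letter[OF assms(1,2) b] unfolding letter_val_def
      by (cases "snd b") (simp_all only: if_True if_False conj loops_minus)
    then show ?case
      using Cons.IH Cons.prems by (simp add: conj loops_add del: add_uminus_conv_diff)
  qed (simp add: zero_loops)
  then show "s i + x - s i \<in> loops" "- s i + x + s i \<in> loops" by auto
qed

text \<open>The words \<open>strand_word k d\<close> serve as coset representatives, according to
  the strand that ends up at position \<open>k\<close>. A further letter on the left either passes
  through the representative or changes it at the cost of at most one loop.\<close>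

theorem combing:
  assumes "w \<in> lists ({k..<n} \<times> UNIV)" "k \<le> n"
  shows "\<exists>d f h. k + d \<le> n \<and> f \<in> lists ({0..<n - k} \<times> UNIV) \<and> h \<in> lists ({Suc k..<n} \<times> UNIV) \<and>
    word_val s w = word_val s (strand_word k d @ loops_word k f @ h)"
proof -
  have "\<exists>d x h. k + d \<le> n \<and> x \<in> loops \<and> h \<in> lists ({Suc k..<n} \<times> UNIV) \<and>
    word_val s w = c d + (x + word_val s h)"
    using assms
  proof (induction w rule: list.induct)
    case Nil
    then show ?case
      by (intro exI[of _ 0] exI[of _ "[]"]) (simp add: zero_loops)
  next
    case (Cons b w)
    obtain d x h where d: "k + d \<le> n" and x: "x \<in> loops" and h: "h \<in> lists ({Suc k..<n} \<times> UNIV)"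
      and w: "word_val s w = c d + (x + word_val s h)"
      using Cons by auto
    obtain i e where b: "b = (i, e)" by (cases b)
    have i: "k \<le> i" "i < n" using Cons.prems by (auto simp: b)
    define \<sigma> where "\<sigma> = letter_val s b"
    have val: "word_val s (b # w) = \<sigma> + c d + (x + word_val s h)"
      by (simp add: \<sigma>_def w add.assoc)
    \<comment> \<open>The letter emerges behind \<open>c d\<close> as a letter \<open>j\<close>
      beyond \<open>k\<close>; there it conjugates the loops, which normalises their subgroup, and
      joins \<open>h\<close>.\<close>
    have push: ?case if "\<sigma> + c d = c d + letter_val s (j, e)" "k < j" "j < n" for j
    proof -
      let ?t = "letter_val s (j, e)"
      have "?t + x - ?t \<in> loops"
        using loops_conj[OF that(2,3) x] by (cases e) auto
      moreover have "(j, e) # h \<in> lists ({Suc k..<n} \<times> UNIV)"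
        using h that by auto
      moreover have "word_val s (b # w) = c d + ((?t + x - ?t) + word_val s ((j, e) # h))"
        unfolding val that(1) word_val_simps(2)[of s "(j, e)"]
        by (simp add: group_norm del: add_uminus_conv_diff)
      ultimately show ?thesis
        using d by blast
    qed
    have absorb: ?case if "\<sigma> + c d = c d' + y" "y \<in> loops" "k + d' \<le> n" for d' y
    proof -
      have "word_val s (b # w) = c d' + ((y + x) + word_val s h)"
        unfolding val that(1) by (simp add: add.assoc)
      then show ?thesis
        using loops_add[OF that(2) x] that(3) h by blast
    qed
    consider "i > k + d" | "i = k + d" | "Suc i = k + d" | "Suc i < k + d" by linarith
    then show ?case
    proof cases
      case 1
      then have "s i + c d = c d + s i"
        using i by (intro s_c_far) auto
      then have "\<sigma> + c d = c d + letter_val s (i, e)"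
        unfolding \<sigma>_def b by (cases e) (simp_all add: commute_minus)
      then show ?thesis
        using push 1 i by auto
    next
      case 2
      show ?thesis
      proof (cases e)
        case True
        then have "\<sigma> + c d = c (Suc d) + 0"
          by (simp add: \<sigma>_def b 2)
        then show ?thesis
          using absorb[of "Suc d" 0] zero_loops 2 i by simp
      next
        case False
        have "s i + c (Suc d) = s i + (s i + c d)"
          by (simp add: 2)
        also have "\<dots> = c d + a d"
          using c_a[of d] 2 i by simp
        finally have *: "s i + c (Suc d) = c d + a d" .
        have "c (Suc d) + - a d = - s i + c d"
        proof -
          have "c (Suc d) = - s i + (c d + a d)"
            using * by (metis minus_add_cancel)
          then show ?thesis
            by (simp add: group_norm del: add_uminus_conv_diff word_val_simps strand_word.simps)
        qed
        then have "\<sigma> + c d = c (Suc d) + - a d"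
          using False by (simp add: \<sigma>_def b)
        then show ?thesis
          using absorb[of "Suc d" "- a d"] loops_letter(2)[of d] 2 i by simp
      qed
    next
      case 3
      then obtain d' where d': "d = Suc d'" using i by (cases d) auto
      have i': "i = k + d'" using 3 d' by simp
      show ?thesis
      proof (cases e)
        case True
        then have "\<sigma> + c d = c d' + a d'"
          using c_a[of d'] i i' by (simp add: \<sigma>_def b d')
        then show ?thesis
          using absorb[of d' "a d'"] loops_letter(1)[of d'] i i' by simp
      next
        case False
        then have "\<sigma> + c d = c d' + 0"
          by (simp add: \<sigma>_def b d' i')
        then show ?thesis
          using absorb[of d' 0] zero_loops i i' by simp
      qed
    next
      case 4
      then have "s i + c d = c d + s (Suc i)"
        using i d by (intro s_c_shift) auto
      then have "- s i + c d = c d + - s (Suc i)"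
        by (rule intertwine_minus)
      then have "\<sigma> + c d = c d + letter_val s (Suc i, e)"
        using \<open>s i + c d = c d + s (Suc i)\<close> unfolding \<sigma>_def b by (cases e) simp_all
      then show ?thesis
        using push[of "Suc i"] 4 i d by auto
    qed
  qed
  then obtain d x h where *: "k + d \<le> n" "x \<in> loops" "h \<in> lists ({Suc k..<n} \<times> UNIV)"
    "word_val s w = c d + (x + word_val s h)" by blast
  obtain f where "f \<in> lists ({0..<n - k} \<times> UNIV)" "x = word_val s (loops_word k f)"
    using *(2) by (rule loopsE)
  then show ?thesis
    using * by (intro exI[of _ d] exI[of _ f] exI[of _ h]) simp
qed

end

end

section \<open>The braid group as a group of bijections\<close>

typedef 'a bijection = "{f :: 'a \<Rightarrow> 'a. bij f}"
  morphisms apply_bij Abs_bij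
  by (rule exI[of _ id]) simp

setup_lifting type_definition_bijection

instantiation bijection :: (type) group_add
begin

lift_definition zero_bijection :: "'a bijection" is id by simp
lift_definition plus_bijection :: "'a bijection \<Rightarrow> 'a bijection \<Rightarrow> 'a bijection" is "(\<circ>)"
  by (rule bij_comp)
lift_definition uminus_bijection :: "'a bijection \<Rightarrow> 'a bijection" is "inv_into UNIV"
  by (rule bij_imp_bij_inv)
definition minus_bijection :: "'a bijection \<Rightarrow> 'a bijection \<Rightarrow> 'a bijection" where
  "minus_bijection a b = a + - b"

instance
  by standard (transfer; auto simp: minus_bijection_def bij_is_inj)+

end

lemma inv_word_mirror: "inv_word w = rev (mirror_word w)"
  by (simp add: inv_word_def mirror_word_def flip_def case_prod_unfold)

lemma mirror_word_flip: "mirror_word w = map flip w"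
  by (simp add: mirror_word_def flip_def case_prod_unfold)

text \<open>Arguments that are not braid classes stay fixed, which makes the map a bijection of the
  whole type.\<close>

definition left_mult :: "nat \<Rightarrow> braid_word \<Rightarrow> braid_word set \<Rightarrow> braid_word set" where
  "left_mult n u C = (if C \<in> braid_of n ` braid_words n then \<Union>v\<in>C. braid_of n (u @ v) else C)"

lemma left_mult_braid_of:
  assumes "u \<in> braid_words n" "v \<in> braid_words n"
  shows "left_mult n u (braid_of n v) = braid_of n (u @ v)"
proof -
  have "braid_of n (u @ v') = braid_of n (u @ v)" if "v' \<in> braid_of n v" for v'
    using that assms unfolding braid_of_def by (blast intro: braid_eq.intros)
  moreover have "v \<in> braid_of n v"
    using assms(2) by (simp add: braid_of_def braid_eq.refl)
  ultimately have "(\<Union>v'\<in>braid_of n v. braid_of n (u @ v')) = braid_of n (u @ v)"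
    by blast
  then show ?thesis
    using assms(2) by (simp add: left_mult_def)
qed

lemma append_in_braid_words [simp]:
  "u @ v \<in> braid_words n \<longleftrightarrow> u \<in> braid_words n \<and> v \<in> braid_words n"
  by (auto simp: braid_words_def)

lemma left_mult_append:
  assumes "u \<in> braid_words n" "v \<in> braid_words n"
  shows "left_mult n (u @ v) = left_mult n u \<circ> left_mult n v"
proof
  fix C
  show "left_mult n (u @ v) C = (left_mult n u \<circ> left_mult n v) C"
  proof (cases "C \<in> braid_of n ` braid_words n")
    case True
    then show ?thesis
      using assms by (auto simp: left_mult_braid_of)
  qed (simp add: left_mult_def)
qed

lemma left_mult_cong:
  assumes "braid_eq n u v"
  shows "left_mult n u = left_mult n v"
proof
  fix C
  have uv: "u \<in> braid_words n" "v \<in> braid_words n"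
    using braid_eq_words[OF assms] by auto
  have "braid_of n (u @ x) = braid_of n (v @ x)" if "x \<in> braid_words n" for x
    using that assms uv by (subst braid_of_eq_iff) (auto intro: braid_eq.intros)
  then show "left_mult n u C = left_mult n v C"
    using uv by (cases "C \<in> braid_of n ` braid_words n") (auto simp: left_mult_braid_of, simp_all add: left_mult_def)
qed

lemma left_mult_Nil: "left_mult n [] = id"
proof
  fix C
  show "left_mult n [] C = id C"
  proof (cases "C \<in> braid_of n ` braid_words n")
    case True
    then obtain v where "v \<in> braid_words n" "C = braid_of n v" by blast
    moreover have "[] \<in> braid_words n" by (simp add: braid_words_def)
    ultimately show ?thesis using left_mult_braid_of[of "[]" n v] by simp
  qed (simp add: left_mult_def)
qed

lemma inv_word_braid_words [simp]: "inv_word w \<in> braid_words n \<longleftrightarrow> w \<in> braid_words n"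
  by (simp add: inv_word_mirror)

lemma braid_eq_inv_word: "w \<in> braid_words n \<Longrightarrow> braid_eq n (inv_word w @ w) []"
  unfolding inv_word_mirror by (rule braid_eq_inverse)

lemma bij_left_mult:
  assumes "w \<in> braid_words n"
  shows "bij (left_mult n w)"
proof (rule o_bij)
  show "left_mult n (inv_word w) \<circ> left_mult n w = id"
    using assms left_mult_append[of "inv_word w" n w] left_mult_cong[OF braid_eq_inv_word[OF assms]]
    by (simp add: left_mult_Nil)
  have "braid_eq n (w @ inv_word w) []"
    using braid_eq_inv_word[of "inv_word w" n] assms by simp
  from left_mult_cong[OF this] show "left_mult n w \<circ> left_mult n (inv_word w) = id"
    using assms left_mult_append[of w n "inv_word w"] by (simp add: left_mult_Nil)
qed

text \<open>The class \<open>group_add\<close> speaks of whole types, while the braid group depends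
  on \<open>n\<close>. It is therefore realised by its left regular representation among the
  bijections of a type.\<close>

definition artin_gen :: "nat \<Rightarrow> nat \<Rightarrow> braid_word set bijection" where
  "artin_gen n i = Abs_bij (left_mult n [(i, True)])"

lemma letter_in_braid_words [simp]: "[a] \<in> braid_words n \<longleftrightarrow> 1 \<le> fst a \<and> fst a < n"
  by (cases a) (auto simp: braid_words_def)

lemma Nil_in_braid_words [simp]: "[] \<in> braid_words n"
  by (simp add: braid_words_def)

lemma Cons_in_braid_words: "a # w \<in> braid_words n \<longleftrightarrow> 1 \<le> fst a \<and> fst a < n \<and> w \<in> braid_words n"
  using append_in_braid_words[of "[a]" w n] by (auto simp del: append_in_braid_words)

lemma apply_artin_gen:
  assumes "w \<in> braid_words n"
  shows "apply_bij (word_val (artin_gen n) w) = left_mult n w"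
  using assms
proof (induction w)
  case Nil
  show ?case by (simp add: left_mult_Nil zero_bijection.rep_eq)
next
  case (Cons a w)
  obtain i e where a: "a = (i, e)" by (cases a)
  have i: "1 \<le> i" "i < n" and w: "w \<in> braid_words n"
    using Cons.prems by (auto simp: a Cons_in_braid_words)
  have gen: "apply_bij (artin_gen n i) = left_mult n [(i, True)]"
    unfolding artin_gen_def using i by (intro Abs_bij_inverse) (simp add: bij_left_mult)
  have "inv_into UNIV (left_mult n [(i, True)]) = left_mult n [(i, False)]"
  proof (rule inv_equality)
    have 1: "left_mult n [(i, False)] \<circ> left_mult n [(i, True)] = id"
      using i left_mult_append[of "[(i, False)]" n "[(i, True)]"]
        left_mult_cong[OF braid_eq.cancel[of i n False]] by (simp add: left_mult_Nil)
    have 2: "left_mult n [(i, True)] \<circ> left_mult n [(i, False)] = id"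
      using i left_mult_append[of "[(i, True)]" n "[(i, False)]"]
        left_mult_cong[OF braid_eq.cancel[of i n True]] by (simp add: left_mult_Nil)
    show "left_mult n [(i, False)] (left_mult n [(i, True)] x) = x" for x
      using fun_cong[OF 1, of x] by simp
    show "left_mult n [(i, True)] (left_mult n [(i, False)] x) = x" for x
      using fun_cong[OF 2, of x] by simp
  qed
  then have "apply_bij (letter_val (artin_gen n) a) = left_mult n [a]"
    by (cases e) (simp_all add: a gen uminus_bijection.rep_eq)
  moreover have "left_mult n (a # w) = left_mult n [a] \<circ> left_mult n w"
    using left_mult_append[of "[a]" n w] i w by (simp add: a)
  ultimately show ?case
    using Cons.IH w by (simp add: plus_bijection.rep_eq)
qed

text \<open>The regular representation is faithful, since a word sends the class of the empty word
  to its own class.\<close>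

lemma braid_eq_iff_word_val:
  assumes "u \<in> braid_words n" "v \<in> braid_words n"
  shows "braid_eq n u v \<longleftrightarrow> word_val (artin_gen n) u = word_val (artin_gen n) v"
proof
  assume "braid_eq n u v"
  then show "word_val (artin_gen n) u = word_val (artin_gen n) v"
    using left_mult_cong apply_artin_gen assms by (metis apply_bij_inject)
next
  assume "word_val (artin_gen n) u = word_val (artin_gen n) v"
  then have "left_mult n u (braid_of n []) = left_mult n v (braid_of n [])"
    using apply_artin_gen assms by metis
  then show "braid_eq n u v"
    using assms by (simp add: left_mult_braid_of braid_of_eq_iff)
qed

lemma artin_relations_artin_gen: "artin_relations n (artin_gen n)"
proof
  fix i j :: nat assume "1 \<le> i" "j < n" "i + 2 \<le> j"
  then show "artin_gen n i + artin_gen n j = artin_gen n j + artin_gen n i"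
    using braid_eq.commute[of i n j] braid_eq_iff_word_val[of "[(i, True), (j, True)]" n "[(j, True), (i, True)]"]
    by (simp add: Cons_in_braid_words)
next
  fix i :: nat assume "1 \<le> i" "Suc i < n"
  then show "artin_gen n i + (artin_gen n (Suc i) + artin_gen n i)
      = artin_gen n (Suc i) + (artin_gen n i + artin_gen n (Suc i))"
    using braid_eq.braid[of i n] braid_eq_iff_word_val[of "[(i, True), (Suc i, True), (i, True)]" n
        "[(Suc i, True), (i, True), (Suc i, True)]"]
    by (simp add: Cons_in_braid_words)
qed

section \<open>Faithfulness of the Hurwitz action\<close>

lemma hurwitz_braid_eq: "braid_eq n u v \<Longrightarrow> hurwitz y u = hurwitz y v"
proof (induction arbitrary: y rule: braid_eq.induct)
  case (append u u' v v')
  then show ?case by (simp add: append.IH)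
next
  case (cancel i e)
  then show ?case using hurwitz_move_flip[of "(i, e)" y] by simp
next
  case (commute i j)
  then show ?case by (auto simp: hurwitz_move_def Let_def fun_eq_iff)
next
  case (braid i)
  then show ?case
    by (auto simp: hurwitz_move_def Let_def fun_eq_iff group_norm simp del: add_uminus_conv_diff)
qed auto

lemma hurwitz_strand_word: "hurwitz y (strand_word k d) k = y (k + d)"
  by (induction d arbitrary: y) (auto simp: hurwitz_move_def Let_def)

lemma hurwitz_loop_word: "hurwitz y (loop_word k d) k = - y (k + Suc d) + y k + y (k + Suc d)"
  by (induction d arbitrary: y)
    (auto simp: hurwitz_move_def Let_def group_norm simp del: add_uminus_conv_diff)

text \<open>Applied after the generator of strand \<open>k\<close> has been killed: the loops then
  leave the tuple unchanged, which makes the conjugator of the entry \<open>k\<close>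
  computable.\<close>

lemma hurwitz_loop_word_0:
  assumes "y k = 0"
  shows "hurwitz y (loop_word k d) = y"
  using assms
proof (induction d arbitrary: y)
  case 0
  then show ?case by (auto simp: hurwitz_move_def Let_def)
next
  case (Suc d)
  have "hurwitz (hurwitz_move (k + Suc d, True) y) (loop_word k d) = hurwitz_move (k + Suc d, True) y"
    using Suc.prems by (intro Suc.IH) (auto simp: hurwitz_move_def)
  then show ?case
    using hurwitz_move_flip[of "(k + Suc d, True)" y] by simp
qed

lemma loops_word_single:
  "loops_word k [(d, e)] = (if e then loop_word k d else inv_word (loop_word k d))"
  by (simp add: loops_word_def)

lemma hurwitz_loops_word:
  "\<exists>g. hurwitz y (loops_word k f) k = g + y k - g"
proof (induction f rule: rev_induct)
  case Nil
  show ?case by (rule exI[of _ 0]) simp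
next
  case (snoc b f)
  obtain d e where b: "b = (d, e)" by (cases b)
  define z where "z = hurwitz y (loops_word k f)"
  obtain g where g: "z k = g + y k - g"
    using snoc by (auto simp: z_def)
  show ?case
  proof (cases e)
    case True
    then have "hurwitz y (loops_word k (f @ [b])) k = - z (k + Suc d) + z k + z (k + Suc d)"
      by (simp add: b loops_word_single hurwitz_loop_word flip: z_def)
    then show ?thesis
      by (intro exI[of _ "- z (k + Suc d) + g"]) (simp add: g group_norm del: add_uminus_conv_diff)
  next
    case False
    define x where "x = hurwitz z (inv_word (loop_word k d))"
    have "z k = - x (k + Suc d) + x k + x (k + Suc d)"
      unfolding hurwitz_loop_word[symmetric] by (simp add: x_def)
    then have "x k = x (k + Suc d) + z k - x (k + Suc d)"
      by (simp add: group_norm del: add_uminus_conv_diff)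
    then show ?thesis
      using False by (intro exI[of _ "x (k + Suc d) + g"])
        (simp add: b loops_word_single g group_norm del: add_uminus_conv_diff flip: z_def x_def)
  qed
qed

text \<open>Each loop contributes one factor to the conjugator of the entry \<open>k\<close>. Modulo
  the generator of strand \<open>k\<close> the tuple stays standard, so every contributed factor is
  a known generator, and the word \<open>f\<close> can be read off from the conjugator.\<close>

lemma hurwitz_loops_word_std:
  assumes "k \<ge> 1"
  defines "\<kappa> \<equiv> hom_free (\<lambda>j. if Suc j = k then 0 else gen_free j)"
  shows "(\<lambda>i. \<kappa> (hurwitz std_tuple (loops_word k f) i)) = (\<lambda>i. \<kappa> (std_tuple i)) \<and>
    (\<exists>g. hurwitz std_tuple (loops_word k f) k = g + std_tuple k - g \<and>
      \<kappa> g = - word_val (\<lambda>d. gen_free (k + d)) f)"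
proof (induction f rule: rev_induct)
  case Nil
  show ?case by (auto intro: exI[of _ 0] simp: \<kappa>_def)
next
  case (snoc b f)
  obtain d e where b: "b = (d, e)" by (cases b)
  have hom: "\<kappa> (x + y) = \<kappa> x + \<kappa> y" "\<kappa> (- x) = - \<kappa> x" for x y
    by (simp_all add: \<kappa>_def hom_free_add)
  define z where "z = hurwitz std_tuple (loops_word k f)"
  obtain g where g: "z k = g + std_tuple k - g" "\<kappa> g = - word_val (\<lambda>d. gen_free (k + d)) f"
    and z: "(\<lambda>i. \<kappa> (z i)) = (\<lambda>i. \<kappa> (std_tuple i))"
    using snoc by (auto simp: z_def)
  have k0: "\<kappa> (std_tuple k) = 0"
    using assms by (simp add: \<kappa>_def)
  have kd: "\<kappa> (std_tuple (k + Suc d)) = gen_free (k + d)"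
    by (simp add: \<kappa>_def)
  have loop: "hurwitz (\<lambda>i. \<kappa> (std_tuple i)) (loop_word k d) = (\<lambda>i. \<kappa> (std_tuple i))"
    using k0 by (intro hurwitz_loop_word_0)
  show ?case
  proof (cases e)
    case True
    then have w: "hurwitz std_tuple (loops_word k (f @ [b])) = hurwitz z (loop_word k d)"
      by (simp add: b loops_word_single z_def)
    have "(\<lambda>i. \<kappa> (hurwitz z (loop_word k d) i)) = (\<lambda>i. \<kappa> (std_tuple i))"
      using hurwitz_hom[of \<kappa> z "loop_word k d", OF hom] by (simp add: z loop)
    moreover have "hurwitz z (loop_word k d) k = (- z (k + Suc d) + g) + std_tuple k - (- z (k + Suc d) + g)"
      by (simp add: hurwitz_loop_word g(1) group_norm del: add_uminus_conv_diff)
    moreover have "\<kappa> (- z (k + Suc d) + g) = - word_val (\<lambda>d. gen_free (k + d)) (f @ [b])"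
      using fun_cong[OF z, of "k + Suc d"] kd True
      by (simp add: hom g(2) b minus_add)
    ultimately show ?thesis
      unfolding w by blast
  next
    case False
    define x where "x = hurwitz z (inv_word (loop_word k d))"
    have w: "hurwitz std_tuple (loops_word k (f @ [b])) = x"
      using False by (simp add: b loops_word_single z_def x_def)
    have "hurwitz (\<lambda>i. \<kappa> (std_tuple i)) (inv_word (loop_word k d)) = (\<lambda>i. \<kappa> (std_tuple i))"
      using hurwitz_inv_word[of "\<lambda>i. \<kappa> (std_tuple i)" "loop_word k d"] by (simp add: loop)
    then have xk: "(\<lambda>i. \<kappa> (x i)) = (\<lambda>i. \<kappa> (std_tuple i))"
      using hurwitz_hom[of \<kappa> z "inv_word (loop_word k d)", OF hom] by (simp add: z x_def)
    have "z k = - x (k + Suc d) + x k + x (k + Suc d)"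
      unfolding hurwitz_loop_word[symmetric] by (simp add: x_def)
    then have "x k = x (k + Suc d) + z k - x (k + Suc d)"
      by (simp add: group_norm del: add_uminus_conv_diff)
    then have "x k = (x (k + Suc d) + g) + std_tuple k - (x (k + Suc d) + g)"
      by (simp add: g(1) group_norm del: add_uminus_conv_diff)
    moreover have "\<kappa> (x (k + Suc d) + g) = - word_val (\<lambda>d. gen_free (k + d)) (f @ [b])"
      using fun_cong[OF xk, of "k + Suc d"] kd False
      by (simp add: hom g(2) b minus_add)
    ultimately show ?thesis
      using xk unfolding w by blast
  qed
qed

text \<open>Only powers of a generator commute with it, and these are killed by
  \<open>f\<close>.\<close>

lemma centralizer_generator:
  fixes g :: free_group and f :: "nat \<Rightarrow> free_group"
  assumes "g + gen_free a - g = gen_free a" "f a = 0"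
  shows "hom_free f g = 0"
proof -
  obtain w where w: "reduced (conj_word w a)" "g + gen_free a - g = free_val (conj_word w a)"
    "hom_free f g = word_val f w"
    using conjugate_of_generator[of a g] assms(2) by metis
  then have "free_val (conj_word w a) = free_val [(a, True)]"
    using assms(1) by simp
  then have "conj_word w a = [(a, True)]"
    using w(1) by (subst (asm) free_val_eq_iff) (auto simp: reduced_Cons)
  then have "w = []"
    by (auto simp: conj_word_def append_eq_Cons_conv)
  then show ?thesis using w(3) by simp
qed

text \<open>Combing writes \<open>w\<close> as a strand move, a product of loops and a braid
  \<open>h\<close> on the later strands. As \<open>h\<close> does not touch position
  \<open>k\<close>, the first two factors already return the generator there. This excludes a strand
  move and makes the word of the loops trivial in the free group; what remains is \<open>h\<close>,
  with one strand less.\<close>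

theorem hurwitz_faithful:
  assumes "w \<in> lists ({k..<n} \<times> UNIV)" "1 \<le> k" "k \<le> n" "hurwitz std_tuple w = std_tuple"
  shows "braid_eq n w []"
  using assms
proof (induction "n - k" arbitrary: k w)
  case 0
  then have "w = []" by (cases w) auto
  then show ?case by (simp add: braid_eq.refl)
next
  case (Suc m)
  interpret artin_relations n "artin_gen n"
    by (rule artin_relations_artin_gen)
  obtain d f h where d: "k + d \<le> n" and f: "f \<in> lists ({0..<n - k} \<times> UNIV)"
    and h: "h \<in> lists ({Suc k..<n} \<times> UNIV)"
    and w: "word_val (artin_gen n) w = word_val (artin_gen n) (strand_word k d @ loops_word k f @ h)"
    using combing[OF Suc.prems(2,1,3)] by blast
  have words: "lists ({j..<n} \<times> UNIV) \<subseteq> braid_words n" if "j \<ge> 1" for j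
    using that unfolding braid_words_def by (intro lists_mono) auto
  have sw: "strand_word k d \<in> braid_words n" using d Suc.prems(2)
    by (induction d) (auto simp: Cons_in_braid_words)
  have "loop_word k j \<in> braid_words n" if "j < n - k" for j
    using that Suc.prems(2) by (induction j) (auto simp: Cons_in_braid_words)
  then have lw: "loops_word k f \<in> braid_words n"
    using f by (induction f rule: list.induct) (auto simp: loops_word_def)
  have hw: "h \<in> braid_words n" "w \<in> braid_words n"
    using words[of "Suc k"] words[of k] h Suc.prems by auto
  have eq: "braid_eq n w (strand_word k d @ loops_word k f @ h)"
    using w sw lw hw by (simp add: braid_eq_iff_word_val del: word_val_simps)
  define y where "y = hurwitz std_tuple (strand_word k d @ loops_word k f)"
  have "hurwitz y h = std_tuple"
    using hurwitz_braid_eq[OF eq, of std_tuple] Suc.prems(4) by (simp add: y_def)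
  then have "y k = hurwitz std_tuple (inv_word h) k"
    using hurwitz_inv_word[of y h] by simp
  also have "\<dots> = std_tuple k"
    using h by (intro hurwitz_outside) (auto simp: inv_word_def flip_def)
  finally have yk: "y k = std_tuple k" .
  have "d = 0"
  proof (rule ccontr)
    assume "d \<noteq> 0"
    obtain g where "y k = g + gen_free (k + d - 1) - g"
      using hurwitz_loops_word[of "hurwitz std_tuple (strand_word k d)" k f]
      by (auto simp: y_def hurwitz_strand_word)
    \<comment> \<open>The exponent sum of the generator \<open>k - 1\<close> is invariant under
      conjugation and tells the two generators apart.\<close>
    then have "hom_free (\<lambda>j. if j = k - 1 then 1 else (0::int)) (gen_free (k - 1))
        = hom_free (\<lambda>j. if j = k - 1 then 1 else (0::int)) (gen_free (k + d - 1))"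
      using yk by (simp add: hom_free_add hom_free_diff del: hom_free_gen)
    then show False
      using \<open>d \<noteq> 0\<close> Suc.prems(2) by (simp split: if_splits)
  qed
  then have y: "y = hurwitz std_tuple (loops_word k f)"
    by (simp add: y_def)
  define \<kappa> where "\<kappa> = (\<lambda>j. if Suc j = k then 0 else gen_free j)"
  obtain g where g: "y k = g + std_tuple k - g" "hom_free \<kappa> g = - word_val (\<lambda>d. gen_free (k + d)) f"
    using hurwitz_loops_word_std[OF Suc.prems(2), of f] unfolding y \<kappa>_def by blast
  have "hom_free \<kappa> g = 0"
    using g(1) yk Suc.prems(2) by (intro centralizer_generator[of g "k - 1"]) (auto simp: \<kappa>_def)
  then have "word_val (\<lambda>d. gen_free (k + d)) f = 0"
    using g(2) by simp
  \<comment> \<open>A relation between free generators holds for any elements of a group; here the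
    generator \<open>k + d\<close> goes to the value of \<open>loop_word k d\<close>, the
    subtraction undoing the shift by \<open>k\<close>.\<close>
  from arg_cong[OF this, of "hom_free (\<lambda>j. word_val (artin_gen n) (loop_word k (j - k)))"]
  have "word_val (artin_gen n) (loops_word k f) = 0"
    by (simp add: hom_free_word_val word_val_loops_word)
  then have wh: "braid_eq n w h"
    using w \<open>d = 0\<close> hw by (simp add: braid_eq_iff_word_val)
  have "hurwitz std_tuple h = std_tuple"
    using hurwitz_braid_eq[OF wh] Suc.prems(4) by metis
  then have "braid_eq n h []"
    using Suc.hyps(2) h by (intro Suc.hyps(1)[of "Suc k" h]) auto
  then show ?case
    using wh by (metis braid_eq.trans)
qed

section \<open>Braid words in which a letter occurs with one sign only\<close>

definition one_signed :: "braid_word \<Rightarrow> bool" where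
  "one_signed w \<longleftrightarrow> (\<exists>i e. (i, e) \<in> set w \<and> (i, \<not> e) \<notin> set w)"

text \<open>The embedding of a braid group into the next one that leaves the first strand
  alone.\<close>

definition shift_word :: "braid_word \<Rightarrow> braid_word" where
  "shift_word w = map (\<lambda>(i, e). (Suc i, e)) w"

lemma shift_word_in: "w \<in> braid_words n \<Longrightarrow> shift_word w \<in> braid_words (Suc n)"
  by (induction w) (auto simp: shift_word_def Cons_in_braid_words)

lemma braid_eq_shift_word: "braid_eq n u v \<Longrightarrow> braid_eq (Suc n) (shift_word u) (shift_word v)"
proof (induction rule: braid_eq.induct)
  case (refl w)
  then show ?case by (intro braid_eq.refl shift_word_in)
next
  case (append u u' v v')
  then show ?case using braid_eq.append by (simp add: shift_word_def)
next
  case (cancel i e)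
  then show ?case using braid_eq.cancel[of "Suc i" "Suc n" e] by (simp add: shift_word_def)
next
  case (commute i j)
  then show ?case using braid_eq.commute[of "Suc i" "Suc n" "Suc j"] by (simp add: shift_word_def)
next
  case (braid i)
  then show ?case using braid_eq.braid[of "Suc i" "Suc n"] by (simp add: shift_word_def)
qed (auto intro: braid_eq.intros)

lemma one_signed_shift_word: "one_signed w \<Longrightarrow> one_signed (shift_word w)"
  unfolding one_signed_def shift_word_def by (force simp: image_iff)

lemma one_signed_mirror_word: "one_signed w \<Longrightarrow> one_signed (mirror_word w)"
  unfolding one_signed_def mirror_word_def by (force simp: image_iff)

lemma one_signed_inv_word:
  assumes "(i, e) \<in> set w" "(i, \<not> e) \<notin> set w"
  shows "one_signed (inv_word w)"
proof -
  have "(i, \<not> e) \<in> set (inv_word w)"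
    using assms(1) by (force simp: inv_word_def flip_def image_iff)
  moreover have "(i, \<not> \<not> e) \<notin> set (inv_word w)"
    using assms(2) by (force simp: inv_word_def flip_def image_iff)
  ultimately show ?thesis
    unfolding one_signed_def by blast
qed

lemma braid_eq_inv_wordI:
  assumes "braid_eq n (w @ v) []"
  shows "braid_eq n w (inv_word v)"
proof -
  have wv: "w \<in> braid_words n" "v \<in> braid_words n"
    using braid_eq_words[OF assms] by auto
  have "word_val (artin_gen n) (w @ v) = word_val (artin_gen n) []"
    using assms wv braid_eq_iff_word_val[of "w @ v" n "[]"] by simp
  then have "word_val (artin_gen n) w = word_val (artin_gen n) (inv_word v)"
    by (simp add: eq_neg_iff_add_eq_0)
  then show ?thesis
    using wv by (simp add: braid_eq_iff_word_val del: word_val_inv_word)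
qed

text \<open>Dehornoy's trichotomy, without the exclusiveness of the cases.\<close>

theorem braid_trivial_or_one_signed:
  assumes "w \<in> braid_words n"
  shows "braid_eq n w [] \<or> (\<exists>v. braid_eq n w v \<and> one_signed v)"
  using assms
proof (induction n arbitrary: w)
  case 0
  then have "w = []" by (cases w) (auto simp: braid_words_def)
  then show ?case by (simp add: braid_eq.refl)
next
  case (Suc m)
  let ?n = "Suc m"
  \<comment> \<open>A braid that brings the first generator back to position 1 is inverted by a word
    without \<sigma>_1: \<open>standard_first_arc\<close> straightens the rest of the tuple, and
    faithfulness turns the standard tuple into triviality.\<close>
  have std: "\<exists>v\<in>lists ({2..<?n} \<times> UNIV). braid_eq ?n (u @ v) []"
    if u: "u \<in> lists ({1..<?n} \<times> UNIV)" and u1: "hurwitz std_tuple u 1 = gen_free 0" for u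
  proof -
    have "tuple_sum (hurwitz std_tuple u) 1 ?n = free_val (pos_word 0 ?n)"
      by (subst tuple_sum_hurwitz[OF u]) (rule partial_sum_std[unfolded partial_sum_def])
    then obtain v where v: "v \<in> lists ({2..<?n} \<times> UNIV)"
      and *: "\<forall>i\<in>{1..?n}. hurwitz (hurwitz std_tuple u) v i = std_tuple i"
      using standard_first_arc[OF conj_gen_hurwitz[OF conj_gen_std u] _ _ u1] by auto
    have uv: "u @ v \<in> lists ({1..<?n} \<times> UNIV)"
      using u v by auto
    have "hurwitz std_tuple (u @ v) i = std_tuple i" for i
    proof (cases "i \<in> {1..?n}")
      case False
      then show ?thesis
        using uv by (intro hurwitz_outside) auto
    qed (use * in auto)
    then have "braid_eq ?n (u @ v) []"
      by (intro hurwitz_faithful[OF uv]) auto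
    then show ?thesis using v by blast
  qed
  \<comment> \<open>\<open>v\<close> followed by a word without \<sigma>_1 inverts \<open>u\<close>;
    so \<open>u\<close> equals an inverse word, in which \<sigma>_1 occurs but never
    positively.\<close>
  have signed: "\<exists>x. braid_eq ?n u x \<and> one_signed x"
    if H: "u \<in> lists ({1..<?n} \<times> UNIV)" "v \<in> lists ({1..<?n} \<times> UNIV)" "(1, True) \<in> set v" "(1, False) \<notin> set v"
      "hurwitz std_tuple (u @ v) 1 = gen_free 0" for u v
  proof -
    obtain v' where v': "v' \<in> lists ({2..<?n} \<times> UNIV)" "braid_eq ?n ((u @ v) @ v') []"
      using std[of "u @ v"] H(1,2,5) by (metis append_in_lists_conv)
    then have "braid_eq ?n u (inv_word (v @ v'))"
      by (intro braid_eq_inv_wordI) simp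
    moreover have "one_signed (inv_word (v @ v'))"
      using H(3,4) v'(1) by (intro one_signed_inv_word[of 1 True]) auto
    ultimately show ?thesis by blast
  qed
  have w: "w \<in> lists ({1..<?n} \<times> UNIV)"
    using Suc.prems by (simp add: braid_words_def)
  have n1: "1 \<le> ?n" by simp
  show ?case
  proof (rule one_sided_multiple[OF w n1], goal_cases)
    \<comment> \<open>Here \<open>w\<close> equals a word without \<sigma>_1, which is the shift of
      a word on one strand less.\<close>
    case 1
    then obtain v where v: "v \<in> lists ({2..<?n} \<times> UNIV)" "braid_eq ?n (w @ v) []"
      using std[OF w] by auto
    define u where "u = map (\<lambda>(i, e). (i - 1, e)) (inv_word v)"
    have iv: "\<forall>a\<in>set (inv_word v). 2 \<le> fst a \<and> fst a < ?n"
      using v(1) by (fastforce simp: inv_word_def flip_def)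
    then have "\<forall>a\<in>set u. 1 \<le> fst a \<and> fst a < m"
      by (auto simp: u_def)
    then have "u \<in> braid_words m"
      by (auto simp: braid_words_def)
    moreover have "shift_word u = inv_word v"
      unfolding u_def shift_word_def map_map using iv by (intro map_idI) auto
    ultimately have "braid_eq ?n (inv_word v) [] \<or> (\<exists>x. braid_eq ?n (inv_word v) x \<and> one_signed x)"
      using Suc.IH[of u] braid_eq_shift_word[of m u] one_signed_shift_word
      by (metis list.simps(8) shift_word_def)
    then show ?thesis
      using braid_eq_inv_wordI[OF v(2)] by (metis braid_eq.trans)
  next
    case (2 v)
    then show ?thesis using signed[OF w] by blast
  next
    \<comment> \<open>The condition \<open>one_signed\<close> does not prefer a sign, so a word for
      the mirror braid serves as well.\<close>
    case (3 v)
    have "map flip w \<in> lists ({1..<?n} \<times> UNIV)"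
      using Suc.prems mirror_word_in[of w ?n] by (simp add: mirror_word_flip braid_words_def)
    then obtain x where "braid_eq ?n (map flip w) x" "one_signed x"
      using signed[of "map flip w" v] 3 by blast
    then have "braid_eq ?n w (mirror_word x)" "one_signed (mirror_word x)"
      using braid_eq_mirror_word one_signed_mirror_word by (metis mirror_word_flip mirror_word_mirror_word)+
    then show ?thesis by blast
  qed
qed

section \<open>Polynomials over the field with two elements\<close>

text \<open>Exponents are multisets, so squares exist in the ring itself and vanish only modulo the
  ideals introduced for resolutions.\<close>

type_synonym 'p poly2 = "'p multiset \<Rightarrow>\<^sub>0 bit"

definition monomial :: "'p multiset \<Rightarrow> 'p poly2" where
  "monomial m = Poly_Mapping.single m 1"

abbreviation var :: "'p \<Rightarrow> 'p poly2" where
  "var p \<equiv> monomial {#p#}"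

lemma poly2_double [simp]: "(x :: 'p poly2) + x = 0"
proof (rule poly_mapping_eqI)
  fix k
  have "b + b = 0" for b :: bit
    by (cases b) simp_all
  then show "Poly_Mapping.lookup (x + x) k = Poly_Mapping.lookup 0 k"
    by (simp only: lookup_add lookup_zero)
qed

lemma poly2_minus [simp]: "- (x :: 'p poly2) = x" "(x :: 'p poly2) - y = x + y"
proof -
  show *: "- y = y" for y :: "'p poly2"
    by (rule minus_unique) simp
  show "x - y = x + y"
    by (simp only: diff_conv_add_uminus *)
qed

lemma poly2_double' [simp]: "(x :: 'p poly2) + (x + y) = y"
  by (simp add: add.assoc[symmetric])

lemma monomial_mult: "monomial m * monomial m' = monomial (m + m')"
  by (simp add: monomial_def mult_single)

lemma monomial_empty [simp]: "monomial {#} = 1"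
  by (simp add: monomial_def zero_multiset_def[symmetric] single_one)

lemma poly2_eq_sum: "r = (\<Sum>m\<in>Poly_Mapping.keys r. monomial m)"
proof (rule poly_mapping_eqI)
  fix k
  have "Poly_Mapping.lookup r k = (if k \<in> Poly_Mapping.keys r then 1 else 0)"
    by (cases "Poly_Mapping.lookup r k") (simp_all add: in_keys_iff)
  then show "Poly_Mapping.lookup r k = Poly_Mapping.lookup (\<Sum>m\<in>Poly_Mapping.keys r. monomial m) k"
    by (simp add: lookup_sum monomial_def lookup_single when_def)
qed

lemma poly2_induct [case_names zero add]:
  assumes "P 0" "\<And>m r. P r \<Longrightarrow> P (monomial m + r)"
  shows "P (r :: 'p poly2)"
proof -
  have "P (\<Sum>m\<in>A. monomial m)" if "finite A" for A :: "'p multiset set"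
    using that by induction (use assms in auto)
  from this[of "Poly_Mapping.keys r"] show ?thesis
    by (simp flip: poly2_eq_sum)
qed

definition lin :: "('p multiset \<Rightarrow> 'a :: comm_monoid_add) \<Rightarrow> 'p poly2 \<Rightarrow> 'a" where
  "lin f r = (\<Sum>m\<in>Poly_Mapping.keys r. f m)"

lemma lin_zero [simp]: "lin f 0 = 0"
  by (simp add: lin_def)

lemma lin_mon [simp]: "lin f (monomial m) = f m"
  by (simp add: lin_def monomial_def)

text \<open>The keys of a sum form the symmetric difference of the keys; a common key contributes
  its value twice, which is zero by assumption.\<close>

lemma lin_add:
  assumes "\<And>x :: 'a :: ab_group_add. x \<in> f ` UNIV \<Longrightarrow> x + x = 0"
  shows "lin f (r + s) = lin f r + lin f s"
proof -
  have keys: "Poly_Mapping.keys (r + s) = (Poly_Mapping.keys r - Poly_Mapping.keys s) \<union> (Poly_Mapping.keys s - Poly_Mapping.keys r)"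
    by (auto simp: in_keys_iff lookup_add)
  have double: "(\<Sum>m\<in>A. f m) + (\<Sum>m\<in>A. f m) = 0" for A
    by (simp add: sum.distrib[symmetric] assms)
  have "lin f r = (\<Sum>m\<in>Poly_Mapping.keys r - Poly_Mapping.keys s. f m) + (\<Sum>m\<in>Poly_Mapping.keys r \<inter> Poly_Mapping.keys s. f m)"
    "lin f s = (\<Sum>m\<in>Poly_Mapping.keys s - Poly_Mapping.keys r. f m) + (\<Sum>m\<in>Poly_Mapping.keys r \<inter> Poly_Mapping.keys s. f m)"
    unfolding lin_def
    by (subst sum.union_disjoint[symmetric]; force intro: sum.cong)+
  moreover have "lin f (r + s) = (\<Sum>m\<in>Poly_Mapping.keys r - Poly_Mapping.keys s. f m) + (\<Sum>m\<in>Poly_Mapping.keys s - Poly_Mapping.keys r. f m)"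
    unfolding lin_def keys by (intro sum.union_disjoint) auto
  ultimately show ?thesis
    using double[of "Poly_Mapping.keys r \<inter> Poly_Mapping.keys s"]
    by (simp add: algebra_simps)
qed

definition rename :: "('p \<Rightarrow> 'q) \<Rightarrow> 'p poly2 \<Rightarrow> 'q poly2" where
  "rename \<phi> = lin (\<lambda>m. monomial (image_mset \<phi> m))"

lemma rename_simps [simp]:
  "rename \<phi> 0 = 0" "rename \<phi> (monomial m) = monomial (image_mset \<phi> m)"
  "rename \<phi> (r + s) = rename \<phi> r + rename \<phi> s"
  by (auto simp: rename_def lin_add)

lemma rename_one [simp]: "rename \<phi> 1 = 1"
  using rename_simps(2)[of \<phi> "{#}"] by simp

lemma rename_mult [simp]: "rename \<phi> (r * s) = rename \<phi> r * rename \<phi> s"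
proof (induction r rule: poly2_induct)
  case (add m r)
  have "rename \<phi> (monomial m * s) = rename \<phi> (monomial m) * rename \<phi> s"
    by (induction s rule: poly2_induct) (simp_all add: distrib_left monomial_mult)
  then show ?case
    using add by (simp add: distrib_right)
qed simp

lemma rename_sum [simp]: "rename \<phi> (\<Sum>i\<in>A. f i) = (\<Sum>i\<in>A. rename \<phi> (f i))"
  by (induction A rule: infinite_finite_induct) auto

lemma rename_rename: "rename \<phi> (rename \<chi> r) = rename (\<phi> \<circ> \<chi>) r"
  by (induction r rule: poly2_induct) (auto simp: multiset.map_comp o_def)

text \<open>Where \<open>c\<close> lies on a circle of its own, this extracts the part in which that
  circle is labeled v_-. Monomials with a higher power of \<open>c\<close> are dropped, as they
  vanish in the quotient; otherwise the map would not pass to it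
  (\<open>coeff1_ideal\<close>).\<close>

definition coeff1 :: "'p \<Rightarrow> 'p poly2 \<Rightarrow> 'p poly2" where
  "coeff1 c = lin (\<lambda>m. if count m c = 1 then monomial (m - {#c#}) else 0)"

lemma coeff1_simps [simp]:
  "coeff1 c 0 = 0" "coeff1 c (r + s) = coeff1 c r + coeff1 c s"
  "coeff1 c (monomial m) = (if count m c = 1 then monomial (m - {#c#}) else 0)"
  by (auto simp: coeff1_def lin_add)

lemma coeff1_sum: "coeff1 c (\<Sum>i\<in>A. f i) = (\<Sum>i\<in>A. coeff1 c (f i))"
  by (induction A rule: infinite_finite_induct) auto

lemma coeff1_var_mult: "p \<noteq> c \<Longrightarrow> coeff1 c (var p * r) = var p * coeff1 c r"
  by (induction r rule: poly2_induct) (auto simp: distrib_left monomial_mult)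

lemma coeff1_rename: "(\<And>p. \<phi> p \<noteq> c) \<Longrightarrow> coeff1 c (rename \<phi> r) = 0"
  proof (induction r rule: poly2_induct)
  case (add m r)
  have "count (image_mset \<phi> m) c = 0"
    using add.prems by (auto simp: count_eq_zero_iff)
  then show ?case
    using add by simp
qed simp

lemma coeff1_var_rename: "(\<And>p. \<phi> p \<noteq> c) \<Longrightarrow> coeff1 c (var c * rename \<phi> r) = rename \<phi> r"
proof (induction r rule: poly2_induct)
  case (add m r)
  have "count (image_mset \<phi> m) c = 0"
    using add.prems by (auto simp: count_eq_zero_iff)
  then show ?case
    using add by (simp add: distrib_left monomial_mult)
qed simp

section \<open>The ideal of a resolution\<close>

definition equiv_cl :: "('p \<times> 'p) set \<Rightarrow> ('p \<times> 'p) set" where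
  "equiv_cl G = (G \<union> G\<inverse>)\<^sup>*"

lemma equiv_cl_refl [simp]: "(p, p) \<in> equiv_cl G"
  by (simp add: equiv_cl_def)

lemma equiv_cl_sym: "(p, q) \<in> equiv_cl G \<Longrightarrow> (q, p) \<in> equiv_cl G"
  unfolding equiv_cl_def by (meson sym_Un_converse sym_rtrancl symD)

lemma equiv_cl_sym_iff: "(p, q) \<in> equiv_cl G \<longleftrightarrow> (q, p) \<in> equiv_cl G"
  by (blast intro: equiv_cl_sym)

lemma equiv_cl_trans: "(p, q) \<in> equiv_cl G \<Longrightarrow> (q, r) \<in> equiv_cl G \<Longrightarrow> (p, r) \<in> equiv_cl G"
  unfolding equiv_cl_def by (rule rtrancl_trans)

lemma equiv_cl_base: "(p, q) \<in> G \<Longrightarrow> (p, q) \<in> equiv_cl G"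
  by (auto simp: equiv_cl_def)

lemma equiv_cl_least:
  assumes "(p, q) \<in> equiv_cl G" "\<And>x y. (x, y) \<in> G \<Longrightarrow> R x y"
    "\<And>x. R x x" "\<And>x y. R x y \<Longrightarrow> R y x" "\<And>x y z. R x y \<Longrightarrow> R y z \<Longrightarrow> R x z"
  shows "R p q"
  using assms(1) unfolding equiv_cl_def
  by (induction rule: rtrancl_induct) (use assms in blast)+

lemma equiv_cl_map:
  assumes "(p, q) \<in> equiv_cl G" "\<And>x y. (x, y) \<in> G \<Longrightarrow> (\<phi> x, \<phi> y) \<in> equiv_cl H"
  shows "(\<phi> p, \<phi> q) \<in> equiv_cl H"
  using assms(1) by (rule equiv_cl_least) (use assms(2) in \<open>auto intro: equiv_cl_sym equiv_cl_trans\<close>)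

lemma equiv_cl_mono:
  assumes "(p, q) \<in> equiv_cl G" "G \<subseteq> equiv_cl H"
  shows "(p, q) \<in> equiv_cl H"
  using equiv_cl_map[of p q G "\<lambda>x. x" H] assms by auto

text \<open>The quotient is a tensor product of copies of F[x]/(x^2), one for each class of points
  generated by \<open>G\<close>, with 1 for v_+ and x for v_-.\<close>

inductive_set ideal :: "('p \<times> 'p) set \<Rightarrow> 'p poly2 set" for G where
  zero: "0 \<in> ideal G"
| linear: "(p, q) \<in> G \<Longrightarrow> x \<in> ideal G \<Longrightarrow> r * (var p + var q) + x \<in> ideal G"
| square: "x \<in> ideal G \<Longrightarrow> r * (var p * var p) + x \<in> ideal G"

lemma ideal_add: "x \<in> ideal G \<Longrightarrow> y \<in> ideal G \<Longrightarrow> x + y \<in> ideal G"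
  by (induction rule: ideal.induct) (auto simp: add.assoc intro: ideal.intros)

lemma ideal_mult: "x \<in> ideal G \<Longrightarrow> s * x \<in> ideal G"
  by (induction rule: ideal.induct) (auto simp: distrib_left mult.assoc[symmetric] intro: ideal.intros
      simp del: distrib_left_numeral, metis distrib_left ideal.linear mult.assoc, metis ideal.square mult.assoc)

definition eqm :: "('p \<times> 'p) set \<Rightarrow> 'p poly2 \<Rightarrow> 'p poly2 \<Rightarrow> bool" where
  "eqm G x y \<longleftrightarrow> x + y \<in> ideal G"

lemma eqm_refl [simp]: "eqm G x x"
  by (simp add: eqm_def ideal.zero)

lemma eqm_sym: "eqm G x y \<Longrightarrow> eqm G y x"
  by (simp add: eqm_def add.commute)

lemma eqm_trans [trans]: "eqm G x y \<Longrightarrow> eqm G y z \<Longrightarrow> eqm G x z"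
  unfolding eqm_def using ideal_add[of "x + y" G "y + z"] by (simp add: add.assoc)

lemma eqm_eq_trans [trans]: "eqm G x y \<Longrightarrow> y = z \<Longrightarrow> eqm G x z" "x = y \<Longrightarrow> eqm G y z \<Longrightarrow> eqm G x z"
  by simp_all

lemma eqm_add: "eqm G x y \<Longrightarrow> eqm G x' y' \<Longrightarrow> eqm G (x + x') (y + y')"
  unfolding eqm_def using ideal_add[of "x + y" G "x' + y'"] by (simp add: ac_simps)

lemma eqm_mult_left: "eqm G x y \<Longrightarrow> eqm G (r * x) (r * y)"
  unfolding eqm_def using ideal_mult[of "x + y" G r] by (simp add: distrib_left)

lemma eqm_mult: "eqm G x y \<Longrightarrow> eqm G x' y' \<Longrightarrow> eqm G (x * x') (y * y')"
  by (metis eqm_mult_left eqm_trans mult.commute)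

lemma eqm_sum: "(\<And>i. i \<in> A \<Longrightarrow> eqm G (f i) (g i)) \<Longrightarrow> eqm G (\<Sum>i\<in>A. f i) (\<Sum>i\<in>A. g i)"
  by (induction A rule: infinite_finite_induct) (auto intro: eqm_add)

lemma eqm_var: "(p, q) \<in> equiv_cl G \<Longrightarrow> eqm G (var p) (var q)"
proof (erule equiv_cl_least)
  fix x y assume "(x, y) \<in> G"
  from ideal.linear[OF this ideal.zero, of 1] show "eqm G (var x) (var y)"
    by (simp add: eqm_def)
qed (auto intro: eqm_sym eqm_trans)

lemma eqm_square: "eqm G (var p * var p) 0"
  using ideal.square[OF ideal.zero, of 1 p G] by (simp add: eqm_def)

lemma eqm_square': "(p, q) \<in> equiv_cl G \<Longrightarrow> eqm G (var p * var q) 0"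
  by (meson eqm_mult_left eqm_square eqm_sym eqm_trans eqm_var)

lemma rename_ideal:
  assumes "x \<in> ideal G" "\<And>p q. (p, q) \<in> G \<Longrightarrow> (\<phi> p, \<phi> q) \<in> equiv_cl H"
  shows "rename \<phi> x \<in> ideal H"
  using assms(1)
proof induction
  case zero
  show ?case by (simp add: ideal.zero)
next
  case (linear p q x r)
  have "var (\<phi> p) + var (\<phi> q) \<in> ideal H"
    using eqm_var[OF assms(2)[OF linear(1)]] by (simp add: eqm_def)
  then show ?case
    using linear(3) by (auto intro: ideal_add ideal_mult)
next
  case (square x r p)
  have "var (\<phi> p) * var (\<phi> p) \<in> ideal H"
    using eqm_square[of H "\<phi> p"] by (simp add: eqm_def)
  then show ?case
    using square(2) by (auto intro: ideal_add ideal_mult)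
qed

lemma rename_eqm:
  assumes "eqm G x y" "\<And>p q. (p, q) \<in> G \<Longrightarrow> (\<phi> p, \<phi> q) \<in> equiv_cl H"
  shows "eqm H (rename \<phi> x) (rename \<phi> y)"
  using rename_ideal[of "x + y" G \<phi> H] assms by (simp add: eqm_def)

lemma rename_id [simp]: "rename (\<lambda>p. p) x = x"
  by (induction x rule: poly2_induct) auto

lemma eqm_mono:
  assumes "eqm G x y" "G \<subseteq> equiv_cl H"
  shows "eqm H x y"
  using rename_eqm[of G x y "\<lambda>p. p" H] assms by auto

lemma eqm_rename_self:
  assumes "\<And>p. (p, \<phi> p) \<in> equiv_cl G"
  shows "eqm G x (rename \<phi> x)"
proof (induction x rule: poly2_induct)
  case (add m x)
  have "eqm G (monomial m) (monomial (image_mset \<phi> m))"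
  proof (induction m)
    case (add p m)
    have "monomial (add_mset p m) = var p * monomial m" "monomial (image_mset \<phi> (add_mset p m)) = var (\<phi> p) * monomial (image_mset \<phi> m)"
      by (simp_all add: monomial_mult)
    then show ?case
      using eqm_mult[OF eqm_var[OF assms] add] by metis
  qed simp
  then show ?case
    using add by (simp add: eqm_add)
qed simp

lemma coeff1_ideal:
  assumes "x \<in> ideal G" "\<And>p q. (p, q) \<in> G \<Longrightarrow> p \<noteq> c \<and> q \<noteq> c"
  shows "coeff1 c x \<in> ideal G"
  using assms(1)
proof induction
  case zero
  show ?case by (simp add: ideal.zero)
next
  case (linear p q x r)
  have "coeff1 c (r * (var p + var q)) = coeff1 c r * (var p + var q)"
    using assms(2)[OF linear(1)] coeff1_var_mult[of p c r] coeff1_var_mult[of q c r]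
    by (simp add: distrib_left mult.commute)
  then show ?case
    using linear by (simp add: ideal.linear)
next
  case (square x r p)
  have "coeff1 c (r * (var p * var p)) = (if p = c then 0 else coeff1 c r * (var p * var p))"
  proof (cases "p = c")
    case True
    have "coeff1 c (r * monomial {#c, c#}) = 0"
      by (induction r rule: poly2_induct) (auto simp: distrib_right monomial_mult)
    then show ?thesis
      using True by (simp add: monomial_mult)
  next
    case False
    then show ?thesis
      using coeff1_var_mult[of p c "var p * r"] coeff1_var_mult[of p c r] by (simp add: mult_ac)
  qed
  then show ?case
    using square by (auto simp: ideal.square)
qed

lemma coeff1_eqm:
  assumes "eqm G x y" "\<And>p q. (p, q) \<in> G \<Longrightarrow> p \<noteq> c \<and> q \<noteq> c"
  shows "eqm G (coeff1 c x) (coeff1 c y)"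
  using coeff1_ideal[of "x + y" G c] assms by (simp add: eqm_def)

section \<open>Saddles\<close>

text \<open>Stated for the generated equivalences, since different sets of arcs may describe the
  same circles.\<close>

definition merges :: "('p \<times> 'p) set \<Rightarrow> ('p \<times> 'p) set \<Rightarrow> 'p \<Rightarrow> 'p \<Rightarrow> bool" where
  "merges G H a b \<longleftrightarrow> (a, b) \<notin> equiv_cl G \<and>
    (\<forall>p q. (p, q) \<in> equiv_cl H \<longleftrightarrow> (p, q) \<in> equiv_cl G \<or>
      (p, a) \<in> equiv_cl G \<and> (b, q) \<in> equiv_cl G \<or> (p, b) \<in> equiv_cl G \<and> (a, q) \<in> equiv_cl G)"

definition saddle :: "('p \<times> 'p) set \<Rightarrow> ('p \<times> 'p) set \<Rightarrow> 'p \<Rightarrow> 'p \<Rightarrow> bool" where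
  "saddle G H a b \<longleftrightarrow> merges G H a b \<or> merges H G a b"

text \<open>The image of \<open>1\<close> under the map of a saddle that separates \<open>a\<close> from \<open>b\<close> or joins them.\<close>

definition scoeff :: "('p \<times> 'p) set \<Rightarrow> 'p \<Rightarrow> 'p \<Rightarrow> 'p poly2" where
  "scoeff G a b = (if (a, b) \<in> equiv_cl G then var a + var b else 1)"

lemma merges_equiv:
  assumes "merges G H a b"
  shows "(a, b) \<notin> equiv_cl G" "(a, b) \<in> equiv_cl H" "equiv_cl G \<subseteq> equiv_cl H"
    "(p, q) \<in> equiv_cl H \<longleftrightarrow> (p, q) \<in> equiv_cl G \<or>
      (p, a) \<in> equiv_cl G \<and> (b, q) \<in> equiv_cl G \<or> (p, b) \<in> equiv_cl G \<and> (a, q) \<in> equiv_cl G"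
  using assms unfolding merges_def by auto

lemma scoeff_commute: "scoeff G a b = scoeff G b a"
  by (simp add: scoeff_def equiv_cl_sym_iff[of a b] add.commute)

text \<open>For a split, the difference of two points that are no longer joined is congruent to
  \<open>var a + var b\<close>; multiplied by the coefficient it becomes (x + y)^2 = x^2 + y^2,
  which is zero. So the edge maps are well defined on the quotients.\<close>

lemma scoeff_eqm:
  assumes "saddle G H a b" "eqm G x y"
  shows "eqm H (scoeff G a b * x) (scoeff G a b * y)"
  using assms(1) unfolding saddle_def
proof
  assume m: "merges G H a b"
  have "G \<subseteq> equiv_cl H"
    using merges_equiv(3)[OF m] by (auto intro: equiv_cl_base)
  then have "eqm H x y"
    by (rule eqm_mono[OF assms(2)])
  then show ?thesis by (rule eqm_mult_left)
next
  assume m: "merges H G a b"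
  have "scoeff G a b * z \<in> ideal H" if "z \<in> ideal G" for z
    using that
  proof induction
    case zero
    show ?case by (simp add: ideal.zero)
  next
    case (square z r p)
    have "eqm H (scoeff G a b * r * (var p * var p)) (scoeff G a b * r * 0)"
      by (intro eqm_mult_left eqm_square)
    then show ?case
      using square by (simp add: eqm_def distrib_left mult.assoc ideal_add)
  next
    case (linear p q z r)
    have "eqm H (scoeff G a b * (var p + var q)) 0"
    proof (cases "(p, q) \<in> equiv_cl H")
      case True
      then have "eqm H (var p + var q) (var q + var q)"
        by (intro eqm_add eqm_var) auto
      from eqm_mult_left[OF this] show ?thesis by simp
    next
      case False
      have s: "scoeff G a b = var a + var b"
        using merges_equiv(2)[OF m] by (simp add: scoeff_def)
      have "(p, a) \<in> equiv_cl H \<and> (b, q) \<in> equiv_cl H \<or> (p, b) \<in> equiv_cl H \<and> (a, q) \<in> equiv_cl H"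
        using False merges_equiv(4)[OF m, of p q] equiv_cl_base[OF linear(1)] by blast
      then have "eqm H (var p + var q) (var a + var b)"
        by (metis add.commute eqm_add eqm_var equiv_cl_sym)
      then have "eqm H (scoeff G a b * (var p + var q)) ((var a + var b) * (var a + var b))"
        unfolding s by (rule eqm_mult_left)
      also have "(var a + var b) * (var a + var b) = var a * var a + var b * var b"
        by (simp add: distrib_left distrib_right mult.commute add.assoc)
      also have "eqm H \<dots> (0 + 0)"
        by (intro eqm_add eqm_square)
      finally show ?thesis by simp
    qed
    from eqm_mult_left[OF this, of r] show ?case
      using linear by (simp add: eqm_def distrib_left mult.assoc mult.left_commute ideal_add)
  qed
  from this[of "x + y"] show ?thesis
    using assms(2) by (simp add: eqm_def distrib_left)
qed

lemma scoeff_cong: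
  assumes "(a, a') \<in> equiv_cl G" "(b, b') \<in> equiv_cl G" "(a, a') \<in> equiv_cl H" "(b, b') \<in> equiv_cl H"
  shows "eqm H (scoeff G a b) (scoeff G a' b')"
proof -
  have "(a, b) \<in> equiv_cl G \<longleftrightarrow> (a', b') \<in> equiv_cl G"
    using assms by (meson equiv_cl_sym equiv_cl_trans)
  then show ?thesis
    using assms by (auto simp: scoeff_def intro: eqm_add eqm_var)
qed

lemma eqm_var_add: "(a, b) \<in> equiv_cl G \<Longrightarrow> eqm G (var a + var b) 0"
  using eqm_add[OF eqm_var[of a b G] eqm_refl[of G "var b"]] by simp

text \<open>The conclusion means that the other path through the square also consists of two merges:
  the number of circles drops by two along either path.\<close>

lemma merges_merges:
  assumes "merges G00 G10 a b" "merges G10 G11 c d" "saddle G00 G01 c d" "saddle G01 G11 a b"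
  shows "(c, d) \<notin> equiv_cl G00 \<and> (a, b) \<notin> equiv_cl G01"
proof -
  have cd: "(c, d) \<notin> equiv_cl G00"
    using merges_equiv(3)[OF assms(1)] merges_equiv(1)[OF assms(2)] by blast
  then have "merges G00 G01 c d"
    using assms(3) cd unfolding saddle_def by (auto dest: merges_equiv(2))
  then have "(a, b) \<notin> equiv_cl G01"
    using merges_equiv(4)[of G00 G01 c d a b] merges_equiv(4)[OF assms(1), of c d]
      merges_equiv(1)[OF assms(1)] merges_equiv(1)[OF assms(2)] equiv_cl_sym
    by metis
  then show ?thesis using cd by blast
qed

lemma splits_splits:
  assumes "merges G10 G00 a b" "merges G11 G10 c d" "saddle G00 G01 c d" "saddle G01 G11 a b"
  shows "(c, d) \<in> equiv_cl G00 \<and> (a, b) \<in> equiv_cl G01"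
proof -
  have "saddle G11 G01 a b" "saddle G01 G00 c d"
    using assms(3,4) by (auto simp: saddle_def)
  then have "(a, b) \<notin> equiv_cl G11"
    using merges_merges[OF assms(2,1)] by blast
  then have "(a, b) \<in> equiv_cl G01"
    using assms(4) unfolding saddle_def by (auto dest: merges_equiv(2))
  moreover have "(c, d) \<in> equiv_cl G00"
    using merges_equiv(3)[OF assms(1)] merges_equiv(2)[OF assms(2)] by blast
  ultimately show ?thesis by blast
qed

lemma saddle_cases:
  assumes "saddle G H a b"
  obtains "merges G H a b" "(a, b) \<notin> equiv_cl G" "scoeff G a b = 1"
  | "merges H G a b" "(a, b) \<in> equiv_cl G" "scoeff G a b = var a + var b"
  using assms merges_equiv(1,2) unfolding saddle_def scoeff_def by metis

text \<open>The two paths change the number of circles by the same amount. If each saddle has the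
  same kind on both paths, the products agree as polynomials. Otherwise either both paths merge and
  then split, and at the end \<open>a\<close>, \<open>b\<close> and \<open>c\<close>,
  \<open>d\<close> mark the same two circles; or both split and then merge, and at the end both
  coefficients vanish.\<close>

lemma scoeff_square:
  assumes "saddle G00 G10 a b" "saddle G01 G11 a b" "saddle G00 G01 c d" "saddle G10 G11 c d"
  shows "eqm G11 (scoeff G00 a b * scoeff G10 c d) (scoeff G00 c d * scoeff G01 a b)"
  using assms(1)
proof (cases rule: saddle_cases)
  case 1
  note ab = this
  show ?thesis using assms(4)
  proof (cases rule: saddle_cases)
    case 1
    then show ?thesis
      using merges_merges[OF ab(1) 1(1) assms(3,2)] ab by (simp add: scoeff_def)
  next
    case 2
    note cd = this
    show ?thesis using assms(3)
    proof (cases rule: saddle_cases)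
      case 1
      note cd' = this
      show ?thesis using assms(2)
      proof (cases rule: saddle_cases)
        case 1
        then show ?thesis
          using merges_merges[OF cd'(1) 1(1) assms(1,4)] cd by blast
      next
        case 2
        have "(a, b) \<in> equiv_cl G10"
          using merges_equiv(2)[OF ab(1)] .
        then have "(a, c) \<in> equiv_cl G11 \<and> (d, b) \<in> equiv_cl G11 \<or> (a, d) \<in> equiv_cl G11 \<and> (c, b) \<in> equiv_cl G11"
          using merges_equiv(4)[OF cd(1), of a b] merges_equiv(1)[OF 2(1)] by blast
        then have "eqm G11 (var c + var d) (var a + var b)"
          by (metis add.commute eqm_add eqm_var equiv_cl_sym)
        then show ?thesis
          using ab cd cd' 2 by simp
      qed
    next
      case 2
      note cd' = this
      show ?thesis using assms(2)
      proof (cases rule: saddle_cases)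
        case 1
        then show ?thesis using ab cd cd' by simp
      next
        case 2
        then show ?thesis
          using splits_splits[OF cd'(1) 2(1) assms(1,4)] ab by blast
      qed
    qed
  qed
next
  case 2
  note ab = this
  show ?thesis using assms(4)
  proof (cases rule: saddle_cases)
    case 2
    then show ?thesis
      using splits_splits[OF ab(1) 2(1) assms(3,2)] ab by (simp add: scoeff_def mult.commute)
  next
    case 1
    note cd = this
    show ?thesis using assms(3)
    proof (cases rule: saddle_cases)
      case 2
      note cd' = this
      show ?thesis using assms(2)
      proof (cases rule: saddle_cases)
        case 1
        have "(c, a) \<in> equiv_cl G10 \<and> (b, d) \<in> equiv_cl G10 \<or> (c, b) \<in> equiv_cl G10 \<and> (a, d) \<in> equiv_cl G10"
          using merges_equiv(4)[OF ab(1), of c d] merges_equiv(1)[OF cd(1)] cd'(2) by blast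
        then have "(a, b) \<in> equiv_cl G11"
          using merges_equiv(4)[OF cd(1), of a b] equiv_cl_sym by metis
        moreover have "(c, d) \<in> equiv_cl G11"
          using merges_equiv(2)[OF cd(1)] .
        ultimately have "eqm G11 (var a + var b) (var c + var d)"
          by (meson eqm_var_add eqm_sym eqm_trans)
        then show ?thesis
          using ab cd cd' 1 by simp
      next
        case 2
        then show ?thesis
          using splits_splits[OF cd'(1) 2(1) assms(1,4)] cd by blast
      qed
    next
      case 1
      note cd' = this
      show ?thesis using assms(2)
      proof (cases rule: saddle_cases)
        case 1
        then show ?thesis
          using merges_merges[OF cd'(1) 1(1) assms(1,4)] ab by blast
      next
        case 2
        then show ?thesis using ab cd cd' by simp
      qed
    qed
  qed
qed

text \<open>Of a saddle and its reverse, one is a merge and has coefficient 1. The marks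
  \<open>c\<close>, \<open>d\<close> are joined to \<open>a\<close>, \<open>b\<close> on one side
  and crosswise on the other, like the two diagonals of a crossing.\<close>

lemma scoeff_roundtrip:
  assumes "saddle G H a b"
    and "(a, c) \<in> equiv_cl G" "(b, d) \<in> equiv_cl G" "(a, d) \<in> equiv_cl H" "(b, c) \<in> equiv_cl H"
  shows "eqm G (scoeff G a b * scoeff H c d) (var a + var b)"
  using assms(1)
proof (cases rule: saddle_cases)
  case 1
  then have "(c, d) \<in> equiv_cl H"
    using merges_equiv(2)[OF 1(1)] assms by (meson equiv_cl_sym equiv_cl_trans)
  then show ?thesis
    using 1 assms by (auto simp: scoeff_def intro: eqm_add eqm_var equiv_cl_sym)
next
  case 2
  then have "(c, d) \<notin> equiv_cl H"
    using merges_equiv(1)[OF 2(1)] assms by (meson equiv_cl_sym equiv_cl_trans)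
  then show ?thesis
    using 2 by (simp add: scoeff_def[of H])
qed

section \<open>Cubes of resolutions\<close>

definition edge_sum :: "(nat set \<Rightarrow> ('p \<times> 'p) set) \<Rightarrow> (nat \<Rightarrow> 'p) \<Rightarrow> (nat \<Rightarrow> 'p) \<Rightarrow> (nat set \<Rightarrow> 'p poly2) \<Rightarrow>
    nat set \<Rightarrow> 'p poly2" where
  "edge_sum G a b g s = (\<Sum>t\<in>s. scoeff (G (s - {t})) (a t) (b t) * g (s - {t}))"

text \<open>With \<open>edge_sum\<close> as the differential, \<open>\<psi>\<close> placed at the
  vertex \<open>s\<^sub>0\<close> is the boundary of the chain \<open>g\<close>.\<close>

definition vanishes :: "nat set \<Rightarrow> (nat set \<Rightarrow> ('p \<times> 'p) set) \<Rightarrow> (nat \<Rightarrow> 'p) \<Rightarrow> (nat \<Rightarrow> 'p) \<Rightarrow>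
    nat set \<Rightarrow> 'p poly2 \<Rightarrow> bool" where
  "vanishes T G a b s\<^sub>0 \<psi> \<longleftrightarrow>
    (\<exists>g. \<forall>s\<subseteq>T. eqm (G s) (edge_sum G a b g s) (if s = s\<^sub>0 then \<psi> else 0))"

definition saddle_cube :: "nat set \<Rightarrow> (nat set \<Rightarrow> ('p \<times> 'p) set) \<Rightarrow> (nat \<Rightarrow> 'p) \<Rightarrow> (nat \<Rightarrow> 'p) \<Rightarrow> bool" where
  "saddle_cube T G a b \<longleftrightarrow> (\<forall>s t. s \<subseteq> T \<longrightarrow> t \<in> T - s \<longrightarrow> saddle (G s) (G (insert t s)) (a t) (b t))"

lemma saddle_cubeD:
  "saddle_cube T G a b \<Longrightarrow> s \<subseteq> T \<Longrightarrow> t \<in> s \<Longrightarrow> saddle (G (s - {t})) (G s) (a t) (b t)"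
  unfolding saddle_cube_def by (metis DiffI Diff_subset insertCI insert_Diff subset_iff subset_trans Diff_iff)

text \<open>Each edge contributes one commuting square from \<open>scoeff_square\<close>; so saddles
  between corresponding vertices of two cubes form a chain map.\<close>

lemma edge_sum_commute:
  assumes "saddle_cube T P a b" "saddle_cube T Q a b" "\<And>u. u \<subseteq> T \<Longrightarrow> saddle (P u) (Q u) c d" "u \<subseteq> T"
  shows "eqm (Q u) (edge_sum Q a b (\<lambda>v. scoeff (P v) c d * h v) u) (scoeff (P u) c d * edge_sum P a b h u)"
proof -
  have "eqm (Q u) (scoeff (Q (u - {t})) (a t) (b t) * (scoeff (P (u - {t})) c d * h (u - {t})))
      (scoeff (P u) c d * (scoeff (P (u - {t})) (a t) (b t) * h (u - {t})))" if "t \<in> u" for t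
  proof -
    have "saddle (P (u - {t})) (Q (u - {t})) c d" "saddle (P u) (Q u) c d"
      using assms(3,4) by blast+
    then have "eqm (Q u) (scoeff (P (u - {t})) c d * scoeff (Q (u - {t})) (a t) (b t))
        (scoeff (P (u - {t})) (a t) (b t) * scoeff (P u) c d)"
      using saddle_cubeD[OF assms(1,4) that] saddle_cubeD[OF assms(2,4) that]
      by (rule scoeff_square)
    from eqm_mult[OF this eqm_refl, of "h (u - {t})"] show ?thesis
      by (simp add: mult_ac)
  qed
  then show ?thesis
    unfolding edge_sum_def sum_distrib_left by (intro eqm_sum)
qed

lemma edge_sum_add: "edge_sum G a b (\<lambda>v. g v + h v) u = edge_sum G a b g u + edge_sum G a b h u"
  by (simp add: edge_sum_def distrib_left sum.distrib)

lemma edge_sum_zero [simp]: "edge_sum G a b (\<lambda>v. 0) u = 0"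
  by (simp add: edge_sum_def)

lemma edge_sum_Un:
  assumes "finite u" "finite x" "u \<inter> x = {}"
  shows "edge_sum G a b g (u \<union> x) = edge_sum (\<lambda>v. G (v \<union> x)) a b (\<lambda>v. g (v \<union> x)) u
    + edge_sum (\<lambda>y. G (u \<union> y)) a b (\<lambda>y. g (u \<union> y)) x"
proof -
  have "u \<union> x - {t} = u - {t} \<union> x" if "t \<in> u" for t
    using that assms by auto
  moreover have "u \<union> x - {t} = u \<union> (x - {t})" if "t \<in> x" for t
    using that assms by auto
  ultimately show ?thesis
    unfolding edge_sum_def using assms by (subst sum.union_disjoint) auto
qed

text \<open>\<open>G\<close> and \<open>Q\<close> are the same equivalence relation, except that \<open>\<phi>\<close> eliminates the points
  outside \<open>F\<close>.\<close>

definition retract :: "'p set \<Rightarrow> ('p \<Rightarrow> 'p) \<Rightarrow> ('p \<times> 'p) set \<Rightarrow> ('p \<times> 'p) set \<Rightarrow> bool" where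
  "retract F \<phi> G Q \<longleftrightarrow> Q \<subseteq> F \<times> F \<and> range \<phi> \<subseteq> F \<and> (\<forall>p\<in>F. \<phi> p = p) \<and>
    (\<forall>(p, q)\<in>G. (\<phi> p, \<phi> q) \<in> equiv_cl Q) \<and> Q \<subseteq> equiv_cl G \<and> (\<forall>p. (p, \<phi> p) \<in> equiv_cl G)"

lemma retractD:
  assumes "retract F \<phi> G Q"
  shows "\<phi> p \<in> F" "p \<in> F \<Longrightarrow> \<phi> p = p" "(p, q) \<in> G \<Longrightarrow> (\<phi> p, \<phi> q) \<in> equiv_cl Q"
    "Q \<subseteq> equiv_cl G" "(p, \<phi> p) \<in> equiv_cl G" "Q \<subseteq> F \<times> F"
  using assms unfolding retract_def by auto

lemma retract_iff:
  assumes "retract F \<phi> G Q"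
  shows "(p, q) \<in> equiv_cl G \<longleftrightarrow> (\<phi> p, \<phi> q) \<in> equiv_cl Q"
proof
  assume "(p, q) \<in> equiv_cl G"
  then show "(\<phi> p, \<phi> q) \<in> equiv_cl Q"
    using retractD(3)[OF assms] by (rule equiv_cl_map)
next
  assume "(\<phi> p, \<phi> q) \<in> equiv_cl Q"
  then have "(\<phi> p, \<phi> q) \<in> equiv_cl G"
    using retractD(4)[OF assms] by (rule equiv_cl_mono)
  then show "(p, q) \<in> equiv_cl G"
    using retractD(5)[OF assms] by (meson equiv_cl_sym equiv_cl_trans)
qed

lemma retract_iff_F:
  assumes "retract F \<phi> G Q" "p \<in> F" "q \<in> F"
  shows "(p, q) \<in> equiv_cl G \<longleftrightarrow> (p, q) \<in> equiv_cl Q"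
  using retract_iff[OF assms(1), of p q] retractD(2)[OF assms(1)] assms(2,3) by simp

lemma retract_eqm: "retract F \<phi> G Q \<Longrightarrow> eqm G x y \<Longrightarrow> eqm Q (rename \<phi> x) (rename \<phi> y)"
  by (rule rename_eqm) (auto dest: retractD(3))

lemma retract_eqm': "retract F \<phi> G Q \<Longrightarrow> eqm Q x y \<Longrightarrow> eqm G x y"
  by (rule eqm_mono) (auto dest: retractD(4))

lemma scoeff_retract: "retract F \<phi> G Q \<Longrightarrow> p \<in> F \<Longrightarrow> q \<in> F \<Longrightarrow> scoeff G p q = scoeff Q p q"
  by (simp add: scoeff_def retract_iff_F)

lemma rename_scoeff: "\<phi> p = p \<Longrightarrow> \<phi> q = q \<Longrightarrow> rename \<phi> (scoeff G p q) = scoeff G p q"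
  by (simp add: scoeff_def)

lemma equiv_cl_outside:
  assumes "(p, q) \<in> equiv_cl Q" "Q \<subseteq> F \<times> F"
  shows "p = q \<or> p \<in> F \<and> q \<in> F"
  using assms(1) by (rule equiv_cl_least) (use assms(2) in blast)+

lemma merges_retract:
  assumes "retract F \<phi> G Q" "retract F \<chi> H R" "merges G H a b" "a \<in> F" "b \<in> F"
  shows "merges Q R a b"
proof -
  have ab: "(a, b) \<notin> equiv_cl Q"
    using retract_iff_F[OF assms(1,4,5)] merges_equiv(1)[OF assms(3)] by blast
  have "(p, q) \<in> equiv_cl R \<longleftrightarrow> (p, q) \<in> equiv_cl Q \<or>
      (p, a) \<in> equiv_cl Q \<and> (b, q) \<in> equiv_cl Q \<or> (p, b) \<in> equiv_cl Q \<and> (a, q) \<in> equiv_cl Q" for p q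
  proof (cases "p \<in> F \<and> q \<in> F")
    case True
    then show ?thesis
      using merges_equiv(4)[OF assms(3), of p q] retract_iff_F[OF assms(1)] retract_iff_F[OF assms(2)]
        assms(4,5) by blast
  next
    case False
    then show ?thesis
      using equiv_cl_outside[of _ _ Q F] equiv_cl_outside[of _ _ R F] retractD(6)[OF assms(1)]
        retractD(6)[OF assms(2)] assms(4,5) equiv_cl_refl by metis
  qed
  with ab show ?thesis
    unfolding merges_def by blast
qed

lemma merges_mark_cong:
  assumes "merges G H a b" "(a, a') \<in> equiv_cl G" "(b, b') \<in> equiv_cl G"
  shows "merges G H a' b'"
proof -
  have "(p, a) \<in> equiv_cl G \<longleftrightarrow> (p, a') \<in> equiv_cl G" "(p, b) \<in> equiv_cl G \<longleftrightarrow> (p, b') \<in> equiv_cl G"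
    "(a, p) \<in> equiv_cl G \<longleftrightarrow> (a', p) \<in> equiv_cl G" "(b, p) \<in> equiv_cl G \<longleftrightarrow> (b', p) \<in> equiv_cl G" for p
    using assms(2,3) by (meson equiv_cl_sym equiv_cl_trans)+
  then show ?thesis
    using assms(1) unfolding merges_def by simp
qed

text \<open>Under this condition the marks of an edge may be replaced without changing the edge map
  (\<open>scoeff_cong\<close>); it is used to move marks out of a block.\<close>

definition same_marks :: "('p \<times> 'p) set \<Rightarrow> ('p \<times> 'p) set \<Rightarrow> 'p \<Rightarrow> 'p \<Rightarrow> 'p \<Rightarrow> 'p \<Rightarrow> bool" where
  "same_marks G H a b a' b' \<longleftrightarrow> (a, a') \<in> equiv_cl G \<and> (b, b') \<in> equiv_cl G \<and>
    (a, a') \<in> equiv_cl H \<and> (b, b') \<in> equiv_cl H"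

lemma saddle_retract:
  assumes "retract F \<phi> G Q" "retract F \<chi> H R" "saddle G H a b" "same_marks G H a b a' b'"
    "a' \<in> F" "b' \<in> F"
  shows "saddle Q R a' b'"
  using assms merges_mark_cong merges_retract unfolding saddle_def same_marks_def by metis

lemma edge_retract:
  assumes "retract F \<phi> G Q" "retract F' \<chi> H R" "F \<subseteq> F'" "saddle G H a b" "same_marks G H a b a' b'"
    "a' \<in> F" "b' \<in> F"
  shows "eqm R (rename \<chi> (scoeff G a b * g)) (scoeff Q a' b' * rename \<phi> g)"
proof -
  have "eqm G g (rename \<phi> g)"
    using retractD(5)[OF assms(1)] by (rule eqm_rename_self)
  then have "eqm H (scoeff G a b * g) (scoeff G a b * rename \<phi> g)"
    by (rule scoeff_eqm[OF assms(4)])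
  also have "eqm H \<dots> (scoeff G a' b' * rename \<phi> g)"
    using assms(5) unfolding same_marks_def by (intro eqm_mult scoeff_cong) auto
  finally have "eqm R (rename \<chi> (scoeff G a b * g)) (rename \<chi> (scoeff G a' b' * rename \<phi> g))"
    by (rule retract_eqm[OF assms(2)])
  also have "rename \<chi> (scoeff G a' b' * rename \<phi> g) = scoeff Q a' b' * rename \<phi> g"
  proof -
    have "\<chi> \<circ> \<phi> = \<phi>"
    proof
      fix p
      have "\<phi> p \<in> F'" using retractD(1)[OF assms(1), of p] assms(3) by blast
      then show "(\<chi> \<circ> \<phi>) p = \<phi> p" using retractD(2)[OF assms(2)] by simp
    qed
    moreover have "\<chi> a' = a'" "\<chi> b' = b'"
      using retractD(2)[OF assms(2)] assms(3,6,7) by auto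
    ultimately show ?thesis
      using scoeff_retract[OF assms(1,6,7)] by (simp add: rename_rename rename_scoeff)
  qed
  finally show ?thesis .
qed

lemma edge_retract':
  assumes "retract F \<phi> G Q" "same_marks G H a b a' b'" "a' \<in> F" "b' \<in> F"
  shows "eqm H (scoeff G a b * g) (scoeff Q a' b' * g)"
  using assms(2) scoeff_retract[OF assms(1,3,4)] scoeff_cong[of a a' G b b' H]
  unfolding same_marks_def by (metis eqm_mult eqm_refl)

lemma rename_edge_sum:
  assumes "\<And>u. u \<subseteq> T \<Longrightarrow> retract F \<phi> (G u) (Q u)" "\<And>t. t \<in> T \<Longrightarrow> a t \<in> F \<and> b t \<in> F" "u \<subseteq> T"
  shows "rename \<phi> (edge_sum G a b g u) = edge_sum Q a b (\<lambda>v. rename \<phi> (g v)) u"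
proof -
  have "rename \<phi> (scoeff (G (u - {t})) (a t) (b t)) = scoeff (Q (u - {t})) (a t) (b t)" if "t \<in> u" for t
  proof -
    have "a t \<in> F" "b t \<in> F" "u - {t} \<subseteq> T" using that assms(2,3) by auto
    then show ?thesis
      using assms(1)[of "u - {t}"] retractD(2)[OF assms(1)[of "u - {t}"]]
      by (simp add: rename_scoeff scoeff_retract)
  qed
  then show ?thesis
    by (simp add: edge_sum_def)
qed

lemma edge_sum_retract:
  assumes "\<And>u. u \<subseteq> T \<Longrightarrow> retract F \<phi> (G u) (Q u)" "\<And>t. t \<in> T \<Longrightarrow> a t \<in> F \<and> b t \<in> F" "u \<subseteq> T"
  shows "edge_sum G a b g u = edge_sum Q a b g u"
proof -
  have "scoeff (G (u - {t})) (a t) (b t) = scoeff (Q (u - {t})) (a t) (b t)" if "t \<in> u" for t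
    using that assms(2,3) by (intro scoeff_retract[OF assms(1)]) auto
  then show ?thesis
    by (simp add: edge_sum_def)
qed

lemma saddle_cube_retract:
  assumes "\<And>u. u \<subseteq> T \<Longrightarrow> retract F \<phi> (G u) (Q u)" "\<And>t. t \<in> T \<Longrightarrow> a t \<in> F \<and> b t \<in> F"
    "saddle_cube T G a b"
  shows "saddle_cube T Q a b"
  unfolding saddle_cube_def
proof (intro allI impI)
  fix s t assume "s \<subseteq> T" "t \<in> T - s"
  then show "saddle (Q s) (Q (insert t s)) (a t) (b t)"
    using assms unfolding saddle_cube_def
    by (intro saddle_retract[OF assms(1)[of s] assms(1)[of "insert t s"]]) (auto simp: same_marks_def)
qed

lemma coeff1_edge_sum:
  assumes "\<And>t. t \<in> u \<Longrightarrow> a t \<noteq> c \<and> b t \<noteq> c"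
  shows "coeff1 c (edge_sum Q a b g u) = edge_sum Q a b (\<lambda>v. coeff1 c (g v)) u"
proof -
  have "coeff1 c (scoeff R p q * x) = scoeff R p q * coeff1 c x" if "p \<noteq> c" "q \<noteq> c" for R p q x
    using that by (simp add: scoeff_def distrib_right coeff1_var_mult)
  then show ?thesis
    using assms by (simp add: edge_sum_def coeff1_sum)
qed

lemma saddle_cube_face:
  assumes "saddle_cube (T \<union> K) G a b" "x \<subseteq> K" "T \<inter> K = {}"
  shows "saddle_cube T (\<lambda>u. G (u \<union> x)) a b"
  unfolding saddle_cube_def
proof (intro allI impI)
  fix s t assume "s \<subseteq> T" "t \<in> T - s"
  then have "s \<union> x \<subseteq> T \<union> K" "t \<in> T \<union> K - (s \<union> x)"
    using assms(2,3) by auto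
  then show "saddle (G (s \<union> x)) (G (insert t s \<union> x)) (a t) (b t)"
    using assms(1) unfolding saddle_cube_def by simp
qed

text \<open>The cube is viewed as a cube over \<open>K\<close> whose vertices are cubes over
  \<open>T\<close>. A local move then deals with the few vertices over \<open>K\<close>, while the
  crossings of \<open>T\<close> are carried along as a differential.\<close>

lemma vanishes_split:
  assumes "finite T" "finite K" "T \<inter> K = {}"
  shows "vanishes (T \<union> K) G a b s\<^sub>0 \<psi> \<longleftrightarrow> (\<exists>g. \<forall>u\<subseteq>T. \<forall>x\<subseteq>K. eqm (G (u \<union> x))
    (edge_sum (\<lambda>v. G (v \<union> x)) a b (\<lambda>v. g v x) u + edge_sum (\<lambda>y. G (u \<union> y)) a b (g u) x)
    (if u \<union> x = s\<^sub>0 then \<psi> else 0))" (is "?L \<longleftrightarrow> ?R")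
proof
  assume ?L
  then obtain g where g: "\<And>s. s \<subseteq> T \<union> K \<Longrightarrow> eqm (G s) (edge_sum G a b g s) (if s = s\<^sub>0 then \<psi> else 0)"
    unfolding vanishes_def by blast
  have *: "eqm (G (u \<union> x)) (edge_sum (\<lambda>v. G (v \<union> x)) a b (\<lambda>v. g (v \<union> x)) u
      + edge_sum (\<lambda>y. G (u \<union> y)) a b (\<lambda>y. g (u \<union> y)) x) (if u \<union> x = s\<^sub>0 then \<psi> else 0)"
    if "u \<subseteq> T" "x \<subseteq> K" for u x
  proof -
    have "finite u" "finite x" "u \<inter> x = {}" "u \<union> x \<subseteq> T \<union> K"
      using that assms finite_subset[of u T] finite_subset[of x K] by auto
    then show ?thesis
      using g[of "u \<union> x"] by (simp only: edge_sum_Un)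
  qed
  show ?R by (intro exI[of _ "\<lambda>u x. g (u \<union> x)"] allI impI *)
next
  assume ?R
  then obtain g where "\<forall>u\<subseteq>T. \<forall>x\<subseteq>K. eqm (G (u \<union> x))
    (edge_sum (\<lambda>v. G (v \<union> x)) a b (\<lambda>v. g v x) u + edge_sum (\<lambda>y. G (u \<union> y)) a b (g u) x)
    (if u \<union> x = s\<^sub>0 then \<psi> else 0)" ..
  note g = this[rule_format]
  define g' where "g' s = g (s \<inter> T) (s \<inter> K)" for s
  have *: "eqm (G s) (edge_sum G a b g' s) (if s = s\<^sub>0 then \<psi> else 0)" if "s \<subseteq> T \<union> K" for s
  proof -
    define u x where ux: "u = s \<inter> T" "x = s \<inter> K"
    have s: "s = u \<union> x" "u \<subseteq> T" "x \<subseteq> K" "u \<inter> x = {}" "finite u" "finite x"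
      using that assms unfolding ux by (auto intro: finite_subset)
    have "g' (v \<union> x) = g v x" if "v \<subseteq> u" for v
    proof -
      have "(v \<union> x) \<inter> T = v" "(v \<union> x) \<inter> K = x"
        using that s assms(3) by auto
      then show ?thesis by (simp add: g'_def)
    qed
    then have 1: "edge_sum (\<lambda>v. G (v \<union> x)) a b (\<lambda>v. g' (v \<union> x)) u = edge_sum (\<lambda>v. G (v \<union> x)) a b (\<lambda>v. g v x) u"
      by (simp add: edge_sum_def Diff_subset)
    have "g' (u \<union> y) = g u y" if "y \<subseteq> x" for y
    proof -
      have "(u \<union> y) \<inter> T = u" "(u \<union> y) \<inter> K = y"
        using that s assms(3) by auto
      then show ?thesis by (simp add: g'_def)
    qed
    then have 2: "edge_sum (\<lambda>y. G (u \<union> y)) a b (\<lambda>y. g' (u \<union> y)) x = edge_sum (\<lambda>y. G (u \<union> y)) a b (g u) x"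
      by (simp add: edge_sum_def Diff_subset)
    show ?thesis
      using g[OF s(2,3)] unfolding s(1) edge_sum_Un[OF s(5,6,4)] 1 2 .
  qed
  show ?L unfolding vanishes_def by (intro exI[of _ g'] allI impI *)
qed

section \<open>Invariance under local moves\<close>

lemma edge_sum_small:
  "edge_sum G a b g {} = 0"
  "edge_sum G a b g {A} = scoeff (G {}) (a A) (b A) * g {}"
  "A \<noteq> B \<Longrightarrow> edge_sum G a b g {A, B} =
    scoeff (G {B}) (a A) (b A) * g {B} + scoeff (G {A}) (a B) (b B) * g {A}"
  "A \<noteq> B \<Longrightarrow> A \<noteq> C \<Longrightarrow> B \<noteq> C \<Longrightarrow> edge_sum G a b g {A, B, C} =
    scoeff (G {B, C}) (a A) (b A) * g {B, C} + scoeff (G {A, C}) (a B) (b B) * g {A, C} +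
    scoeff (G {A, B}) (a C) (b C) * g {A, B}"
  by (auto simp: edge_sum_def insert_Diff_if insert_commute add.assoc)

lemma subset_pairD: "x \<subseteq> {A, B} \<Longrightarrow> x = {} \<or> x = {A} \<or> x = {B} \<or> x = {A, B}"
  by auto

lemma subset_tripleD:
  assumes "x \<subseteq> {A, B, C}"
  shows "x = {} \<or> x = {A} \<or> x = {B} \<or> x = {C} \<or> x = {A, B} \<or> x = {A, C} \<or> x = {B, C} \<or> x = {A, B, C}"
proof -
  define y where "y = x - {C}"
  have y: "x = y \<or> x = insert C y" "y \<subseteq> {A, B}"
    unfolding y_def using assms by blast+
  have com: "{C, A} = {A, C}" "{C, B} = {B, C}" "{C, A, B} = {A, B, C}"
    by auto
  from y(1) subset_pairD[OF y(2)] show ?thesis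
    by (elim disjE) (simp_all add: com)
qed
lemma eqm_move: "eqm G (x + y) z \<Longrightarrow> eqm G x (y + z)"
  unfolding eqm_def by (simp add: ac_simps)

abbreviation pcoeff :: "('p \<times> 'p) set \<Rightarrow> 'p \<times> 'p \<Rightarrow> 'p poly2" where
  "pcoeff G m \<equiv> scoeff G (fst m) (snd m)"

text \<open>In both words of a Reidemeister 2 move, the positive crossing \<open>P\<close> and the negative crossing \<open>N\<close>
  are resolved to a circle and a turn-back if \<open>P\<close> alone is 1-resolved, and to the identity if \<open>N\<close>
  alone is; \<open>c\<close> is a point of the circle.\<close>

locale r2_cube =
  fixes T :: "nat set" and N P :: nat and G :: "nat set \<Rightarrow> ('p \<times> 'p) set" and a b :: "nat \<Rightarrow> 'p"
    and F :: "'p set" and c :: 'p and QU QI :: "nat set \<Rightarrow> ('p \<times> 'p) set" and \<phi> :: "nat set \<Rightarrow> 'p \<Rightarrow> 'p"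
    and mU mI :: "'p \<times> 'p" and q :: 'p
  assumes finite: "finite T" and NP: "N \<notin> T" "P \<notin> T" "N \<noteq> P"
    and cube: "saddle_cube (T \<union> {N, P}) G a b"
    and marks: "\<And>t. t \<in> T \<Longrightarrow> a t \<in> F \<and> b t \<in> F"
    and F: "c \<notin> F" "q \<in> F" "fst mU \<in> F" "snd mU \<in> F" "fst mI \<in> F" "snd mI \<in> F"
    and r0: "\<And>u. u \<subseteq> T \<Longrightarrow> retract F (\<phi> {}) (G u) (QU u)"
    and rN: "\<And>u. u \<subseteq> T \<Longrightarrow> retract F (\<phi> {N}) (G (u \<union> {N})) (QI u)"
    and rP: "\<And>u. u \<subseteq> T \<Longrightarrow> retract (insert c F) (\<phi> {P}) (G (u \<union> {P})) (QU u)"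
    and rNP: "\<And>u. u \<subseteq> T \<Longrightarrow> retract F (\<phi> {N, P}) (G (u \<union> {N, P})) (QU u)"
    and m0N: "\<And>u. u \<subseteq> T \<Longrightarrow> same_marks (G u) (G (u \<union> {N})) (a N) (b N) (fst mU) (snd mU)"
    and mNP: "\<And>u. u \<subseteq> T \<Longrightarrow> same_marks (G (u \<union> {N})) (G (u \<union> {N, P})) (a P) (b P) (fst mI) (snd mI)"
    and split: "\<And>u. u \<subseteq> T \<Longrightarrow> (a P, b P) \<in> equiv_cl (G u)"
    and split': "\<And>u. u \<subseteq> T \<Longrightarrow> (a P, c) \<in> equiv_cl (G (u \<union> {P})) \<and> (b P, q) \<in> equiv_cl (G (u \<union> {P})) \<or>
      (b P, c) \<in> equiv_cl (G (u \<union> {P})) \<and> (a P, q) \<in> equiv_cl (G (u \<union> {P}))"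
    and merge: "\<And>u. u \<subseteq> T \<Longrightarrow> (a N, b N) \<notin> equiv_cl (G (u \<union> {P}))"
begin

lemma saddles:
  assumes "u \<subseteq> T"
  shows "saddle (G u) (G (u \<union> {N})) (a N) (b N)" "saddle (G u) (G (u \<union> {P})) (a P) (b P)"
    "saddle (G (u \<union> {N})) (G (u \<union> {N, P})) (a P) (b P)"
proof -
  have S: "saddle (G s) (G (insert t s)) (a t) (b t)" if "s \<subseteq> T \<union> {N, P}" "t \<in> T \<union> {N, P} - s" for s t
    using cube that unfolding saddle_cube_def by blast
  show "saddle (G u) (G (u \<union> {N})) (a N) (b N)" "saddle (G u) (G (u \<union> {P})) (a P) (b P)"
    using S[of u N] S[of u P] assms NP by auto
  have "insert P (u \<union> {N}) = u \<union> {N, P}" by auto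
  then show "saddle (G (u \<union> {N})) (G (u \<union> {N, P})) (a P) (b P)"
    using S[of "u \<union> {N}" P] assms NP by auto
qed

lemma saddle_Q:
  assumes "u \<subseteq> T"
  shows "saddle (QU u) (QI u) (fst mU) (snd mU)" "saddle (QI u) (QU u) (fst mI) (snd mI)"
  using saddle_retract[OF r0[OF assms] rN[OF assms] saddles(1)[OF assms] m0N[OF assms]]
    saddle_retract[OF rN[OF assms] rNP[OF assms] saddles(3)[OF assms] mNP[OF assms]] F by auto

lemma cube_Q: "saddle_cube T QI a b" "saddle_cube T QU a b"
proof -
  have disj: "T \<inter> {N, P} = {}" using NP by auto
  show "saddle_cube T QI a b"
    by (rule saddle_cube_retract[OF rN marks saddle_cube_face[OF cube _ disj]]) auto
  have "saddle_cube T (\<lambda>u. G (u \<union> {})) a b"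
    by (rule saddle_cube_face[OF cube _ disj]) auto
  then show "saddle_cube T QU a b"
    by (intro saddle_cube_retract[OF r0 marks]) auto
qed

text \<open>The split creates the circle of \<open>c\<close> with coefficient
  \<open>var c + var q\<close>. Taking the coefficient of \<open>c\<close> turns this edge into the
  identity, the pivot of the elimination.\<close>

lemma split_edge:
  assumes u: "u \<subseteq> T" and x: "\<And>p. rename (\<phi> {P}) (rename (\<phi> {}) x) = rename (\<phi> {}) x"
  shows "eqm (QU u) (coeff1 c (rename (\<phi> {P}) (scoeff (G u) (a P) (b P) * x))) (rename (\<phi> {}) x)"
proof -
  have Q: "p \<noteq> c \<and> p' \<noteq> c" if "(p, p') \<in> QU u" for p p'
    using that retractD(6)[OF r0[OF u]] F(1) by auto
  have nc: "\<phi> {} p \<noteq> c" for p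
    using retractD(1)[OF r0[OF u], of p] F(1) by auto
  let ?h = "rename (\<phi> {}) x"
  have s: "scoeff (G u) (a P) (b P) = var (a P) + var (b P)"
    using split[OF u] by (simp add: scoeff_def)
  have "eqm (G (u \<union> {P})) (scoeff (G u) (a P) (b P) * x) (scoeff (G u) (a P) (b P) * ?h)"
    using retractD(5)[OF r0[OF u]] by (intro scoeff_eqm[OF saddles(2)[OF u]] eqm_rename_self)
  also have "scoeff (G u) (a P) (b P) * ?h = (var (a P) + var (b P)) * ?h"
    by (simp only: s)
  also have "eqm (G (u \<union> {P})) ((var (a P) + var (b P)) * ?h) ((var c + var q) * ?h)"
    using split'[OF u]
  proof
    assume "(a P, c) \<in> equiv_cl (G (u \<union> {P})) \<and> (b P, q) \<in> equiv_cl (G (u \<union> {P}))"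
    then show ?thesis by (intro eqm_mult eqm_add eqm_var) auto
  next
    assume "(b P, c) \<in> equiv_cl (G (u \<union> {P})) \<and> (a P, q) \<in> equiv_cl (G (u \<union> {P}))"
    then have "eqm (G (u \<union> {P})) (var (b P) + var (a P)) (var c + var q)"
      by (intro eqm_add eqm_var) auto
    then show ?thesis
      unfolding add.commute[of "var (a P)"] by (intro eqm_mult) auto
  qed
  finally have "eqm (QU u) (rename (\<phi> {P}) (scoeff (G u) (a P) (b P) * x))
      (rename (\<phi> {P}) ((var c + var q) * ?h))"
    by (rule retract_eqm[OF rP[OF u]])
  also have "rename (\<phi> {P}) ((var c + var q) * ?h) = (var c + var q) * ?h"
    using retractD(2)[OF rP[OF u]] F(2) x by simp
  finally have "eqm (QU u) (coeff1 c (rename (\<phi> {P}) (scoeff (G u) (a P) (b P) * x)))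
      (coeff1 c ((var c + var q) * ?h))"
    by (rule coeff1_eqm) (rule Q)
  also have "coeff1 c ((var c + var q) * ?h) = ?h"
    using F(1,2) nc coeff1_var_mult[of q c ?h] coeff1_rename[of "\<phi> {}" c x]
    by (auto simp: distrib_right coeff1_var_rename)
  finally show ?thesis .
qed

text \<open>The vertex without \<open>N\<close> and \<open>P\<close> is eliminated against the part
  of the vertex \<open>P\<close> whose circle is labeled v_-. That part is \<open>w\<close>, and its
  differential is the value at the eliminated vertex; so the correction in \<open>h\<close>, the
  image of \<open>w\<close> under the edge to \<open>N\<close>, cancels what the eliminated vertex
  contributes there.\<close>

theorem r2_delete:
  assumes "vanishes (T \<union> {N, P}) G a b (u\<^sub>0 \<union> {N}) \<psi>" "u\<^sub>0 \<subseteq> T" "rename (\<phi> {N}) \<psi> = \<psi>"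
  shows "vanishes T QI a b u\<^sub>0 \<psi>"
proof -
  have disj: "T \<inter> {N, P} = {}" and fin: "Finite_Set.finite {N, P}" using NP by auto
  obtain g where "\<forall>u\<subseteq>T. \<forall>x\<subseteq>{N, P}. eqm (G (u \<union> x))
    (edge_sum (\<lambda>v. G (v \<union> x)) a b (\<lambda>v. g v x) u + edge_sum (\<lambda>y. G (u \<union> y)) a b (g u) x)
    (if u \<union> x = u\<^sub>0 \<union> {N} then \<psi> else 0)"
    using assms(1) unfolding vanishes_split[OF finite fin disj] ..
  note g = this[rule_format]
  define w where "w v = coeff1 c (rename (\<phi> {P}) (g v {P}))" for v
  define h where "h v = rename (\<phi> {N}) (g v {N}) + pcoeff (QU v) mU * w v" for v
  have *: "eqm (QI u) (edge_sum QI a b h u) (if u = u\<^sub>0 then \<psi> else 0)" if u: "u \<subseteq> T" for u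
  proof -
    let ?h0 = "rename (\<phi> {}) (g u {})"
    have uN: "u \<union> {N} = u\<^sub>0 \<union> {N} \<longleftrightarrow> u = u\<^sub>0" "u \<union> {P} \<noteq> u\<^sub>0 \<union> {N}"
      using NP u assms(2) by auto
    have "eqm (QI u) (rename (\<phi> {N}) (edge_sum (\<lambda>v. G (v \<union> {N})) a b (\<lambda>v. g v {N}) u +
        scoeff (G u) (a N) (b N) * g u {})) (rename (\<phi> {N}) (if u = u\<^sub>0 then \<psi> else 0))"
      using g[OF u, of "{N}"] uN(1) by (intro retract_eqm[OF rN[OF u]]) (simp add: edge_sum_small)
    moreover have "rename (\<phi> {N}) (if u = u\<^sub>0 then \<psi> else 0) = (if u = u\<^sub>0 then \<psi> else 0)"
      using assms(3) by simp
    ultimately have "eqm (QI u) (edge_sum QI a b (\<lambda>v. rename (\<phi> {N}) (g v {N})) u +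
        rename (\<phi> {N}) (scoeff (G u) (a N) (b N) * g u {})) (if u = u\<^sub>0 then \<psi> else 0)"
      using rename_edge_sum[OF rN marks u] by simp
    then have "eqm (QI u) (edge_sum QI a b (\<lambda>v. rename (\<phi> {N}) (g v {N})) u)
        (rename (\<phi> {N}) (scoeff (G u) (a N) (b N) * g u {}) + (if u = u\<^sub>0 then \<psi> else 0))"
      by (rule eqm_move)
    also have "eqm (QI u) \<dots> (pcoeff (QU u) mU * ?h0 + (if u = u\<^sub>0 then \<psi> else 0))"
      using F by (intro eqm_add edge_retract[OF r0[OF u] rN[OF u] _ saddles(1)[OF u] m0N[OF u]]) auto
    finally have 1: "eqm (QI u) (edge_sum QI a b (\<lambda>v. rename (\<phi> {N}) (g v {N})) u)
        (pcoeff (QU u) mU * ?h0 + (if u = u\<^sub>0 then \<psi> else 0))" .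
    have fix0: "rename (\<phi> {P}) (rename (\<phi> {}) x) = rename (\<phi> {}) x" for x
    proof -
      have "\<phi> {P} \<circ> \<phi> {} = \<phi> {}"
        using retractD(1)[OF r0[OF u]] retractD(2)[OF rP[OF u]] by (auto simp: fun_eq_iff)
      then show ?thesis by (simp add: rename_rename)
    qed
    have "eqm (QU u) (rename (\<phi> {P}) (edge_sum (\<lambda>v. G (v \<union> {P})) a b (\<lambda>v. g v {P}) u +
        scoeff (G u) (a P) (b P) * g u {})) (rename (\<phi> {P}) 0)"
      using g[OF u, of "{P}"] uN(2) by (intro retract_eqm[OF rP[OF u]]) (simp add: edge_sum_small)
    then have "eqm (QU u) (coeff1 c (rename (\<phi> {P}) (edge_sum (\<lambda>v. G (v \<union> {P})) a b (\<lambda>v. g v {P}) u +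
        scoeff (G u) (a P) (b P) * g u {}))) (coeff1 c (rename (\<phi> {P}) 0))"
      by (rule coeff1_eqm) (use retractD(6)[OF r0[OF u]] F(1) in auto)
    moreover have "rename (\<phi> {P}) (edge_sum (\<lambda>v. G (v \<union> {P})) a b (\<lambda>v. g v {P}) u)
        = edge_sum QU a b (\<lambda>v. rename (\<phi> {P}) (g v {P})) u"
      using marks by (intro rename_edge_sum[OF rP _ u]) auto
    moreover have "coeff1 c (edge_sum QU a b (\<lambda>v. rename (\<phi> {P}) (g v {P})) u) = edge_sum QU a b w u"
      unfolding w_def using marks u F(1) by (intro coeff1_edge_sum) auto
    ultimately have "eqm (QU u) (edge_sum QU a b w u
        + coeff1 c (rename (\<phi> {P}) (scoeff (G u) (a P) (b P) * g u {}))) 0"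
      by simp
    then have "eqm (QU u) (edge_sum QU a b w u)
        (coeff1 c (rename (\<phi> {P}) (scoeff (G u) (a P) (b P) * g u {})) + 0)"
      by (rule eqm_move)
    also have "eqm (QU u) \<dots> (?h0 + 0)"
      using fix0 by (intro eqm_add split_edge[OF u]) auto
    finally have 2: "eqm (QU u) (edge_sum QU a b w u) ?h0" by simp
    have "eqm (QI u) (edge_sum QI a b (\<lambda>v. pcoeff (QU v) mU * w v) u)
        (pcoeff (QU u) mU * edge_sum QU a b w u)"
      by (rule edge_sum_commute[OF cube_Q(2,1) saddle_Q(1) u])
    also have "eqm (QI u) \<dots> (pcoeff (QU u) mU * ?h0)"
      by (rule scoeff_eqm[OF saddle_Q(1)[OF u] 2])
    finally have "eqm (QI u) (edge_sum QI a b h u)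
        ((pcoeff (QU u) mU * ?h0 + (if u = u\<^sub>0 then \<psi> else 0)) + pcoeff (QU u) mU * ?h0)"
      unfolding h_def edge_sum_add using 1 by (intro eqm_add)
    then show ?thesis by (simp add: ac_simps)
  qed
  show ?thesis unfolding vanishes_def by (intro exI[of _ h] allI impI *)
qed

text \<open>The primitive is placed at \<open>N\<close> and continued at \<open>P\<close> with the
  circle labeled v_+; the merge of this circle has coefficient 1 and cancels the edge from
  \<open>N\<close> at the last vertex. At \<open>P\<close> the differential has to vanish, which for
  \<open>\<psi>\<close> itself is the last assumption.\<close>

theorem r2_insert:
  assumes "vanishes T QI a b u\<^sub>0 \<psi>" "u\<^sub>0 \<subseteq> T" "eqm (QU u\<^sub>0) (pcoeff (QI u\<^sub>0) mI * \<psi>) 0"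
  shows "vanishes (T \<union> {N, P}) G a b (u\<^sub>0 \<union> {N}) \<psi>"
proof -
  have disj: "T \<inter> {N, P} = {}" and fin: "Finite_Set.finite {N, P}" using NP by auto
  obtain h where h: "\<And>u. u \<subseteq> T \<Longrightarrow> eqm (QI u) (edge_sum QI a b h u) (if u = u\<^sub>0 then \<psi> else 0)"
    using assms(1) unfolding vanishes_def by blast
  define g where "g v x = (if x = {N} then h v else if x = {P} then pcoeff (QI v) mI * h v else 0)"
    for v x
  have *: "eqm (G (u \<union> x)) (edge_sum (\<lambda>v. G (v \<union> x)) a b (\<lambda>v. g v x) u + edge_sum (\<lambda>y. G (u \<union> y)) a b (g u) x)
      (if u \<union> x = u\<^sub>0 \<union> {N} then \<psi> else 0)" if u: "u \<subseteq> T" and x: "x \<subseteq> {N, P}" for u x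
  proof -
    have eqs: "u \<union> {} \<noteq> u\<^sub>0 \<union> {N}" "u \<union> {N} = u\<^sub>0 \<union> {N} \<longleftrightarrow> u = u\<^sub>0" "u \<union> {P} \<noteq> u\<^sub>0 \<union> {N}"
      "u \<union> {N, P} \<noteq> u\<^sub>0 \<union> {N}"
      using NP u assms(2) by auto
    have dist: "{N} \<noteq> {P}" "{N, P} \<noteq> {N}" "{N, P} \<noteq> {P}" "{P} \<noteq> {N}"
      using NP by auto
    consider "x = {}" | "x = {N}" | "x = {P}" | "x = {N, P}"
      using x by (metis subset_pairD)
    then show ?thesis
    proof cases
      case 1
      then show ?thesis using eqs(1) by (simp add: g_def edge_sum_small)
    next
      case 2
      have "eqm (G (u \<union> {N})) (edge_sum QI a b h u) (if u = u\<^sub>0 then \<psi> else 0)"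
        by (rule retract_eqm'[OF rN[OF u] h[OF u]])
      then show ?thesis
        using 2 eqs(2) edge_sum_retract[OF rN marks u, where g = h] by (simp add: g_def edge_sum_small)
    next
      case 3
      have "eqm (QU u) (edge_sum QU a b (\<lambda>v. pcoeff (QI v) mI * h v) u) (pcoeff (QI u) mI * edge_sum QI a b h u)"
        by (rule edge_sum_commute[OF cube_Q saddle_Q(2) u])
      also have "eqm (QU u) \<dots> (pcoeff (QI u) mI * (if u = u\<^sub>0 then \<psi> else 0))"
        by (rule scoeff_eqm[OF saddle_Q(2)[OF u] h[OF u]])
      also have "eqm (QU u) \<dots> 0"
        using assms(3) by auto
      finally have "eqm (G (u \<union> {P})) (edge_sum QU a b (\<lambda>v. pcoeff (QI v) mI * h v) u) 0"
        by (rule retract_eqm'[OF rP[OF u]])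
      moreover have "edge_sum (\<lambda>v. G (v \<union> {P})) a b (\<lambda>v. pcoeff (QI v) mI * h v) u
          = edge_sum QU a b (\<lambda>v. pcoeff (QI v) mI * h v) u"
        using marks by (intro edge_sum_retract[OF rP _ u]) auto
      ultimately show ?thesis
        using 3 eqs(3) dist by (simp add: g_def edge_sum_small)
    next
      case 4
      have "eqm (G (u \<union> {N, P})) (scoeff (G (u \<union> {N})) (a P) (b P) * h u) (pcoeff (QI u) mI * h u)"
        using F by (intro edge_retract'[OF rN[OF u] mNP[OF u]]) auto
      from eqm_add[OF eqm_refl[of _ "pcoeff (QI u) mI * h u"] this]
      have "eqm (G (u \<union> {N, P})) (pcoeff (QI u) mI * h u + scoeff (G (u \<union> {N})) (a P) (b P) * h u) 0"
        by simp
      moreover have "scoeff (G (u \<union> {P})) (a N) (b N) = 1"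
        using merge[OF u] by (simp add: scoeff_def)
      ultimately show ?thesis
        using 4 eqs(4) dist NP by (simp add: g_def edge_sum_small)
    qed
  qed
  show ?thesis
    unfolding vanishes_split[OF finite fin disj] by (intro exI[of _ g] allI impI *)
qed

end

text \<open>Gaussian elimination of the circle in the cube of \<open>\<sigma>\<^sub>1\<sigma>\<^sub>2\<sigma>\<^sub>1\<close> leaves the complex
  \<open>QI \<rightarrow> Q1 \<oplus> Q2 \<rightarrow> QD \<oplus> QE\<close>, which is symmetric in the two generators.\<close>

definition r3_core :: "nat set \<Rightarrow> (nat \<Rightarrow> 'p) \<Rightarrow> (nat \<Rightarrow> 'p) \<Rightarrow> (nat set \<Rightarrow> ('p \<times> 'p) set) \<Rightarrow>
    (nat set \<Rightarrow> ('p \<times> 'p) set) \<Rightarrow> (nat set \<Rightarrow> ('p \<times> 'p) set) \<Rightarrow> (nat set \<Rightarrow> ('p \<times> 'p) set) \<Rightarrow>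
    (nat set \<Rightarrow> ('p \<times> 'p) set) \<Rightarrow> 'p \<times> 'p \<Rightarrow> 'p \<times> 'p \<Rightarrow> 'p \<times> 'p \<Rightarrow> 'p \<times> 'p \<Rightarrow> 'p \<times> 'p \<Rightarrow> 'p \<times> 'p \<Rightarrow>
    nat set \<Rightarrow> 'p poly2 \<Rightarrow> bool" where
  "r3_core T a b QI Q1 Q2 QD QE m1 m2 mD1 mE1 mD2 mE2 u\<^sub>0 \<psi> \<longleftrightarrow> (\<exists>hI h1 h2 hD hE. \<forall>u\<subseteq>T.
    eqm (QI u) (edge_sum QI a b hI u) (if u = u\<^sub>0 then \<psi> else 0) \<and>
    eqm (Q1 u) (edge_sum Q1 a b h1 u) (pcoeff (QI u) m1 * hI u) \<and>
    eqm (Q2 u) (edge_sum Q2 a b h2 u) (pcoeff (QI u) m2 * hI u) \<and>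
    eqm (QD u) (edge_sum QD a b hD u) (pcoeff (Q1 u) mD1 * h1 u + pcoeff (Q2 u) mD2 * h2 u) \<and>
    eqm (QE u) (edge_sum QE a b hE u) (pcoeff (Q1 u) mE1 * h1 u + pcoeff (Q2 u) mE2 * h2 u))"

lemma r3_core_swap:
  "r3_core T a b QI Q1 Q2 QD QE m1 m2 mD1 mE1 mD2 mE2 u\<^sub>0 \<psi> \<Longrightarrow>
    r3_core T a b QI Q2 Q1 QE QD m2 m1 mE2 mD2 mE1 mD1 u\<^sub>0 \<psi>"
  unfolding r3_core_def
  by (elim exE, rule_tac x = hI in exI, rule_tac x = h2 in exI, rule_tac x = h1 in exI,
      rule_tac x = hE in exI, rule_tac x = hD in exI) (simp add: add.commute)

text \<open>\<open>A\<close>, \<open>B\<close>, \<open>C\<close> are the crossings in order. The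
  resolution \<open>{A, C}\<close> has a closed circle through \<open>c\<close>; apart from it, it
  agrees with \<open>{A}\<close>, \<open>{C}\<close> and \<open>{A, B, C}\<close>, which all reduce
  to \<open>Q1\<close>. \<open>QD\<close> and \<open>QE\<close> belong to \<open>{A, B}\<close> and
  \<open>{B, C}\<close>.\<close>

locale r3_cube =
  fixes T :: "nat set" and A B C :: nat and G :: "nat set \<Rightarrow> ('p \<times> 'p) set" and a b :: "nat \<Rightarrow> 'p"
    and F :: "'p set" and c :: 'p and QI Q1 Q2 QD QE :: "nat set \<Rightarrow> ('p \<times> 'p) set"
    and \<phi> :: "nat set \<Rightarrow> 'p \<Rightarrow> 'p"
    and m1 m2 mD1 mE1 mD2 mE2 mD mE :: "'p \<times> 'p" and q q' :: 'p
  assumes finite: "finite T" and ABC: "A \<notin> T" "B \<notin> T" "C \<notin> T" "A \<noteq> B" "A \<noteq> C" "B \<noteq> C"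
    and cube: "saddle_cube (T \<union> {A, B, C}) G a b"
    and marks: "\<And>t. t \<in> T \<Longrightarrow> a t \<in> F \<and> b t \<in> F"
    and F: "c \<notin> F" "q \<in> F" "q' \<in> F" "{m1, m2, mD1, mE1, mD2, mE2, mD, mE} \<subseteq> F \<times> F"
    and r0: "\<And>u. u \<subseteq> T \<Longrightarrow> retract F (\<phi> {}) (G u) (QI u)"
    and rA: "\<And>u. u \<subseteq> T \<Longrightarrow> retract F (\<phi> {A}) (G (u \<union> {A})) (Q1 u)"
    and rB: "\<And>u. u \<subseteq> T \<Longrightarrow> retract F (\<phi> {B}) (G (u \<union> {B})) (Q2 u)"
    and rC: "\<And>u. u \<subseteq> T \<Longrightarrow> retract F (\<phi> {C}) (G (u \<union> {C})) (Q1 u)"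
    and rAB: "\<And>u. u \<subseteq> T \<Longrightarrow> retract F (\<phi> {A, B}) (G (u \<union> {A, B})) (QD u)"
    and rAC: "\<And>u. u \<subseteq> T \<Longrightarrow> retract (insert c F) (\<phi> {A, C}) (G (u \<union> {A, C})) (Q1 u)"
    and rBC: "\<And>u. u \<subseteq> T \<Longrightarrow> retract F (\<phi> {B, C}) (G (u \<union> {B, C})) (QE u)"
    and rABC: "\<And>u. u \<subseteq> T \<Longrightarrow> retract F (\<phi> {A, B, C}) (G (u \<union> {A, B, C})) (Q1 u)"
    and m0A: "\<And>u. u \<subseteq> T \<Longrightarrow> same_marks (G u) (G (u \<union> {A})) (a A) (b A) (fst m1) (snd m1)"
    and m0B: "\<And>u. u \<subseteq> T \<Longrightarrow> same_marks (G u) (G (u \<union> {B})) (a B) (b B) (fst m2) (snd m2)"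
    and m0C: "\<And>u. u \<subseteq> T \<Longrightarrow> same_marks (G u) (G (u \<union> {C})) (a C) (b C) (fst m1) (snd m1)"
    and mAB: "\<And>u. u \<subseteq> T \<Longrightarrow> same_marks (G (u \<union> {A})) (G (u \<union> {A, B})) (a B) (b B) (fst mD1) (snd mD1)"
    and mBA: "\<And>u. u \<subseteq> T \<Longrightarrow> same_marks (G (u \<union> {B})) (G (u \<union> {A, B})) (a A) (b A) (fst mD2) (snd mD2)"
    and mBC: "\<And>u. u \<subseteq> T \<Longrightarrow> same_marks (G (u \<union> {B})) (G (u \<union> {B, C})) (a C) (b C) (fst mE2) (snd mE2)"
    and mCB: "\<And>u. u \<subseteq> T \<Longrightarrow> same_marks (G (u \<union> {C})) (G (u \<union> {B, C})) (a B) (b B) (fst mE1) (snd mE1)"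
    and mABC: "\<And>u. u \<subseteq> T \<Longrightarrow> same_marks (G (u \<union> {A, B})) (G (u \<union> {A, B, C})) (a C) (b C) (fst mD) (snd mD)"
    and mBCA: "\<And>u. u \<subseteq> T \<Longrightarrow> same_marks (G (u \<union> {B, C})) (G (u \<union> {A, B, C})) (a A) (b A) (fst mE) (snd mE)"
    and splitA: "\<And>u. u \<subseteq> T \<Longrightarrow> (a C, b C) \<in> equiv_cl (G (u \<union> {A}))"
    and splitC: "\<And>u. u \<subseteq> T \<Longrightarrow> (a A, b A) \<in> equiv_cl (G (u \<union> {C}))"
    and circle: "\<And>u. u \<subseteq> T \<Longrightarrow> (a C, c) \<in> equiv_cl (G (u \<union> {A, C})) \<and> (b C, q) \<in> equiv_cl (G (u \<union> {A, C}))"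
      "\<And>u. u \<subseteq> T \<Longrightarrow> (b A, c) \<in> equiv_cl (G (u \<union> {A, C})) \<and> (a A, q') \<in> equiv_cl (G (u \<union> {A, C}))"
    and merge: "\<And>u. u \<subseteq> T \<Longrightarrow> (a B, b B) \<notin> equiv_cl (G (u \<union> {A, C}))"
    and tripD: "\<And>u. u \<subseteq> T \<Longrightarrow>
      eqm (Q1 u) (pcoeff (Q1 u) mD1 * pcoeff (QD u) mD) (var (fst mD1) + var (snd mD1))"
    and tripE: "\<And>u. u \<subseteq> T \<Longrightarrow>
      eqm (Q1 u) (pcoeff (Q1 u) mE1 * pcoeff (QE u) mE) (var (fst mE1) + var (snd mE1))"
    and trip: "\<And>u. u \<subseteq> T \<Longrightarrow>
      eqm (Q1 u) (var (fst mD1) + var (snd mD1) + (var (fst mE1) + var (snd mE1))) (var q + var q')"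
begin

lemma saddle_insert:
  assumes "u \<subseteq> T" "x \<subseteq> {A, B, C}" "t \<in> {A, B, C} - x"
  shows "saddle (G (u \<union> x)) (G (u \<union> insert t x)) (a t) (b t)"
proof -
  have "u \<union> x \<subseteq> T \<union> {A, B, C}" "t \<in> T \<union> {A, B, C} - (u \<union> x)"
    using assms ABC by auto
  then show ?thesis
    using cube unfolding saddle_cube_def by simp
qed

lemma saddles:
  assumes "u \<subseteq> T"
  shows "saddle (G u) (G (u \<union> {A})) (a A) (b A)" "saddle (G u) (G (u \<union> {B})) (a B) (b B)"
    "saddle (G u) (G (u \<union> {C})) (a C) (b C)"
    "saddle (G (u \<union> {A})) (G (u \<union> {A, B})) (a B) (b B)" "saddle (G (u \<union> {B})) (G (u \<union> {A, B})) (a A) (b A)"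
    "saddle (G (u \<union> {A})) (G (u \<union> {A, C})) (a C) (b C)" "saddle (G (u \<union> {C})) (G (u \<union> {A, C})) (a A) (b A)"
    "saddle (G (u \<union> {B})) (G (u \<union> {B, C})) (a C) (b C)" "saddle (G (u \<union> {C})) (G (u \<union> {B, C})) (a B) (b B)"
    "saddle (G (u \<union> {A, B})) (G (u \<union> {A, B, C})) (a C) (b C)"
    "saddle (G (u \<union> {B, C})) (G (u \<union> {A, B, C})) (a A) (b A)"
proof -
  have com: "{B, A} = {A, B}" "{C, A} = {A, C}" "{C, B} = {B, C}" "{C, A, B} = {A, B, C}"
    by auto
  note S = saddle_insert[OF assms]
  show "saddle (G u) (G (u \<union> {A})) (a A) (b A)" "saddle (G u) (G (u \<union> {B})) (a B) (b B)"
    "saddle (G u) (G (u \<union> {C})) (a C) (b C)"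
    using S[of "{}" A] S[of "{}" B] S[of "{}" C] by auto
  show "saddle (G (u \<union> {A})) (G (u \<union> {A, B})) (a B) (b B)" "saddle (G (u \<union> {A})) (G (u \<union> {A, C})) (a C) (b C)"
    using S[of "{A}" B] S[of "{A}" C] ABC unfolding com by simp_all
  show "saddle (G (u \<union> {B})) (G (u \<union> {A, B})) (a A) (b A)" "saddle (G (u \<union> {B})) (G (u \<union> {B, C})) (a C) (b C)"
    using S[of "{B}" A] S[of "{B}" C] ABC unfolding com by simp_all
  show "saddle (G (u \<union> {C})) (G (u \<union> {A, C})) (a A) (b A)" "saddle (G (u \<union> {C})) (G (u \<union> {B, C})) (a B) (b B)"
    using S[of "{C}" A] S[of "{C}" B] ABC unfolding com by simp_all
  show "saddle (G (u \<union> {A, B})) (G (u \<union> {A, B, C})) (a C) (b C)"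
    "saddle (G (u \<union> {B, C})) (G (u \<union> {A, B, C})) (a A) (b A)"
    using S[of "{A, B}" C] S[of "{B, C}" A] ABC unfolding com by simp_all
qed

lemma F': "fst m1 \<in> F" "snd m1 \<in> F" "fst m2 \<in> F" "snd m2 \<in> F" "fst mD1 \<in> F" "snd mD1 \<in> F"
  "fst mE1 \<in> F" "snd mE1 \<in> F" "fst mD2 \<in> F" "snd mD2 \<in> F" "fst mE2 \<in> F" "snd mE2 \<in> F"
  "fst mD \<in> F" "snd mD \<in> F" "fst mE \<in> F" "snd mE \<in> F"
  using F(4) by auto

lemma saddle_Q:
  assumes u: "u \<subseteq> T"
  shows "saddle (Q1 u) (QE u) (fst mE1) (snd mE1)" "saddle (Q1 u) (QD u) (fst mD1) (snd mD1)"
    "saddle (Q2 u) (QD u) (fst mD2) (snd mD2)" "saddle (Q2 u) (QE u) (fst mE2) (snd mE2)"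
    "saddle (QD u) (Q1 u) (fst mD) (snd mD)" "saddle (QE u) (Q1 u) (fst mE) (snd mE)"
  by (rule saddle_retract[OF rC rBC saddles(9) mCB F'(7,8)] saddle_retract[OF rA rAB saddles(4) mAB F'(5,6)]
      saddle_retract[OF rB rAB saddles(5) mBA F'(9,10)] saddle_retract[OF rB rBC saddles(8) mBC F'(11,12)]
      saddle_retract[OF rAB rABC saddles(10) mABC F'(13,14)]
      saddle_retract[OF rBC rABC saddles(11) mBCA F'(15,16)]; rule u)+

lemma disj: "T \<inter> {A, B, C} = {}"
  using ABC by auto

lemma face: "x \<subseteq> {A, B, C} \<Longrightarrow> saddle_cube T (\<lambda>u. G (u \<union> x)) a b"
  by (rule saddle_cube_face[OF cube _ disj])

lemma cube_Q: "saddle_cube T Q1 a b" "saddle_cube T QD a b" "saddle_cube T QE a b"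
  by (rule saddle_cube_retract[OF rA marks face] saddle_cube_retract[OF rAB marks face]
      saddle_cube_retract[OF rBC marks face]; simp)+

lemma no_circle: "u \<subseteq> T \<Longrightarrow> (p, p') \<in> Q1 u \<Longrightarrow> p \<noteq> c \<and> p' \<noteq> c"
  using retractD(6)[OF rA] F(1) by blast

lemma split_edge:
  assumes u: "u \<subseteq> T" and s: "saddle H (G (u \<union> {A, C})) x y" and r: "retract F \<chi> H (Q1 u)"
    and xy: "(x, y) \<in> equiv_cl H" "(x, c) \<in> equiv_cl (G (u \<union> {A, C}))" "(y, z) \<in> equiv_cl (G (u \<union> {A, C}))"
    and z: "z \<in> F"
  shows "eqm (Q1 u) (coeff1 c (rename (\<phi> {A, C}) (scoeff H x y * g))) (rename \<chi> g)"
proof -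
  have nc: "\<chi> p \<noteq> c" for p
    using retractD(1)[OF r, of p] F(1) by auto
  let ?h = "rename \<chi> g"
  have "\<phi> {A, C} \<circ> \<chi> = \<chi>"
    using retractD(1)[OF r] retractD(2)[OF rAC[OF u]] by (auto simp: fun_eq_iff)
  then have fixed: "rename (\<phi> {A, C}) ?h = ?h"
    by (simp add: rename_rename)
  have "eqm (G (u \<union> {A, C})) (scoeff H x y * g) (scoeff H x y * ?h)"
    using retractD(5)[OF r] by (intro scoeff_eqm[OF s] eqm_rename_self)
  also have "scoeff H x y * ?h = (var x + var y) * ?h"
    using xy(1) by (simp add: scoeff_def)
  also have "eqm (G (u \<union> {A, C})) ((var x + var y) * ?h) ((var c + var z) * ?h)"
    using xy by (intro eqm_mult eqm_add eqm_var) auto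
  finally have "eqm (Q1 u) (rename (\<phi> {A, C}) (scoeff H x y * g)) (rename (\<phi> {A, C}) ((var c + var z) * ?h))"
    by (rule retract_eqm[OF rAC[OF u]])
  also have "rename (\<phi> {A, C}) ((var c + var z) * ?h) = (var c + var z) * ?h"
    using retractD(2)[OF rAC[OF u]] z fixed by simp
  finally have "eqm (Q1 u) (coeff1 c (rename (\<phi> {A, C}) (scoeff H x y * g))) (coeff1 c ((var c + var z) * ?h))"
    by (rule coeff1_eqm) (rule no_circle[OF u])
  also have "coeff1 c ((var c + var z) * ?h) = ?h"
    using F(1) z nc coeff1_var_mult[of z c ?h] coeff1_rename[of \<chi> c g]
    by (auto simp: distrib_right coeff1_var_rename)
  finally show ?thesis .
qed

text \<open>This square commutes in the full cube; all its marks can be moved to points of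
  \<open>F\<close>, so the equation survives the elimination of the other points.\<close>

lemma square_Q:
  assumes u: "u \<subseteq> T"
  shows "eqm (Q1 u) (pcoeff (Q2 u) mD2 * pcoeff (QD u) mD) (pcoeff (Q2 u) mE2 * pcoeff (QE u) mE)"
proof -
  let ?H = "G (u \<union> {A, B, C})"
  have "eqm ?H (scoeff (G (u \<union> {A, B})) (a C) (b C) * (scoeff (G (u \<union> {B})) (a A) (b A) * 1))
      (scoeff (G (u \<union> {A, B})) (a C) (b C) * (pcoeff (Q2 u) mD2 * 1))"
    by (intro scoeff_eqm[OF saddles(10)[OF u]] edge_retract'[OF rB[OF u] mBA[OF u] F'(9,10)])
  also have "eqm ?H \<dots> (pcoeff (QD u) mD * (pcoeff (Q2 u) mD2 * 1))"
    by (rule edge_retract'[OF rAB[OF u] mABC[OF u] F'(13,14)])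
  finally have D: "eqm ?H (scoeff (G (u \<union> {B})) (a A) (b A) * scoeff (G (u \<union> {A, B})) (a C) (b C))
      (pcoeff (Q2 u) mD2 * pcoeff (QD u) mD)"
    by (simp add: mult.commute)
  have "eqm ?H (scoeff (G (u \<union> {B, C})) (a A) (b A) * (scoeff (G (u \<union> {B})) (a C) (b C) * 1))
      (scoeff (G (u \<union> {B, C})) (a A) (b A) * (pcoeff (Q2 u) mE2 * 1))"
    by (intro scoeff_eqm[OF saddles(11)[OF u]] edge_retract'[OF rB[OF u] mBC[OF u] F'(11,12)])
  also have "eqm ?H \<dots> (pcoeff (QE u) mE * (pcoeff (Q2 u) mE2 * 1))"
    by (rule edge_retract'[OF rBC[OF u] mBCA[OF u] F'(15,16)])
  finally have E: "eqm ?H (scoeff (G (u \<union> {B})) (a C) (b C) * scoeff (G (u \<union> {B, C})) (a A) (b A))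
      (pcoeff (Q2 u) mE2 * pcoeff (QE u) mE)"
    by (simp add: mult.commute)
  have "eqm ?H (scoeff (G (u \<union> {B})) (a A) (b A) * scoeff (G (u \<union> {A, B})) (a C) (b C))
      (scoeff (G (u \<union> {B})) (a C) (b C) * scoeff (G (u \<union> {B, C})) (a A) (b A))"
    by (rule scoeff_square[OF saddles(5)[OF u] saddles(11)[OF u] saddles(8)[OF u] saddles(10)[OF u]])
  then have "eqm ?H (pcoeff (Q2 u) mD2 * pcoeff (QD u) mD) (pcoeff (Q2 u) mE2 * pcoeff (QE u) mE)"
    using D E by (meson eqm_sym eqm_trans)
  from retract_eqm[OF rABC[OF u] this] show ?thesis
    using retractD(2)[OF rABC[OF u]] F' by (simp add: rename_scoeff)
qed

text \<open>The part of \<open>{A, C}\<close> with the circle labeled v_- is \<open>w\<close>, and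
  its differential is the sum of the values at \<open>{A}\<close> and \<open>{C}\<close>. Adding the
  image of \<open>w\<close> to the value at \<open>{B, C}\<close> therefore replaces the
  contribution of \<open>{C}\<close> by that of \<open>{A}\<close>.\<close>

theorem to_core:
  assumes "vanishes (T \<union> {A, B, C}) G a b u\<^sub>0 \<psi>" "u\<^sub>0 \<subseteq> T" "rename (\<phi> {}) \<psi> = \<psi>"
  shows "r3_core T a b QI Q1 Q2 QD QE m1 m2 mD1 mE1 mD2 mE2 u\<^sub>0 \<psi>"
proof -
  have fin: "Finite_Set.finite {A, B, C}" by simp
  obtain g where "\<forall>u\<subseteq>T. \<forall>x\<subseteq>{A, B, C}. eqm (G (u \<union> x))
    (edge_sum (\<lambda>v. G (v \<union> x)) a b (\<lambda>v. g v x) u + edge_sum (\<lambda>y. G (u \<union> y)) a b (g u) x)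
    (if u \<union> x = u\<^sub>0 then \<psi> else 0)"
    using assms(1) unfolding vanishes_split[OF finite fin disj] ..
  note g = this[rule_format]
  define h where "h x v = rename (\<phi> x) (g v x)" for x v
  define w where "w v = coeff1 c (rename (\<phi> {A, C}) (g v {A, C}))" for v
  define hE where "hE v = h {B, C} v + pcoeff (Q1 v) mE1 * w v" for v
  have ne: "u \<union> x \<noteq> u\<^sub>0" if "x \<subseteq> {A, B, C}" "x \<noteq> {}" "u \<subseteq> T" for u x
    using that assms(2) disj by blast
  have edge: "eqm (Q u) (edge_sum Q a b (h x) u)
      (rename (\<phi> x) (edge_sum (\<lambda>y. G (u \<union> y)) a b (g u) x) + rename (\<phi> x) (if u \<union> x = u\<^sub>0 then \<psi> else 0))"
    if u: "u \<subseteq> T" and x: "x \<subseteq> {A, B, C}" and r: "\<And>v. v \<subseteq> T \<Longrightarrow> retract F (\<phi> x) (G (v \<union> x)) (Q v)" for Q x u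
  proof -
    have "rename (\<phi> x) (edge_sum (\<lambda>v. G (v \<union> x)) a b (\<lambda>v. g v x) u) = edge_sum Q a b (h x) u"
      unfolding h_def by (rule rename_edge_sum[OF r marks u])
    then show ?thesis
      using retract_eqm[OF r[OF u] g[OF u x]] by (intro eqm_move) simp
  qed
  have "eqm (QI u) (edge_sum QI a b (h {}) u) (if u = u\<^sub>0 then \<psi> else 0) \<and>
    eqm (Q1 u) (edge_sum Q1 a b (h {A}) u) (pcoeff (QI u) m1 * h {} u) \<and>
    eqm (Q2 u) (edge_sum Q2 a b (h {B}) u) (pcoeff (QI u) m2 * h {} u) \<and>
    eqm (QD u) (edge_sum QD a b (h {A, B}) u) (pcoeff (Q1 u) mD1 * h {A} u + pcoeff (Q2 u) mD2 * h {B} u) \<and>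
    eqm (QE u) (edge_sum QE a b hE u) (pcoeff (Q1 u) mE1 * h {A} u + pcoeff (Q2 u) mE2 * h {B} u)"
    if u: "u \<subseteq> T" for u
  proof (intro conjI)
    show "eqm (QI u) (edge_sum QI a b (h {}) u) (if u = u\<^sub>0 then \<psi> else 0)"
      using edge[OF u, of "{}" QI] r0 assms(3) by (simp add: edge_sum_small split: if_splits)
    have "eqm (Q1 u) (edge_sum Q1 a b (h {A}) u) (rename (\<phi> {A}) (scoeff (G u) (a A) (b A) * g u {}))"
      using edge[OF u, of "{A}" Q1] rA ne[of "{A}" u] u by (simp add: edge_sum_small)
    also have "eqm (Q1 u) \<dots> (pcoeff (QI u) m1 * h {} u)"
      unfolding h_def by (rule edge_retract[OF r0[OF u] rA[OF u] _ saddles(1)[OF u] m0A[OF u] F'(1,2)]) simp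
    finally show "eqm (Q1 u) (edge_sum Q1 a b (h {A}) u) (pcoeff (QI u) m1 * h {} u)" .
    have "eqm (Q2 u) (edge_sum Q2 a b (h {B}) u) (rename (\<phi> {B}) (scoeff (G u) (a B) (b B) * g u {}))"
      using edge[OF u, of "{B}" Q2] rB ne[of "{B}" u] u by (simp add: edge_sum_small)
    also have "eqm (Q2 u) \<dots> (pcoeff (QI u) m2 * h {} u)"
      unfolding h_def by (rule edge_retract[OF r0[OF u] rB[OF u] _ saddles(2)[OF u] m0B[OF u] F'(3,4)]) simp
    finally show "eqm (Q2 u) (edge_sum Q2 a b (h {B}) u) (pcoeff (QI u) m2 * h {} u)" .
    have "eqm (QD u) (edge_sum QD a b (h {A, B}) u)
        (rename (\<phi> {A, B}) (scoeff (G (u \<union> {B})) (a A) (b A) * g u {B}) +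
         rename (\<phi> {A, B}) (scoeff (G (u \<union> {A})) (a B) (b B) * g u {A}))"
      using edge[OF u, of "{A, B}" QD] rAB ne[of "{A, B}" u] u ABC by (simp add: edge_sum_small)
    also have "eqm (QD u) \<dots> (pcoeff (Q2 u) mD2 * h {B} u + pcoeff (Q1 u) mD1 * h {A} u)"
      unfolding h_def
      by (intro eqm_add edge_retract[OF rB[OF u] rAB[OF u] _ saddles(5)[OF u] mBA[OF u] F'(9,10)]
          edge_retract[OF rA[OF u] rAB[OF u] _ saddles(4)[OF u] mAB[OF u] F'(5,6)]) auto
    finally show "eqm (QD u) (edge_sum QD a b (h {A, B}) u)
        (pcoeff (Q1 u) mD1 * h {A} u + pcoeff (Q2 u) mD2 * h {B} u)"
      by (simp add: add.commute)
    have "eqm (QE u) (edge_sum QE a b (h {B, C}) u)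
        (rename (\<phi> {B, C}) (scoeff (G (u \<union> {C})) (a B) (b B) * g u {C}) +
         rename (\<phi> {B, C}) (scoeff (G (u \<union> {B})) (a C) (b C) * g u {B}))"
      using edge[OF u, of "{B, C}" QE] rBC ne[of "{B, C}" u] u ABC by (simp add: edge_sum_small)
    also have "eqm (QE u) \<dots> (pcoeff (Q1 u) mE1 * h {C} u + pcoeff (Q2 u) mE2 * h {B} u)"
      unfolding h_def
      by (intro eqm_add edge_retract[OF rC[OF u] rBC[OF u] _ saddles(9)[OF u] mCB[OF u] F'(7,8)]
          edge_retract[OF rB[OF u] rBC[OF u] _ saddles(8)[OF u] mBC[OF u] F'(11,12)]) auto
    finally have E: "eqm (QE u) (edge_sum QE a b (h {B, C}) u)
        (pcoeff (Q1 u) mE1 * h {C} u + pcoeff (Q2 u) mE2 * h {B} u)" .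
    have "eqm (Q1 u) (rename (\<phi> {A, C}) (edge_sum (\<lambda>v. G (v \<union> {A, C})) a b (\<lambda>v. g v {A, C}) u +
        (scoeff (G (u \<union> {C})) (a A) (b A) * g u {C} + scoeff (G (u \<union> {A})) (a C) (b C) * g u {A})))
        (rename (\<phi> {A, C}) 0)"
      using g[OF u, of "{A, C}"] ne[of "{A, C}" u] u ABC
      by (intro retract_eqm[OF rAC[OF u]]) (simp add: edge_sum_small)
    then have "eqm (Q1 u) (coeff1 c (rename (\<phi> {A, C}) (edge_sum (\<lambda>v. G (v \<union> {A, C})) a b (\<lambda>v. g v {A, C}) u +
        (scoeff (G (u \<union> {C})) (a A) (b A) * g u {C} + scoeff (G (u \<union> {A})) (a C) (b C) * g u {A}))))
        (coeff1 c (rename (\<phi> {A, C}) 0))"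
      by (rule coeff1_eqm) (rule no_circle[OF u])
    moreover have "rename (\<phi> {A, C}) (edge_sum (\<lambda>v. G (v \<union> {A, C})) a b (\<lambda>v. g v {A, C}) u)
        = edge_sum Q1 a b (\<lambda>v. rename (\<phi> {A, C}) (g v {A, C})) u"
      using marks by (intro rename_edge_sum[OF rAC _ u]) auto
    moreover have "coeff1 c (edge_sum Q1 a b (\<lambda>v. rename (\<phi> {A, C}) (g v {A, C})) u) = edge_sum Q1 a b w u"
      unfolding w_def using marks u F(1) by (intro coeff1_edge_sum) auto
    ultimately have "eqm (Q1 u) (edge_sum Q1 a b w u +
        (coeff1 c (rename (\<phi> {A, C}) (scoeff (G (u \<union> {C})) (a A) (b A) * g u {C})) +
         coeff1 c (rename (\<phi> {A, C}) (scoeff (G (u \<union> {A})) (a C) (b C) * g u {A})))) 0"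
      by simp
    then have "eqm (Q1 u) (edge_sum Q1 a b w u)
        (coeff1 c (rename (\<phi> {A, C}) (scoeff (G (u \<union> {C})) (a A) (b A) * g u {C})) +
         coeff1 c (rename (\<phi> {A, C}) (scoeff (G (u \<union> {A})) (a C) (b C) * g u {A})) + 0)"
      by (rule eqm_move)
    also have "eqm (Q1 u) \<dots> (h {C} u + h {A} u + 0)"
    proof (intro eqm_add eqm_refl)
      show "eqm (Q1 u) (coeff1 c (rename (\<phi> {A, C}) (scoeff (G (u \<union> {A})) (a C) (b C) * g u {A}))) (h {A} u)"
        unfolding h_def using circle(1)[OF u] F(2)
        by (intro split_edge[OF u saddles(6)[OF u] rA[OF u] splitA[OF u]]) auto
      have "saddle (G (u \<union> {C})) (G (u \<union> {A, C})) (b A) (a A)"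
        using saddles(7)[OF u] unfolding saddle_def merges_def by (auto simp: equiv_cl_sym_iff[of "b A" "a A"])
      then show "eqm (Q1 u) (coeff1 c (rename (\<phi> {A, C}) (scoeff (G (u \<union> {C})) (a A) (b A) * g u {C}))) (h {C} u)"
        unfolding h_def scoeff_commute[of _ "a A"] using circle(2)[OF u] F(3) splitC[OF u]
        by (intro split_edge[OF u _ rC[OF u]]) (auto intro: equiv_cl_sym)
    qed
    finally have W: "eqm (Q1 u) (edge_sum Q1 a b w u) (h {C} u + h {A} u)" by simp
    have "eqm (QE u) (edge_sum QE a b (\<lambda>v. pcoeff (Q1 v) mE1 * w v) u) (pcoeff (Q1 u) mE1 * edge_sum Q1 a b w u)"
      by (rule edge_sum_commute[OF cube_Q(1,3) saddle_Q(1) u])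
    also have "eqm (QE u) \<dots> (pcoeff (Q1 u) mE1 * (h {C} u + h {A} u))"
      by (rule scoeff_eqm[OF saddle_Q(1)[OF u] W])
    finally have "eqm (QE u) (edge_sum QE a b hE u)
        (pcoeff (Q1 u) mE1 * h {C} u + pcoeff (Q2 u) mE2 * h {B} u + pcoeff (Q1 u) mE1 * (h {C} u + h {A} u))"
      unfolding hE_def edge_sum_add using E by (intro eqm_add)
    then show "eqm (QE u) (edge_sum QE a b hE u) (pcoeff (Q1 u) mE1 * h {A} u + pcoeff (Q2 u) mE2 * h {B} u)"
      by (simp add: distrib_left ac_simps)
  qed
  then show ?thesis
    unfolding r3_core_def by (intro exI[of _ "h {}"] exI[of _ "h {A}"] exI[of _ "h {B}"] exI[of _ "h {A, B}"]
        exI[of _ hE] allI impI)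
qed

text \<open>The values at \<open>{A}\<close> and \<open>{C}\<close> are taken to be equal, and the
  value \<open>w\<close> at \<open>{A, C}\<close> is forced by the last vertex, where the merge of
  the circle has coefficient 1. The equation at \<open>{A, C}\<close> then requires the round trips
  through \<open>QD\<close> and \<open>QE\<close> to add up to the sum of the two split
  coefficients; the assumptions \<open>tripD\<close>, \<open>tripE\<close> and \<open>trip\<close>
  provide this.\<close>

theorem from_core:
  assumes "r3_core T a b QI Q1 Q2 QD QE m1 m2 mD1 mE1 mD2 mE2 u\<^sub>0 \<psi>" "u\<^sub>0 \<subseteq> T"
  shows "vanishes (T \<union> {A, B, C}) G a b u\<^sub>0 \<psi>"
proof -
  have fin: "Finite_Set.finite {A, B, C}" by simp
  obtain hI h1 h2 hD hE where "\<forall>u\<subseteq>T.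
    eqm (QI u) (edge_sum QI a b hI u) (if u = u\<^sub>0 then \<psi> else 0) \<and>
    eqm (Q1 u) (edge_sum Q1 a b h1 u) (pcoeff (QI u) m1 * hI u) \<and>
    eqm (Q2 u) (edge_sum Q2 a b h2 u) (pcoeff (QI u) m2 * hI u) \<and>
    eqm (QD u) (edge_sum QD a b hD u) (pcoeff (Q1 u) mD1 * h1 u + pcoeff (Q2 u) mD2 * h2 u) \<and>
    eqm (QE u) (edge_sum QE a b hE u) (pcoeff (Q1 u) mE1 * h1 u + pcoeff (Q2 u) mE2 * h2 u)"
    using assms(1) unfolding r3_core_def by (elim exE)
  then have hI: "\<And>u. u \<subseteq> T \<Longrightarrow> eqm (QI u) (edge_sum QI a b hI u) (if u = u\<^sub>0 then \<psi> else 0)"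
    and h1: "\<And>u. u \<subseteq> T \<Longrightarrow> eqm (Q1 u) (edge_sum Q1 a b h1 u) (pcoeff (QI u) m1 * hI u)"
    and h2: "\<And>u. u \<subseteq> T \<Longrightarrow> eqm (Q2 u) (edge_sum Q2 a b h2 u) (pcoeff (QI u) m2 * hI u)"
    and hD: "\<And>u. u \<subseteq> T \<Longrightarrow>
      eqm (QD u) (edge_sum QD a b hD u) (pcoeff (Q1 u) mD1 * h1 u + pcoeff (Q2 u) mD2 * h2 u)"
    and hE: "\<And>u. u \<subseteq> T \<Longrightarrow>
      eqm (QE u) (edge_sum QE a b hE u) (pcoeff (Q1 u) mE1 * h1 u + pcoeff (Q2 u) mE2 * h2 u)"
    by simp_all
  define w where "w v = pcoeff (QD v) mD * hD v + pcoeff (QE v) mE * hE v" for v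
  define g where "g v x = (if A \<in> x then if B \<in> x then if C \<in> x then 0 else hD v else if C \<in> x then w v else h1 v
    else if B \<in> x then if C \<in> x then hE v else h2 v else if C \<in> x then h1 v else hI v)" for v x
  have ne: "u \<union> x \<noteq> u\<^sub>0" if "x \<subseteq> {A, B, C}" "x \<noteq> {}" "u \<subseteq> T" for u x
    using that assms(2) disj by blast
  have gs: "g v {} = hI v" "g v {A} = h1 v" "g v {B} = h2 v" "g v {C} = h1 v" "g v {A, B} = hD v"
    "g v {B, C} = hE v" "g v {A, C} = w v" "g v {A, B, C} = 0" for v
    using ABC by (auto simp: g_def)
  have finish: "eqm H (x + y) 0" if "eqm H x z" "eqm H y z" for H :: "('p \<times> 'p) set" and x y z
    using eqm_add[OF that] by simp
  have *: "eqm (G (u \<union> x)) (edge_sum (\<lambda>v. G (v \<union> x)) a b (\<lambda>v. g v x) u + edge_sum (\<lambda>y. G (u \<union> y)) a b (g u) x)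
      (if u \<union> x = u\<^sub>0 then \<psi> else 0)" if u: "u \<subseteq> T" and x: "x \<subseteq> {A, B, C}" for u x
  proof -
    consider "x = {}" | "x = {A}" | "x = {B}" | "x = {C}" | "x = {A, B}" | "x = {A, C}" | "x = {B, C}"
      | "x = {A, B, C}"
      using subset_tripleD[OF x] by blast
    then show ?thesis
    proof cases
      case 1
      have "eqm (G u) (edge_sum QI a b hI u) (if u = u\<^sub>0 then \<psi> else 0)"
        by (rule retract_eqm'[OF r0[OF u] hI[OF u]])
      moreover have "edge_sum G a b hI u = edge_sum QI a b hI u"
        by (rule edge_sum_retract[OF r0 marks u])
      ultimately show ?thesis
        using 1 by (simp add: gs edge_sum_small)
    next
      case 2
      have "edge_sum (\<lambda>v. G (v \<union> {A})) a b h1 u = edge_sum Q1 a b h1 u"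
        by (rule edge_sum_retract[OF rA marks u])
      moreover have "eqm (G (u \<union> {A})) (edge_sum Q1 a b h1 u + scoeff (G u) (a A) (b A) * hI u) 0"
        by (rule finish[OF retract_eqm'[OF rA[OF u] h1[OF u]] edge_retract'[OF r0[OF u] m0A[OF u] F'(1,2)]])
      ultimately show ?thesis
        using 2 ne[OF x _ u] by (simp add: gs edge_sum_small)
    next
      case 3
      have "edge_sum (\<lambda>v. G (v \<union> {B})) a b h2 u = edge_sum Q2 a b h2 u"
        by (rule edge_sum_retract[OF rB marks u])
      moreover have "eqm (G (u \<union> {B})) (edge_sum Q2 a b h2 u + scoeff (G u) (a B) (b B) * hI u) 0"
        by (rule finish[OF retract_eqm'[OF rB[OF u] h2[OF u]] edge_retract'[OF r0[OF u] m0B[OF u] F'(3,4)]])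
      ultimately show ?thesis
        using 3 ne[OF x _ u] by (simp add: gs edge_sum_small)
    next
      case 4
      have "edge_sum (\<lambda>v. G (v \<union> {C})) a b h1 u = edge_sum Q1 a b h1 u"
        by (rule edge_sum_retract[OF rC marks u])
      moreover have "eqm (G (u \<union> {C})) (edge_sum Q1 a b h1 u + scoeff (G u) (a C) (b C) * hI u) 0"
        by (rule finish[OF retract_eqm'[OF rC[OF u] h1[OF u]] edge_retract'[OF r0[OF u] m0C[OF u] F'(1,2)]])
      ultimately show ?thesis
        using 4 ne[OF x _ u] by (simp add: gs edge_sum_small)
    next
      case 5
      have "edge_sum (\<lambda>v. G (v \<union> {A, B})) a b hD u = edge_sum QD a b hD u"
        by (rule edge_sum_retract[OF rAB marks u])
      moreover have "eqm (G (u \<union> {A, B})) (scoeff (G (u \<union> {B})) (a A) (b A) * h2 u +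
          scoeff (G (u \<union> {A})) (a B) (b B) * h1 u) (pcoeff (Q2 u) mD2 * h2 u + pcoeff (Q1 u) mD1 * h1 u)"
        by (intro eqm_add edge_retract'[OF rB[OF u] mBA[OF u] F'(9,10)] edge_retract'[OF rA[OF u] mAB[OF u] F'(5,6)])
      then have "eqm (G (u \<union> {A, B})) (edge_sum QD a b hD u + (scoeff (G (u \<union> {B})) (a A) (b A) * h2 u +
          scoeff (G (u \<union> {A})) (a B) (b B) * h1 u)) 0"
        by (intro finish[OF retract_eqm'[OF rAB[OF u] hD[OF u]]]) (simp add: add.commute)
      ultimately show ?thesis
        using 5 ne[OF x _ u] ABC by (simp add: gs edge_sum_small)
    next
      case 7
      have "edge_sum (\<lambda>v. G (v \<union> {B, C})) a b hE u = edge_sum QE a b hE u"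
        by (rule edge_sum_retract[OF rBC marks u])
      moreover have "eqm (G (u \<union> {B, C})) (scoeff (G (u \<union> {C})) (a B) (b B) * h1 u +
          scoeff (G (u \<union> {B})) (a C) (b C) * h2 u) (pcoeff (Q1 u) mE1 * h1 u + pcoeff (Q2 u) mE2 * h2 u)"
        by (intro eqm_add edge_retract'[OF rC[OF u] mCB[OF u] F'(7,8)] edge_retract'[OF rB[OF u] mBC[OF u] F'(11,12)])
      then have "eqm (G (u \<union> {B, C})) (edge_sum QE a b hE u + (scoeff (G (u \<union> {C})) (a B) (b B) * h1 u +
          scoeff (G (u \<union> {B})) (a C) (b C) * h2 u)) 0"
        by (rule finish[OF retract_eqm'[OF rBC[OF u] hE[OF u]]])
      ultimately show ?thesis
        using 7 ne[OF x _ u] ABC by (simp add: gs edge_sum_small)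
    next
      case 6
      have "edge_sum (\<lambda>v. G (v \<union> {A, C})) a b w u = edge_sum Q1 a b w u"
        using marks by (intro edge_sum_retract[OF rAC _ u]) auto
      have "eqm (Q1 u) (edge_sum Q1 a b w u) (pcoeff (QD u) mD * edge_sum QD a b hD u
          + pcoeff (QE u) mE * edge_sum QE a b hE u)"
        unfolding w_def edge_sum_add
        by (intro eqm_add edge_sum_commute[OF cube_Q(2,1) saddle_Q(5) u] edge_sum_commute[OF cube_Q(3,1) saddle_Q(6) u])
      also have "eqm (Q1 u) \<dots> (pcoeff (QD u) mD * (pcoeff (Q1 u) mD1 * h1 u + pcoeff (Q2 u) mD2 * h2 u)
          + pcoeff (QE u) mE * (pcoeff (Q1 u) mE1 * h1 u + pcoeff (Q2 u) mE2 * h2 u))"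
        by (intro eqm_add scoeff_eqm[OF saddle_Q(5)[OF u] hD[OF u]] scoeff_eqm[OF saddle_Q(6)[OF u] hE[OF u]])
      also have "\<dots> = (pcoeff (Q1 u) mD1 * pcoeff (QD u) mD + pcoeff (Q1 u) mE1 * pcoeff (QE u) mE) * h1 u
          + (pcoeff (Q2 u) mD2 * pcoeff (QD u) mD + pcoeff (Q2 u) mE2 * pcoeff (QE u) mE) * h2 u"
        by (simp add: distrib_left distrib_right mult_ac ac_simps)
      also have "eqm (Q1 u) \<dots> ((var q + var q') * h1 u + 0 * h2 u)"
      proof (rule eqm_add[OF eqm_mult[OF _ eqm_refl] eqm_mult[OF _ eqm_refl]])
        show "eqm (Q1 u) (pcoeff (Q1 u) mD1 * pcoeff (QD u) mD + pcoeff (Q1 u) mE1 * pcoeff (QE u) mE)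
            (var q + var q')"
          using eqm_add[OF tripD[OF u] tripE[OF u]] trip[OF u] by (rule eqm_trans)
        have "eqm (Q1 u) (pcoeff (Q2 u) mD2 * pcoeff (QD u) mD) (pcoeff (Q2 u) mE2 * pcoeff (QE u) mE)"
          by (rule square_Q[OF u])
        then show "eqm (Q1 u) (pcoeff (Q2 u) mD2 * pcoeff (QD u) mD + pcoeff (Q2 u) mE2 * pcoeff (QE u) mE) 0"
          by (rule finish) simp
      qed
      finally have "eqm (G (u \<union> {A, C})) (edge_sum Q1 a b w u) ((var q + var q') * h1 u)"
        by (intro retract_eqm'[OF rAC[OF u]]) simp
      moreover have "eqm (G (u \<union> {A, C})) (scoeff (G (u \<union> {C})) (a A) (b A) * h1 u
          + scoeff (G (u \<union> {A})) (a C) (b C) * h1 u) ((var q' + var c) * h1 u + (var c + var q) * h1 u)"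
        using circle[OF u] unfolding scoeff_def if_P[OF splitA[OF u]] if_P[OF splitC[OF u]]
        by (intro eqm_add eqm_mult eqm_var) auto
      moreover have "(var q' + var c) * h1 u + (var c + var q) * h1 u = (var q + var q') * h1 u"
        by (simp add: distrib_right add_ac)
      ultimately have "eqm (G (u \<union> {A, C})) (edge_sum Q1 a b w u + (scoeff (G (u \<union> {C})) (a A) (b A) * h1 u
          + scoeff (G (u \<union> {A})) (a C) (b C) * h1 u)) 0"
        by (intro finish) auto
      then show ?thesis
        using 6 ne[OF x _ u] ABC \<open>edge_sum (\<lambda>v. G (v \<union> {A, C})) a b w u = edge_sum Q1 a b w u\<close>
        by (simp add: gs edge_sum_small)
    next
      case 8
      have "eqm (G (u \<union> {A, B, C})) (scoeff (G (u \<union> {B, C})) (a A) (b A) * hE u) (pcoeff (QE u) mE * hE u)"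
        "eqm (G (u \<union> {A, B, C})) (scoeff (G (u \<union> {A, B})) (a C) (b C) * hD u) (pcoeff (QD u) mD * hD u)"
        by (rule edge_retract'[OF rBC[OF u] mBCA[OF u] F'(15,16)] edge_retract'[OF rAB[OF u] mABC[OF u] F'(13,14)])+
      from eqm_add[OF eqm_add[OF this(1) eqm_refl[of _ "w u"]] this(2)]
      have "eqm (G (u \<union> {A, B, C})) (scoeff (G (u \<union> {B, C})) (a A) (b A) * hE u + w u
          + scoeff (G (u \<union> {A, B})) (a C) (b C) * hD u) 0"
        unfolding w_def by (simp add: ac_simps)
      moreover have "scoeff (G (u \<union> {A, C})) (a B) (b B) = 1"
        using merge[OF u] by (simp add: scoeff_def)
      ultimately show ?thesis
        using 8 ne[OF x _ u] ABC by (simp add: gs edge_sum_small)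
    qed
  qed
  show ?thesis
    unfolding vanishes_split[OF finite fin disj] by (intro exI[of _ g] allI impI *)
qed

end

section \<open>Resolutions as permutations\<close>

lemma merges_commute: "merges G H a b \<Longrightarrow> merges G H b a"
  unfolding merges_def by (auto simp: equiv_cl_sym_iff[of b a])

lemma equiv_cl_subset: "G \<subseteq> equiv_cl H \<Longrightarrow> equiv_cl G \<subseteq> equiv_cl H"
  by (auto intro: equiv_cl_mono)

lemma funpow_equiv_cl: "(x, (f ^^ j) x) \<in> equiv_cl (range (\<lambda>x. (x, f x)))"
proof (induction j)
  case (Suc j)
  have "((f ^^ j) x, f ((f ^^ j) x)) \<in> equiv_cl (range (\<lambda>x. (x, f x)))"
    by (rule equiv_cl_base) blast
  with Suc show ?case by (auto intro: equiv_cl_trans)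
qed simp

text \<open>Every point has a positive period, so forward steps alone already reach the whole
  cycle.\<close>

lemma equiv_cl_permutation:
  assumes "permutation f"
  shows "(x, y) \<in> equiv_cl (range (\<lambda>x. (x, f x))) \<longleftrightarrow> (\<exists>j. (f ^^ j) x = y)"
proof
  assume "(x, y) \<in> equiv_cl (range (\<lambda>x. (x, f x)))"
  then show "\<exists>j. (f ^^ j) x = y"
  proof (rule equiv_cl_least)
    fix u v assume "(u, v) \<in> range (\<lambda>x. (x, f x))"
    then show "\<exists>j. (f ^^ j) u = v" by (intro exI[of _ 1]) auto
  next
    fix u show "\<exists>j. (f ^^ j) u = u" by (rule exI[of _ 0]) simp
  next
    fix u v assume "\<exists>j. (f ^^ j) u = v"
    then obtain j where j: "(f ^^ j) u = v" ..
    have "u \<in> orbit f u"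
      by (rule permutation_self_in_orbit[OF assms])
    then obtain m where m: "0 < m" "(f ^^ m) u = u"
      unfolding orbit_altdef by auto
    have *: "(f ^^ (m * k)) u = u" for k
      by (induction k) (simp_all add: funpow_add m(2))
    have "m * j = (m * j - j) + j"
      using m(1) by simp
    then have "(f ^^ (m * j - j)) v = u"
      using *[of j] j by (metis comp_apply funpow_add)
    then show "\<exists>j. (f ^^ j) v = u" by blast
  next
    fix u v w assume "\<exists>j. (f ^^ j) u = v" "\<exists>j. (f ^^ j) v = w"
    then obtain j k where "(f ^^ j) u = v" "(f ^^ k) v = w" by blast
    then have "(f ^^ (k + j)) u = w" by (simp add: funpow_add)
    then show "\<exists>j. (f ^^ j) u = w" by blast
  qed
qed (use funpow_equiv_cl in auto)

text \<open>Starting at \<open>a\<close>, the new permutation enters the cycle of \<open>b\<close>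
  and runs through all of it, in \<open>m\<close> steps, before it continues on the old cycle of
  \<open>a\<close>. So the two cycles become one.\<close>

lemma merges_transpose:
  assumes f: "permutation f" and g: "g = f \<circ> transpose a b"
    and ab: "(a, b) \<notin> equiv_cl (range (\<lambda>x. (x, f x)))"
  shows "merges (range (\<lambda>x. (x, f x))) (range (\<lambda>x. (x, g x))) a b"
proof -
  let ?E = "equiv_cl (range (\<lambda>x. (x, f x)))" and ?E' = "equiv_cl (range (\<lambda>x. (x, g x)))"
  have "a \<noteq> b" using ab by auto
  have gab: "g a = f b" "g b = f a" "\<And>x. x \<noteq> a \<Longrightarrow> x \<noteq> b \<Longrightarrow> g x = f x"
    by (auto simp: g)
  have base: "(x, g x) \<in> ?E'" "(x, f x) \<in> ?E" for x
    by (auto intro: equiv_cl_base)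
  have "b \<in> orbit f b"
    by (rule permutation_self_in_orbit[OF f])
  then have ex: "\<exists>m>0. (f ^^ m) b = b"
    unfolding orbit_altdef by auto
  define m where "m = (LEAST m. 0 < m \<and> (f ^^ m) b = b)"
  have m: "0 < m" "(f ^^ m) b = b" and least: "\<And>j. 0 < j \<Longrightarrow> j < m \<Longrightarrow> (f ^^ j) b \<noteq> b"
    using LeastI_ex[OF ex] not_less_Least[of _ "\<lambda>m. 0 < m \<and> (f ^^ m) b = b"] unfolding m_def by auto
  have reach: "(a, (f ^^ Suc j) b) \<in> ?E'" if "Suc j \<le> m" for j
    using that
  proof (induction j)
    case 0
    show ?case using base(1)[of a] gab(1) by simp
  next
    case (Suc j)
    have "(f ^^ Suc j) b \<noteq> a"
      using ab funpow_equiv_cl[where x = b and f = f and j = "Suc j"] equiv_cl_sym by metis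
    moreover have "(f ^^ Suc j) b \<noteq> b"
      using Suc.prems by (intro least) auto
    ultimately have "g ((f ^^ Suc j) b) = (f ^^ Suc (Suc j)) b"
      using gab(3) by simp
    then show ?case
      using Suc base(1)[of "(f ^^ Suc j) b"] by (metis Suc_leD equiv_cl_trans)
  qed
  have ab': "(a, b) \<in> ?E'"
    using reach[of "m - 1"] m by simp
  have step: "(x, f x) \<in> ?E'" for x
  proof -
    consider "x = a" | "x = b" | "x \<noteq> a" "x \<noteq> b" by blast
    then show ?thesis
    proof cases
      case 1
      have "(b, f a) \<in> ?E'" using base(1)[of b] gab(2) by simp
      then show ?thesis using ab' 1 by (auto intro: equiv_cl_trans)
    next
      case 2
      have "(a, f b) \<in> ?E'" using base(1)[of a] gab(1) by simp
      then show ?thesis using ab' 2 by (auto intro: equiv_cl_trans equiv_cl_sym)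
    next
      case 3
      then show ?thesis using base(1)[of x] gab(3) by simp
    qed
  qed
  have sub: "(x, y) \<in> ?E'" if "(x, y) \<in> ?E" for x y
    using that by (rule equiv_cl_mono) (use step in auto)
  define R where "R p q \<longleftrightarrow> (p, q) \<in> ?E \<or> (p, a) \<in> ?E \<and> (b, q) \<in> ?E \<or> (p, b) \<in> ?E \<and> (a, q) \<in> ?E" for p q
  have "R p q" if "(p, q) \<in> ?E'" for p q
    using that
  proof (rule equiv_cl_least)
    fix x y assume "(x, y) \<in> range (\<lambda>x. (x, g x))"
    then have y: "y = g x" by auto
    consider "x = a" | "x = b" | "x \<noteq> a" "x \<noteq> b" by blast
    then show "R x y"
      using y base(2)[of a] base(2)[of b] base(2)[of x] gab by cases (auto simp: R_def)
  next
    show "R x x" for x by (simp add: R_def)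
    show "R x y \<Longrightarrow> R y x" for x y
      unfolding R_def by (blast intro: equiv_cl_sym)
    show "R x y \<Longrightarrow> R y z \<Longrightarrow> R x z" for x y z
      unfolding R_def by (blast intro: equiv_cl_sym equiv_cl_trans)
  qed
  moreover have "(p, q) \<in> ?E'" if "R p q" for p q
    using that unfolding R_def
  proof (elim disjE conjE)
    assume "(p, a) \<in> ?E" "(b, q) \<in> ?E"
    then show ?thesis
      using equiv_cl_trans[OF equiv_cl_trans[OF sub[of p a] ab'] sub[of b q]] by blast
  next
    assume "(p, b) \<in> ?E" "(a, q) \<in> ?E"
    then show ?thesis
      using equiv_cl_trans[OF equiv_cl_trans[OF sub[of p b] equiv_cl_sym[OF ab']] sub[of a q]] by blast
  qed (rule sub)
  ultimately show ?thesis
    unfolding merges_def using ab by (auto simp: R_def)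
qed

text \<open>This takes the place of a planarity argument: a transposition joins two cycles or cuts
  one, so a change of resolution never preserves the circles.\<close>

lemma saddle_transpose:
  assumes f: "permutation f" and g: "g = f \<circ> transpose a b" and ab: "a \<noteq> b"
  shows "saddle (range (\<lambda>x. (x, f x))) (range (\<lambda>x. (x, g x))) a b"
proof (cases "(a, b) \<in> equiv_cl (range (\<lambda>x. (x, f x)))")
  case False
  then show ?thesis
    unfolding saddle_def using merges_transpose[OF f g] by blast
next
  case True
  have pg: "permutation g"
    unfolding g by (intro permutation_compose f permutation_swap_id)
  have gab: "g a = f b" "\<And>x. x \<noteq> a \<Longrightarrow> x \<noteq> b \<Longrightarrow> g x = f x"
    by (auto simp: g)
  have "(b, a) \<in> equiv_cl (range (\<lambda>x. (x, f x)))"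
    using True by (rule equiv_cl_sym)
  then have ex: "\<exists>k. (f ^^ k) b = a"
    unfolding equiv_cl_permutation[OF f] .
  define k where "k = (LEAST k. (f ^^ k) b = a)"
  have k: "(f ^^ k) b = a" and least: "\<And>j. j < k \<Longrightarrow> (f ^^ j) b \<noteq> a"
    using LeastI_ex[OF ex] not_less_Least[of _ "\<lambda>k. (f ^^ k) b = a"] unfolding k_def by auto
  have k0: "0 < k" using k ab by (cases k) auto
  have nb: "(f ^^ j) b \<noteq> b" if "0 < j" "j \<le> k" for j
  proof
    assume j: "(f ^^ j) b = b"
    have "k = (k - j) + j" using that by simp
    then have "(f ^^ (k - j)) b = a"
      using j k by (metis comp_apply funpow_add)
    then show False using least[of "k - j"] that by simp
  qed
  \<comment> \<open>\<open>k\<close> is the first time at which the cycle leads from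
    \<open>b\<close> to \<open>a\<close>. The orbit of \<open>a\<close> under \<open>g\<close> is
    confined to this segment, which does not contain \<open>b\<close>.\<close>
  have stay: "\<exists>i. 0 < i \<and> i \<le> k \<and> (g ^^ j) a = (f ^^ i) b" for j
  proof (induction j)
    case 0
    show ?case using k k0 by auto
  next
    case (Suc j)
    then obtain i where i: "0 < i" "i \<le> k" "(g ^^ j) a = (f ^^ i) b" by blast
    show ?case
    proof (cases "i = k")
      case True
      then have "(g ^^ Suc j) a = (f ^^ 1) b" using i k gab by simp
      then show ?thesis using k0 by (intro exI[of _ 1]) auto
    next
      case False
      then have "(g ^^ Suc j) a = (f ^^ Suc i) b"
        using i nb least[of i] gab(2) by simp
      then show ?thesis using i False by (intro exI[of _ "Suc i"]) auto
    qed
  qed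
  have "(a, b) \<notin> equiv_cl (range (\<lambda>x. (x, g x)))"
    unfolding equiv_cl_permutation[OF pg] using stay nb by metis
  moreover have "f = g \<circ> transpose a b"
    by (simp add: g comp_assoc)
  ultimately show ?thesis
    unfolding saddle_def using merges_transpose[OF pg] by blast
qed

text \<open>All arcs of all resolutions are coherently oriented if the strands in odd positions run
  upwards and those in even positions run downwards.\<close>

definition turns :: "braid_word \<Rightarrow> nat set \<Rightarrow> nat \<Rightarrow> nat \<Rightarrow> bool" where
  "turns w s t p \<longleftrightarrow> \<not> oriented_at w s t \<and> p \<in> {fst (w ! t), Suc (fst (w ! t))}"

definition partner :: "braid_word \<Rightarrow> nat \<Rightarrow> nat \<Rightarrow> nat" where
  "partner w t p = (if p = fst (w ! t) then Suc p else fst (w ! t))"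

definition up_step :: "braid_word \<Rightarrow> nat set \<Rightarrow> point \<Rightarrow> point" where
  "up_step w s = (\<lambda>(l, p). if l = length w then (0, p) else if turns w s l p then (l, partner w l p) else (Suc l, p))"

definition down_step :: "braid_word \<Rightarrow> nat set \<Rightarrow> point \<Rightarrow> point" where
  "down_step w s = (\<lambda>(l, p). if l = 0 then (length w, p)
    else if turns w s (l - 1) p then (l, partner w (l - 1) p) else (l - 1, p))"

text \<open>Points outside the diagram stay fixed, so this is a permutation of the whole type with
  finite support.\<close>

definition succ_point :: "nat \<Rightarrow> braid_word \<Rightarrow> nat set \<Rightarrow> point \<Rightarrow> point" where
  "succ_point n w s x = (if x \<notin> points n w then x else if odd (snd x) then up_step w s x else down_step w s x)"

definition pred_point :: "nat \<Rightarrow> braid_word \<Rightarrow> nat set \<Rightarrow> point \<Rightarrow> point" where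
  "pred_point n w s x = (if x \<notin> points n w then x else if odd (snd x) then down_step w s x else up_step w s x)"

lemma braid_word_nth:
  assumes "w \<in> braid_words n" "t < length w"
  shows "1 \<le> fst (w ! t)" "fst (w ! t) < n"
  using assms nth_mem[OF assms(2)] unfolding braid_words_def in_lists_conv_set by fastforce+

lemma partner:
  assumes "turns w s t p"
  shows "partner w t (partner w t p) = p" "turns w s t (partner w t p)" "odd (partner w t p) \<longleftrightarrow> even p"
  using assms by (auto simp: turns_def partner_def)

lemma partner_range:
  assumes "w \<in> braid_words n" "t < length w" "turns w s t p"
  shows "partner w t p \<in> {1..n}"
  using assms(3) braid_word_nth[OF assms(1,2)] by (auto simp: turns_def partner_def)

lemma step_points:
  assumes "w \<in> braid_words n" "x \<in> points n w"
  shows "up_step w s x \<in> points n w" "down_step w s x \<in> points n w"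
  using assms(2) partner_range[OF assms(1)]
  by (auto simp: points_def up_step_def down_step_def split: prod.splits if_splits)

lemma up_down:
  assumes "l \<le> length w"
  shows "if turns w s l p \<and> l < length w then up_step w s (up_step w s (l, p)) = (l, p)
    else down_step w s (up_step w s (l, p)) = (l, p)"
    "if 0 < l \<and> turns w s (l - 1) p then down_step w s (down_step w s (l, p)) = (l, p)
    else up_step w s (down_step w s (l, p)) = (l, p)"
  using assms partner[of w s l p] partner[of w s "l - 1" p]
  by (auto simp: up_step_def down_step_def)

lemma step_parity:
  "odd (snd (up_step w s (l, p))) \<longleftrightarrow> (if turns w s l p \<and> l \<noteq> length w then even p else odd p)"
  "odd (snd (down_step w s (l, p))) \<longleftrightarrow> (if 0 < l \<and> turns w s (l - 1) p then even p else odd p)"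
  using partner(3)[of w s l p] partner(3)[of w s "l - 1" p]
  by (auto simp: up_step_def down_step_def)

lemma succ_pred:
  assumes "w \<in> braid_words n"
  shows "pred_point n w s (succ_point n w s x) = x" "succ_point n w s (pred_point n w s x) = x"
proof -
  obtain l p where x: "x = (l, p)" by (cases x)
  have "pred_point n w s (succ_point n w s x) = x \<and> succ_point n w s (pred_point n w s x) = x"
  proof (cases "x \<in> points n w")
    case True
    then have l: "l \<le> length w" by (auto simp: x points_def)
    have pt: "up_step w s (l, p) \<in> points n w" "down_step w s (l, p) \<in> points n w"
      using step_points[OF assms True] by (simp_all add: x)
    show ?thesis
      using up_down[OF l, of s p] step_parity[of w s l p] pt True l
      unfolding succ_point_def pred_point_def x by (auto split: if_splits)
  qed (simp add: succ_point_def pred_point_def)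
  then show "pred_point n w s (succ_point n w s x) = x" "succ_point n w s (pred_point n w s x) = x"
    by auto
qed

lemma permutation_succ_point:
  assumes "w \<in> braid_words n"
  shows "permutation (succ_point n w s)"
proof -
  have "bij (succ_point n w s)"
    by (rule o_bij[of "pred_point n w s"]) (auto simp: succ_pred[OF assms] fun_eq_iff)
  moreover have "{x. succ_point n w s x \<noteq> x} \<subseteq> points n w"
    by (auto simp: succ_point_def)
  then have "finite {x. succ_point n w s x \<noteq> x}"
    by (rule finite_subset) (simp add: points_def)
  ultimately show ?thesis
    by (simp add: permutation)
qed

lemma arcs_succ_point:
  assumes "w \<in> braid_words n"
  shows "equiv_cl (arcs n w s) = equiv_cl (range (\<lambda>x. (x, succ_point n w s x)))"
proof -
  let ?N = "range (\<lambda>x. (x, succ_point n w s x))"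
  have N: "(x, succ_point n w s x) \<in> equiv_cl ?N" for x
    by (auto intro: equiv_cl_base)
  have pts: "(l, p) \<in> points n w \<longleftrightarrow> l \<le> length w \<and> 1 \<le> p \<and> p \<le> n" for l p
    by (auto simp: points_def)
  have vert: "((t, p), (Suc t, p)) \<in> equiv_cl ?N" if "t < length w" "p \<in> {1..n}" "\<not> turns w s t p" for t p
    using N[of "(t, p)"] N[of "(Suc t, p)"] that
    by (cases "odd p") (auto simp: succ_point_def pts up_step_def down_step_def intro: equiv_cl_sym)
  have clos: "((length w, p), (0, p)) \<in> equiv_cl ?N" if "p \<in> {1..n}" for p
    using N[of "(length w, p)"] N[of "(0, p)"] that
    by (cases "odd p") (auto simp: succ_point_def pts up_step_def down_step_def intro: equiv_cl_sym)
  have turn: "((t, i), (t, i + 1)) \<in> equiv_cl ?N" "((Suc t, i), (Suc t, i + 1)) \<in> equiv_cl ?N"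
    if t: "t < length w" and i: "i = fst (w ! t)" and o: "\<not> oriented_at w s t" for t i
  proof -
    have "1 \<le> i" "i < n" using braid_word_nth[OF assms t] i by auto
    then show "((t, i), (t, i + 1)) \<in> equiv_cl ?N" "((Suc t, i), (Suc t, i + 1)) \<in> equiv_cl ?N"
      using N[of "(t, i)"] N[of "(t, Suc i)"] N[of "(Suc t, i)"] N[of "(Suc t, Suc i)"] t i o
      by (cases "odd i"; auto simp: succ_point_def pts up_step_def down_step_def turns_def partner_def
          intro: equiv_cl_sym)+
  qed
  have "arcs n w s \<subseteq> equiv_cl ?N"
    unfolding arcs_def closure_arcs_def level_arcs_def Let_def
    using clos vert turn by (auto simp: turns_def split: if_splits)
  then have 1: "equiv_cl (arcs n w s) \<subseteq> equiv_cl ?N"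
    by (rule equiv_cl_subset)
  have A: "(x, y) \<in> equiv_cl (arcs n w s)" if "(x, y) \<in> level_arcs n w s t" "t < length w" for x y t
    using that by (intro equiv_cl_base) (auto simp: arcs_def)
  have clos': "((length w, p), (0, p)) \<in> equiv_cl (arcs n w s)" if "p \<in> {1..n}" for p
    using that by (intro equiv_cl_base) (auto simp: arcs_def closure_arcs_def)
  have vert': "((t, p), (Suc t, p)) \<in> equiv_cl (arcs n w s)"
    if "t < length w" "p \<in> {1..n}" "\<not> turns w s t p" for t p
    using that by (intro A[of _ _ t]) (auto simp: level_arcs_def Let_def turns_def)
  have turn': "((t, p), (t, partner w t p)) \<in> equiv_cl (arcs n w s)"
    "((Suc t, p), (Suc t, partner w t p)) \<in> equiv_cl (arcs n w s)"
    if "t < length w" "turns w s t p" for t p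
  proof -
    have "((t, fst (w ! t)), (t, Suc (fst (w ! t)))) \<in> equiv_cl (arcs n w s)"
      "((Suc t, fst (w ! t)), (Suc t, Suc (fst (w ! t)))) \<in> equiv_cl (arcs n w s)"
      using that by (auto intro!: A[of _ _ t] simp: level_arcs_def Let_def turns_def)
    then show "((t, p), (t, partner w t p)) \<in> equiv_cl (arcs n w s)"
      "((Suc t, p), (Suc t, partner w t p)) \<in> equiv_cl (arcs n w s)"
      using that(2) by (auto simp: turns_def partner_def intro: equiv_cl_sym)
  qed
  have up: "((l, p), up_step w s (l, p)) \<in> equiv_cl (arcs n w s)" if "(l, p) \<in> points n w" for l p
    using that vert'[of l p] turn'(1)[of l p] clos'[of p] by (auto simp: up_step_def pts)
  have down: "((l, p), down_step w s (l, p)) \<in> equiv_cl (arcs n w s)" if "(l, p) \<in> points n w" for l p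
    using that vert'[of "l - 1" p] turn'(2)[of "l - 1" p] clos'[of p]
    by (cases l) (auto simp: down_step_def pts intro: equiv_cl_sym)
  have "(x, succ_point n w s x) \<in> equiv_cl (arcs n w s)" for x
    using up down by (cases x) (auto simp: succ_point_def)
  then have "?N \<subseteq> equiv_cl (arcs n w s)" by auto
  then have 2: "equiv_cl ?N \<subseteq> equiv_cl (arcs n w s)"
    by (rule equiv_cl_subset)
  show ?thesis using 1 2 by (rule subset_antisym)
qed

lemma saddle_equiv_cl_cong:
  "equiv_cl G = equiv_cl G' \<Longrightarrow> equiv_cl H = equiv_cl H' \<Longrightarrow> saddle G H a b \<longleftrightarrow> saddle G' H' a b"
  by (simp add: saddle_def merges_def)

lemma saddle_commute: "saddle G H a b \<Longrightarrow> saddle H G a b"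
  by (auto simp: saddle_def)

text \<open>For a crossing at an even position, the transposed points form the other diagonal. Each
  of its corners is joined to one corner of the marked diagonal in \<open>G\<close> and to the other
  one in \<open>H\<close>.\<close>

lemma saddle_other_diagonal:
  assumes "saddle G H a2 b1"
    "(a1, b1) \<in> equiv_cl G" "(a2, b2) \<in> equiv_cl G" "(a1, a2) \<in> equiv_cl H" "(b1, b2) \<in> equiv_cl H"
  shows "saddle G H a1 b2"
  using assms(1) unfolding saddle_def
proof
  assume "merges G H a2 b1"
  from merges_mark_cong[OF this assms(3) equiv_cl_sym[OF assms(2)]]
  show "merges G H a1 b2 \<or> merges H G a1 b2"
    by (blast intro: merges_commute)
next
  assume "merges H G a2 b1"
  from merges_mark_cong[OF this equiv_cl_sym[OF assms(4)] assms(5)]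
  show "merges G H a1 b2 \<or> merges H G a1 b2" ..
qed

lemma saddle_orientation:
  assumes w: "w \<in> braid_words n" and t: "t < length w"
    and o: "oriented_at w s t" "\<not> oriented_at w s' t"
    and same: "\<And>t'. t' \<noteq> t \<Longrightarrow> oriented_at w s t' \<longleftrightarrow> oriented_at w s' t'"
  shows "saddle (arcs n w s) (arcs n w s') (t, fst (w ! t)) (Suc t, Suc (fst (w ! t)))"
proof -
  define i where "i = fst (w ! t)"
  have i: "1 \<le> i" "i < n"
    using braid_word_nth[OF w t] by (auto simp: i_def)
  have tn: "turns w s' t' p \<longleftrightarrow> turns w s t' p" if "t' \<noteq> t" for t' p
    using same[OF that] by (simp add: turns_def)
  have tt: "\<not> turns w s t p" "turns w s' t p \<longleftrightarrow> p = i \<or> p = Suc i" for p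
    using o by (auto simp: turns_def i_def)
  have pp: "partner w t i = Suc i" "partner w t (Suc i) = i"
    by (simp_all add: partner_def i_def)
  have pts: "(l, p) \<in> points n w \<longleftrightarrow> l \<le> length w \<and> 1 \<le> p \<and> p \<le> n" for l p
    by (auto simp: points_def)
  \<comment> \<open>The two corners at which the coherent orientation enters the crossing; changing
    the resolution exchanges their successors.\<close>
  define a b where ab: "a = (if odd i then (t, i) else (t, Suc i))" "b = (if odd i then (Suc t, Suc i) else (Suc t, i))"
  have "succ_point n w s' = succ_point n w s \<circ> transpose a b"
  proof
    fix x :: point
    obtain l p where x: "x = (l, p)" by (cases x)
    consider "x = a" | "x = b" | "x \<noteq> a" "x \<noteq> b" by blast
    then show "succ_point n w s' x = (succ_point n w s \<circ> transpose a b) x"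
    proof cases
      case 1
      then show ?thesis
        using i t by (auto simp: ab succ_point_def pts up_step_def down_step_def tt pp)
    next
      case 2
      then show ?thesis
        using i t by (auto simp: ab succ_point_def pts up_step_def down_step_def tt pp)
    next
      case 3
      have up: "up_step w s' (l, p) = up_step w s (l, p)" if "odd p"
        using 3(1) that tn[of l p] tt(1)[of p] tt(2)[of p]
        by (cases "l = t") (auto simp: up_step_def x ab split: if_splits)
      have down: "down_step w s' (l, p) = down_step w s (l, p)" if "even p"
        using 3(2) that tn[of "l - 1" p] tt(1)[of p] tt(2)[of p]
        by (cases "l = Suc t") (auto simp: down_step_def x ab split: if_splits)
      have "succ_point n w s' x = succ_point n w s x"
        using up down by (simp add: succ_point_def x)
      then show ?thesis using 3 by simp
    qed
  qed
  then have "saddle (arcs n w s) (arcs n w s') a b"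
    using saddle_transpose[OF permutation_succ_point[OF w, of s], of "succ_point n w s'" a b]
      saddle_equiv_cl_cong[OF arcs_succ_point[OF w, of s] arcs_succ_point[OF w, of s'], of a b]
    by (auto simp: ab split: if_splits)
  moreover have "saddle (arcs n w s) (arcs n w s') (t, i) (Suc t, Suc i)"
    if "saddle (arcs n w s) (arcs n w s') (t, Suc i) (Suc t, i)"
    by (rule saddle_other_diagonal[OF that]; rule equiv_cl_base)
      (use o t i in \<open>auto simp: arcs_def level_arcs_def Let_def i_def[symmetric]\<close>)
  ultimately show ?thesis
    by (auto simp: ab i_def[symmetric] split: if_splits)
qed

text \<open>With \<open>mark_b\<close>, two opposite corners of the crossing. They lie on different
  arcs in either resolution, so one pair of marks serves merges and splits alike.\<close>

abbreviation mark_a :: "braid_word \<Rightarrow> nat \<Rightarrow> point" where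
  "mark_a w t \<equiv> (t, fst (w ! t))"

abbreviation mark_b :: "braid_word \<Rightarrow> nat \<Rightarrow> point" where
  "mark_b w t \<equiv> (Suc t, Suc (fst (w ! t)))"

theorem saddle_cube_arcs:
  assumes "w \<in> braid_words n"
  shows "saddle_cube {..<length w} (arcs n w) (mark_a w) (mark_b w)"
  unfolding saddle_cube_def
proof (intro allI impI)
  fix s t assume "s \<subseteq> {..<length w}" "t \<in> {..<length w} - s"
  then have t: "t < length w" "t \<notin> s" by auto
  show "saddle (arcs n w s) (arcs n w (insert t s)) (mark_a w t) (mark_b w t)"
  proof (cases "snd (w ! t)")
    case True
    then show ?thesis
      using t by (intro saddle_orientation[OF assms]) (auto simp: oriented_at_def)
  next
    case False
    then have "saddle (arcs n w (insert t s)) (arcs n w s) (mark_a w t) (mark_b w t)"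
      using t by (intro saddle_orientation[OF assms]) (auto simp: oriented_at_def)
    then show ?thesis by (rule saddle_commute)
  qed
qed

section \<open>From polynomials to chains\<close>

definition negatives :: "braid_word \<Rightarrow> nat set" where
  "negatives w = {t. t < length w \<and> \<not> snd (w ! t)}"

text \<open>In the oriented resolution every circle has exactly one point on level 0, so this
  monomial labels all circles v_-.\<close>

definition psi_poly :: "nat \<Rightarrow> point poly2" where
  "psi_poly n = (\<Prod>p\<in>{1..n}. var (0, p))"

definition word_vanishes :: "nat \<Rightarrow> braid_word \<Rightarrow> bool" where
  "word_vanishes n w \<longleftrightarrow>
    vanishes {..<length w} (arcs n w) (mark_a w) (mark_b w) (negatives w) (psi_poly n)"

abbreviation circle_of :: "nat \<Rightarrow> braid_word \<Rightarrow> nat set \<Rightarrow> point \<Rightarrow> circle" where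
  "circle_of n w s p \<equiv> equiv_cl (arcs n w s) `` {p}"

lemma circles_eq: "circles n w s = circle_of n w s ` points n w"
  unfolding circles_def quotient_def equiv_cl_def by auto

lemma arcs_points:
  assumes "w \<in> braid_words n"
  shows "arcs n w s \<subseteq> points n w \<times> points n w"
  using braid_word_nth[OF assms]
  by (fastforce simp: arcs_def closure_arcs_def level_arcs_def Let_def points_def split: if_splits)

lemma circle_of_eq_iff: "circle_of n w s p = circle_of n w s q \<longleftrightarrow> (p, q) \<in> equiv_cl (arcs n w s)"
proof
  assume "circle_of n w s p = circle_of n w s q"
  then have "q \<in> circle_of n w s p" by auto
  then show "(p, q) \<in> equiv_cl (arcs n w s)" by simp
next
  assume *: "(p, q) \<in> equiv_cl (arcs n w s)"
  show "circle_of n w s p = circle_of n w s q"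
    using equiv_cl_trans[OF *] equiv_cl_trans[OF equiv_cl_sym[OF *]] by auto
qed

lemma circlesD: "C \<in> circles n w s \<Longrightarrow> p \<in> C \<Longrightarrow> C = circle_of n w s p"
proof -
  assume "C \<in> circles n w s" "p \<in> C"
  then obtain q where "C = circle_of n w s q" "(q, p) \<in> equiv_cl (arcs n w s)"
    unfolding circles_eq by blast
  then show ?thesis by (simp add: circle_of_eq_iff)
qed

lemma circle_of_in: "p \<in> points n w \<Longrightarrow> circle_of n w s p \<in> circles n w s"
  by (auto simp: circles_eq)

lemma finite_circles [simp]: "finite (circles n w s)"
  by (simp add: circles_eq points_def)

text \<open>Translates a merge of equivalence relations into the set differences of circles by which
  \<open>diff_term\<close> recognises merges and splits.\<close>

lemma merge_circles:
  assumes m: "merges (arcs n w s) (arcs n w s') a b" and pts: "a \<in> points n w" "b \<in> points n w"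
  defines "A \<equiv> circle_of n w s a" and "B \<equiv> circle_of n w s b"
  shows "A \<noteq> B" "A \<inter> B = {}" "circles n w s - circles n w s' = {A, B}"
    "circles n w s' - circles n w s = {A \<union> B}"
proof -
  let ?E = "equiv_cl (arcs n w s)" and ?E' = "equiv_cl (arcs n w s')"
  have nab: "(a, b) \<notin> ?E" by (rule merges_equiv(1)[OF m])
  then show AB: "A \<noteq> B" unfolding A_def B_def circle_of_eq_iff .
  show disj: "A \<inter> B = {}"
    using nab unfolding A_def B_def by (auto dest: equiv_cl_sym equiv_cl_trans)
  have in': "circle_of n w s' p = A \<union> B" if "p \<in> A \<union> B" for p
  proof -
    have "q \<in> circle_of n w s' p \<longleftrightarrow> q \<in> A \<union> B" for q
      using that merges_equiv(4)[OF m, of p q] unfolding A_def B_def Image_singleton_iff Un_iff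
      by (metis equiv_cl_sym equiv_cl_trans)
    then show ?thesis by blast
  qed
  have out: "circle_of n w s' p = circle_of n w s p" if "p \<notin> A \<union> B" for p
  proof -
    have "q \<in> circle_of n w s' p \<longleftrightarrow> q \<in> circle_of n w s p" for q
      using that merges_equiv(4)[OF m, of p q] unfolding A_def B_def Image_singleton_iff Un_iff
      by (metis equiv_cl_sym)
    then show ?thesis by blast
  qed
  have aA: "a \<in> A" "b \<in> B" by (auto simp: A_def B_def)
  have X: "A \<in> circles n w s" "B \<in> circles n w s"
    unfolding A_def B_def using pts by (auto intro: circle_of_in)
  have Y: "A \<union> B \<in> circles n w s'"
    using in'[of a] aA circle_of_in[OF pts(1), of s'] by simp
  have notY: "C \<notin> circles n w s'" if "C = A \<or> C = B" for C
  proof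
    assume C: "C \<in> circles n w s'"
    then have "C = A \<union> B"
      using that circlesD[OF C] in' aA by (metis Un_iff)
    then show False using that aA disj by blast
  qed
  have notX: "A \<union> B \<notin> circles n w s"
  proof
    assume C: "A \<union> B \<in> circles n w s"
    have "A \<union> B = A"
      by (rule circlesD[OF C UnI1[OF aA(1)], folded A_def])
    then show False using aA(2) disj by blast
  qed
  have cA: "circle_of n w s p = A" if "p \<in> A" for p
    using that X(1) circlesD by blast
  have cB: "circle_of n w s p = B" if "p \<in> B" for p
    using that X(2) circlesD by blast
  show "circles n w s - circles n w s' = {A, B}"
  proof (intro equalityI subsetI)
    fix C assume C: "C \<in> circles n w s - circles n w s'"
    then obtain p where p: "p \<in> points n w" "C = circle_of n w s p" by (auto simp: circles_eq)
    have "p \<in> A \<union> B"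
    proof (rule ccontr)
      assume "p \<notin> A \<union> B"
      from circle_of_in[OF p(1), of s'] show False
        using C unfolding out[OF \<open>p \<notin> A \<union> B\<close>] p(2) by blast
    qed
    then have "C = A \<or> C = B" using cA[of p] cB[of p] p(2) by (elim UnE) simp_all
    then show "C \<in> {A, B}" by blast
  qed (use X notY in auto)
  show "circles n w s' - circles n w s = {A \<union> B}"
  proof (intro equalityI subsetI)
    fix C assume C: "C \<in> circles n w s' - circles n w s"
    then obtain p where p: "p \<in> points n w" "C = circle_of n w s' p" by (auto simp: circles_eq)
    have "p \<in> A \<union> B"
    proof (rule ccontr)
      assume "p \<notin> A \<union> B"
      from circle_of_in[OF p(1), of s] show False
        using C unfolding p(2) out[OF \<open>p \<notin> A \<union> B\<close>] by blast
    qed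
    then have "C = A \<union> B" using in'[of p] p(2) by simp
    then show "C \<in> {A \<union> B}" by blast
  qed (use Y notX in auto)
qed

text \<open>A monomial with at most one point on each circle stands for one labeling; with two
  points on a circle it stands for none, in accordance with the vanishing of squares.\<close>

definition represents :: "nat \<Rightarrow> braid_word \<Rightarrow> nat set \<Rightarrow> point multiset \<Rightarrow> (circle \<Rightarrow> label) \<Rightarrow> bool" where
  "represents n w s m l \<longleftrightarrow> set_mset m \<subseteq> points n w \<and>
    (\<forall>C\<in>circles n w s. size (filter_mset (\<lambda>p. p \<in> C) m) = (if l C = Vminus then 1 else 0))"

definition label_coeff :: "nat \<Rightarrow> braid_word \<Rightarrow> nat set \<Rightarrow> (circle \<Rightarrow> label) \<Rightarrow> point poly2 \<Rightarrow> bit" where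
  "label_coeff n w s l = lin (\<lambda>m. if represents n w s m l then 1 else 0)"

lemma bit_double: "(x :: bit) + x = 0"
  by (cases x) simp_all

lemma label_coeff_add: "label_coeff n w s l (x + y) = label_coeff n w s l x + label_coeff n w s l y"
  unfolding label_coeff_def by (rule lin_add) (rule bit_double)

lemma label_coeff_0 [simp]: "label_coeff n w s l 0 = 0"
  by (simp add: label_coeff_def)

lemma label_coeff_mon: "label_coeff n w s l (monomial m) = (if represents n w s m l then 1 else 0)"
  by (simp add: label_coeff_def)

lemma label_coeff_sum: "label_coeff n w s l (\<Sum>i\<in>A. f i) = (\<Sum>i\<in>A. label_coeff n w s l (f i))"
  by (induction A rule: infinite_finite_induct) (simp_all add: label_coeff_add del: add_bit_eq_xor)

text \<open>Joined points lie on the same circle, so they are interchangeable for every labeling; a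
  repeated point puts two points on one circle.\<close>

lemma label_coeff_ideal:
  assumes w: "w \<in> braid_words n" and "x \<in> ideal (arcs n w s)"
  shows "label_coeff n w s l x = 0"
  using assms(2)
proof induction
  case (linear p q x r)
  have pq: "p \<in> points n w" "q \<in> points n w"
    using linear(1) arcs_points[OF w] by auto
  have "p \<in> C \<longleftrightarrow> q \<in> C" if "C \<in> circles n w s" for C
    using that circlesD[OF that] equiv_cl_base[OF linear(1)] by (metis Image_singleton_iff equiv_cl_sym)
  then have "represents n w s (m + {#p#}) l \<longleftrightarrow> represents n w s (m + {#q#}) l" for m
    unfolding represents_def using pq by auto
  then have "label_coeff n w s l (r * var p) = label_coeff n w s l (r * var q)"
    by (induction r rule: poly2_induct)
      (simp_all add: distrib_right monomial_mult label_coeff_add label_coeff_mon del: add_bit_eq_xor)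
  then show ?case
    using linear(3) by (simp add: distrib_left label_coeff_add bit_double del: add_bit_eq_xor)
next
  case (square x r p)
  have "\<not> represents n w s (m + {#p, p#}) l" for m
  proof
    assume r: "represents n w s (m + {#p, p#}) l"
    then have "circle_of n w s p \<in> circles n w s"
      by (intro circle_of_in) (auto simp: represents_def)
    with r have "size (filter_mset (\<lambda>x. x \<in> circle_of n w s p) (m + {#p, p#})) \<le> 1"
      unfolding represents_def by (metis le_refl zero_le_one)
    then show False by simp
  qed
  then have "label_coeff n w s l (r * (var p * var p)) = 0"
    by (induction r rule: poly2_induct)
      (simp_all add: distrib_right monomial_mult label_coeff_add label_coeff_mon del: add_bit_eq_xor)
  then show ?case
    using square by (simp add: label_coeff_add del: add_bit_eq_xor)
qed simp

lemma label_coeff_eqm: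
  assumes "w \<in> braid_words n" "eqm (arcs n w s) x y"
  shows "label_coeff n w s l x = label_coeff n w s l y"
proof -
  have "label_coeff n w s l x + label_coeff n w s l y = 0"
    using label_coeff_ideal[OF assms(1), of "x + y" s l] assms(2) by (simp add: eqm_def label_coeff_add del: add_bit_eq_xor)
  then show ?thesis by (cases "label_coeff n w s l x"; cases "label_coeff n w s l y") simp_all
qed

lemma ball_split: "Y = I \<union> {A, B} \<Longrightarrow> (\<forall>C\<in>Y. P C) \<longleftrightarrow> (\<forall>C\<in>I. P C) \<and> P A \<and> P B"
  by auto

lemma label_le1: "(if x = Vminus then 1 else 0 :: nat) \<le> 1"
  by simp

lemma split_termI:
  "(if x = Vminus then 1 else 0 :: nat) + 1 = (if y = Vminus then 1 else 0) + (if z = Vminus then 1 else 0) \<Longrightarrow>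
    split_term x y z"
  by (cases x; cases y; cases z) (auto simp: split_term_def)

lemma split_termD:
  "split_term x y z \<Longrightarrow> a + b = (if x = Vminus then 1 else 0 :: nat) \<Longrightarrow>
    a + 1 = (if y = Vminus then 1 else 0) \<and> b = (if z = Vminus then 1 else 0) \<or>
    a = (if y = Vminus then 1 else 0) \<and> b + 1 = (if z = Vminus then 1 else 0)"
  by (auto simp: split_term_def add_is_1)

lemma representsD:
  "represents n w s m l \<Longrightarrow> C \<in> circles n w s \<Longrightarrow>
    size (filter_mset (\<lambda>p. p \<in> C) m) = (if l C = Vminus then 1 else 0)"
  by (simp add: represents_def)

lemma label_eqI: "(if x = Vminus then 1 else 0 :: nat) = (if y = Vminus then 1 else 0) \<Longrightarrow> x = y"
  by (cases x; cases y) auto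

lemma represents_unique:
  assumes "represents n w s m l" "represents n w s m l'"
    "l \<in> circles n w s \<rightarrow>\<^sub>E UNIV" "l' \<in> circles n w s \<rightarrow>\<^sub>E UNIV"
  shows "l = l'"
proof (rule PiE_ext[OF assms(3,4)])
  fix C assume "C \<in> circles n w s"
  then have "l C = Vminus \<longleftrightarrow> l' C = Vminus"
    using assms(1,2) unfolding represents_def by (metis zero_neq_one)
  then show "l C = l' C" by (cases "l C"; cases "l' C") auto
qed

lemma size_filter_Un:
  "A \<inter> B = {} \<Longrightarrow> size (filter_mset (\<lambda>p. p \<in> A \<union> B) m) =
    size (filter_mset (\<lambda>p. p \<in> A) m) + size (filter_mset (\<lambda>p. p \<in> B) m)"
  by (induction m) auto

definition label_of :: "nat \<Rightarrow> braid_word \<Rightarrow> nat set \<Rightarrow> point multiset \<Rightarrow> circle \<Rightarrow> label" where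
  "label_of n w s m = (\<lambda>C\<in>circles n w s.
    if size (filter_mset (\<lambda>p. p \<in> C) m) = 1 then Vminus else Vplus)"

lemma represents_label_of:
  assumes "set_mset m \<subseteq> points n w" "\<And>C. C \<in> circles n w s \<Longrightarrow> size (filter_mset (\<lambda>p. p \<in> C) m) \<le> 1"
  shows "represents n w s m (label_of n w s m)"
proof -
  have "size (filter_mset (\<lambda>p. p \<in> C) m) = (if label_of n w s m C = Vminus then 1 else 0)"
    if "C \<in> circles n w s" for C
    using assms(2)[OF that] that unfolding label_of_def by (cases "size (filter_mset (\<lambda>p. p \<in> C) m)") auto
  then show ?thesis
    using assms(1) by (simp add: represents_def)
qed

lemma label_of_in: "label_of n w s m \<in> circles n w s \<rightarrow>\<^sub>E UNIV"
  by (auto simp: label_of_def)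

lemma diff_term_merge:
  assumes "t < length w" "t \<notin> s" "A \<noteq> B" "circles n w s - circles n w (insert t s) = {A, B}"
    "circles n w (insert t s) - circles n w s = {C}"
  shows "diff_term n w (s, l) (insert t s, l') \<longleftrightarrow>
    (\<forall>D\<in>circles n w s \<inter> circles n w (insert t s). l' D = l D) \<and> merge_term (l A) (l B) (l' C)"
proof -
  have sym: "merge_term x y z \<longleftrightarrow> merge_term y x z" for x y z
    by (auto simp: merge_term_def)
  have "(\<exists>A' B' C'. A' \<noteq> B' \<and> {A, B} = {A', B'} \<and> {C} = {C'} \<and> merge_term (l A') (l B') (l' C')) \<longleftrightarrow>
      merge_term (l A) (l B) (l' C)"
    using assms(3) sym by (auto simp: doubleton_eq_iff)
  moreover have "\<not> (\<exists>A' B' C'. B' \<noteq> C' \<and> {A, B} = {A'} \<and> {C} = {B', C'} \<and> split_term (l A') (l' B') (l' C'))"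
    using assms(3) by auto
  ultimately show ?thesis
    unfolding diff_term_def Let_def using assms by auto
qed

lemma diff_term_split:
  assumes "t < length w" "t \<notin> s" "A \<noteq> B" "circles n w (insert t s) - circles n w s = {A, B}"
    "circles n w s - circles n w (insert t s) = {C}"
  shows "diff_term n w (s, l) (insert t s, l') \<longleftrightarrow>
    (\<forall>D\<in>circles n w s \<inter> circles n w (insert t s). l' D = l D) \<and> split_term (l C) (l' A) (l' B)"
proof -
  have sym: "split_term x y z \<longleftrightarrow> split_term x z y" for x y z
    by (auto simp: split_term_def)
  have "(\<exists>C' A' B'. A' \<noteq> B' \<and> {C} = {C'} \<and> {A, B} = {A', B'} \<and> split_term (l C') (l' A') (l' B')) \<longleftrightarrow>
      split_term (l C) (l' A) (l' B)"
    using assms(3) sym by (auto simp: doubleton_eq_iff)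
  moreover have "\<not> (\<exists>A' B' C'. A' \<noteq> B' \<and> {C} = {A', B'} \<and> {A, B} = {C'} \<and> merge_term (l A') (l B') (l' C'))"
    using assms(3) by auto
  ultimately show ?thesis
    unfolding diff_term_def Let_def using assms by auto
qed

text \<open>It suffices to treat monomials, each of which stands for at most one labeling. At a
  merge the numbers of points on the two circles add up. At a split the factor
  \<open>var a + var b\<close> puts one more point on either of the two new circles, which is the
  split map.\<close>

lemma label_coeff_saddle:
  assumes w: "w \<in> braid_words n" and s: "s \<subseteq> {..<length w}" and t: "t < length w" "t \<notin> s"
  shows "label_coeff n w (insert t s) l' (scoeff (arcs n w s) (mark_a w t) (mark_b w t) * x) =
    (\<Sum>l | l \<in> (circles n w s \<rightarrow>\<^sub>E UNIV) \<and> diff_term n w (s, l) (insert t s, l'). label_coeff n w s l x)"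
proof -
  let ?X = "circles n w s" and ?Y = "circles n w (insert t s)"
  let ?a = "mark_a w t" and ?b = "mark_b w t"
  define L where "L = {l \<in> ?X \<rightarrow>\<^sub>E UNIV. diff_term n w (s, l) (insert t s, l')}"
  have finL: "finite L"
    unfolding L_def by (rule finite_subset[of _ "?X \<rightarrow>\<^sub>E (UNIV :: label set)"])
      (auto intro!: finite_PiE finite_subset[of UNIV "{Vplus, Vminus}"] intro: label.exhaust)
  have pts: "?a \<in> points n w" "?b \<in> points n w"
    using braid_word_nth[OF w t(1)] t(1) by (auto simp: points_def)
  have unique: "(\<Sum>l\<in>L. if represents n w s m l then 1 else 0 :: bit) =
      (if \<exists>l\<in>L. represents n w s m l then 1 else 0)" for m
  proof (cases "\<exists>l\<in>L. represents n w s m l")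
    case True
    then obtain l where l: "l \<in> L" "represents n w s m l" by blast
    have "(\<Sum>k\<in>L. if represents n w s m k then 1 else 0 :: bit) = (\<Sum>k\<in>L. if k = l then 1 else 0)"
    proof (rule sum.cong)
      fix k assume "k \<in> L"
      then have "represents n w s m k \<longleftrightarrow> k = l"
        using represents_unique[OF _ l(2), of k] l unfolding L_def by blast
      then show "(if represents n w s m k then 1 else 0 :: bit) = (if k = l then 1 else 0)"
        by simp
    qed simp
    then show ?thesis using True l(1) finL by simp
  qed simp
  have sad: "saddle (arcs n w s) (arcs n w (insert t s)) ?a ?b"
    using saddle_cube_arcs[OF w] s t unfolding saddle_cube_def by auto
  have mono: "label_coeff n w (insert t s) l' (scoeff (arcs n w s) ?a ?b * monomial m) =
      (if \<exists>l\<in>L. represents n w s m l then 1 else 0)" for m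
    using sad
  proof (cases rule: saddle_cases)
    case 1
    define A B where "A = circle_of n w s ?a" and "B = circle_of n w s ?b"
    note mc = merge_circles[OF 1(1) pts, folded A_def B_def]
    have inX: "A \<in> ?X" "B \<in> ?X" "A \<union> B \<in> ?Y" using mc(3,4) by auto
    have dt: "diff_term n w (s, l) (insert t s, l') \<longleftrightarrow>
      (\<forall>D\<in>?X \<inter> ?Y. l' D = l D) \<and> merge_term (l A) (l B) (l' (A \<union> B))" for l
      by (rule diff_term_merge[OF t mc(1,3,4)])
    let ?c = "\<lambda>C. size (filter_mset (\<lambda>p. p \<in> C) m)"
    have cAB: "?c (A \<union> B) = ?c A + ?c B"
      by (rule size_filter_Un[OF mc(2)])
    have "represents n w (insert t s) m l' \<longleftrightarrow> (\<exists>l\<in>L. represents n w s m l)"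
    proof
      assume r: "represents n w (insert t s) m l'"
      have le: "?c C \<le> 1" if "C \<in> ?Y" for C
        using representsD[OF r that] by simp
      have "?c C \<le> 1" if "C \<in> ?X" for C
      proof (cases "C \<in> ?Y")
        case False
        then have "C = A \<or> C = B" using that mc(3) by auto
        then show ?thesis using le[OF inX(3)] cAB by auto
      qed (rule le)
      then have rl: "represents n w s m (label_of n w s m)"
        using r by (intro represents_label_of) (auto simp: represents_def)
      have "l' D = label_of n w s m D" if "D \<in> ?X \<inter> ?Y" for D
        using representsD[OF r, of D] representsD[OF rl, of D] that by (intro label_eqI) simp
      moreover have "merge_term (label_of n w s m A) (label_of n w s m B) (l' (A \<union> B))"
      proof -
        have "?c A = (if label_of n w s m A = Vminus then 1 else 0)" "?c B = (if label_of n w s m B = Vminus then 1 else 0)"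
          "?c (A \<union> B) = (if l' (A \<union> B) = Vminus then 1 else 0)"
          using representsD[OF r] representsD[OF rl] inX by blast+
        then show ?thesis
          using cAB unfolding merge_term_def
          by (cases "label_of n w s m A"; cases "label_of n w s m B"; cases "l' (A \<union> B)") auto
      qed
      ultimately have "label_of n w s m \<in> L"
        unfolding L_def using dt label_of_in by blast
      then show "\<exists>l\<in>L. represents n w s m l" using rl by blast
    next
      assume "\<exists>l\<in>L. represents n w s m l"
      then obtain l where l: "represents n w s m l" "\<forall>D\<in>?X \<inter> ?Y. l' D = l D" "merge_term (l A) (l B) (l' (A \<union> B))"
        unfolding L_def using dt by blast
      have "?c C = (if l' C = Vminus then 1 else 0)" if "C \<in> ?Y" for C
      proof (cases "C \<in> ?X")
        case True
        then show ?thesis using representsD[OF l(1) True] l(2) that by simp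
      next
        case False
        then have C: "C = A \<union> B" using that mc(4) by auto
        have "?c A = (if l A = Vminus then 1 else 0)" "?c B = (if l B = Vminus then 1 else 0)"
          using representsD[OF l(1)] inX by blast+
        then show ?thesis
          using cAB l(3) unfolding C merge_term_def by auto
      qed
      then show "represents n w (insert t s) m l'"
        using l(1) unfolding represents_def by blast
    qed
    then show ?thesis
      using 1 by (simp add: label_coeff_mon)
  next
    case 2
    define A B where "A = circle_of n w (insert t s) ?a" and "B = circle_of n w (insert t s) ?b"
    note mc = merge_circles[OF 2(1) pts, folded A_def B_def]
    have inX: "A \<in> ?Y" "B \<in> ?Y" "A \<union> B \<in> ?X" using mc(3,4) by auto
    have dt: "diff_term n w (s, l) (insert t s, l') \<longleftrightarrow>
      (\<forall>D\<in>?X \<inter> ?Y. l' D = l D) \<and> split_term (l (A \<union> B)) (l' A) (l' B)" for l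
      by (rule diff_term_split[OF t mc(1,3,4)])
    let ?c = "\<lambda>C m. size (filter_mset (\<lambda>p. p \<in> C) m)"
    have cAB: "?c (A \<union> B) m = ?c A m + ?c B m"
      by (rule size_filter_Un[OF mc(2)])
    have "?a \<in> A" "?b \<in> B"
      by (simp_all add: A_def B_def)
    with mc(2) have mem: "?a \<in> A" "?b \<in> B" "?a \<notin> B" "?b \<notin> A"
      by blast+
    have other: "?a \<notin> D \<and> ?b \<notin> D" if "D \<in> ?Y" "D \<noteq> A" "D \<noteq> B" for D
      using that circlesD[OF that(1), of ?a] circlesD[OF that(1), of ?b] unfolding A_def B_def by blast
    have Ysplit: "?Y = (?X \<inter> ?Y) \<union> {A, B}" using mc(3) by blast
    have notI: "A \<notin> ?X \<inter> ?Y" "B \<notin> ?X \<inter> ?Y" using mc(3) by auto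
    have ra: "represents n w (insert t s) (m + {#?a#}) l' \<longleftrightarrow> set_mset m \<subseteq> points n w \<and>
        (\<forall>D\<in>?X \<inter> ?Y. ?c D m = (if l' D = Vminus then 1 else 0)) \<and>
        ?c A m + 1 = (if l' A = Vminus then 1 else 0) \<and> ?c B m = (if l' B = Vminus then 1 else 0)"
    proof -
      have cc: "?c D (m + {#?a#}) = (if D = A then ?c A m + 1 else ?c D m)" if "D \<in> ?Y" for D
        using that other[OF that] mem by auto
      have pts': "set_mset (m + {#?a#}) \<subseteq> points n w \<longleftrightarrow> set_mset m \<subseteq> points n w"
        using pts by simp
      have "(\<forall>D\<in>?X \<inter> ?Y. ?c D (m + {#?a#}) = (if l' D = Vminus then 1 else 0)) \<longleftrightarrow>
          (\<forall>D\<in>?X \<inter> ?Y. ?c D m = (if l' D = Vminus then 1 else 0))"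
      proof (rule ball_cong)
        fix D assume "D \<in> ?X \<inter> ?Y"
        then have "D \<in> ?Y" "D \<noteq> A" using notI by auto
        then show "?c D (m + {#?a#}) = (if l' D = Vminus then 1 else 0) \<longleftrightarrow>
            ?c D m = (if l' D = Vminus then 1 else 0)"
          by (simp only: cc if_False)
      qed simp
      moreover have "?c A (m + {#?a#}) = ?c A m + 1" "?c B (m + {#?a#}) = ?c B m"
        using cc[OF inX(1)] cc[OF inX(2)] mc(1) by auto
      ultimately show ?thesis
        unfolding represents_def pts' ball_split[OF Ysplit] by simp
    qed
    have rb: "represents n w (insert t s) (m + {#?b#}) l' \<longleftrightarrow> set_mset m \<subseteq> points n w \<and>
        (\<forall>D\<in>?X \<inter> ?Y. ?c D m = (if l' D = Vminus then 1 else 0)) \<and>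
        ?c A m = (if l' A = Vminus then 1 else 0) \<and> ?c B m + 1 = (if l' B = Vminus then 1 else 0)"
    proof -
      have cc: "?c D (m + {#?b#}) = (if D = B then ?c B m + 1 else ?c D m)" if "D \<in> ?Y" for D
        using that other[OF that] mem by auto
      have pts': "set_mset (m + {#?b#}) \<subseteq> points n w \<longleftrightarrow> set_mset m \<subseteq> points n w"
        using pts by simp
      have "(\<forall>D\<in>?X \<inter> ?Y. ?c D (m + {#?b#}) = (if l' D = Vminus then 1 else 0)) \<longleftrightarrow>
          (\<forall>D\<in>?X \<inter> ?Y. ?c D m = (if l' D = Vminus then 1 else 0))"
      proof (rule ball_cong)
        fix D assume "D \<in> ?X \<inter> ?Y"
        then have "D \<in> ?Y" "D \<noteq> B" using notI by auto
        then show "?c D (m + {#?b#}) = (if l' D = Vminus then 1 else 0) \<longleftrightarrow>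
            ?c D m = (if l' D = Vminus then 1 else 0)"
          by (simp only: cc if_False)
      qed simp
      moreover have "?c A (m + {#?b#}) = ?c A m" "?c B (m + {#?b#}) = ?c B m + 1"
        using cc[OF inX(1)] cc[OF inX(2)] mc(1) by auto
      ultimately show ?thesis
        unfolding represents_def pts' ball_split[OF Ysplit] by simp
    qed
    have "(represents n w (insert t s) (m + {#?a#}) l' \<or> represents n w (insert t s) (m + {#?b#}) l') \<longleftrightarrow>
        (\<exists>l\<in>L. represents n w s m l)"
    proof
      assume r: "represents n w (insert t s) (m + {#?a#}) l' \<or> represents n w (insert t s) (m + {#?b#}) l'"
      note r = this[unfolded ra rb]
      have m: "set_mset m \<subseteq> points n w"
        using r by blast
      have D: "\<forall>D\<in>?X \<inter> ?Y. ?c D m = (if l' D = Vminus then 1 else 0)"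
        using r by blast
      have AB: "?c A m + ?c B m + 1 = (if l' A = Vminus then 1 else 0) + (if l' B = Vminus then 1 else 0)"
        using r by (elim disjE conjE) linarith+
      have "?c C m \<le> 1" if "C \<in> ?X" for C
      proof (cases "C \<in> ?Y")
        case True
        then show ?thesis using D that by auto
      next
        case False
        then have "C = A \<union> B" using that mc(4) by auto
        then have "?c C m = ?c A m + ?c B m" using cAB by simp
        then show ?thesis using AB label_le1[of "l' A"] label_le1[of "l' B"] by linarith
      qed
      then have rl: "represents n w s m (label_of n w s m)"
        using m by (intro represents_label_of)
      have "l' E = label_of n w s m E" if "E \<in> ?X \<inter> ?Y" for E
        using D representsD[OF rl, of E] that by (intro label_eqI) simp
      moreover have "split_term (label_of n w s m (A \<union> B)) (l' A) (l' B)"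
      proof -
        have "?c (A \<union> B) m = (if label_of n w s m (A \<union> B) = Vminus then 1 else 0)"
          using representsD[OF rl inX(3)] .
        then show ?thesis
          using cAB AB by (intro split_termI) linarith
      qed
      ultimately have "label_of n w s m \<in> L"
        unfolding L_def using dt label_of_in by blast
      then show "\<exists>l\<in>L. represents n w s m l" using rl by blast
    next
      assume "\<exists>l\<in>L. represents n w s m l"
      then obtain l where l: "represents n w s m l" "\<forall>D\<in>?X \<inter> ?Y. l' D = l D" "split_term (l (A \<union> B)) (l' A) (l' B)"
        unfolding L_def using dt by blast
      have "?c (A \<union> B) m = (if l (A \<union> B) = Vminus then 1 else 0)"
        using representsD[OF l(1) inX(3)] .
      then have "(?c A m + 1 = (if l' A = Vminus then 1 else 0) \<and> ?c B m = (if l' B = Vminus then 1 else 0)) \<or>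
          (?c A m = (if l' A = Vminus then 1 else 0) \<and> ?c B m + 1 = (if l' B = Vminus then 1 else 0))"
        unfolding cAB by (rule split_termD[OF l(3)])
      moreover have "set_mset m \<subseteq> points n w" "\<forall>D\<in>?X \<inter> ?Y. ?c D m = (if l' D = Vminus then 1 else 0)"
        using l(1,2) unfolding represents_def by auto
      ultimately show "represents n w (insert t s) (m + {#?a#}) l' \<or> represents n w (insert t s) (m + {#?b#}) l'"
        unfolding ra rb by blast
    qed
    \<comment> \<open>The two monomials differ in the number of points on each of the new circles,
      so they never stand for the same labeling, and the sum modulo 2 is the disjunction.\<close>
    moreover have "\<not> (represents n w (insert t s) (m + {#?a#}) l' \<and> represents n w (insert t s) (m + {#?b#}) l')"
    proof
      assume "represents n w (insert t s) (m + {#?a#}) l' \<and> represents n w (insert t s) (m + {#?b#}) l'"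
      from this[unfolded ra rb] show False by (elim conjE) linarith
    qed
    ultimately show ?thesis
      using 2 by (auto simp: distrib_right monomial_mult label_coeff_add label_coeff_mon)
  qed
  have "label_coeff n w (insert t s) l' (scoeff (arcs n w s) ?a ?b * x) = (\<Sum>l\<in>L. label_coeff n w s l x)"
  proof (induction x rule: poly2_induct)
    case (add m x)
    show ?case
      unfolding distrib_left label_coeff_add sum.distrib add.IH mono label_coeff_mon unique ..
  qed simp
  then show ?thesis by (simp add: L_def)
qed

lemma oriented_psi:
  assumes w: "w \<in> braid_words n" and l: "l \<in> circles n w (negatives w) \<rightarrow>\<^sub>E UNIV"
  shows "label_coeff n w (negatives w) l (psi_poly n) =
    (if l = (\<lambda>C\<in>circles n w (negatives w). Vminus) then 1 else 0)"
proof -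
  let ?s = "negatives w"
  let ?m = "image_mset (Pair 0) (mset_set {1..n}) :: point multiset"
  have *: "(\<Prod>p\<in>A. var (0, p)) = monomial (image_mset (Pair 0) (mset_set A))" if "finite A" for A :: "nat set"
    using that by induction (simp_all add: monomial_mult)
  have psi: "psi_poly n = monomial ?m"
    unfolding psi_poly_def by (rule *) simp
  have o: "oriented_at w ?s t" if "t < length w" for t
    using that by (auto simp: oriented_at_def negatives_def)
  have same: "snd p = snd q" if "(p, q) \<in> equiv_cl (arcs n w ?s)" for p q
    using that by (rule equiv_cl_least)
      (auto simp: arcs_def closure_arcs_def level_arcs_def Let_def o)
  have col: "((0, p), (t, p)) \<in> equiv_cl (arcs n w ?s)" if "t \<le> length w" "p \<in> {1..n}" for t p
    using that(1)
  proof (induction t)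
    case (Suc t)
    have "((t, p), (Suc t, p)) \<in> equiv_cl (arcs n w ?s)"
      using Suc.prems that(2) o[of t] by (intro equiv_cl_base) (auto simp: arcs_def level_arcs_def Let_def)
    then show ?case using Suc by (auto intro: equiv_cl_trans)
  qed simp
  have one: "size (filter_mset (\<lambda>x. x \<in> C) ?m) = 1" if C: "C \<in> circles n w ?s" for C
  proof -
    obtain t p where p: "(t, p) \<in> points n w" "C = circle_of n w ?s (t, p)"
      using C by (auto simp: circles_eq)
    have "q \<in> {1..n} \<and> (0, q) \<in> C \<longleftrightarrow> q = p" for q
      using p same[of "(t, p)" "(0, q)"] col[of t p] by (auto simp: points_def intro: equiv_cl_sym)
    then have *: "{q \<in> {1..n}. (0, q) \<in> C} = {p}" by blast
    show ?thesis
      using * by (simp add: filter_mset_image_mset filter_mset_mset_set)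
  qed
  have "represents n w ?s ?m l \<longleftrightarrow> (\<forall>C\<in>circles n w ?s. l C = Vminus)"
    unfolding represents_def using one by (auto simp: points_def)
  also have "\<dots> \<longleftrightarrow> l = (\<lambda>C\<in>circles n w ?s. Vminus)"
    using l by (auto simp: fun_eq_iff PiE_def extensional_def)
  finally show ?thesis
    by (simp add: psi label_coeff_mon)
qed

text \<open>The chain \<open>f\<close> records the coefficients of the polynomial primitive. In its
  differential the sources of a generator are sorted by the crossing \<open>t\<close> that is
  changed, and each crossing contributes one edge map by \<open>label_coeff_saddle\<close>.\<close>

theorem psi_trivial:
  assumes w: "w \<in> braid_words n" and v: "word_vanishes n w"
  shows "psi n w = \<one>\<^bsub>Kh n w\<^esub>"
proof -
  let ?T = "{..<length w}"
  obtain g where g: "\<And>s. s \<subseteq> ?T \<Longrightarrow> eqm (arcs n w s) (edge_sum (arcs n w) (mark_a w) (mark_b w) g s)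
      (if s = negatives w then psi_poly n else 0)"
    using v unfolding word_vanishes_def vanishes_def by blast
  define f where "f x = (if x \<in> generators n w then label_coeff n w (fst x) (snd x) (g (fst x)) else 0)" for x
  have "diff n w f y = psi_cycle n w y" for y
  proof (cases "y \<in> generators n w")
    case False
    have "psi_generator n w \<in> generators n w"
      by (auto simp: psi_generator_def generators_def Let_def)
    then show ?thesis
      using False by (auto simp: diff_def psi_cycle_def)
  next
    case True
    obtain s l where y: "y = (s, l)" by (cases y)
    have s: "s \<subseteq> ?T" and l: "l \<in> circles n w s \<rightarrow>\<^sub>E UNIV"
      using True by (auto simp: y generators_def)
    have fin: "finite s" using s by (rule finite_subset) simp
    define L where "L t = {l' \<in> circles n w (s - {t}) \<rightarrow>\<^sub>E UNIV. diff_term n w (s - {t}, l') (s, l)}" for t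
    have finL: "finite (L t)" for t
      unfolding L_def by (rule finite_subset[of _ "circles n w (s - {t}) \<rightarrow>\<^sub>E (UNIV :: label set)"])
        (auto intro!: finite_PiE finite_subset[of UNIV "{Vplus, Vminus}"] intro: label.exhaust)
    have "{x. x \<in> generators n w \<and> diff_term n w x (s, l)} = (\<lambda>(t, l'). (s - {t}, l')) ` (SIGMA t:s. L t)"
    proof (intro equalityI subsetI)
      fix x assume x: "x \<in> {x. x \<in> generators n w \<and> diff_term n w x (s, l)}"
      obtain s' l' where x': "x = (s', l')" by (cases x)
      have "\<exists>t<length w. t \<notin> s' \<and> s = insert t s'"
        using x by (auto simp: x' diff_term_def Let_def)
      then obtain t where t: "t \<notin> s'" "s = insert t s'" by blast
      then have "s' = s - {t}" "t \<in> s" by auto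
      then show "x \<in> (\<lambda>(t, l'). (s - {t}, l')) ` (SIGMA t:s. L t)"
        using x by (intro image_eqI[of _ _ "(t, l')"]) (auto simp: x' L_def generators_def)
    next
      fix x assume "x \<in> (\<lambda>(t, l'). (s - {t}, l')) ` (SIGMA t:s. L t)"
      then show "x \<in> {x. x \<in> generators n w \<and> diff_term n w x (s, l)}"
        using s by (auto simp: L_def generators_def)
    qed
    moreover have "inj_on (\<lambda>(t, l'). (s - {t}, l')) (SIGMA t:s. L t)"
      by (auto simp: inj_on_def)
    ultimately have "diff n w f (s, l) = (\<Sum>(t, l')\<in>(SIGMA t:s. L t). f (s - {t}, l'))"
      using True unfolding diff_def y by (simp add: sum.reindex case_prod_unfold)
    also have "\<dots> = (\<Sum>t\<in>s. \<Sum>l'\<in>L t. f (s - {t}, l'))"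
      using fin finL by (subst sum.Sigma) auto
    also have "\<dots> = (\<Sum>t\<in>s. \<Sum>l'\<in>L t. label_coeff n w (s - {t}) l' (g (s - {t})))"
      using s by (intro sum.cong) (auto simp: f_def L_def generators_def)
    also have "\<dots> = (\<Sum>t\<in>s. label_coeff n w s l
        (scoeff (arcs n w (s - {t})) (mark_a w t) (mark_b w t) * g (s - {t})))"
    proof (rule sum.cong)
      fix t assume t: "t \<in> s"
      then have "insert t (s - {t}) = s" by auto
      then show "(\<Sum>l'\<in>L t. label_coeff n w (s - {t}) l' (g (s - {t}))) = label_coeff n w s l
        (scoeff (arcs n w (s - {t})) (mark_a w t) (mark_b w t) * g (s - {t}))"
        using label_coeff_saddle[OF w, of "s - {t}" t l "g (s - {t})"] s t unfolding L_def
        by (simp add: subset_iff)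
    qed simp
    also have "\<dots> = label_coeff n w s l (edge_sum (arcs n w) (mark_a w) (mark_b w) g s)"
      unfolding edge_sum_def label_coeff_sum ..
    also have "\<dots> = label_coeff n w s l (if s = negatives w then psi_poly n else 0)"
      by (rule label_coeff_eqm[OF w g[OF s]])
    also have "\<dots> = psi_cycle n w (s, l)"
      using oriented_psi[OF w, of l] l
      by (auto simp: psi_cycle_def psi_generator_def Let_def negatives_def[symmetric])
    finally show ?thesis by (simp add: y)
  qed
  then have psi: "psi_cycle n w = diff n w f" by auto
  have add: "diff n w (\<lambda>x. h x + k x) = (\<lambda>y. diff n w h y + diff n w k y)" for h k
    by (simp add: diff_def sum.distrib fun_eq_iff del: add_bit_eq_xor)
  have carrier: "(\<lambda>x. h x + f x) \<in> carrier (CKh n w)" "f \<in> carrier (CKh n w)" if "h \<in> carrier (CKh n w)" for h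
    using that by (auto simp: CKh_def f_def)
  have "psi n w = (\<lambda>h y. h y + diff n w f y) ` boundaries n w"
    unfolding psi_def psi r_coset_def by (auto simp: CKh_def)
  also have "\<dots> = boundaries n w"
  proof (intro equalityI subsetI)
    fix k assume "k \<in> (\<lambda>h y. h y + diff n w f y) ` boundaries n w"
    then obtain h where "h \<in> carrier (CKh n w)" "k = (\<lambda>y. diff n w h y + diff n w f y)"
      by (auto simp: boundaries_def)
    then show "k \<in> boundaries n w"
      unfolding boundaries_def add[symmetric] using carrier(1) by blast
  next
    fix k assume "k \<in> boundaries n w"
    then obtain h where h: "h \<in> carrier (CKh n w)" "k = diff n w h"
      by (auto simp: boundaries_def)
    have "k = (\<lambda>y. (diff n w h y + diff n w f y) + diff n w f y)"
      unfolding h(2) by (simp add: add.assoc bit_double del: add_bit_eq_xor)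
    moreover have "(\<lambda>y. diff n w h y + diff n w f y) \<in> boundaries n w"
      unfolding boundaries_def add[symmetric] using carrier(1)[OF h(1)] by blast
    ultimately show "k \<in> (\<lambda>h y. h y + diff n w f y) ` boundaries n w"
      by (intro image_eqI[of _ _ "\<lambda>y. diff n w h y + diff n w f y"])
  qed
  finally show ?thesis
    by (simp add: Kh_def FactGroup_def)
qed

section \<open>Replacing a block of a braid word\<close>

text \<open>The points of a block with \<open>d\<close> strands are numbered by \<open>t * d + c\<close> for level \<open>t\<close> and column
  \<open>c\<close>, so that statements about its finitely many resolutions can be decided by evaluation.\<close>

definition labels :: "nat \<Rightarrow> (nat \<times> nat) list \<Rightarrow> nat list" where
  "labels N E = fold (\<lambda>(x, y) L. map (\<lambda>z. if z = L ! x then L ! y else z) L) E [0..<N]"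

text \<open>A point of \<open>I\<close> is sent to the first point outside \<open>I\<close> with the
  same label. If there is none, the head of the empty list is unspecified; \<open>check_reps\<close>
  tests whatever results.\<close>

definition reps :: "nat \<Rightarrow> nat list \<Rightarrow> nat list \<Rightarrow> nat list" where
  "reps N I L = map (\<lambda>p. if List.member I p then hd (filter (\<lambda>q. \<not> List.member I q \<and> L ! q = L ! p) [0..<N]) else p) [0..<N]"

text \<open>Every condition on connectivity asks for equal labels, so \<open>labels_sound\<close>
  justifies all of them.\<close>

definition check_reps :: "nat \<Rightarrow> nat list \<Rightarrow> (nat \<times> nat) list \<Rightarrow> (nat \<times> nat) list \<Rightarrow> nat list \<Rightarrow> nat list \<Rightarrow> nat list \<Rightarrow> bool" where
  "check_reps N I E P L M R \<longleftrightarrow>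
    list_all (\<lambda>(x, y). x < N \<and> y < N \<and> M ! (R ! x) = M ! (R ! y)) E \<and>
    list_all (\<lambda>(x, y). x < N \<and> y < N \<and> \<not> List.member I x \<and> \<not> List.member I y \<and> L ! x = L ! y) P \<and>
    list_all (\<lambda>x. \<not> List.member I (R ! x) \<and> R ! x < N \<and> L ! x = L ! (R ! x)) [0..<N] \<and> list_all (\<lambda>x. x < N) I"

definition check_retract :: "nat \<Rightarrow> nat list \<Rightarrow> (nat \<times> nat) list \<Rightarrow> (nat \<times> nat) list \<Rightarrow> bool" where
  "check_retract N I E P \<longleftrightarrow> check_reps N I E P (labels N E) (labels N P) (reps N I (labels N E))"

definition resolve_letter :: "nat \<Rightarrow> nat \<Rightarrow> bool \<Rightarrow> nat \<Rightarrow> (nat \<times> nat) list" where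
  "resolve_letter d k e t =
    (if e then map (\<lambda>c. (t * d + c, Suc t * d + c)) [0..<d]
     else map (\<lambda>c. (t * d + c, Suc t * d + c)) (filter (\<lambda>c. c \<noteq> k \<and> c \<noteq> Suc k) [0..<d]) @
       [(t * d + k, t * d + Suc k), (Suc t * d + k, Suc t * d + Suc k)])"

definition resolve :: "nat \<Rightarrow> nat list \<Rightarrow> bool list \<Rightarrow> (nat \<times> nat) list" where
  "resolve d ks es = concat (map (\<lambda>t. resolve_letter d (ks ! t) (es ! t) t) [0..<length ks])"

definition rep_map :: "nat \<Rightarrow> nat list \<Rightarrow> (nat \<times> nat) list \<Rightarrow> nat \<Rightarrow> nat" where
  "rep_map N I E j = (if j < N then reps N I (labels N E) ! j else j)"

lemma labels_snoc: "labels N (E @ [(x, y)]) =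
    map (\<lambda>z. if z = labels N E ! x then labels N E ! y else z) (labels N E)"
  by (simp add: labels_def)

lemma length_labels [simp]: "length (labels N E) = N"
proof (induction E rule: rev_induct)
  case (snoc e E)
  then show ?case by (cases e) (simp add: labels_snoc)
qed (simp add: labels_def)

lemma equiv_cl_Un1:
  assumes "(p, q) \<in> equiv_cl G"
  shows "(p, q) \<in> equiv_cl (G \<union> H)"
  using assms by (rule equiv_cl_mono) (auto intro: equiv_cl_base)

lemma labels_sound:
  assumes "\<forall>(x, y)\<in>set E. x < N \<and> y < N" "p < N" "q < N" "labels N E ! p = labels N E ! q"
  shows "(p, q) \<in> equiv_cl (set E)"
  using assms
proof (induction E arbitrary: p q rule: rev_induct)
  case Nil
  then show ?case by (simp add: labels_def)
next
  case (snoc e E)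
  obtain x y where e: "e = (x, y)" by (cases e)
  let ?L = "labels N E" and ?G = "equiv_cl (set (E @ [e]))"
  have xy: "x < N" "y < N" using snoc.prems(1) by (auto simp: e)
  have IH: "(p, q) \<in> ?G" if "p < N" "q < N" "?L ! p = ?L ! q" for p q
    using equiv_cl_Un1[OF snoc.IH[OF _ that], of "{e}"] snoc.prems(1) by simp
  have step: "(x, y) \<in> ?G" by (rule equiv_cl_base) (simp add: e)
  have c: "\<exists>r. r < N \<and> (p, r) \<in> ?G \<and> ?L ! r = labels N (E @ [e]) ! p" if "p < N" for p
  proof (cases "?L ! p = ?L ! x")
    case True
    have "(p, y) \<in> ?G"
      using IH[OF that xy(1) True] step by (rule equiv_cl_trans)
    then show ?thesis
      using True that xy by (auto simp: e labels_snoc)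
  next
    case False
    then show ?thesis
      using that by (intro exI[of _ p]) (simp add: e labels_snoc)
  qed
  obtain p' q' where *: "p' < N" "(p, p') \<in> ?G" "?L ! p' = labels N (E @ [e]) ! p"
    "q' < N" "(q, q') \<in> ?G" "?L ! q' = labels N (E @ [e]) ! q"
    using c[OF snoc.prems(2)] c[OF snoc.prems(3)] by blast
  have "(p', q') \<in> ?G"
    by (rule IH) (use * snoc.prems(4) in simp_all)
  with *(2) have "(p, q') \<in> ?G" by (rule equiv_cl_trans)
  then show ?case
    using equiv_cl_sym[OF *(5)] by (rule equiv_cl_trans)
qed

lemma retractI:
  assumes "\<And>p q. (p, q) \<in> Q \<Longrightarrow> p \<in> F \<and> q \<in> F" "\<And>p. \<phi> p \<in> F" "\<And>p. p \<in> F \<Longrightarrow> \<phi> p = p"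
    "\<And>p q. (p, q) \<in> G \<Longrightarrow> (\<phi> p, \<phi> q) \<in> equiv_cl Q" "\<And>p q. (p, q) \<in> Q \<Longrightarrow> (p, q) \<in> equiv_cl G"
    "\<And>p. (p, \<phi> p) \<in> equiv_cl G"
  shows "retract F \<phi> G Q"
proof -
  have "Q \<subseteq> F \<times> F" "range \<phi> \<subseteq> F" "\<forall>(p, q)\<in>G. (\<phi> p, \<phi> q) \<in> equiv_cl Q" "Q \<subseteq> equiv_cl G"
    using assms(1,2,4,5) by auto
  with assms(3,6) show ?thesis
    unfolding retract_def by simp
qed

lemma check_retract_sound:
  assumes "check_retract N I E P"
  shows "retract (- set I) (rep_map N I E) (set E) (set P)"
    and "set E \<subseteq> {..<N} \<times> {..<N}"
proof -
  let ?L = "labels N E" and ?M = "labels N P" and ?R = "reps N I (labels N E)" and ?f = "rep_map N I E"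
  have E: "x < N \<and> y < N \<and> ?M ! (?R ! x) = ?M ! (?R ! y)" if "(x, y) \<in> set E" for x y
    using assms that unfolding check_retract_def check_reps_def list_all_iff by blast
  have P: "x < N \<and> y < N \<and> x \<notin> set I \<and> y \<notin> set I \<and> ?L ! x = ?L ! y" if "(x, y) \<in> set P" for x y
    using assms that unfolding check_retract_def check_reps_def list_all_iff by auto
  have R: "?R ! x \<notin> set I \<and> ?R ! x < N \<and> ?L ! x = ?L ! (?R ! x)" if "x < N" for x
  proof -
    have "\<forall>x\<in>set [0..<N]. ?R ! x \<notin> set I \<and> ?R ! x < N \<and> ?L ! x = ?L ! (?R ! x)"
      using assms unfolding check_retract_def check_reps_def list_all_iff List.member_iff by (elim conjE)
    moreover have "x \<in> set [0..<N]" using that by simp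
    ultimately show ?thesis by (rule bspec)
  qed
  have I: "x < N" if "x \<in> set I" for x
    using assms that unfolding check_retract_def check_reps_def list_all_iff by (elim conjE) (rule bspec)
  have E': "\<forall>(x, y)\<in>set E. x < N \<and> y < N" and P': "\<forall>(x, y)\<in>set P. x < N \<and> y < N"
    using E P by blast+
  then show "set E \<subseteq> {..<N} \<times> {..<N}" by auto
  have f: "?f x = ?R ! x" if "x < N" for x
    using that by (simp add: rep_map_def)
  have id: "?f p = p" if "p \<notin> set I" for p
    using that by (simp add: rep_map_def reps_def)
  have fix_f: "(p, ?f p) \<in> equiv_cl (set E)" for p
  proof (cases "p < N")
    case True
    then show ?thesis
      using labels_sound[OF E' True, of "?f p"] R[OF True] unfolding f[OF True] by blast
  qed (simp add: rep_map_def)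
  have range: "?f p \<notin> set I" for p
  proof (cases "p < N")
    case True
    then show ?thesis using R[OF True] unfolding f[OF True] by blast
  next
    case False
    then show ?thesis using I by (auto simp: rep_map_def)
  qed
  have map: "(?f p, ?f q) \<in> equiv_cl (set P)" if "(p, q) \<in> set E" for p q
    using labels_sound[OF P', of "?f p" "?f q"] E[OF that] R[of p] R[of q] f[of p] f[of q] by metis
  have sub: "(p, q) \<in> equiv_cl (set E)" if "(p, q) \<in> set P" for p q
    using labels_sound[OF E', of p q] P[OF that] by blast
  show "retract (- set I) ?f (set E) (set P)"
    by (rule retractI) (use P range id map sub fix_f in simp_all)
qed

section \<open>Embedding a block into the diagram\<close>

definition lift :: "(nat \<Rightarrow> 'p) \<Rightarrow> (nat \<Rightarrow> nat) \<Rightarrow> 'p \<Rightarrow> 'p" where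
  "lift \<kappa> f p = (if p \<in> range \<kappa> then \<kappa> (f (the_inv \<kappa> p)) else p)"

lemma lift_apply: "inj \<kappa> \<Longrightarrow> lift \<kappa> f (\<kappa> j) = \<kappa> (f j)"
  by (simp add: lift_def the_inv_f_f)

lemma equiv_cl_embed: "(p, q) \<in> equiv_cl E \<Longrightarrow> (\<kappa> p, \<kappa> q) \<in> equiv_cl (R \<union> map_prod \<kappa> \<kappa> ` E)"
  by (erule equiv_cl_map) (rule equiv_cl_base, force)

text \<open>The arcs \<open>R\<close> outside the block avoid the eliminated points, so a retraction
  of the block extends by the identity.\<close>

lemma lift_retract:
  assumes "inj \<kappa>" "retract (- I) f E P" "R \<subseteq> (- \<kappa> ` I) \<times> (- \<kappa> ` I)"
  shows "retract (- \<kappa> ` I) (lift \<kappa> f) (R \<union> map_prod \<kappa> \<kappa> ` E) (R \<union> map_prod \<kappa> \<kappa> ` P)"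
proof -
  note r = retractD[OF assms(2)]
  have id: "lift \<kappa> f p = p" if "p \<notin> \<kappa> ` I" for p
  proof (cases "p \<in> range \<kappa>")
    case True
    then obtain j where j: "p = \<kappa> j" by blast
    then have "j \<notin> I" using that by blast
    then show ?thesis using r(2)[of j] by (simp add: j lift_apply[OF assms(1)])
  qed (simp add: lift_def)
  have range: "lift \<kappa> f p \<notin> \<kappa> ` I" for p
  proof (cases "p \<in> range \<kappa>")
    case True
    then obtain j where j: "p = \<kappa> j" by blast
    show ?thesis using r(1)[of j] assms(1) by (auto simp: j lift_apply[OF assms(1)] dest: injD)
  qed (auto simp: lift_def)
  have E: "(lift \<kappa> f p, lift \<kappa> f q) \<in> equiv_cl (R \<union> map_prod \<kappa> \<kappa> ` P)" if "(p, q) \<in> R \<union> map_prod \<kappa> \<kappa> ` E" for p q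
  proof (cases "(p, q) \<in> R")
    case True
    then have "lift \<kappa> f p = p" "lift \<kappa> f q = q" using assms(3) id by blast+
    then show ?thesis using True by (auto intro: equiv_cl_base)
  next
    case False
    with that obtain x y where "(x, y) \<in> E" "p = \<kappa> x" "q = \<kappa> y" by auto
    then show ?thesis using equiv_cl_embed[OF r(3)] by (simp add: lift_apply[OF assms(1)])
  qed
  have P: "(p, q) \<in> equiv_cl (R \<union> map_prod \<kappa> \<kappa> ` E)" if "(p, q) \<in> R \<union> map_prod \<kappa> \<kappa> ` P" for p q
  proof (cases "(p, q) \<in> R")
    case True
    then show ?thesis by (intro equiv_cl_base UnI1)
  next
    case False
    with that obtain x y where xy: "(x, y) \<in> P" "p = \<kappa> x" "q = \<kappa> y" by auto
    have "(x, y) \<in> equiv_cl E" by (rule subsetD[OF r(4) xy(1)])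
    then show ?thesis unfolding xy(2,3) by (rule equiv_cl_embed)
  qed
  have self: "(p, lift \<kappa> f p) \<in> equiv_cl (R \<union> map_prod \<kappa> \<kappa> ` E)" for p
  proof (cases "p \<in> range \<kappa>")
    case True
    then obtain j where j: "p = \<kappa> j" by blast
    show ?thesis using equiv_cl_embed[OF r(5)] by (simp add: j lift_apply[OF assms(1)])
  qed (simp add: lift_def)
  have F: "p \<notin> \<kappa> ` I \<and> q \<notin> \<kappa> ` I" if "(p, q) \<in> R \<union> map_prod \<kappa> \<kappa> ` P" for p q
  proof (cases "(p, q) \<in> R")
    case True
    then show ?thesis using assms(3) by blast
  next
    case False
    with that obtain x y where xy: "(x, y) \<in> P" "p = \<kappa> x" "q = \<kappa> y" by auto
    have "x \<notin> I" "y \<notin> I" using subsetD[OF r(6) xy(1)] by auto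
    then show ?thesis unfolding xy(2,3) using inj_image_mem_iff[OF assms(1)] by simp
  qed
  show ?thesis
    by (rule retractI) (use F range id E P self in \<open>simp_all only: Compl_iff not_False_eq_True simp_thms\<close>)
qed

definition block_point :: "nat \<Rightarrow> nat \<Rightarrow> nat \<Rightarrow> nat \<Rightarrow> point" where
  "block_point i d L j = (L + j div d, i + j mod d)"

definition outer_arcs :: "nat \<Rightarrow> nat \<Rightarrow> nat \<Rightarrow> nat \<Rightarrow> nat \<Rightarrow> braid_word \<Rightarrow> nat set \<Rightarrow> (point \<times> point) set" where
  "outer_arcs n i d L k w s = closure_arcs n w \<union> (\<Union>t\<in>{..<length w} - {L..<L + k}. level_arcs n w s t) \<union>
    (\<Union>t\<in>{L..<L + k}. (\<lambda>p. ((t, p), (Suc t, p))) ` ({1..n} - {i..<i + d}))"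

lemma block_point_apply: "c < d \<Longrightarrow> block_point i d L (t * d + c) = (L + t, i + c)"
  by (simp add: block_point_def)

lemma inj_block_point:
  assumes "0 < d"
  shows "inj (block_point i d L)"
proof (rule injI)
  fix x y assume "block_point i d L x = block_point i d L y"
  then have "x div d = y div d" "x mod d = y mod d" by (auto simp: block_point_def)
  then show "x = y" by (metis div_mult_mod_eq)
qed

lemma level_arcs_block:
  assumes "i \<le> fst (w ! (L + t))" "Suc (fst (w ! (L + t))) < i + d" "1 \<le> i" "i + d \<le> Suc n"
  shows "level_arcs n w s (L + t) = (\<lambda>p. ((L + t, p), (Suc (L + t), p))) ` ({1..n} - {i..<i + d}) \<union>
    map_prod (block_point i d L) (block_point i d L) `
      set (resolve_letter d (fst (w ! (L + t)) - i) (oriented_at w s (L + t)) t)"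
proof -
  define k where "k = fst (w ! (L + t)) - i"
  have k: "fst (w ! (L + t)) = i + k" "Suc k < d" using assms by (auto simp: k_def)
  have cols: "{1..n} - X = ({1..n} - {i..<i + d}) \<union> (\<lambda>c. i + c) ` {c \<in> {..<d}. i + c \<notin> X}"
    if "X \<subseteq> {i..<i + d}" for X
  proof -
    have "(\<lambda>c. i + c) ` {c \<in> {..<d}. i + c \<notin> X} = {i..<i + d} - X"
    proof (intro equalityI subsetI)
      fix x assume x: "x \<in> {i..<i + d} - X"
      then have "x - i \<in> {c \<in> {..<d}. i + c \<notin> X}" by auto
      then show "x \<in> (\<lambda>c. i + c) ` {c \<in> {..<d}. i + c \<notin> X}"
        using x by (intro image_eqI[of _ _ "x - i"]) auto
    qed auto
    then show ?thesis using that assms(3,4) by auto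
  qed
  have kap: "map_prod (block_point i d L) (block_point i d L) ` (\<lambda>c. (t * d + c, Suc t * d + c)) ` A
      = (\<lambda>p. ((L + t, p), (Suc (L + t), p))) ` (\<lambda>c. i + c) ` A" if "A \<subseteq> {..<d}" for A
  proof -
    have "map_prod (block_point i d L) (block_point i d L) (t * d + c, Suc t * d + c) = ((L + t, i + c), (Suc (L + t), i + c))"
      if "c \<in> A" for c
    proof -
      have "c < d" using that \<open>A \<subseteq> {..<d}\<close> by auto
      then show ?thesis
        using block_point_apply[of c d i L t] block_point_apply[of c d i L "Suc t"] by simp
    qed
    then show ?thesis unfolding image_image by (rule image_cong[OF HOL.refl])
  qed
  have pts: "block_point i d L (t * d + k) = (L + t, i + k)" "block_point i d L (t * d + Suc k) = (L + t, Suc (i + k))"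
    "block_point i d L (Suc t * d + k) = (Suc (L + t), i + k)" "block_point i d L (Suc t * d + Suc k) = (Suc (L + t), Suc (i + k))"
    using block_point_apply[of k d i L t] block_point_apply[of k d i L "Suc t"]
      block_point_apply[of "Suc k" d i L t] block_point_apply[of "Suc k" d i L "Suc t"] k by simp_all
  have set_image: "{((L + t, p), (Suc (L + t), p)) | p. p \<in> X} = (\<lambda>p. ((L + t, p), (Suc (L + t), p))) ` X" for X
    by auto
  show ?thesis
  proof (cases "oriented_at w s (L + t)")
    case True
    have 1: "{1..n} = ({1..n} - {i..<i + d}) \<union> (\<lambda>c. i + c) ` {..<d}"
      using cols[of "{}"] by (simp add: lessThan_def)
    have 2: "set [0..<d] = {..<d}" by auto
    have "level_arcs n w s (L + t) = (\<lambda>p. ((L + t, p), (Suc (L + t), p))) ` {1..n}"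
      using True unfolding level_arcs_def Let_def set_image by simp
    also have "\<dots> = (\<lambda>p. ((L + t, p), (Suc (L + t), p))) ` ({1..n} - {i..<i + d}) \<union>
        (\<lambda>p. ((L + t, p), (Suc (L + t), p))) ` (\<lambda>c. i + c) ` {..<d}"
      by (subst 1) (rule image_Un)
    finally show ?thesis
      unfolding resolve_letter_def if_P[OF True] set_map 2 kap[OF order_refl] .
  next
    case False
    let ?A = "{c \<in> {..<d}. c \<noteq> k \<and> c \<noteq> Suc k}"
    have 1: "{1..n} - {i + k, i + k + 1} = ({1..n} - {i..<i + d}) \<union> (\<lambda>c. i + c) ` ?A"
      using cols[of "{i + k, i + k + 1}"] k(2) by simp
    have 2: "set (filter (\<lambda>c. c \<noteq> k \<and> c \<noteq> Suc k) [0..<d]) = ?A" by auto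
    have 3: "?A \<subseteq> {..<d}" by auto
    show ?thesis
      unfolding level_arcs_def resolve_letter_def Let_def set_image k(1) add_diff_cancel_left' 1
      unfolding if_not_P[OF False] set_append set_map 2 image_Un kap[OF 3] list.set image_insert map_prod_simp pts
        image_empty
      by (simp add: Un_assoc)
  qed
qed

lemma arcs_block:
  assumes "\<And>t. t < k \<Longrightarrow> i \<le> fst (w ! (L + t)) \<and> Suc (fst (w ! (L + t))) < i + d" "1 \<le> i" "i + d \<le> Suc n"
    "L + k \<le> length w" "length ks = k" "\<And>t. t < k \<Longrightarrow> ks ! t = fst (w ! (L + t)) - i"
    "\<And>t. t < k \<Longrightarrow> es ! t = oriented_at w s (L + t)"
  shows "arcs n w s = outer_arcs n i d L k w s \<union>
    map_prod (block_point i d L) (block_point i d L) ` set (resolve d ks es)"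
proof -
  let ?m = "\<lambda>X. map_prod (block_point i d L) (block_point i d L) ` X"
  let ?S = "\<lambda>t. (\<lambda>p. ((t, p), (Suc t, p))) ` ({1..n} - {i..<i + d})"
  have "{..<length w} = ({..<length w} - {L..<L + k}) \<union> {L..<L + k}"
    using assms(4) by auto
  then have 1: "(\<Union>t<length w. level_arcs n w s t) = (\<Union>t\<in>{..<length w} - {L..<L + k}. level_arcs n w s t) \<union>
      (\<Union>t\<in>{L..<L + k}. level_arcs n w s t)"
    by blast
  have im: "{L..<L + k} = (\<lambda>t. L + t) ` {0..<k}"
    by (simp only: image_add_atLeastLessThan add_0 add.commute[of L k])
  have 2: "(\<Union>t\<in>{L..<L + k}. level_arcs n w s t) =
      (\<Union>t\<in>{0..<k}. ?S (L + t) \<union> ?m (set (resolve_letter d (ks ! t) (es ! t) t)))"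
    unfolding im image_image
    using level_arcs_block[OF _ _ assms(2,3)] assms(1,6,7) by (intro SUP_cong) simp_all
  have 3: "?m (set (resolve d ks es)) = (\<Union>t\<in>{0..<k}. ?m (set (resolve_letter d (ks ! t) (es ! t) t)))"
    by (simp add: resolve_def assms(5) image_UN)
  have 4: "(\<Union>t\<in>{L..<L + k}. ?S t) = (\<Union>t\<in>{0..<k}. ?S (L + t))"
    unfolding im image_image ..
  show ?thesis
    unfolding arcs_def outer_arcs_def 1 2 3 4 UN_Un_distrib by blast
qed

definition check_links :: "nat \<Rightarrow> (nat \<times> nat) list \<Rightarrow> (nat \<times> nat) list \<Rightarrow> bool" where
  "check_links N E ps \<longleftrightarrow> list_all (\<lambda>(x, y). x < N \<and> y < N) E \<and>
    (let L = labels N E in list_all (\<lambda>(x, y). x < N \<and> y < N \<and> L ! x = L ! y) ps)"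

lemma check_links_sound:
  assumes "check_links N E ps" "(x, y) \<in> set ps"
  shows "(x, y) \<in> equiv_cl (set E)"
proof -
  have E: "\<forall>(x, y)\<in>set E. x < N \<and> y < N"
    using assms(1) unfolding check_links_def list_all_iff by (elim conjE)
  have "\<forall>(x, y)\<in>set ps. x < N \<and> y < N \<and> labels N E ! x = labels N E ! y"
    using assms(1) unfolding check_links_def list_all_iff Let_def by (elim conjE)
  from bspec[OF this assms(2)] show ?thesis
    using labels_sound[OF E, of x y] by blast
qed

lemma rename_psi_poly:
  assumes "\<And>p. p \<in> {1..n} \<Longrightarrow> \<phi> (0, p) = (0, p)"
  shows "rename \<phi> (psi_poly n) = psi_poly n"
proof -
  have "rename \<phi> (\<Prod>p\<in>A. var (0, p)) = (\<Prod>p\<in>A. var (0, p))" if "A \<subseteq> {1..n}" for A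
    using finite_subset[OF that finite_atLeastAtMost] that
    by induction (use assms in simp_all)
  then show ?thesis unfolding psi_poly_def by blast
qed

definition mark_links :: "nat \<times> nat \<Rightarrow> nat \<times> nat \<Rightarrow> (nat \<times> nat) list" where
  "mark_links p m = [(fst p, fst m), (snd p, snd m)]"

locale word_block =
  fixes n i d L k :: nat and w :: braid_word and ks :: "nat list"
  assumes w: "w \<in> braid_words n"
    and letters: "\<And>t. t < k \<Longrightarrow> i \<le> fst (w ! (L + t)) \<and> Suc (fst (w ! (L + t))) < i + d"
    and i: "1 \<le> i" "i + d \<le> Suc n" and len: "L + k \<le> length w"
    and d: "0 < d" and k: "0 < k"
    and ks: "length ks = k" "\<And>t. t < k \<Longrightarrow> ks ! t = fst (w ! (L + t)) - i"
begin

abbreviation "\<kappa> \<equiv> block_point i d L"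
abbreviation "pt \<equiv> map_prod \<kappa> \<kappa>"
abbreviation "others \<equiv> {..<length w} - {L..<L + k}"
text \<open>The numbers from \<open>d\<close> to \<open>k * d - 1\<close> belong to the levels
  strictly between the bottom and the top of the block; all other points of the diagram are common
  to every word that a local move compares at this block.\<close>

abbreviation "frame \<equiv> - \<kappa> ` {d..<k * d}"

definition joined :: "(nat \<times> nat) list \<Rightarrow> nat set \<Rightarrow> (point \<times> point) set" where
  "joined P u = outer_arcs n i d L k w u \<union> map_prod \<kappa> \<kappa> ` set P"

definition state :: "nat set \<Rightarrow> (nat \<times> nat) list" where
  "state x = resolve d ks (map (\<lambda>t. snd (w ! (L + t)) \<noteq> (L + t \<in> x)) [0..<k])"

lemma inj_kappa: "inj \<kappa>"
  by (rule inj_block_point[OF d])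

lemma arcs_state:
  assumes "u \<subseteq> others" "x \<subseteq> {L..<L + k}"
  shows "arcs n w (u \<union> x) = joined (state x) u"
proof -
  have "t \<in> u \<union> x \<longleftrightarrow> t \<in> u" if "t \<in> others" for t
    using that assms by auto
  then have "level_arcs n w (u \<union> x) t = level_arcs n w u t" if "t \<in> others" for t
    using that by (simp add: level_arcs_def oriented_at_def)
  then have 1: "outer_arcs n i d L k w (u \<union> x) = outer_arcs n i d L k w u"
    unfolding outer_arcs_def by simp
  have 2: "L + t \<in> u \<union> x \<longleftrightarrow> L + t \<in> x" if "t < k" for t
    using assms(1) that by auto
  have "arcs n w (u \<union> x) = outer_arcs n i d L k w (u \<union> x) \<union> map_prod \<kappa> \<kappa> ` set (state x)"
    unfolding state_def using letters i len ks 2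
    by (intro arcs_block) (auto simp: oriented_at_def)
  then show ?thesis
    unfolding joined_def 1 .
qed

lemma kappa_interior: "(l, p) \<in> \<kappa> ` {d..<k * d} \<longleftrightarrow> L < l \<and> l < L + k \<and> i \<le> p \<and> p < i + d"
proof
  assume "(l, p) \<in> \<kappa> ` {d..<k * d}"
  then obtain j where j: "d \<le> j" "j < k * d" "l = L + j div d" "p = i + j mod d"
    by (auto simp: block_point_def)
  have "0 < j div d" using j(1) d by (simp add: div_greater_zero_iff)
  moreover have "j div d < k" using j(2) by (simp add: less_mult_imp_div_less)
  ultimately show "L < l \<and> l < L + k \<and> i \<le> p \<and> p < i + d"
    using j(3,4) d by simp
next
  assume *: "L < l \<and> l < L + k \<and> i \<le> p \<and> p < i + d"
  define t c where "t = l - L" and "c = p - i"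
  have tc: "0 < t" "t < k" "c < d" "l = L + t" "p = i + c" using * by (auto simp: t_def c_def)
  have "Suc t * d \<le> k * d" using tc(2) by (intro mult_le_mono1) simp
  moreover have "d \<le> t * d" using tc(1) by simp
  ultimately have "t * d + c \<in> {d..<k * d}" using tc(3) by (simp only: atLeastLessThan_iff mult_Suc) linarith
  moreover have "\<kappa> (t * d + c) = (l, p)"
    using tc block_point_apply[of c d i L t] by simp
  ultimately show "(l, p) \<in> \<kappa> ` {d..<k * d}" by (metis image_eqI)
qed

lemma outer_arcs_frame: "outer_arcs n i d L k w u \<subseteq> frame \<times> frame"
proof -
  have out: "(l, p) \<in> frame" if "l \<le> L \<or> L + k \<le> l \<or> p < i \<or> i + d \<le> p" for l p
    using that unfolding Compl_iff kappa_interior by linarith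
  have "closure_arcs n w \<subseteq> frame \<times> frame"
    unfolding closure_arcs_def using len out by blast
  moreover have "level_arcs n w u t \<subseteq> frame \<times> frame" if "t \<in> others" for t
  proof -
    have "t \<le> L \<and> Suc t \<le> L \<or> L + k \<le> t \<and> L + k \<le> Suc t" using that by auto
    then have "(t, p) \<in> frame \<and> (Suc t, p) \<in> frame" for p using out by blast
    then show ?thesis unfolding level_arcs_def Let_def by auto
  qed
  moreover have "(\<lambda>p. ((t, p), (Suc t, p))) ` ({1..n} - {i..<i + d}) \<subseteq> frame \<times> frame" for t
  proof -
    have "(t, p) \<in> frame \<and> (Suc t, p) \<in> frame" if "p \<in> {1..n} - {i..<i + d}" for p
    proof -
      have "p < i \<or> i + d \<le> p" using that by auto
      then show ?thesis using out by blast
    qed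
    then show ?thesis by blast
  qed
  ultimately show ?thesis
    unfolding outer_arcs_def by blast
qed

lemma marks_frame: "t \<in> others \<Longrightarrow> mark_a w t \<in> frame \<and> mark_b w t \<in> frame"
  unfolding Compl_iff kappa_interior by auto

lemma kappa_frame: "\<kappa> j \<in> frame \<longleftrightarrow> j \<notin> {d..<k * d}"
  using inj_image_mem_iff[OF inj_kappa] by simp

lemma marks_block:
  assumes "t < k"
  shows "mark_a w (L + t) = \<kappa> (t * d + ks ! t)" "mark_b w (L + t) = \<kappa> (Suc t * d + Suc (ks ! t))"
  using letters[OF assms] ks(2)[OF assms] block_point_apply[of "ks ! t" d i L t]
    block_point_apply[of "Suc (ks ! t)" d i L "Suc t"]
  by auto

lemma state_retract:
  assumes "u \<subseteq> others" "x \<subseteq> {L..<L + k}" "check_retract N I (state x) P" "set I \<subseteq> {d..<k * d}"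
  shows "retract (- \<kappa> ` set I) (lift \<kappa> (rep_map N I (state x))) (arcs n w (u \<union> x)) (joined P u)"
  unfolding arcs_state[OF assms(1,2)] unfolding joined_def
proof (rule lift_retract[OF inj_kappa check_retract_sound(1)[OF assms(3)]])
  have "frame \<subseteq> - \<kappa> ` set I" using assms(4) by blast
  then show "outer_arcs n i d L k w u \<subseteq> (- \<kappa> ` set I) \<times> (- \<kappa> ` set I)"
    using outer_arcs_frame by blast
qed

lemma joined_link:
  assumes "check_links N P ps" "(x, y) \<in> set ps"
  shows "(\<kappa> x, \<kappa> y) \<in> equiv_cl (joined P u)"
  unfolding joined_def by (rule equiv_cl_embed[OF check_links_sound[OF assms]])

lemma state_link:
  assumes "u \<subseteq> others" "x \<subseteq> {L..<L + k}" "check_links N (state x) ps" "(p, q) \<in> set ps"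
  shows "(\<kappa> p, \<kappa> q) \<in> equiv_cl (arcs n w (u \<union> x))"
  unfolding arcs_state[OF assms(1,2)] by (rule joined_link[OF assms(3,4)])

lemma same:
  assumes "u \<subseteq> others" "x \<subseteq> {L..<L + k}" "y \<subseteq> {L..<L + k}" "check_links N (state x) ps" "check_links N (state y) qs"
    "set (mark_links p m) \<subseteq> set ps" "set (mark_links p m) \<subseteq> set qs"
  shows "same_marks (arcs n w (u \<union> x)) (arcs n w (u \<union> y)) (\<kappa> (fst p)) (\<kappa> (snd p)) (fst (pt m)) (snd (pt m))"
  using state_link[OF assms(1,2,4), of "fst p" "fst m"] state_link[OF assms(1,2,4), of "snd p" "snd m"]
    state_link[OF assms(1,3,5), of "fst p" "fst m"] state_link[OF assms(1,3,5), of "snd p" "snd m"] assms(6,7)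
  unfolding same_marks_def by (simp add: mark_links_def)

end

section \<open>Invariance under the braid relation\<close>

text \<open>Evaluates the hypotheses of \<open>scoeff_roundtrip\<close>; the second alternative
  covers marks \<open>m'\<close> listed in the opposite order, which have the same
  coefficient.\<close>

definition check_roundtrip :: "(nat \<times> nat) list \<Rightarrow> (nat \<times> nat) list \<Rightarrow> nat \<times> nat \<Rightarrow> nat \<times> nat \<Rightarrow> bool" where
  "check_roundtrip P Q m m' \<longleftrightarrow>
    check_links 12 P (mark_links m m') \<and> check_links 12 Q (mark_links m (prod.swap m')) \<or>
    check_links 12 P (mark_links m (prod.swap m')) \<and> check_links 12 Q (mark_links m m')"

definition r3_state :: "nat \<Rightarrow> nat \<Rightarrow> bool \<Rightarrow> bool \<Rightarrow> bool \<Rightarrow> (nat \<times> nat) list" where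
  "r3_state k0 k1 x y z = resolve 3 [k0, k1, k0] [\<not> x, \<not> y, \<not> z]"

text \<open>The block has four levels of three points, numbered 0 to 11, with interior 3 to 8;
  \<alpha>, \<beta>, \<gamma> are the marks of the crossings. The point 4, in the middle of the
  second level, lies on the closed circle for both words, so it is kept where the first and third
  crossings are turned.\<close>

definition r3_check :: "nat \<Rightarrow> nat \<Rightarrow> (nat \<times> nat) list \<Rightarrow> (nat \<times> nat) list \<Rightarrow> (nat \<times> nat) list \<Rightarrow>
    (nat \<times> nat) list \<Rightarrow> (nat \<times> nat) list \<Rightarrow> nat \<times> nat \<Rightarrow> nat \<times> nat \<Rightarrow> nat \<times> nat \<Rightarrow> nat \<times> nat \<Rightarrow> nat \<times> nat \<Rightarrow>
    nat \<times> nat \<Rightarrow> nat \<times> nat \<Rightarrow> nat \<times> nat \<Rightarrow> nat \<Rightarrow> nat \<Rightarrow> bool" where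
  "r3_check k0 k1 PI P1 P2 PD PE m1 m2 mD1 mE1 mD2 mE2 mD mE q q' \<longleftrightarrow>
    (let \<alpha> = (k0, 4 + k0); \<beta> = (3 + k1, 7 + k1); \<gamma> = (6 + k0, 10 + k0); S = r3_state k0 k1 in
      check_retract 12 [3, 4, 5, 6, 7, 8] (S False False False) PI \<and>
      check_retract 12 [3, 4, 5, 6, 7, 8] (S True False False) P1 \<and>
      check_retract 12 [3, 4, 5, 6, 7, 8] (S False True False) P2 \<and>
      check_retract 12 [3, 4, 5, 6, 7, 8] (S False False True) P1 \<and>
      check_retract 12 [3, 4, 5, 6, 7, 8] (S True True False) PD \<and>
      check_retract 12 [3, 5, 6, 7, 8] (S True False True) P1 \<and>
      check_retract 12 [3, 4, 5, 6, 7, 8] (S False True True) PE \<and>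
      check_retract 12 [3, 4, 5, 6, 7, 8] (S True True True) P1 \<and>
      check_links 12 (S False False False) (mark_links \<alpha> m1 @ mark_links \<beta> m2 @ mark_links \<gamma> m1) \<and>
      check_links 12 (S True False False) (mark_links \<alpha> m1 @ mark_links \<beta> mD1 @ [\<gamma>]) \<and>
      check_links 12 (S False True False) (mark_links \<alpha> mD2 @ mark_links \<beta> m2 @ mark_links \<gamma> mE2) \<and>
      check_links 12 (S False False True) (mark_links \<gamma> m1 @ mark_links \<beta> mE1 @ [\<alpha>]) \<and>
      check_links 12 (S True True False) (mark_links \<alpha> mD2 @ mark_links \<beta> mD1 @ mark_links \<gamma> mD) \<and>
      check_links 12 (S True False True) ([(fst \<gamma>, 4), (snd \<gamma>, q), (snd \<alpha>, 4), (fst \<alpha>, q')]) \<and>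
      check_links 12 (S False True True) (mark_links \<alpha> mE @ mark_links \<beta> mE1 @ mark_links \<gamma> mE2) \<and>
      check_links 12 (S True True True) (mark_links \<alpha> mE @ mark_links \<gamma> mD) \<and>
      (rep_map 12 [3, 5, 6, 7, 8] (S True False True) (fst \<beta>) = 4) \<noteq> (rep_map 12 [3, 5, 6, 7, 8] (S True False True) (snd \<beta>) = 4) \<and>
      check_roundtrip P1 PD mD1 mD \<and>
      check_roundtrip P1 PE mE1 mE \<and>
      (check_links 12 P1 [(fst mD1, q), (snd mD1, snd mE1), (fst mE1, q')] \<or>
      check_links 12 P1 [(snd mD1, q), (fst mD1, fst mE1), (snd mE1, q')]) \<and>
      list_all (\<lambda>(x, y). x \<notin> {3..<9} \<and> y \<notin> {3..<9}) [m1, m2, mD1, mE1, mD2, mE2, mD, mE, (q, q')])"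

locale r3_block = word_block n i 3 L 3 w "[k0, k1, k0]" for n i L w k0 k1 +
  fixes PI P1 P2 PD PE :: "(nat \<times> nat) list" and m1 m2 mD1 mE1 mD2 mE2 mD mE :: "nat \<times> nat" and q q' :: nat
  assumes positive: "\<And>t. t < 3 \<Longrightarrow> snd (w ! (L + t))"
    and check: "r3_check k0 k1 PI P1 P2 PD PE m1 m2 mD1 mE1 mD2 mE2 mD mE q q'"
begin

abbreviation "\<alpha> \<equiv> (k0, 4 + k0)"
abbreviation "\<beta> \<equiv> (3 + k1, 7 + k1)"
abbreviation "\<gamma> \<equiv> (6 + k0, 10 + k0)"

lemma state_eq: "state x = r3_state k0 k1 (L \<in> x) (L + 1 \<in> x) (L + 2 \<in> x)"
  using positive[of 0] positive[of 1] positive[of 2]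
  by (simp add: state_def r3_state_def upt_rec)

lemma marks:
  "mark_a w L = \<kappa> (fst \<alpha>)" "mark_b w L = \<kappa> (snd \<alpha>)"
  "mark_a w (L + 1) = \<kappa> (fst \<beta>)" "mark_b w (L + 1) = \<kappa> (snd \<beta>)"
  "mark_a w (L + 2) = \<kappa> (fst \<gamma>)" "mark_b w (L + 2) = \<kappa> (snd \<gamma>)"
  using marks_block[of 0] marks_block[of 1] marks_block[of 2] by simp_all

lemma c0: "check_retract 12 [3, 4, 5, 6, 7, 8] (state {}) PI"
proof -
  have "check_retract 12 [3, 4, 5, 6, 7, 8] (r3_state k0 k1 False False False) PI"
    using check unfolding r3_check_def Let_def by (elim conjE)
  then show ?thesis by (simp add: state_eq)
qed

lemma l0: "check_links 12 (state {}) (mark_links \<alpha> m1 @ mark_links \<beta> m2 @ mark_links \<gamma> m1)"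
proof -
  have "check_links 12 (r3_state k0 k1 False False False) (mark_links \<alpha> m1 @ mark_links \<beta> m2 @ mark_links \<gamma> m1)"
    using check unfolding r3_check_def Let_def by (elim conjE)
  then show ?thesis by (simp add: state_eq)
qed

lemma cA: "check_retract 12 [3, 4, 5, 6, 7, 8] (state {L}) P1"
proof -
  have "check_retract 12 [3, 4, 5, 6, 7, 8] (r3_state k0 k1 True False False) P1"
    using check unfolding r3_check_def Let_def by (elim conjE)
  then show ?thesis by (simp add: state_eq)
qed

lemma lA: "check_links 12 (state {L}) (mark_links \<alpha> m1 @ mark_links \<beta> mD1 @ [\<gamma>])"
proof -
  have "check_links 12 (r3_state k0 k1 True False False) (mark_links \<alpha> m1 @ mark_links \<beta> mD1 @ [\<gamma>])"
    using check unfolding r3_check_def Let_def by (elim conjE)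
  then show ?thesis by (simp add: state_eq)
qed

lemma cB: "check_retract 12 [3, 4, 5, 6, 7, 8] (state {L + 1}) P2"
proof -
  have "check_retract 12 [3, 4, 5, 6, 7, 8] (r3_state k0 k1 False True False) P2"
    using check unfolding r3_check_def Let_def by (elim conjE)
  then show ?thesis by (simp add: state_eq)
qed

lemma lB: "check_links 12 (state {L + 1}) (mark_links \<alpha> mD2 @ mark_links \<beta> m2 @ mark_links \<gamma> mE2)"
proof -
  have "check_links 12 (r3_state k0 k1 False True False) (mark_links \<alpha> mD2 @ mark_links \<beta> m2 @ mark_links \<gamma> mE2)"
    using check unfolding r3_check_def Let_def by (elim conjE)
  then show ?thesis by (simp add: state_eq)
qed

lemma cC: "check_retract 12 [3, 4, 5, 6, 7, 8] (state {L + 2}) P1"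
proof -
  have "check_retract 12 [3, 4, 5, 6, 7, 8] (r3_state k0 k1 False False True) P1"
    using check unfolding r3_check_def Let_def by (elim conjE)
  then show ?thesis by (simp add: state_eq)
qed

lemma lC: "check_links 12 (state {L + 2}) (mark_links \<gamma> m1 @ mark_links \<beta> mE1 @ [\<alpha>])"
proof -
  have "check_links 12 (r3_state k0 k1 False False True) (mark_links \<gamma> m1 @ mark_links \<beta> mE1 @ [\<alpha>])"
    using check unfolding r3_check_def Let_def by (elim conjE)
  then show ?thesis by (simp add: state_eq)
qed

lemma cAB: "check_retract 12 [3, 4, 5, 6, 7, 8] (state {L, L + 1}) PD"
proof -
  have "check_retract 12 [3, 4, 5, 6, 7, 8] (r3_state k0 k1 True True False) PD"
    using check unfolding r3_check_def Let_def by (elim conjE)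
  then show ?thesis by (simp add: state_eq)
qed

lemma lAB: "check_links 12 (state {L, L + 1}) (mark_links \<alpha> mD2 @ mark_links \<beta> mD1 @ mark_links \<gamma> mD)"
proof -
  have "check_links 12 (r3_state k0 k1 True True False) (mark_links \<alpha> mD2 @ mark_links \<beta> mD1 @ mark_links \<gamma> mD)"
    using check unfolding r3_check_def Let_def by (elim conjE)
  then show ?thesis by (simp add: state_eq)
qed

lemma cAC: "check_retract 12 [3, 5, 6, 7, 8] (state {L, L + 2}) P1"
proof -
  have "check_retract 12 [3, 5, 6, 7, 8] (r3_state k0 k1 True False True) P1"
    using check unfolding r3_check_def Let_def by (elim conjE)
  then show ?thesis by (simp add: state_eq)
qed

lemma lAC: "check_links 12 (state {L, L + 2}) ([(fst \<gamma>, 4), (snd \<gamma>, q), (snd \<alpha>, 4), (fst \<alpha>, q')])"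
proof -
  have "check_links 12 (r3_state k0 k1 True False True) ([(fst \<gamma>, 4), (snd \<gamma>, q), (snd \<alpha>, 4), (fst \<alpha>, q')])"
    using check unfolding r3_check_def Let_def by (elim conjE)
  then show ?thesis by (simp add: state_eq)
qed

lemma cBC: "check_retract 12 [3, 4, 5, 6, 7, 8] (state {L + 1, L + 2}) PE"
proof -
  have "check_retract 12 [3, 4, 5, 6, 7, 8] (r3_state k0 k1 False True True) PE"
    using check unfolding r3_check_def Let_def by (elim conjE)
  then show ?thesis by (simp add: state_eq)
qed

lemma lBC: "check_links 12 (state {L + 1, L + 2}) (mark_links \<alpha> mE @ mark_links \<beta> mE1 @ mark_links \<gamma> mE2)"
proof -
  have "check_links 12 (r3_state k0 k1 False True True) (mark_links \<alpha> mE @ mark_links \<beta> mE1 @ mark_links \<gamma> mE2)"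
    using check unfolding r3_check_def Let_def by (elim conjE)
  then show ?thesis by (simp add: state_eq)
qed

lemma cABC: "check_retract 12 [3, 4, 5, 6, 7, 8] (state {L, L + 1, L + 2}) P1"
proof -
  have "check_retract 12 [3, 4, 5, 6, 7, 8] (r3_state k0 k1 True True True) P1"
    using check unfolding r3_check_def Let_def by (elim conjE)
  then show ?thesis by (simp add: state_eq)
qed

lemma lABC: "check_links 12 (state {L, L + 1, L + 2}) (mark_links \<alpha> mE @ mark_links \<gamma> mD)"
proof -
  have "check_links 12 (r3_state k0 k1 True True True) (mark_links \<alpha> mE @ mark_links \<gamma> mD)"
    using check unfolding r3_check_def Let_def by (elim conjE)
  then show ?thesis by (simp add: state_eq)
qed

lemma frame_marks: "{pt m1, pt m2, pt mD1, pt mE1, pt mD2, pt mE2, pt mD, pt mE} \<subseteq> frame \<times> frame"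
  "\<kappa> q \<in> frame" "\<kappa> q' \<in> frame"
proof -
  have "list_all (\<lambda>(x, y). x \<notin> {3..<9} \<and> y \<notin> {3..<9}) [m1, m2, mD1, mE1, mD2, mE2, mD, mE, (q, q')]"
    using check unfolding r3_check_def Let_def by (elim conjE)
  then have *: "\<forall>(x, y)\<in>{m1, m2, mD1, mE1, mD2, mE2, mD, mE, (q, q')}. x \<notin> {3..<3 * 3} \<and> y \<notin> {3..<3 * 3}"
    by (simp add: list_all_iff)
  have "pt m \<in> frame \<times> frame" if "m \<in> {m1, m2, mD1, mE1, mD2, mE2, mD, mE, (q, q')}" for m
    using bspec[OF * that] kappa_frame[of "fst m"] kappa_frame[of "snd m"] by (cases m) simp
  note ** = this
  have "pt (q, q') \<in> frame \<times> frame" by (rule **) simp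
  then show "\<kappa> q \<in> frame" "\<kappa> q' \<in> frame" by simp_all
  show "{pt m1, pt m2, pt mD1, pt mE1, pt mD2, pt mE2, pt mD, pt mE} \<subseteq> frame \<times> frame"
    unfolding insert_subset by (intro conjI ** empty_subsetI) simp_all
qed

definition \<phi> :: "nat set \<Rightarrow> point \<Rightarrow> point" where
  "\<phi> x = lift \<kappa> (rep_map 12 (if x = {L, L + 2} then [3, 5, 6, 7, 8] else [3, 4, 5, 6, 7, 8]) (state x))"

lemma interior: "set [3, 4, 5, 6, 7, 8] = {3..<3 * 3 :: nat}"
  by auto

lemma retracts:
  assumes "u \<subseteq> others"
  shows "retract (frame) (\<phi> {}) (arcs n w (u \<union> {})) (joined PI u)"
    "retract (frame) (\<phi> {L}) (arcs n w (u \<union> {L})) (joined P1 u)"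
    "retract (frame) (\<phi> {L + 1}) (arcs n w (u \<union> {L + 1})) (joined P2 u)"
    "retract (frame) (\<phi> {L + 2}) (arcs n w (u \<union> {L + 2})) (joined P1 u)"
    "retract (frame) (\<phi> {L, L + 1}) (arcs n w (u \<union> {L, L + 1})) (joined PD u)"
    "retract (insert (\<kappa> 4) frame) (\<phi> {L, L + 2}) (arcs n w (u \<union> {L, L + 2})) (joined P1 u)"
    "retract (frame) (\<phi> {L + 1, L + 2}) (arcs n w (u \<union> {L + 1, L + 2})) (joined PE u)"
    "retract (frame) (\<phi> {L, L + 1, L + 2}) (arcs n w (u \<union> {L, L + 1, L + 2})) (joined P1 u)"
proof -
  have F: "insert (\<kappa> 4) frame = - \<kappa> ` set [3, 5, 6, 7, 8]"
  proof -
    have set: "{3..<3 * 3} = insert 4 (set [3, 5, 6, 7, 8 :: nat])" by auto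
    have ins: "insert x (- insert x A) = - A" if "x \<notin> A" for x :: point and A using that by blast
    show ?thesis
      unfolding set image_insert by (rule ins) (simp only: inj_image_mem_iff[OF inj_kappa], simp)
  qed
  note r = state_retract[OF assms _ _ equalityD1[OF interior], unfolded interior]
  have "{} \<noteq> {L, L + 2}" by auto
  then show "retract frame (\<phi> {}) (arcs n w (u \<union> {})) (joined PI u)"
    unfolding \<phi>_def by (simp only: if_False) (rule r[OF _ c0], auto)
  have "{L} \<noteq> {L, L + 2}" by auto
  then show "retract frame (\<phi> {L}) (arcs n w (u \<union> {L})) (joined P1 u)"
    unfolding \<phi>_def by (simp only: if_False) (rule r[OF _ cA], auto)
  have "{L + 1} \<noteq> {L, L + 2}" by (rule notI, drule equalityD1, simp)
  then show "retract frame (\<phi> {L + 1}) (arcs n w (u \<union> {L + 1})) (joined P2 u)"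
    unfolding \<phi>_def by (simp only: if_False) (rule r[OF _ cB], auto)
  have "{L + 2} \<noteq> {L, L + 2}" by auto
  then show "retract frame (\<phi> {L + 2}) (arcs n w (u \<union> {L + 2})) (joined P1 u)"
    unfolding \<phi>_def by (simp only: if_False) (rule r[OF _ cC], auto)
  have "{L, L + 1} \<noteq> {L, L + 2}" by (rule notI, drule equalityD1, simp)
  then show "retract frame (\<phi> {L, L + 1}) (arcs n w (u \<union> {L, L + 1})) (joined PD u)"
    unfolding \<phi>_def by (simp only: if_False) (rule r[OF _ cAB], auto)
  show "retract (insert (\<kappa> 4) frame) (\<phi> {L, L + 2}) (arcs n w (u \<union> {L, L + 2})) (joined P1 u)"
    unfolding F \<phi>_def if_P[OF HOL.refl] by (rule state_retract[OF assms _ cAC]) auto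
  have "{L + 1, L + 2} \<noteq> {L, L + 2}" by (rule notI, drule equalityD1, simp)
  then show "retract frame (\<phi> {L + 1, L + 2}) (arcs n w (u \<union> {L + 1, L + 2})) (joined PE u)"
    unfolding \<phi>_def by (simp only: if_False) (rule r[OF _ cBC], auto)
  have "{L, L + 1, L + 2} \<noteq> {L, L + 2}" by (rule notI, drule equalityD1, simp)
  then show "retract frame (\<phi> {L, L + 1, L + 2}) (arcs n w (u \<union> {L, L + 1, L + 2})) (joined P1 u)"
    unfolding \<phi>_def by (simp only: if_False) (rule r[OF _ cABC], auto)
qed

sublocale r3_cube others L "L + 1" "L + 2" "arcs n w" "mark_a w" "mark_b w" frame "\<kappa> 4" "joined PI" "joined P1"
  "joined P2" "joined PD" "joined PE" \<phi> "pt m1" "pt m2" "pt mD1" "pt mE1" "pt mD2" "pt mE2" "pt mD" "pt mE"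
  "\<kappa> q" "\<kappa> q'"
proof
  show "Finite_Set.finite others" by simp
  show "L \<notin> others" "L + 1 \<notin> others" "L + 2 \<notin> others" "L \<noteq> L + 1" "L \<noteq> L + 2" "L + 1 \<noteq> L + 2" by auto
  have all: "others \<union> {L, L + 1, L + 2} = {..<length w}"
    using len by auto
  show cube: "saddle_cube (others \<union> {L, L + 1, L + 2}) (arcs n w) (mark_a w) (mark_b w)"
    unfolding all by (rule saddle_cube_arcs[OF w])
  show "\<And>t. t \<in> others \<Longrightarrow> mark_a w t \<in> frame \<and> mark_b w t \<in> frame"
    by (rule marks_frame)
  show "\<kappa> 4 \<notin> frame" unfolding kappa_frame by simp
  show "\<kappa> q \<in> frame" "\<kappa> q' \<in> frame" "{pt m1, pt m2, pt mD1, pt mE1, pt mD2, pt mE2, pt mD, pt mE} \<subseteq> frame \<times> frame"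
    by (rule frame_marks)+
  fix u assume u: "u \<subseteq> others"
  show r0: "retract (frame) (\<phi> {}) (arcs n w (u)) (joined PI u)"
    using retracts(1)[OF u] by simp
  show rA: "retract (frame) (\<phi> {L}) (arcs n w (u \<union> {L})) (joined P1 u)"
    using retracts(2)[OF u] by simp
  show rB: "retract (frame) (\<phi> {L + 1}) (arcs n w (u \<union> {L + 1})) (joined P2 u)"
    using retracts(3)[OF u] by simp
  show rC: "retract (frame) (\<phi> {L + 2}) (arcs n w (u \<union> {L + 2})) (joined P1 u)"
    using retracts(4)[OF u] by simp
  show rAB: "retract (frame) (\<phi> {L, L + 1}) (arcs n w (u \<union> {L, L + 1})) (joined PD u)"
    using retracts(5)[OF u] by simp
  show rAC: "retract (insert (\<kappa> 4) frame) (\<phi> {L, L + 2}) (arcs n w (u \<union> {L, L + 2})) (joined P1 u)"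
    using retracts(6)[OF u] by simp
  show rBC: "retract (frame) (\<phi> {L + 1, L + 2}) (arcs n w (u \<union> {L + 1, L + 2})) (joined PE u)"
    using retracts(7)[OF u] by simp
  show rABC: "retract (frame) (\<phi> {L, L + 1, L + 2}) (arcs n w (u \<union> {L, L + 1, L + 2})) (joined P1 u)"
    using retracts(8)[OF u] by simp
  show s0A: "same_marks (arcs n w (u)) (arcs n w (u \<union> {L})) (mark_a w (L)) (mark_b w (L)) (fst (pt m1)) (snd (pt m1))"
    unfolding marks by (rule same[OF u _ _ l0 lA, unfolded Un_empty_right]) auto
  show s0B: "same_marks (arcs n w (u)) (arcs n w (u \<union> {L + 1})) (mark_a w (L + 1)) (mark_b w (L + 1)) (fst (pt m2)) (snd (pt m2))"
    unfolding marks by (rule same[OF u _ _ l0 lB, unfolded Un_empty_right]) auto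
  show s0C: "same_marks (arcs n w (u)) (arcs n w (u \<union> {L + 2})) (mark_a w (L + 2)) (mark_b w (L + 2)) (fst (pt m1)) (snd (pt m1))"
    unfolding marks by (rule same[OF u _ _ l0 lC, unfolded Un_empty_right]) auto
  show sAAB: "same_marks (arcs n w (u \<union> {L})) (arcs n w (u \<union> {L, L + 1})) (mark_a w (L + 1)) (mark_b w (L + 1)) (fst (pt mD1)) (snd (pt mD1))"
    unfolding marks by (rule same[OF u _ _ lA lAB]) auto
  show sBAB: "same_marks (arcs n w (u \<union> {L + 1})) (arcs n w (u \<union> {L, L + 1})) (mark_a w (L)) (mark_b w (L)) (fst (pt mD2)) (snd (pt mD2))"
    unfolding marks by (rule same[OF u _ _ lB lAB]) auto
  show sBBC: "same_marks (arcs n w (u \<union> {L + 1})) (arcs n w (u \<union> {L + 1, L + 2})) (mark_a w (L + 2)) (mark_b w (L + 2)) (fst (pt mE2)) (snd (pt mE2))"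
    unfolding marks by (rule same[OF u _ _ lB lBC]) auto
  show sCBC: "same_marks (arcs n w (u \<union> {L + 2})) (arcs n w (u \<union> {L + 1, L + 2})) (mark_a w (L + 1)) (mark_b w (L + 1)) (fst (pt mE1)) (snd (pt mE1))"
    unfolding marks by (rule same[OF u _ _ lC lBC]) auto
  show sABABC: "same_marks (arcs n w (u \<union> {L, L + 1})) (arcs n w (u \<union> {L, L + 1, L + 2})) (mark_a w (L + 2)) (mark_b w (L + 2)) (fst (pt mD)) (snd (pt mD))"
    unfolding marks by (rule same[OF u _ _ lAB lABC]) auto
  show sBCABC: "same_marks (arcs n w (u \<union> {L + 1, L + 2})) (arcs n w (u \<union> {L, L + 1, L + 2})) (mark_a w (L)) (mark_b w (L)) (fst (pt mE)) (snd (pt mE))"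
    unfolding marks by (rule same[OF u _ _ lBC lABC]) auto
  show "(mark_a w (L + 2), mark_b w (L + 2)) \<in> equiv_cl (arcs n w (u \<union> {L}))"
    unfolding marks by (rule state_link[OF u _ lA]) auto
  show "(mark_a w L, mark_b w L) \<in> equiv_cl (arcs n w (u \<union> {L + 2}))"
    unfolding marks by (rule state_link[OF u _ lC]) auto
  have *: "(\<kappa> (fst \<gamma>), \<kappa> 4) \<in> equiv_cl (arcs n w (u \<union> {L, L + 2}))" "(\<kappa> (snd \<gamma>), \<kappa> q) \<in> equiv_cl (arcs n w (u \<union> {L, L + 2}))"
    "(\<kappa> (snd \<alpha>), \<kappa> 4) \<in> equiv_cl (arcs n w (u \<union> {L, L + 2}))" "(\<kappa> (fst \<alpha>), \<kappa> q') \<in> equiv_cl (arcs n w (u \<union> {L, L + 2}))"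
    by (rule state_link[OF u _ lAC], (auto)[2])+
  show "(mark_a w (L + 2), \<kappa> 4) \<in> equiv_cl (arcs n w (u \<union> {L, L + 2})) \<and> (mark_b w (L + 2), \<kappa> q) \<in> equiv_cl (arcs n w (u \<union> {L, L + 2}))"
    unfolding marks using * by blast
  show "(mark_b w L, \<kappa> 4) \<in> equiv_cl (arcs n w (u \<union> {L, L + 2})) \<and> (mark_a w L, \<kappa> q') \<in> equiv_cl (arcs n w (u \<union> {L, L + 2}))"
    unfolding marks using * by blast
  \<comment> \<open>The circle of the point 4 is isolated from the frame, and exactly one mark of
    the middle crossing lies on it.\<close>
  show "(mark_a w (L + 1), mark_b w (L + 1)) \<notin> equiv_cl (arcs n w (u \<union> {L, L + 2}))"
  proof
    assume "(mark_a w (L + 1), mark_b w (L + 1)) \<in> equiv_cl (arcs n w (u \<union> {L, L + 2}))"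
    then have "(\<phi> {L, L + 2} (\<kappa> (fst \<beta>)), \<phi> {L, L + 2} (\<kappa> (snd \<beta>))) \<in> equiv_cl (joined P1 u)"
      unfolding retract_iff[OF rAC] marks .
    then have *: "(\<kappa> (rep_map 12 [3, 5, 6, 7, 8] (state {L, L + 2}) (fst \<beta>)), \<kappa> (rep_map 12 [3, 5, 6, 7, 8] (state {L, L + 2}) (snd \<beta>)))
        \<in> equiv_cl (joined P1 u)"
      unfolding \<phi>_def if_P[OF HOL.refl] lift_apply[OF inj_kappa] .
    have "(rep_map 12 [3, 5, 6, 7, 8] (r3_state k0 k1 True False True) (fst \<beta>) = 4) \<noteq>
        (rep_map 12 [3, 5, 6, 7, 8] (r3_state k0 k1 True False True) (snd \<beta>) = 4)"
      using check unfolding r3_check_def Let_def by (elim conjE)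
    then have ne: "(rep_map 12 [3, 5, 6, 7, 8] (state {L, L + 2}) (fst \<beta>) = 4) \<noteq>
        (rep_map 12 [3, 5, 6, 7, 8] (state {L, L + 2}) (snd \<beta>) = 4)"
      by (simp add: state_eq)
    have "joined P1 u \<subseteq> frame \<times> frame"
      using retractD(6)[OF rA] .
    from equiv_cl_outside[OF * this] show False
    proof
      assume "\<kappa> (rep_map 12 [3, 5, 6, 7, 8] (state {L, L + 2}) (fst \<beta>)) = \<kappa> (rep_map 12 [3, 5, 6, 7, 8] (state {L, L + 2}) (snd \<beta>))"
      from injD[OF inj_kappa this] show False using ne by argo
    next
      assume f: "\<kappa> (rep_map 12 [3, 5, 6, 7, 8] (state {L, L + 2}) (fst \<beta>)) \<in> frame \<and>
        \<kappa> (rep_map 12 [3, 5, 6, 7, 8] (state {L, L + 2}) (snd \<beta>)) \<in> frame"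
      have "\<kappa> 4 \<notin> frame" unfolding kappa_frame by simp
      then have "rep_map 12 [3, 5, 6, 7, 8] (state {L, L + 2}) (fst \<beta>) \<noteq> 4" "rep_map 12 [3, 5, 6, 7, 8] (state {L, L + 2}) (snd \<beta>) \<noteq> 4"
        using f by metis+
      then show False using ne by argo
    qed
  qed
  have saddles: "saddle (arcs n w (u \<union> x)) (arcs n w (u \<union> insert t x)) (mark_a w t) (mark_b w t)"
    if "t \<in> {L, L + 1, L + 2}" "x \<subseteq> {L, L + 1, L + 2}" "t \<notin> x" for t x
  proof -
    have "u \<union> x \<subseteq> others \<union> {L, L + 1, L + 2}" "t \<in> others \<union> {L, L + 1, L + 2} - (u \<union> x)"
      using u that by auto
    then have "saddle (arcs n w (u \<union> x)) (arcs n w (insert t (u \<union> x))) (mark_a w t) (mark_b w t)"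
      using cube unfolding saddle_cube_def by blast
    then show ?thesis by simp
  qed
  have roundtrip: "eqm (joined P1 u) (pcoeff (joined P1 u) (pt m) * pcoeff (joined Q u) (pt m')) (var (fst (pt m)) + var (snd (pt m)))"
    if sad: "saddle (joined P1 u) (joined Q u) (fst (pt m)) (snd (pt m))" and c: "check_roundtrip P1 Q m m'" for Q m m'
    using c unfolding check_roundtrip_def
  proof (elim disjE conjE)
    assume c: "check_links 12 P1 (mark_links m m')" "check_links 12 Q (mark_links m (prod.swap m'))"
    show ?thesis
      using sad
      by (rule scoeff_roundtrip) (use joined_link[OF c(1), of _ _ u] joined_link[OF c(2), of _ _ u] in \<open>simp_all add: mark_links_def\<close>)
  next
    assume c: "check_links 12 P1 (mark_links m (prod.swap m'))" "check_links 12 Q (mark_links m m')"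
    show ?thesis
      unfolding scoeff_commute[of "joined Q u" "fst (pt m')"] using sad
      by (rule scoeff_roundtrip) (use joined_link[OF c(1), of _ _ u] joined_link[OF c(2), of _ _ u] in \<open>simp_all add: mark_links_def\<close>)
  qed
  have in_frame: "fst (pt mD1) \<in> frame" "snd (pt mD1) \<in> frame" "fst (pt mE1) \<in> frame" "snd (pt mE1) \<in> frame"
    using frame_marks(1) unfolding insert_subset mem_Times_iff by blast+
  have "saddle (joined P1 u) (joined PD u) (fst (pt mD1)) (snd (pt mD1))"
    using saddles[of "L + 1" "{L}"] by (intro saddle_retract[OF rA rAB _ sAAB] in_frame) (simp_all add: insert_commute)
  moreover have "check_roundtrip P1 PD mD1 mD"
    using check unfolding r3_check_def Let_def by (elim conjE)
  ultimately show "eqm (joined P1 u) (pcoeff (joined P1 u) (pt mD1) * pcoeff (joined PD u) (pt mD)) (var (fst (pt mD1)) + var (snd (pt mD1)))"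
    by (rule roundtrip)
  have "saddle (joined P1 u) (joined PE u) (fst (pt mE1)) (snd (pt mE1))"
    using saddles[of "L + 1" "{L + 2}"] by (intro saddle_retract[OF rC rBC _ sCBC] in_frame) simp_all
  moreover have "check_roundtrip P1 PE mE1 mE"
    using check unfolding r3_check_def Let_def by (elim conjE)
  ultimately show "eqm (joined P1 u) (pcoeff (joined P1 u) (pt mE1) * pcoeff (joined PE u) (pt mE)) (var (fst (pt mE1)) + var (snd (pt mE1)))"
    by (rule roundtrip)
  have cancel: "eqm G (var x + var y + (var x' + var y')) (var r + var r')"
    if "(x, r) \<in> equiv_cl G" "(y, y') \<in> equiv_cl G" "(x', r') \<in> equiv_cl G" for x y x' y' r r' :: point and G
  proof -
    have "var x + var y + (var x' + var y') = (var x + var x') + (var y + var y')" by (simp add: ac_simps)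
    also have "eqm G \<dots> ((var r + var r') + (var y' + var y'))"
      using that by (intro eqm_add eqm_var) auto
    finally show ?thesis by simp
  qed
  have "check_links 12 P1 [(fst mD1, q), (snd mD1, snd mE1), (fst mE1, q')] \<or>
      check_links 12 P1 [(snd mD1, q), (fst mD1, fst mE1), (snd mE1, q')]"
    using check unfolding r3_check_def Let_def by (elim conjE)
  then show "eqm (joined P1 u) (var (fst (pt mD1)) + var (snd (pt mD1)) + (var (fst (pt mE1)) + var (snd (pt mE1)))) (var (\<kappa> q) + var (\<kappa> q'))"
  proof
    assume c: "check_links 12 P1 [(fst mD1, q), (snd mD1, snd mE1), (fst mE1, q')]"
    show ?thesis
      by (rule cancel) (use joined_link[OF c, of _ _ u] in simp_all)
  next
    assume c: "check_links 12 P1 [(snd mD1, q), (fst mD1, fst mE1), (snd mE1, q')]"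
    have "eqm (joined P1 u) (var (snd (pt mD1)) + var (fst (pt mD1)) + (var (snd (pt mE1)) + var (fst (pt mE1)))) (var (\<kappa> q) + var (\<kappa> q'))"
      by (rule cancel) (use joined_link[OF c, of _ _ u] in simp_all)
    then show ?thesis by (simp add: add.commute)
  qed
qed

lemma word_vanishes_iff_core:
  "word_vanishes n w \<longleftrightarrow> r3_core others (mark_a w) (mark_b w) (joined PI) (joined P1) (joined P2) (joined PD) (joined PE)
    (pt m1) (pt m2) (pt mD1) (pt mE1) (pt mD2) (pt mE2) (negatives w) (psi_poly n)"
proof -
  have all: "others \<union> {L, L + 1, L + 2} = {..<length w}"
    using len by auto
  have neg: "negatives w \<subseteq> others"
  proof
    fix t assume t: "t \<in> negatives w"
    have "\<not> (L \<le> t \<and> t < L + 3)"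
    proof
      assume "L \<le> t \<and> t < L + 3"
      then have "t - L < 3" "L + (t - L) = t" by auto
      then show False using positive[of "t - L"] t by (simp add: negatives_def)
    qed
    then show "t \<in> others" using t by (auto simp: negatives_def)
  qed
  have "(0, p) \<in> frame" for p unfolding Compl_iff kappa_interior by simp
  then have psi: "rename (\<phi> {}) (psi_poly n) = psi_poly n"
    using retractD(2)[OF retracts(1)[of "{}"]] by (intro rename_psi_poly) blast
  have "word_vanishes n w \<longleftrightarrow> vanishes (others \<union> {L, L + 1, L + 2}) (arcs n w) (mark_a w) (mark_b w) (negatives w) (psi_poly n)"
    unfolding word_vanishes_def all ..
  then show ?thesis
    by (rule HOL.trans) (rule iffI[OF to_core[OF _ neg psi] from_core[OF _ neg]])
qed

end

lemma edge_sum_cong: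
  assumes "\<And>t. t \<in> u \<Longrightarrow> a t = a' t \<and> b t = b' t"
  shows "edge_sum G a b g u = edge_sum G a' b' g u"
  unfolding edge_sum_def using assms by (intro sum.cong) simp_all

lemma r3_core_cong:
  assumes "\<And>t. t \<in> T \<Longrightarrow> a t = a' t \<and> b t = b' t"
  shows "r3_core T a b = r3_core T a' b'"
proof -
  have *: "edge_sum Q a b h u = edge_sum Q a' b' h u" if "u \<subseteq> T" for Q h u
    using assms that by (intro edge_sum_cong) blast
  have "r3_core T a b QI Q1 Q2 QD QE m1 m2 mD1 mE1 mD2 mE2 u\<^sub>0 \<psi> \<longleftrightarrow>
      r3_core T a' b' QI Q1 Q2 QD QE m1 m2 mD1 mE1 mD2 mE2 u\<^sub>0 \<psi>" for QI Q1 Q2 QD QE m1 m2 mD1 mE1 mD2 mE2 u\<^sub>0 \<psi>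
    unfolding r3_core_def by (simp add: * cong: conj_cong imp_cong)
  then show ?thesis by (intro ext)
qed

lemma nth_block:
  assumes "length l = k" "length l' = k" "t \<notin> {length a..<length a + k}"
  shows "(a @ l @ b) ! t = (a @ l' @ b) ! t"
  using assms by (auto simp: nth_append)

lemma outer_arcs_block_cong:
  assumes "length l = k" "length l' = k"
  shows "outer_arcs n i d (length a) k (a @ l @ b) u = outer_arcs n i d (length a) k (a @ l' @ b) u"
proof -
  have "level_arcs n (a @ l @ b) u t = level_arcs n (a @ l' @ b) u t" if "t \<notin> {length a..<length a + k}" for t
    using nth_block[OF assms that] by (simp add: level_arcs_def oriented_at_def)
  then show ?thesis
    using assms by (simp add: outer_arcs_def closure_arcs_def)
qed

lemma append_block_words:
  "a \<in> braid_words n \<Longrightarrow> l \<in> braid_words n \<Longrightarrow> b \<in> braid_words n \<Longrightarrow> a @ l @ b \<in> braid_words n"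
  by (simp add: braid_words_def)

lemma less_three: "(t :: nat) < 3 \<longleftrightarrow> t = 0 \<or> t = 1 \<or> t = 2"
  by auto

text \<open>After the elimination both words have the same core: the identity, the two turn-backs
  and their two products, the five diagrams of the Temperley-Lieb algebra on three strands, given as
  pairings of the bottom points 0, 1, 2 and the top points 9, 10, 11. The words differ only in which
  turn-back comes first.\<close>

theorem word_vanishes_braid:
  assumes ab: "a \<in> braid_words n" "b \<in> braid_words n" and i: "i \<in> {1..<n}" "i + 1 \<in> {1..<n}"
  shows "word_vanishes n (a @ [(i, True), (i + 1, True), (i, True)] @ b) \<longleftrightarrow>
    word_vanishes n (a @ [(i + 1, True), (i, True), (i + 1, True)] @ b)"
proof -
  let ?l = "[(i, True), (i + 1, True), (i, True)]" and ?l' = "[(i + 1, True), (i, True), (i + 1, True)]"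
  let ?w = "a @ ?l @ b" and ?w' = "a @ ?l' @ b"
  have w: "?w \<in> braid_words n" "?w' \<in> braid_words n"
    using i by (intro append_block_words ab; simp add: braid_words_def)+
  interpret X: r3_block n i "length a" ?w 0 1 "[(0, 9), (1, 10), (2, 11)]" "[(0, 1), (9, 10), (2, 11)]"
    "[(1, 2), (10, 11), (0, 9)]" "[(0, 1), (10, 11), (2, 9)]" "[(1, 2), (9, 10), (0, 11)]"
    "(0, 10)" "(1, 11)" "(9, 11)" "(1, 11)" "(0, 2)" "(0, 10)" "(2, 10)" "(0, 2)" 10 0
  proof
    show "r3_check 0 1 [(0, 9), (1, 10), (2, 11)] [(0, 1), (9, 10), (2, 11)]
      [(1, 2), (10, 11), (0, 9)] [(0, 1), (10, 11), (2, 9)] [(1, 2), (9, 10), (0, 11)]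
      (0, 10) (1, 11) (9, 11) (1, 11) (0, 2) (0, 10) (2, 10) (0, 2) 10 0"
      by code_simp
  qed (use w i in \<open>auto simp: nth_append less_three\<close>)
  \<comment> \<open>The marks of the six core edges are those of the first word in the order of
    \<open>r3_core_swap\<close>, so that the two cores match literally. The marks back to the last
    vertex and the two points beside the circle are specific to this word.\<close>
  interpret Y: r3_block n i "length a" ?w' 1 0 "[(0, 9), (1, 10), (2, 11)]" "[(1, 2), (10, 11), (0, 9)]"
    "[(0, 1), (9, 10), (2, 11)]" "[(1, 2), (9, 10), (0, 11)]" "[(0, 1), (10, 11), (2, 9)]"
    "(1, 11)" "(0, 10)" "(0, 10)" "(0, 2)" "(1, 11)" "(9, 11)" "(9, 11)" "(1, 9)" 11 1
  proof
    show "r3_check 1 0 [(0, 9), (1, 10), (2, 11)] [(1, 2), (10, 11), (0, 9)]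
      [(0, 1), (9, 10), (2, 11)] [(1, 2), (9, 10), (0, 11)] [(0, 1), (10, 11), (2, 9)]
      (1, 11) (0, 10) (0, 10) (0, 2) (1, 11) (9, 11) (9, 11) (1, 9) 11 1"
      by code_simp
  qed (use w i in \<open>auto simp: nth_append less_three\<close>)
  have joined: "X.joined P = Y.joined P" for P
    unfolding X.joined_def Y.joined_def by (intro ext arg_cong2[of _ _ _ _ "(\<union>)"] outer_arcs_block_cong) simp_all
  have marks: "mark_a ?w t = mark_a ?w' t \<and> mark_b ?w t = mark_b ?w' t" if "t \<in> X.others" for t
    using nth_block[of ?l 3 ?l' t a b] that by simp
  have neg: "negatives ?w = negatives ?w'"
    by (auto simp: negatives_def nth_append nth_Cons')
  have len: "length ?w = length ?w'" by simp
  have core: "r3_core X.others (mark_a ?w) (mark_b ?w) = r3_core X.others (mark_a ?w') (mark_b ?w')"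
    by (rule r3_core_cong[OF marks])
  show ?thesis
    unfolding X.word_vanishes_iff_core Y.word_vanishes_iff_core joined neg len[symmetric] core
    by (rule iffI) (erule r3_core_swap)+
qed

section \<open>Invariance under far commutation and cancellation\<close>

text \<open>The point maps \<open>\<phi>\<close> and \<open>\<chi>\<close> need not be inverse to
  each other. It is enough that both carry joined points to joined points and respect the marks:
  then corresponding saddles are of the same kind, and their coefficients agree.\<close>

lemma vanishes_transport:
  assumes bij: "bij_betw \<iota> T T'"
    and fwd: "\<And>s p q. s \<subseteq> T \<Longrightarrow> (p, q) \<in> G s \<Longrightarrow> (\<phi> p, \<phi> q) \<in> equiv_cl (G' (\<iota> ` s))"
    and bwd: "\<And>s p q. s \<subseteq> T \<Longrightarrow> (p, q) \<in> G' (\<iota> ` s) \<Longrightarrow> (\<chi> p, \<chi> q) \<in> equiv_cl (G s)"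
    and marks: "\<And>s t. s \<subseteq> T \<Longrightarrow> t \<in> T \<Longrightarrow> (\<phi> (a t), a' (\<iota> t)) \<in> equiv_cl (G' (\<iota> ` s)) \<and>
      (\<phi> (b t), b' (\<iota> t)) \<in> equiv_cl (G' (\<iota> ` s))"
    and marks': "\<And>s t. s \<subseteq> T \<Longrightarrow> t \<in> T \<Longrightarrow> (\<chi> (a' (\<iota> t)), a t) \<in> equiv_cl (G s) \<and>
      (\<chi> (b' (\<iota> t)), b t) \<in> equiv_cl (G s)"
    and psi: "rename \<phi> \<psi> = \<psi>'" and s0: "s\<^sub>0 \<subseteq> T"
    and v: "vanishes T G a b s\<^sub>0 \<psi>"
  shows "vanishes T' G' a' b' (\<iota> ` s\<^sub>0) \<psi>'"
proof -
  have inj: "inj_on \<iota> T" and im: "\<iota> ` T = T'" using bij by (auto simp: bij_betw_def)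
  obtain g where "\<forall>s\<subseteq>T. eqm (G s) (edge_sum G a b g s) (if s = s\<^sub>0 then \<psi> else 0)"
    using v unfolding vanishes_def ..
  note g = this[rule_format]
  define g' where "g' s' = rename \<phi> (g {t \<in> T. \<iota> t \<in> s'})" for s'
  have g': "g' (\<iota> ` s) = rename \<phi> (g s)" if "s \<subseteq> T" for s
  proof -
    have "{t \<in> T. \<iota> t \<in> \<iota> ` s} = s" using inj that by (auto dest: inj_onD)
    then show ?thesis by (simp add: g'_def)
  qed
  have edge: "eqm (G' (\<iota> ` s)) (scoeff (G' (\<iota> ` v)) (a' (\<iota> t)) (b' (\<iota> t)) * rename \<phi> x)
      (rename \<phi> (scoeff (G v) (a t) (b t) * x))" if "s \<subseteq> T" "v \<subseteq> T" "t \<in> T" for s v t x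
  proof -
    note m = marks[OF that(2,3)] and m' = marks'[OF that(2,3)] and ms = marks[OF that(1,3)]
    have "(a t, b t) \<in> equiv_cl (G v) \<longleftrightarrow> (a' (\<iota> t), b' (\<iota> t)) \<in> equiv_cl (G' (\<iota> ` v))"
    proof
      assume "(a t, b t) \<in> equiv_cl (G v)"
      then have "(\<phi> (a t), \<phi> (b t)) \<in> equiv_cl (G' (\<iota> ` v))"
        by (rule equiv_cl_map) (rule fwd[OF that(2)])
      from equiv_cl_trans[OF equiv_cl_trans[OF equiv_cl_sym[OF conjunct1[OF m]] this] conjunct2[OF m]]
      show "(a' (\<iota> t), b' (\<iota> t)) \<in> equiv_cl (G' (\<iota> ` v))" .
    next
      assume "(a' (\<iota> t), b' (\<iota> t)) \<in> equiv_cl (G' (\<iota> ` v))"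
      then have "(\<chi> (a' (\<iota> t)), \<chi> (b' (\<iota> t))) \<in> equiv_cl (G v)"
        by (rule equiv_cl_map) (rule bwd[OF that(2)])
      from equiv_cl_trans[OF equiv_cl_trans[OF equiv_cl_sym[OF conjunct1[OF m']] this] conjunct2[OF m']]
      show "(a t, b t) \<in> equiv_cl (G v)" .
    qed
    moreover have "eqm (G' (\<iota> ` s)) (var (a' (\<iota> t)) + var (b' (\<iota> t))) (var (\<phi> (a t)) + var (\<phi> (b t)))"
      by (intro eqm_add eqm_var equiv_cl_sym[OF conjunct1[OF ms]] equiv_cl_sym[OF conjunct2[OF ms]])
    ultimately have "eqm (G' (\<iota> ` s)) (scoeff (G' (\<iota> ` v)) (a' (\<iota> t)) (b' (\<iota> t))) (rename \<phi> (scoeff (G v) (a t) (b t)))"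
      unfolding scoeff_def by simp
    then show ?thesis
      unfolding rename_mult by (rule eqm_mult) simp
  qed
  have *: "eqm (G' s') (edge_sum G' a' b' g' s') (if s' = \<iota> ` s\<^sub>0 then \<psi>' else 0)" if s': "s' \<subseteq> T'" for s'
  proof -
    define s where "s = {t \<in> T. \<iota> t \<in> s'}"
    have s: "s \<subseteq> T" "s' = \<iota> ` s" using s' im by (auto simp: s_def)
    have injs: "inj_on \<iota> s" by (rule inj_on_subset[OF inj s(1)])
    have diff: "\<iota> ` s - {\<iota> t} = \<iota> ` (s - {t})" if "t \<in> s" for t
      using inj_on_image_set_diff[OF injs, of s "{t}"] that by auto
    have "edge_sum G' a' b' g' s' = (\<Sum>t\<in>s. scoeff (G' (\<iota> ` (s - {t}))) (a' (\<iota> t)) (b' (\<iota> t)) * rename \<phi> (g (s - {t})))"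
      unfolding edge_sum_def s(2) sum.reindex[OF injs] o_def
    proof (rule sum.cong[OF HOL.refl])
      fix t assume "t \<in> s"
      then have "s - {t} \<subseteq> T" using s(1) by auto
      then show "scoeff (G' (\<iota> ` s - {\<iota> t})) (a' (\<iota> t)) (b' (\<iota> t)) * g' (\<iota> ` s - {\<iota> t}) =
          scoeff (G' (\<iota> ` (s - {t}))) (a' (\<iota> t)) (b' (\<iota> t)) * rename \<phi> (g (s - {t}))"
        unfolding diff[OF \<open>t \<in> s\<close>] by (simp only: g')
    qed
    also have "eqm (G' (\<iota> ` s)) \<dots> (\<Sum>t\<in>s. rename \<phi> (scoeff (G (s - {t})) (a t) (b t) * g (s - {t})))"
      using s(1) by (intro eqm_sum edge) auto
    also have "(\<Sum>t\<in>s. rename \<phi> (scoeff (G (s - {t})) (a t) (b t) * g (s - {t}))) = rename \<phi> (edge_sum G a b g s)"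
      unfolding edge_sum_def rename_sum ..
    also have "eqm (G' (\<iota> ` s)) \<dots> (rename \<phi> (if s = s\<^sub>0 then \<psi> else 0))"
      by (rule rename_eqm[OF g[OF s(1)] fwd[OF s(1)]])
    also have "rename \<phi> (if s = s\<^sub>0 then \<psi> else 0) = (if s' = \<iota> ` s\<^sub>0 then \<psi>' else 0)"
      unfolding s(2) inj_on_image_eq_iff[OF inj s(1) s0] by (simp add: psi)
    finally show ?thesis unfolding s(2) .
  qed
  show ?thesis
    unfolding vanishes_def by (intro exI[of _ g'] allI impI *)
qed

lemma vanishes_transport_iff:
  assumes bij: "bij_betw \<iota> T T'"
    and fwd: "\<And>s p q. s \<subseteq> T \<Longrightarrow> (p, q) \<in> G s \<Longrightarrow> (\<phi> p, \<phi> q) \<in> equiv_cl (G' (\<iota> ` s))"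
    and bwd: "\<And>s p q. s \<subseteq> T \<Longrightarrow> (p, q) \<in> G' (\<iota> ` s) \<Longrightarrow> (\<chi> p, \<chi> q) \<in> equiv_cl (G s)"
    and marks: "\<And>s t. s \<subseteq> T \<Longrightarrow> t \<in> T \<Longrightarrow> (\<phi> (a t), a' (\<iota> t)) \<in> equiv_cl (G' (\<iota> ` s)) \<and>
      (\<phi> (b t), b' (\<iota> t)) \<in> equiv_cl (G' (\<iota> ` s))"
    and marks': "\<And>s t. s \<subseteq> T \<Longrightarrow> t \<in> T \<Longrightarrow> (\<chi> (a' (\<iota> t)), a t) \<in> equiv_cl (G s) \<and>
      (\<chi> (b' (\<iota> t)), b t) \<in> equiv_cl (G s)"
    and psi: "rename \<phi> \<psi> = \<psi>'" "rename \<chi> \<psi>' = \<psi>" and s0: "s\<^sub>0 \<subseteq> T"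
  shows "vanishes T G a b s\<^sub>0 \<psi> \<longleftrightarrow> vanishes T' G' a' b' (\<iota> ` s\<^sub>0) \<psi>'"
proof
  assume "vanishes T G a b s\<^sub>0 \<psi>"
  with bij fwd bwd marks marks' psi(1) s0 show "vanishes T' G' a' b' (\<iota> ` s\<^sub>0) \<psi>'"
    by (rule vanishes_transport)
next
  assume v: "vanishes T' G' a' b' (\<iota> ` s\<^sub>0) \<psi>'"
  let ?j = "the_inv_into T \<iota>"
  have inj: "inj_on \<iota> T" and im: "\<iota> ` T = T'" using bij by (auto simp: bij_betw_def)
  have bij': "bij_betw ?j T' T" by (rule bij_betw_the_inv_into[OF bij])
  have ij: "\<iota> (?j t) = t" if "t \<in> T'" for t using that f_the_inv_into_f[OF inj] im by blast
  have j: "?j t \<in> T" if "t \<in> T'" for t using that bij' by (auto simp: bij_betw_def)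
  have js: "?j ` s \<subseteq> T" if "s \<subseteq> T'" for s using that j by blast
  have ijs: "\<iota> ` ?j ` s = s" if "s \<subseteq> T'" for s
  proof -
    have "(\<lambda>t. \<iota> (?j t)) ` s = (\<lambda>t. t) ` s" using that ij by (intro image_cong) auto
    then show ?thesis by (simp add: image_image)
  qed
  have "vanishes T G a b (?j ` \<iota> ` s\<^sub>0) \<psi>"
  proof (rule vanishes_transport[where G = G' and G' = G and \<phi> = \<chi> and \<chi> = \<phi>, OF bij' _ _ _ _ psi(2) _ v])
    fix s p q assume "s \<subseteq> T'" "(p, q) \<in> G' s"
    then show "(\<chi> p, \<chi> q) \<in> equiv_cl (G (?j ` s))"
      using bwd[OF js[of s], of p q] by (simp only: ijs)
  next
    fix s p q assume "s \<subseteq> T'" "(p, q) \<in> G (?j ` s)"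
    then show "(\<phi> p, \<phi> q) \<in> equiv_cl (G' s)"
      using fwd[OF js[of s], of p q] by (simp only: ijs)
  next
    fix s t assume "s \<subseteq> T'" "t \<in> T'"
    then show "(\<chi> (a' t), a (?j t)) \<in> equiv_cl (G (?j ` s)) \<and> (\<chi> (b' t), b (?j t)) \<in> equiv_cl (G (?j ` s))"
      using marks'[OF js[of s] j[of t]] by (simp only: ij)
  next
    fix s t assume "s \<subseteq> T'" "t \<in> T'"
    then show "(\<phi> (a (?j t)), a' t) \<in> equiv_cl (G' s) \<and> (\<phi> (b (?j t)), b' t) \<in> equiv_cl (G' s)"
      using marks[OF js[of s] j[of t]] by (simp only: ij ijs)
  next
    show "\<iota> ` s\<^sub>0 \<subseteq> T'" using s0 im by blast
  qed
  moreover have "?j ` \<iota> ` s\<^sub>0 = s\<^sub>0"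
  proof -
    have "(\<lambda>t. ?j (\<iota> t)) ` s\<^sub>0 = (\<lambda>t. t) ` s\<^sub>0"
      using s0 the_inv_into_f_f[OF inj] by (intro image_cong) auto
    then show ?thesis by (simp add: image_image)
  qed
  ultimately show "vanishes T G a b s\<^sub>0 \<psi>" by simp
qed

lemma level_arcs_cases:
  assumes "(p, q) \<in> level_arcs n w s t"
  obtains (straight) r where "p = (t, r)" "q = (Suc t, r)" "r \<in> {1..n}"
      "oriented_at w s t \<or> r \<notin> {fst (w ! t), Suc (fst (w ! t))}"
  | (cup) "\<not> oriented_at w s t" "p = (t, fst (w ! t))" "q = (t, Suc (fst (w ! t)))"
  | (cap) "\<not> oriented_at w s t" "p = (Suc t, fst (w ! t))" "q = (Suc t, Suc (fst (w ! t)))"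
  using assms unfolding level_arcs_def Let_def by (fastforce split: if_splits)

lemma level_straight:
  assumes "level_arcs n w s t \<subseteq> G" "r \<in> {1..n}" "oriented_at w s t \<or> r \<notin> {fst (w ! t), Suc (fst (w ! t))}"
  shows "((t, r), (Suc t, r)) \<in> equiv_cl G"
proof -
  have "((t, r), (Suc t, r)) \<in> level_arcs n w s t"
    using assms(2,3) by (auto simp: level_arcs_def Let_def)
  with assms(1) show ?thesis by (blast intro: equiv_cl_base)
qed

lemma level_turns:
  assumes "level_arcs n w s t \<subseteq> G" "\<not> oriented_at w s t"
  shows "((t, fst (w ! t)), (t, Suc (fst (w ! t)))) \<in> equiv_cl G"
    "((Suc t, fst (w ! t)), (Suc t, Suc (fst (w ! t)))) \<in> equiv_cl G"
proof -
  have "((t, fst (w ! t)), (t, Suc (fst (w ! t)))) \<in> level_arcs n w s t"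
    "((Suc t, fst (w ! t)), (Suc t, Suc (fst (w ! t)))) \<in> level_arcs n w s t"
    using assms(2) by (auto simp: level_arcs_def Let_def)
  with assms(1) show "((t, fst (w ! t)), (t, Suc (fst (w ! t)))) \<in> equiv_cl G"
    "((Suc t, fst (w ! t)), (Suc t, Suc (fst (w ! t)))) \<in> equiv_cl G"
    by (blast intro: equiv_cl_base)+
qed

lemma column_run:
  assumes "l \<le> m" "\<And>t. l \<le> t \<Longrightarrow> t < m \<Longrightarrow> level_arcs n w s t \<subseteq> G \<and> oriented_at w s t" "p \<in> {1..n}"
  shows "((l, p), (m, p)) \<in> equiv_cl G"
  using assms(1,2)
proof (induction m rule: dec_induct)
  case (step m)
  have "((l, p), (m, p)) \<in> equiv_cl G" by (rule step.IH) (use step.prems in simp)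
  moreover have "((m, p), (Suc m, p)) \<in> equiv_cl G"
    using step.prems[of m] step.hyps by (intro level_straight[OF _ assms(3)]) auto
  ultimately show ?case by (rule equiv_cl_trans)
qed simp

text \<open>Only on the two strands of the crossing must the map match the points of the new level;
  on the other strands it may collapse or move the level, as long as the ends stay joined.\<close>

lemma level_transport:
  assumes pq: "(p, q) \<in> level_arcs n w s t" and G': "level_arcs n w' s' t' \<subseteq> G'"
    and same: "w' ! t' = w ! t" "t \<in> s \<longleftrightarrow> t' \<in> s'"
    and range: "fst (w ! t) \<in> {1..n}" "Suc (fst (w ! t)) \<in> {1..n}"
    and f: "\<And>r. r \<in> {fst (w ! t), Suc (fst (w ! t))} \<Longrightarrow>
      (f (t, r), (t', r)) \<in> equiv_cl G' \<and> (f (Suc t, r), (Suc t', r)) \<in> equiv_cl G'"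
    and f': "\<And>r. r \<in> {1..n} \<Longrightarrow> r \<notin> {fst (w ! t), Suc (fst (w ! t))} \<Longrightarrow> (f (t, r), f (Suc t, r)) \<in> equiv_cl G'"
  shows "(f p, f q) \<in> equiv_cl G'"
proof -
  have o: "oriented_at w' s' t' \<longleftrightarrow> oriented_at w s t" using same by (simp add: oriented_at_def)
  note join = equiv_cl_trans[OF equiv_cl_trans[OF _ _] equiv_cl_sym]
  from pq show ?thesis
  proof (cases rule: level_arcs_cases)
    case (straight r)
    show ?thesis
    proof (cases "r \<in> {fst (w ! t), Suc (fst (w ! t))}")
      case True
      have "((t', r), (Suc t', r)) \<in> equiv_cl G'"
        using straight True o by (intro level_straight[OF G']) auto
      from join[OF conjunct1[OF f[OF True]] this conjunct2[OF f[OF True]]]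
      show ?thesis unfolding straight(1,2) .
    next
      case False
      show ?thesis unfolding straight(1,2) by (rule f'[OF straight(3) False])
    qed
  next
    case cup
    have "((t', fst (w ! t)), (t', Suc (fst (w ! t)))) \<in> equiv_cl G'"
      using level_turns(1)[OF G'] cup(1) o same(1) by simp
    from join[OF conjunct1[OF f] this conjunct1[OF f]] show ?thesis unfolding cup(2,3) by simp
  next
    case cap
    have "((Suc t', fst (w ! t)), (Suc t', Suc (fst (w ! t)))) \<in> equiv_cl G'"
      using level_turns(2)[OF G'] cap(1) o same(1) by simp
    from join[OF conjunct2[OF f] this conjunct2[OF f]] show ?thesis unfolding cap(2,3) by simp
  qed
qed

lemma level_arcs_subset: "t < length w \<Longrightarrow> level_arcs n w s t \<subseteq> arcs n w s"
  unfolding arcs_def by blast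

lemma closure_equiv: "p \<in> {1..n} \<Longrightarrow> ((length w, p), (0, p)) \<in> equiv_cl (arcs n w s)"
  by (rule equiv_cl_base) (auto simp: arcs_def closure_arcs_def)

lemma arcs_map:
  assumes "(p, q) \<in> arcs n w s"
    and "\<And>r. r \<in> {1..n} \<Longrightarrow> (f (length w, r), f (0, r)) \<in> equiv_cl G"
    and "\<And>t p q. t < length w \<Longrightarrow> (p, q) \<in> level_arcs n w s t \<Longrightarrow> (f p, f q) \<in> equiv_cl G"
  shows "(f p, f q) \<in> equiv_cl G"
  using assms unfolding arcs_def closure_arcs_def by blast

section \<open>Far commutation\<close>

definition exchange :: "nat \<Rightarrow> nat \<Rightarrow> nat" where
  "exchange L t = (if t = L then Suc L else if t = Suc L then L else t)"

lemma exchange_exchange [simp]: "exchange L (exchange L t) = t"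
  by (simp add: exchange_def)

text \<open>Only the level between the two crossings moves: the points at each crossing are pushed
  along straight strands, past the level of the other crossing, to where they lie after the
  exchange.\<close>

definition slide :: "nat \<Rightarrow> nat \<Rightarrow> nat \<Rightarrow> point \<Rightarrow> point" where
  "slide L i j = (\<lambda>(l, p). if l = Suc L \<and> p \<in> {i, Suc i} then (Suc (Suc L), p)
    else if l = Suc L \<and> p \<in> {j, Suc j} then (L, p) else (l, p))"

lemma commute_arcs:
  fixes a b :: braid_word
  defines "L \<equiv> length a"
  assumes ab: "a \<in> braid_words n" "b \<in> braid_words n" and ij: "i \<in> {1..<n}" "j \<in> {1..<n}" "i + 2 \<le> j \<or> j + 2 \<le> i"
    and pq: "(p, q) \<in> arcs n (a @ [(i, d), (j, e)] @ b) s"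
  shows "(slide L i j p, slide L i j q) \<in> equiv_cl (arcs n (a @ [(j, e), (i, d)] @ b) (exchange L ` s))"
    (is "_ \<in> equiv_cl ?G")
  using pq
proof (rule arcs_map)
  let ?w = "a @ [(i, d), (j, e)] @ b" and ?w' = "a @ [(j, e), (i, d)] @ b"
  let ?f = "slide L i j"
  have w: "?w \<in> braid_words n" using ij(1,2) by (intro append_block_words ab) (simp add: braid_words_def)
  have nth: "?w ! L = (i, d)" "?w ! Suc L = (j, e)" "?w' ! L = (j, e)" "?w' ! Suc L = (i, d)"
    by (simp_all add: L_def nth_append)
  have f: "?f (l, r) = (l, r)" if "l \<noteq> Suc L" for l r using that by (simp add: slide_def)
  have fi: "?f (Suc L, r) = (Suc (Suc L), r)" if "r \<in> {i, Suc i}" for r using that by (simp add: slide_def)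
  have fj: "?f (Suc L, r) = (L, r)" if "r \<in> {j, Suc j}" for r using that ij(3) by (auto simp: slide_def)
  have f0: "?f (Suc L, r) = (Suc L, r)" if "r \<notin> {i, Suc i}" "r \<notin> {j, Suc j}" for r using that by (auto simp: slide_def)
  have low: "((L, r), (Suc L, r)) \<in> equiv_cl ?G" if "r \<in> {1..n}" "r \<notin> {j, Suc j}" for r
    using that by (intro level_straight[OF level_arcs_subset]) (simp_all add: L_def nth_append)
  have high: "((Suc L, r), (Suc (Suc L), r)) \<in> equiv_cl ?G" if "r \<in> {1..n}" "r \<notin> {i, Suc i}" for r
    using that by (intro level_straight[OF level_arcs_subset]) (simp_all add: L_def nth_append)
  have mem: "exchange L t \<in> exchange L ` s \<longleftrightarrow> t \<in> s" for t
    by (metis (no_types, lifting) exchange_exchange image_iff)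
  show "(?f (length ?w, r), ?f (0, r)) \<in> equiv_cl ?G" if "r \<in> {1..n}" for r
  proof -
    have "length ?w \<noteq> Suc L" "length ?w = length ?w'" by (simp_all add: L_def)
    then show ?thesis using closure_equiv[OF that, of ?w' "exchange L ` s"] by (simp add: f)
  qed
  fix t p q assume t: "t < length ?w" and pq: "(p, q) \<in> level_arcs n ?w s t"
  have t': "exchange L t < length ?w'" using t by (auto simp: exchange_def L_def)
  have dis: "r \<notin> {j, Suc j}" if "r \<in> {i, Suc i}" for r using that ij(3) by auto
  have range: "fst (?w ! t) \<in> {1..n}" "Suc (fst (?w ! t)) \<in> {1..n}"
    using braid_word_nth[OF w t] by auto
  show "(?f p, ?f q) \<in> equiv_cl ?G"
  proof (rule level_transport[OF pq level_arcs_subset[OF t'] _ mem[of t, symmetric] range])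
    consider "t = L" | "t = Suc L" | "t \<noteq> L" "t \<noteq> Suc L" by blast
    note cs = this
    have ex: "exchange L L = Suc L" "exchange L (Suc L) = L" by (simp_all add: exchange_def)
    show "?w' ! exchange L t = ?w ! t"
      using cs
    proof cases
      case 1
      show ?thesis unfolding 1 ex nth ..
    next
      case 2
      show ?thesis unfolding 2 ex nth ..
    next
      case 3
      then show ?thesis using nth_block[of "[(i, d), (j, e)]" 2 "[(j, e), (i, d)]" t a b]
        by (auto simp: exchange_def L_def)
    qed
    show "(?f (t, r), (exchange L t, r)) \<in> equiv_cl ?G \<and> (?f (Suc t, r), (Suc (exchange L t), r)) \<in> equiv_cl ?G"
      if r: "r \<in> {fst (?w ! t), Suc (fst (?w ! t))}" for r
      using cs
    proof cases
      case 1
      have "r \<in> {i, Suc i}" using r unfolding 1 nth fst_conv .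
      moreover have "r \<in> {1..n}" using calculation ij(1) by auto
      ultimately show ?thesis using low[of r] dis[of r] fi[of r] f[of L r] by (simp add: 1 exchange_def)
    next
      case 2
      have r: "r \<in> {j, Suc j}" using r unfolding 2 nth fst_conv .
      then have "r \<in> {1..n}" "r \<notin> {i, Suc i}" using ij by auto
      then show ?thesis using equiv_cl_sym[OF high[of r]] fj[OF r] f[of "Suc (Suc L)" r] by (simp add: 2 exchange_def)
    next
      case 3
      then show ?thesis using f[of t r] f[of "Suc t" r] by (simp add: exchange_def)
    qed
    show "(?f (t, r), ?f (Suc t, r)) \<in> equiv_cl ?G"
      if r: "r \<in> {1..n}" "r \<notin> {fst (?w ! t), Suc (fst (?w ! t))}" for r
      using cs
    proof cases
      case 1
      have ri: "r \<notin> {i, Suc i}" using r(2) unfolding 1 nth fst_conv .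
      show ?thesis
      proof (cases "r \<in> {j, Suc j}")
        case True
        then show ?thesis using fj[OF True] f[of L r] by (simp add: 1)
      next
        case False
        then show ?thesis using f0[OF ri False] f[of L r] low[OF r(1) False] by (simp add: 1)
      qed
    next
      case 2
      have rj: "r \<notin> {j, Suc j}" using r(2) unfolding 2 nth fst_conv .
      show ?thesis
      proof (cases "r \<in> {i, Suc i}")
        case True
        then show ?thesis using fi[OF True] f[of "Suc (Suc L)" r] by (simp add: 2)
      next
        case False
        then show ?thesis using f0[OF False rj] f[of "Suc (Suc L)" r] high[OF r(1) False] by (simp add: 2)
      qed
    next
      case 3
      then have e: "exchange L t = t" by (simp add: exchange_def)
      have "?w' ! t = ?w ! t"
        using 3 nth_block[of "[(i, d), (j, e)]" 2 "[(j, e), (i, d)]" t a b] by (auto simp: L_def)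
      then have "((t, r), (Suc t, r)) \<in> equiv_cl ?G"
        using r t' unfolding e by (intro level_straight[OF level_arcs_subset]) simp_all
      then show ?thesis using f[of t r] f[of "Suc t" r] 3 by simp
    qed
  qed
qed

lemma commute_marks:
  fixes a b :: braid_word
  defines "L \<equiv> length a"
  assumes ij: "i \<in> {1..<n}" "j \<in> {1..<n}" "i + 2 \<le> j \<or> j + 2 \<le> i"
    and t: "t < length (a @ [(i, d), (j, e)] @ b)"
  shows "(slide L i j (mark_a (a @ [(i, d), (j, e)] @ b) t), mark_a (a @ [(j, e), (i, d)] @ b) (exchange L t))
      \<in> equiv_cl (arcs n (a @ [(j, e), (i, d)] @ b) s)"
    "(slide L i j (mark_b (a @ [(i, d), (j, e)] @ b) t), mark_b (a @ [(j, e), (i, d)] @ b) (exchange L t))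
      \<in> equiv_cl (arcs n (a @ [(j, e), (i, d)] @ b) s)"
proof -
  let ?w = "a @ [(i, d), (j, e)] @ b" and ?w' = "a @ [(j, e), (i, d)] @ b"
  let ?G = "arcs n ?w' s"
  have nth: "?w ! L = (i, d)" "?w ! Suc L = (j, e)" "?w' ! L = (j, e)" "?w' ! Suc L = (i, d)"
    by (simp_all add: L_def nth_append)
  have low: "((L, i), (Suc L, i)) \<in> equiv_cl ?G"
    using ij by (intro level_straight[OF level_arcs_subset]) (auto simp: L_def nth_append)
  have high: "((Suc L, Suc j), (Suc (Suc L), Suc j)) \<in> equiv_cl ?G"
    using ij by (intro level_straight[OF level_arcs_subset]) (auto simp: L_def nth_append)
  have ex: "exchange L L = Suc L" "exchange L (Suc L) = L" by (simp_all add: exchange_def)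
  have sl: "slide L i j (L, i) = (L, i)" "slide L i j (Suc L, Suc i) = (Suc (Suc L), Suc i)"
    "slide L i j (Suc L, j) = (L, j)" "slide L i j (Suc (Suc L), Suc j) = (Suc (Suc L), Suc j)"
    using ij(3) by (auto simp: slide_def)
  consider "t = L" | "t = Suc L" | "t \<noteq> L" "t \<noteq> Suc L" by blast
  then have "(slide L i j (t, fst (?w ! t)), (exchange L t, fst (?w' ! exchange L t))) \<in> equiv_cl ?G \<and>
      (slide L i j (Suc t, Suc (fst (?w ! t))), (Suc (exchange L t), Suc (fst (?w' ! exchange L t)))) \<in> equiv_cl ?G"
  proof cases
    case 1
    show ?thesis unfolding 1 ex nth fst_conv sl using low by simp
  next
    case 2
    show ?thesis unfolding 2 ex nth fst_conv sl using equiv_cl_sym[OF high] by simp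
  next
    case 3
    then have "?w' ! t = ?w ! t"
      using nth_block[of "[(i, d), (j, e)]" 2 "[(j, e), (i, d)]" t a b] by (auto simp: L_def)
    then show ?thesis using 3 by (simp add: exchange_def slide_def)
  qed
  then show "(slide L i j (t, fst (?w ! t)), (exchange L t, fst (?w' ! exchange L t))) \<in> equiv_cl ?G"
    "(slide L i j (Suc t, Suc (fst (?w ! t))), (Suc (exchange L t), Suc (fst (?w' ! exchange L t)))) \<in> equiv_cl ?G"
    by blast+
qed

theorem word_vanishes_commute:
  assumes ab: "a \<in> braid_words n" "b \<in> braid_words n" and ij: "i \<in> {1..<n}" "j \<in> {1..<n}" "i + 2 \<le> j"
  shows "word_vanishes n (a @ [(i, d), (j, e)] @ b) \<longleftrightarrow> word_vanishes n (a @ [(j, e), (i, d)] @ b)"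
proof -
  let ?w = "a @ [(i, d), (j, e)] @ b" and ?w' = "a @ [(j, e), (i, d)] @ b"
  let ?L = "length a" and ?T = "{..<length (a @ [(i, d), (j, e)] @ b)}"
  have ij': "i + 2 \<le> j \<or> j + 2 \<le> i" "j + 2 \<le> i \<or> i + 2 \<le> j" using ij(3) by auto
  have ex: "exchange ?L t \<in> ?T" if "t \<in> ?T" for t using that by (auto simp: exchange_def)
  have img: "exchange ?L ` exchange ?L ` s = s" for s by (simp add: image_image)
  have bij: "bij_betw (exchange ?L) ?T ?T"
    by (rule bij_betw_byWitness[of _ "exchange ?L"]) (use ex in auto)
  have lens: "length ?w' = length ?w" by simp
  have psi: "rename (slide ?L i' j') (psi_poly n) = psi_poly n" for i' j'
    by (rule rename_psi_poly) (simp add: slide_def)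
  have sgn: "snd (?w' ! exchange ?L t) = snd (?w ! t)" for t
    using nth_block[of "[(i, d), (j, e)]" 2 "[(j, e), (i, d)]" t a b]
    by (cases "t = ?L"; cases "t = Suc ?L") (auto simp: exchange_def nth_append)
  have "negatives ?w' = exchange ?L ` negatives ?w"
  proof (intro equalityI subsetI)
    fix t assume t: "t \<in> negatives ?w'"
    then have "exchange ?L t \<in> negatives ?w"
      using sgn[of "exchange ?L t"] ex[of t] lens unfolding negatives_def exchange_exchange by simp
    then show "t \<in> exchange ?L ` negatives ?w" by (metis exchange_exchange image_eqI)
  next
    fix t assume "t \<in> exchange ?L ` negatives ?w"
    then show "t \<in> negatives ?w'" using sgn ex lens unfolding negatives_def by fastforce
  qed
  moreover have "vanishes ?T (arcs n ?w) (mark_a ?w) (mark_b ?w) (negatives ?w) (psi_poly n) \<longleftrightarrow>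
      vanishes ?T (arcs n ?w') (mark_a ?w') (mark_b ?w') (exchange ?L ` negatives ?w) (psi_poly n)"
  proof (rule vanishes_transport_iff[OF bij _ _ _ _ psi[of i j] psi[of j i]])
    fix s p q assume "(p, q) \<in> arcs n ?w s"
    then show "(slide ?L i j p, slide ?L i j q) \<in> equiv_cl (arcs n ?w' (exchange ?L ` s))"
      by (rule commute_arcs[OF ab ij(1,2) ij'(1)])
  next
    fix s p q assume "(p, q) \<in> arcs n ?w' (exchange ?L ` s)"
    from commute_arcs[OF ab ij(2,1) ij'(2) this]
    show "(slide ?L j i p, slide ?L j i q) \<in> equiv_cl (arcs n ?w s)" unfolding img .
  next
    fix s t assume t: "t \<in> ?T"
    then show "(slide ?L i j (mark_a ?w t), mark_a ?w' (exchange ?L t)) \<in> equiv_cl (arcs n ?w' (exchange ?L ` s)) \<and>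
        (slide ?L i j (mark_b ?w t), mark_b ?w' (exchange ?L t)) \<in> equiv_cl (arcs n ?w' (exchange ?L ` s))"
      using commute_marks[OF ij(1,2) ij'(1)] by blast
    have "exchange ?L t < length ?w'" using ex[OF t] lens by simp
    from commute_marks[OF ij(2,1) ij'(2) this, where s = s, unfolded exchange_exchange]
    show "(slide ?L j i (mark_a ?w' (exchange ?L t)), mark_a ?w t) \<in> equiv_cl (arcs n ?w s) \<and>
        (slide ?L j i (mark_b ?w' (exchange ?L t)), mark_b ?w t) \<in> equiv_cl (arcs n ?w s)" by blast
  next
    show "negatives ?w \<subseteq> ?T" by (auto simp: negatives_def)
  qed
  ultimately show ?thesis
    unfolding word_vanishes_def lens by simp
qed

text \<open>Two points on one circle give a factor congruent to a square. This applies where a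
  turn-back joins two strands of the braid.\<close>

lemma psi_poly_zero:
  assumes "((0, p), (0, q)) \<in> equiv_cl G" "p \<in> {1..n}" "q \<in> {1..n}" "p \<noteq> q"
  shows "eqm G (psi_poly n) 0"
proof -
  have "psi_poly n = var (0, p) * (\<Prod>r\<in>{1..n} - {p}. var (0, r))"
    unfolding psi_poly_def using assms by (intro prod.remove) auto
  also have "(\<Prod>r\<in>{1..n} - {p}. var (0, r)) = var (0, q) * (\<Prod>r\<in>{1..n} - {p} - {q}. var (0 :: nat, r))"
    using assms by (intro prod.remove) auto
  finally have *: "psi_poly n = (var (0, p) * var (0, q)) * (\<Prod>r\<in>{1..n} - {p} - {q}. var (0, r))"
    by (simp only: mult.assoc)
  have "eqm G ((var (0, p) * var (0, q)) * (\<Prod>r\<in>{1..n} - {p} - {q}. var (0, r))) (0 * (\<Prod>r\<in>{1..n} - {p} - {q}. var (0, r)))"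
    by (rule eqm_mult[OF eqm_square'[OF assms(1)] eqm_refl])
  then show ?thesis unfolding * by simp
qed

section \<open>Cancellation of inverse letters\<close>

definition r2_state :: "bool \<Rightarrow> bool \<Rightarrow> bool \<Rightarrow> (nat \<times> nat) list" where
  "r2_state e x y = resolve 2 [0, 0] (if e then [\<not> y, x] else [x, \<not> y])"

text \<open>The block has three levels of two points; \<mu> and \<nu> are the marks of the negative
  and of the positive crossing. The closed circle consists of the points 2 and 3, and 2 is kept to
  represent it.\<close>

definition r2_check :: "bool \<Rightarrow> bool" where
  "r2_check e \<longleftrightarrow>
    (let \<mu> = (if e then (2, 5) else (0, 3)); \<nu> = (if e then (0, 3) else (2, 5)); U = [(0, 1), (4, 5)]; S = r2_state e in
      check_retract 6 [2, 3] (S False False) U \<and>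
      check_retract 6 [2, 3] (S True False) [(0, 4), (1, 5)] \<and>
      check_retract 6 [3] (S False True) U \<and>
      check_retract 6 [2, 3] (S True True) U \<and>
      check_links 6 (S False False) (mark_links \<mu> (0, 5) @ [\<nu>]) \<and>
      check_links 6 (S True False) (mark_links \<mu> (0, 5) @ mark_links \<nu> (0, 5)) \<and>
      check_links 6 (S False True) (if e then [(snd \<nu>, 2), (fst \<nu>, 0)] else [(fst \<nu>, 2), (snd \<nu>, 5)]) \<and>
      check_links 6 (S True True) (mark_links \<nu> (0, 5)) \<and>
      check_links 6 U [(0, 1)] \<and>
      (rep_map 6 [3] (S False True) (fst \<mu>) = 2) \<noteq> (rep_map 6 [3] (S False True) (snd \<mu>) = 2))"

lemma r2_check: "r2_check e"
proof -
  have "r2_check True" by code_simp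
  moreover have "r2_check False" by code_simp
  ultimately show ?thesis by (cases e) simp_all
qed

locale r2_block = word_block n i 2 L 2 w "[0, 0]" for n i L w +
  fixes e :: bool
  assumes signs: "snd (w ! L) = e" "snd (w ! Suc L) = (\<not> e)"
begin

definition "N = (if e then L + 1 else L)"
definition "P = (if e then L else L + 1)"

abbreviation "\<mu> \<equiv> (if e then (2, 5) else (0, 3) :: nat \<times> nat)"
abbreviation "\<nu> \<equiv> (if e then (0, 3) else (2, 5) :: nat \<times> nat)"
abbreviation "turned \<equiv> [(0, 1), (4, 5)] :: (nat \<times> nat) list"
abbreviation "through \<equiv> [(0, 4), (1, 5)] :: (nat \<times> nat) list"

lemma state_eq: "state x = r2_state e (N \<in> x) (P \<in> x)"
  unfolding N_def P_def state_def r2_state_def using signs by (cases e) (simp_all add: upt_rec)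

lemma NP: "N \<noteq> P" "N \<notin> others" "P \<notin> others" "{N, P} = {L, L + 1}" "{N, P} \<subseteq> {L..<L + 2}"
  by (auto simp: N_def P_def)

lemma marks:
  "mark_a w N = \<kappa> (fst \<mu>)" "mark_b w N = \<kappa> (snd \<mu>)" "mark_a w P = \<kappa> (fst \<nu>)" "mark_b w P = \<kappa> (snd \<nu>)"
  using marks_block[of 0] marks_block[of 1] by (simp_all add: N_def P_def)

lemma checks:
  "check_retract 6 [2, 3] (state {}) turned"
  "check_retract 6 [2, 3] (state {N}) through"
  "check_retract 6 [3] (state {P}) turned"
  "check_retract 6 [2, 3] (state {N, P}) turned"
  "check_links 6 (state {}) (mark_links \<mu> (0, 5) @ [\<nu>])"
  "check_links 6 (state {N}) (mark_links \<mu> (0, 5) @ mark_links \<nu> (0, 5))"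
  "check_links 6 (state {P}) (if e then [(snd \<nu>, 2), (fst \<nu>, 0)] else [(fst \<nu>, 2), (snd \<nu>, 5)])"
  "check_links 6 (state {N, P}) (mark_links \<nu> (0, 5))"
  "check_links 6 turned [(0, 1)]"
  "(rep_map 6 [3] (state {P}) (fst \<mu>) = 2) \<noteq> (rep_map 6 [3] (state {P}) (snd \<mu>) = 2)"
proof -
  have s: "state {} = r2_state e False False" "state {N} = r2_state e True False"
    "state {P} = r2_state e False True" "state {N, P} = r2_state e True True"
    using NP(1) by (simp_all add: state_eq)
  note c = r2_check[of e, unfolded r2_check_def Let_def]
  show "check_retract 6 [2, 3] (state {}) turned"
    unfolding s using c by (elim conjE)
  show "check_retract 6 [2, 3] (state {N}) through"
    unfolding s using c by (elim conjE)
  show "check_retract 6 [3] (state {P}) turned"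
    unfolding s using c by (elim conjE)
  show "check_retract 6 [2, 3] (state {N, P}) turned"
    unfolding s using c by (elim conjE)
  show "check_links 6 (state {}) (mark_links \<mu> (0, 5) @ [\<nu>])"
    unfolding s using c by (elim conjE)
  show "check_links 6 (state {N}) (mark_links \<mu> (0, 5) @ mark_links \<nu> (0, 5))"
    unfolding s using c by (elim conjE)
  show "check_links 6 (state {P}) (if e then [(snd \<nu>, 2), (fst \<nu>, 0)] else [(fst \<nu>, 2), (snd \<nu>, 5)])"
    unfolding s using c by (elim conjE)
  show "check_links 6 (state {N, P}) (mark_links \<nu> (0, 5))"
    unfolding s using c by (elim conjE)
  show "check_links 6 turned [(0, 1)]"
    unfolding s using c by (elim conjE)
  show "(rep_map 6 [3] (state {P}) (fst \<mu>) = 2) \<noteq> (rep_map 6 [3] (state {P}) (snd \<mu>) = 2)"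
    unfolding s using c by (elim conjE)
qed

definition \<phi> :: "nat set \<Rightarrow> point \<Rightarrow> point" where
  "\<phi> x = lift \<kappa> (rep_map 6 (if x = {P} then [3] else [2, 3]) (state x))"

lemma interior: "set [2, 3] = {2..<2 * 2 :: nat}"
  by auto

lemma insert_frame: "insert (\<kappa> 2) frame = - \<kappa> ` set [3]"
proof -
  have set: "{2..<2 * 2} = insert 2 (set [3 :: nat])" by auto
  have ins: "insert x (- insert x A) = - A" if "x \<notin> A" for x :: point and A using that by blast
  show ?thesis
    unfolding set image_insert by (rule ins) (simp only: inj_image_mem_iff[OF inj_kappa], simp)
qed

lemma retracts:
  assumes "u \<subseteq> others"
  shows "retract frame (\<phi> {}) (arcs n w (u \<union> {})) (joined turned u)"
    "retract frame (\<phi> {N}) (arcs n w (u \<union> {N})) (joined through u)"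
    "retract (insert (\<kappa> 2) frame) (\<phi> {P}) (arcs n w (u \<union> {P})) (joined turned u)"
    "retract frame (\<phi> {N, P}) (arcs n w (u \<union> {N, P})) (joined turned u)"
proof -
  note r = state_retract[OF assms _ _ equalityD1[OF interior], unfolded interior]
  have ne: "{} \<noteq> {P}" "{N} \<noteq> {P}" "{N, P} \<noteq> {P}" using NP(1) by auto
  show "retract frame (\<phi> {}) (arcs n w (u \<union> {})) (joined turned u)"
    unfolding \<phi>_def if_not_P[OF ne(1)] by (rule r[OF _ checks(1)]) simp
  show "retract frame (\<phi> {N}) (arcs n w (u \<union> {N})) (joined through u)"
    unfolding \<phi>_def if_not_P[OF ne(2)] by (rule r[OF _ checks(2)]) (use NP(5) in simp)
  show "retract (insert (\<kappa> 2) frame) (\<phi> {P}) (arcs n w (u \<union> {P})) (joined turned u)"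
    unfolding insert_frame \<phi>_def if_P[OF HOL.refl]
    by (rule state_retract[OF assms _ checks(3)]) (use NP(5) in simp_all)
  show "retract frame (\<phi> {N, P}) (arcs n w (u \<union> {N, P})) (joined turned u)"
    unfolding \<phi>_def if_not_P[OF ne(3)] by (rule r[OF _ checks(4) ]) (rule NP(5))
qed

lemma all: "others \<union> {N, P} = {..<length w}"
  unfolding NP(4) using len by auto

sublocale r2_cube others N P "arcs n w" "mark_a w" "mark_b w" frame "\<kappa> 2" "joined turned" "joined through"
  \<phi> "pt (0, 5)" "pt (0, 5)" "\<kappa> (if e then 0 else 5)"
proof
  show "Finite_Set.finite others" by simp
  show "N \<notin> others" "P \<notin> others" "N \<noteq> P" by (rule NP)+
  show "saddle_cube (others \<union> {N, P}) (arcs n w) (mark_a w) (mark_b w)"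
    unfolding all by (rule saddle_cube_arcs[OF w])
  show "\<And>t. t \<in> others \<Longrightarrow> mark_a w t \<in> frame \<and> mark_b w t \<in> frame"
    by (rule marks_frame)
  show "\<kappa> 2 \<notin> frame" unfolding kappa_frame by simp
  show "\<kappa> (if e then 0 else 5) \<in> frame" unfolding kappa_frame by simp
  have fr: "\<kappa> 0 \<in> frame" "\<kappa> 5 \<in> frame" unfolding kappa_frame by simp_all
  show "fst (pt (0, 5)) \<in> frame" "snd (pt (0, 5)) \<in> frame"
    unfolding map_prod_simp fst_conv snd_conv by (rule fr)+
  fix u assume u: "u \<subseteq> others"
  have sub: "{} \<subseteq> {L..<L + 2}" "{N} \<subseteq> {L..<L + 2}" "{P} \<subseteq> {L..<L + 2}" using NP(5) by auto
  show "retract frame (\<phi> {}) (arcs n w u) (joined turned u)"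
    using retracts(1)[OF u] by (simp only: Un_empty_right)
  show "retract frame (\<phi> {N}) (arcs n w (u \<union> {N})) (joined through u)"
    by (rule retracts(2)[OF u])
  show "retract (insert (\<kappa> 2) frame) (\<phi> {P}) (arcs n w (u \<union> {P})) (joined turned u)"
    by (rule retracts(3)[OF u])
  show "retract frame (\<phi> {N, P}) (arcs n w (u \<union> {N, P})) (joined turned u)"
    by (rule retracts(4)[OF u])
  show "same_marks (arcs n w u) (arcs n w (u \<union> {N})) (mark_a w N) (mark_b w N) (fst (pt (0, 5))) (snd (pt (0, 5)))"
    unfolding marks by (rule same[OF u sub(1,2) checks(5,6), unfolded Un_empty_right]) auto
  show "same_marks (arcs n w (u \<union> {N})) (arcs n w (u \<union> {N, P})) (mark_a w P) (mark_b w P) (fst (pt (0, 5))) (snd (pt (0, 5)))"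
    unfolding marks by (rule same[OF u sub(2) NP(5) checks(6,8)]) auto
  show "(mark_a w P, mark_b w P) \<in> equiv_cl (arcs n w u)"
    unfolding marks by (rule state_link[OF u sub(1) checks(5), unfolded Un_empty_right]) simp
  note c = state_link[OF u sub(3) checks(7)]
  show "(mark_a w P, \<kappa> 2) \<in> equiv_cl (arcs n w (u \<union> {P})) \<and> (mark_b w P, \<kappa> (if e then 0 else 5)) \<in> equiv_cl (arcs n w (u \<union> {P})) \<or>
    (mark_b w P, \<kappa> 2) \<in> equiv_cl (arcs n w (u \<union> {P})) \<and> (mark_a w P, \<kappa> (if e then 0 else 5)) \<in> equiv_cl (arcs n w (u \<union> {P}))"
  proof (cases e)
    case True
    have "(\<kappa> (snd \<nu>), \<kappa> 2) \<in> equiv_cl (arcs n w (u \<union> {P}))" "(\<kappa> (fst \<nu>), \<kappa> 0) \<in> equiv_cl (arcs n w (u \<union> {P}))"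
      by (rule c, simp add: True)+
    then show ?thesis unfolding marks using True by auto
  next
    case False
    have "(\<kappa> (fst \<nu>), \<kappa> 2) \<in> equiv_cl (arcs n w (u \<union> {P}))" "(\<kappa> (snd \<nu>), \<kappa> 5) \<in> equiv_cl (arcs n w (u \<union> {P}))"
      by (rule c, simp add: False)+
    then show ?thesis unfolding marks using False by auto
  qed
  show "(mark_a w N, mark_b w N) \<notin> equiv_cl (arcs n w (u \<union> {P}))"
  proof
    assume "(mark_a w N, mark_b w N) \<in> equiv_cl (arcs n w (u \<union> {P}))"
    then have "(\<phi> {P} (\<kappa> (fst \<mu>)), \<phi> {P} (\<kappa> (snd \<mu>))) \<in> equiv_cl (joined turned u)"
      unfolding retract_iff[OF retracts(3)[OF u]] marks .
    then have *: "(\<kappa> (rep_map 6 [3] (state {P}) (fst \<mu>)), \<kappa> (rep_map 6 [3] (state {P}) (snd \<mu>))) \<in> equiv_cl (joined turned u)"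
      unfolding \<phi>_def if_P[OF HOL.refl] lift_apply[OF inj_kappa] .
    note ne = checks(10)
    from equiv_cl_outside[OF * retractD(6)[OF retracts(1)[OF u]]] show False
    proof
      assume "\<kappa> (rep_map 6 [3] (state {P}) (fst \<mu>)) = \<kappa> (rep_map 6 [3] (state {P}) (snd \<mu>))"
      from injD[OF inj_kappa this] show False using ne by argo
    next
      assume f: "\<kappa> (rep_map 6 [3] (state {P}) (fst \<mu>)) \<in> frame \<and> \<kappa> (rep_map 6 [3] (state {P}) (snd \<mu>)) \<in> frame"
      have "\<kappa> 2 \<notin> frame" unfolding kappa_frame by simp
      then have "rep_map 6 [3] (state {P}) (fst \<mu>) \<noteq> 2" "rep_map 6 [3] (state {P}) (snd \<mu>) \<noteq> 2"
        using f by metis+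
      then show False using ne by argo
    qed
  qed
qed

lemma negatives_N: "negatives w = (negatives w - {N}) \<union> {N}" "negatives w - {N} \<subseteq> others"
proof -
  have "snd (w ! P)" "\<not> snd (w ! N)" using signs by (auto simp: N_def P_def)
  moreover have "N < length w" using all by auto
  ultimately have "N \<in> negatives w" "P \<notin> negatives w" by (auto simp: negatives_def)
  moreover have "negatives w \<subseteq> others \<union> {N, P}" unfolding all by (auto simp: negatives_def)
  ultimately show "negatives w = (negatives w - {N}) \<union> {N}" "negatives w - {N} \<subseteq> others" by blast+
qed

text \<open>At the vertex of \<open>psi_poly\<close> all crossings outside the block are oriented,
  so the turn-back of the block joins the points \<open>i\<close> and \<open>Suc i\<close> of level
  0. Hence the polynomial is zero there, as \<open>r2_insert\<close> requires.\<close>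

lemma word_vanishes_iff_through:
  "word_vanishes n w \<longleftrightarrow> vanishes others (joined through) (mark_a w) (mark_b w) (negatives w - {N}) (psi_poly n)"
proof -
  let ?u = "negatives w - {N}"
  have "(0, p) \<in> frame" for p unfolding Compl_iff kappa_interior by simp
  then have psi: "rename (\<phi> {N}) (psi_poly n) = psi_poly n"
    using retractD(2)[OF retracts(2)[of "{}"]] by (intro rename_psi_poly) blast
  have col: "((0, p), (L, p)) \<in> equiv_cl (joined turned ?u)" if "p \<in> {1..n}" for p
  proof (rule column_run[where w = w and s = ?u, OF _ _ that])
    fix t assume t: "0 \<le> t" "t < L"
    then have "t \<in> others" "t < length w" "t \<noteq> N" using len by (auto simp: N_def)
    then show "level_arcs n w ?u t \<subseteq> joined turned ?u \<and> oriented_at w ?u t"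
      unfolding joined_def outer_arcs_def oriented_at_def negatives_def by auto
  qed simp
  have "i \<in> {1..n}" "Suc i \<in> {1..n}" using i by auto
  moreover have "((L, i), (L, Suc i)) \<in> equiv_cl (joined turned ?u)"
    using joined_link[OF checks(9), of 0 1 ?u] by (simp add: block_point_def)
  ultimately have "((0, i), (0, Suc i)) \<in> equiv_cl (joined turned ?u)"
    using equiv_cl_trans[OF equiv_cl_trans[OF col[of i]] equiv_cl_sym[OF col[of "Suc i"]]] by blast
  then have "eqm (joined turned ?u) (psi_poly n) 0"
    by (rule psi_poly_zero) (use i in auto)
  from eqm_mult_left[OF this] have zero: "eqm (joined turned ?u) (pcoeff (joined through ?u) (pt (0, 5)) * psi_poly n) 0"
    unfolding mult_zero_right .
  have "word_vanishes n w \<longleftrightarrow> vanishes (others \<union> {N, P}) (arcs n w) (mark_a w) (mark_b w) (?u \<union> {N}) (psi_poly n)"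
    unfolding word_vanishes_def all using negatives_N(1) by (rule arg_cong)
  then show ?thesis
    by (rule HOL.trans) (rule iffI[OF r2_delete[OF _ negatives_N(2) psi] r2_insert[OF _ negatives_N(2) zero]])
qed

end

definition skip_level :: "nat \<Rightarrow> nat \<Rightarrow> nat" where
  "skip_level L t = (if t < L then t else t - 2)"

definition collapse :: "nat \<Rightarrow> point \<Rightarrow> point" where
  "collapse L = (\<lambda>(l, p). if l \<le> L then (l, p) else if l = Suc L then (L, p) else (l - 2, p))"

text \<open>A section of \<open>collapse\<close> that chooses the bottom level of the removed block.
  A mark at level \<open>L\<close> therefore agrees with its counterpart only up to the straight
  strands of the block.\<close>

definition expand :: "nat \<Rightarrow> point \<Rightarrow> point" where
  "expand L = (\<lambda>(l, p). if l \<le> L then (l, p) else (l + 2, p))"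

theorem word_vanishes_cancel:
  assumes ab: "a \<in> braid_words n" "b \<in> braid_words n" and i: "i \<in> {1..<n}"
  shows "word_vanishes n (a @ [(i, e), (i, \<not> e)] @ b) \<longleftrightarrow> word_vanishes n (a @ b)"
proof -
  let ?w = "a @ [(i, e), (i, \<not> e)] @ b" and ?v = "a @ b"
  let ?L = "length a"
  have w: "?w \<in> braid_words n" using i by (intro append_block_words ab) (simp add: braid_words_def)
  have v: "?v \<in> braid_words n" using ab by (simp add: braid_words_def)
  interpret X: r2_block n i ?L ?w e
  proof
    fix t :: nat assume "t < 2"
    then have "t = 0 \<or> t = 1" by auto
    then show "i \<le> fst (?w ! (?L + t)) \<and> Suc (fst (?w ! (?L + t))) < i + 2" "[0, 0] ! t = fst (?w ! (?L + t)) - i"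
      by (auto simp: nth_append)
  qed (use w i in \<open>auto simp: nth_append\<close>)
  let ?T = "X.others" and ?J = "X.joined X.through"
  let ?\<iota> = "skip_level ?L" and ?f = "collapse ?L" and ?g = "expand ?L"
  define up where "up t = (if t < ?L then t else t + 2)" for t
  have lenw: "length ?w = length ?v + 2" by simp
  have up: "up t \<in> ?T \<and> ?\<iota> (up t) = t \<and> ?w ! up t = ?v ! t" if "t < length ?v" for t
    using that by (auto simp: up_def skip_level_def nth_append)
  have down: "?\<iota> t < length ?v \<and> up (?\<iota> t) = t" if "t \<in> ?T" for t
    using that by (auto simp: up_def skip_level_def)
  have bij: "bij_betw ?\<iota> ?T {..<length ?v}"
    by (rule bij_betw_byWitness[of _ up]) (use up down in auto)
  have mem: "t \<in> ?\<iota> ` u \<longleftrightarrow> up t \<in> u" if "u \<subseteq> ?T" "t < length ?v" for t u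
  proof
    assume "t \<in> ?\<iota> ` u"
    then obtain t' where "t' \<in> u" "t = ?\<iota> t'" by blast
    then show "up t \<in> u" using down[of t'] that(1) by auto
  next
    assume "up t \<in> u"
    then show "t \<in> ?\<iota> ` u" using up[OF that(2)] by (intro image_eqI[of _ _ "up t"]) auto
  qed
  have V0: "((?L, r), (?L + 2, r)) \<in> equiv_cl (?J u)" if "r \<in> {1..n}" for r u
  proof (cases "r \<in> {i, Suc i}")
    case True
    then have "((?L, r), (?L + 2, r)) \<in> ?J u"
      unfolding X.joined_def by (auto simp: block_point_def)
    then show ?thesis by (rule equiv_cl_base)
  next
    case False
    then have "((?L, r), (Suc ?L, r)) \<in> ?J u" "((Suc ?L, r), (Suc (Suc ?L), r)) \<in> ?J u"
      using that unfolding X.joined_def outer_arcs_def by (fastforce simp: image_iff)+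
    from equiv_cl_trans[OF equiv_cl_base[OF this(1)] equiv_cl_base[OF this(2)]] show ?thesis by simp
  qed
  have V: "(?g (l, r), (l + 2, r)) \<in> equiv_cl (?J u)" if "?L \<le> l" "r \<in> {1..n}" for l r u
    using V0[OF that(2), of u] that(1) by (cases "l = ?L") (simp_all add: expand_def)
  have levels: "level_arcs n ?w u t \<subseteq> ?J u" if "t \<in> ?T" for t u
    using that unfolding X.joined_def outer_arcs_def by blast
  have range: "fst (?w ! t) \<in> {1..n}" "Suc (fst (?w ! t)) \<in> {1..n}" if "t < length ?w" for t
    using braid_word_nth[OF w that] by auto
  have range': "fst (?v ! t) \<in> {1..n}" "Suc (fst (?v ! t)) \<in> {1..n}" if "t < length ?v" for t
    using braid_word_nth[OF v that] by auto
  have fl: "?f (t, r) = (?\<iota> t, r) \<and> ?f (Suc t, r) = (Suc (?\<iota> t), r)" if "t \<in> ?T" for t r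
    using that by (auto simp: collapse_def skip_level_def)
  have gl: "(?g (t, r), (up t, r)) \<in> equiv_cl (?J u) \<and> (?g (Suc t, r), (Suc (up t), r)) \<in> equiv_cl (?J u)"
    if "r \<in> {1..n}" for t r u
  proof (cases "t < ?L")
    case True
    then show ?thesis by (simp add: expand_def up_def)
  next
    case False
    then show ?thesis using V[of t r u] that by (simp add: up_def, simp add: expand_def)
  qed
  have psi: "rename ?f (psi_poly n) = psi_poly n" "rename ?g (psi_poly n) = psi_poly n"
    by (rule rename_psi_poly, simp add: collapse_def expand_def)+
  have "?\<iota> ` (negatives ?w - {X.N}) = negatives ?v"
  proof (intro equalityI subsetI)
    fix t assume "t \<in> ?\<iota> ` (negatives ?w - {X.N})"
    then obtain t' where t': "t = ?\<iota> t'" "t' \<in> negatives ?w - {X.N}" by blast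
    then have T: "t' \<in> ?T" using X.negatives_N(2) by blast
    have "?v ! t = ?w ! t'" "t < length ?v"
      using up[of t] down[OF T] unfolding t'(1) by auto
    then show "t \<in> negatives ?v" using t'(2) unfolding negatives_def by auto
  next
    fix t assume t: "t \<in> negatives ?v"
    then have tl: "t < length ?v" by (simp add: negatives_def)
    have T: "up t \<in> ?T" "?\<iota> (up t) = t" "?w ! up t = ?v ! t" using up[OF tl] by blast+
    then have "up t \<in> negatives ?w - {X.N}" using t X.NP(2) unfolding negatives_def by auto
    then show "t \<in> ?\<iota> ` (negatives ?w - {X.N})" using T(2) by (metis image_eqI)
  qed
  moreover have "vanishes ?T ?J (mark_a ?w) (mark_b ?w) (negatives ?w - {X.N}) (psi_poly n) \<longleftrightarrow>
    vanishes {..<length ?v} (arcs n ?v) (mark_a ?v) (mark_b ?v) (?\<iota> ` (negatives ?w - {X.N})) (psi_poly n)"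
  proof (rule vanishes_transport_iff[where \<phi> = ?f and \<chi> = ?g, OF bij _ _ _ _ psi X.negatives_N(2)])
    fix u p q assume u: "u \<subseteq> ?T" and pq: "(p, q) \<in> ?J u"
    let ?G = "arcs n ?v (?\<iota> ` u)"
    consider (closure) "(p, q) \<in> closure_arcs n ?w"
      | (level) t where "t \<in> ?T" "(p, q) \<in> level_arcs n ?w u t"
      | (strand) t r where "t \<in> {?L..<?L + 2}" "p = (t, r)" "q = (Suc t, r)"
      | (block) "(p, q) \<in> X.pt ` set X.through"
      using pq unfolding X.joined_def outer_arcs_def by blast
    then show "(?f p, ?f q) \<in> equiv_cl ?G"
    proof cases
      case closure
      then obtain r where r: "r \<in> {1..n}" "p = (length ?w, r)" "q = (0, r)" unfolding closure_arcs_def by blast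
      have "?f (length ?w, r) = (length ?v, r)" "?f (0, r) = (0, r)" by (simp_all add: collapse_def)
      then show ?thesis using closure_equiv[OF r(1), of ?v "?\<iota> ` u"] unfolding r(2,3) by simp
    next
      case level
      have t: "?\<iota> t < length ?v" "up (?\<iota> t) = t" using down[OF level(1)] by blast+
      have same: "?v ! ?\<iota> t = ?w ! t" using up[OF t(1)] unfolding t(2) by simp
      have tw: "t < length ?w" using level(1) by simp
      have m: "t \<in> u \<longleftrightarrow> ?\<iota> t \<in> ?\<iota> ` u" using mem[OF u t(1)] unfolding t(2) by simp
      show ?thesis
      proof (rule level_transport[OF level(2) level_arcs_subset[OF t(1)] same m range[OF tw]])
        fix r assume "r \<in> {1..n}" "r \<notin> {fst (?w ! t), Suc (fst (?w ! t))}"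
        then have "((?\<iota> t, r), (Suc (?\<iota> t), r)) \<in> equiv_cl ?G"
          by (intro level_straight[OF level_arcs_subset[OF t(1)]]) (simp_all only: same simp_thms)
        then show "(?f (t, r), ?f (Suc t, r)) \<in> equiv_cl ?G" using fl[OF level(1)] by simp
      qed (use fl[OF level(1)] in simp)
    next
      case strand
      then have "?f p = ?f q" by (auto simp: collapse_def)
      then show ?thesis by simp
    next
      case block
      then have "?f p = ?f q" by (auto simp: collapse_def block_point_def)
      then show ?thesis by simp
    qed
  next
    fix u p q assume u: "u \<subseteq> ?T" and pq: "(p, q) \<in> arcs n ?v (?\<iota> ` u)"
    from pq show "(?g p, ?g q) \<in> equiv_cl (?J u)"
    proof (rule arcs_map)
      fix r assume r: "r \<in> {1..n}"
      have "((length ?w, r), (0, r)) \<in> equiv_cl (?J u)"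
        using r unfolding X.joined_def outer_arcs_def closure_arcs_def by (intro equiv_cl_base) auto
      from equiv_cl_trans[OF V[of "length ?v" r u] this[unfolded lenw]]
      show "(?g (length ?v, r), ?g (0, r)) \<in> equiv_cl (?J u)" using r by (simp add: expand_def)
    next
      fix t p q assume t: "t < length ?v" and pq: "(p, q) \<in> level_arcs n ?v (?\<iota> ` u) t"
      have T: "up t \<in> ?T" "?\<iota> (up t) = t" "?w ! up t = ?v ! t" using up[OF t] by blast+
      show "(?g p, ?g q) \<in> equiv_cl (?J u)"
      proof (rule level_transport[OF pq levels[OF T(1)] T(3) mem[OF u t] range'[OF t]])
        fix r assume r: "r \<in> {1..n}" "r \<notin> {fst (?v ! t), Suc (fst (?v ! t))}"
        have "((up t, r), (Suc (up t), r)) \<in> equiv_cl (?J u)"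
          using r by (intro level_straight[OF levels[OF T(1)]]) (simp_all only: T(3) simp_thms)
        from equiv_cl_trans[OF equiv_cl_trans[OF conjunct1[OF gl[OF r(1)]] this] equiv_cl_sym[OF conjunct2[OF gl[OF r(1)]]]]
        show "(?g (t, r), ?g (Suc t, r)) \<in> equiv_cl (?J u)" .
      next
        fix r assume "r \<in> {fst (?v ! t), Suc (fst (?v ! t))}"
        then have "r \<in> {1..n}" using range'[OF t] by auto
        then show "(?g (t, r), (up t, r)) \<in> equiv_cl (?J u) \<and> (?g (Suc t, r), (Suc (up t), r)) \<in> equiv_cl (?J u)"
          by (rule gl)
      qed
    qed
  next
    fix u t assume u: "u \<subseteq> ?T" and t: "t \<in> ?T"
    have d: "?\<iota> t < length ?v" "up (?\<iota> t) = t" using down[OF t] by blast+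
    have same: "?v ! ?\<iota> t = ?w ! t" using up[OF d(1)] unfolding d(2) by simp
    have tw: "t < length ?w" using t by simp
    show "(?f (mark_a ?w t), mark_a ?v (?\<iota> t)) \<in> equiv_cl (arcs n ?v (?\<iota> ` u)) \<and>
        (?f (mark_b ?w t), mark_b ?v (?\<iota> t)) \<in> equiv_cl (arcs n ?v (?\<iota> ` u))"
      unfolding same using fl[OF t] by simp
    show "(?g (mark_a ?v (?\<iota> t)), mark_a ?w t) \<in> equiv_cl (?J u) \<and> (?g (mark_b ?v (?\<iota> t)), mark_b ?w t) \<in> equiv_cl (?J u)"
      unfolding same using conjunct1[OF gl[OF range(1)[OF tw], of "?\<iota> t" u]] conjunct2[OF gl[OF range(2)[OF tw], of "?\<iota> t" u]]
      unfolding d(2) ..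
  qed
  ultimately show ?thesis
    unfolding X.word_vanishes_iff_through word_vanishes_def[of n ?v] by simp
qed

text \<open>The contexts \<open>a\<close> and \<open>b\<close> are part of the induction because a
  relation may be applied inside a word.\<close>

lemma word_vanishes_block:
  "braid_eq n u v \<Longrightarrow> a \<in> braid_words n \<Longrightarrow> b \<in> braid_words n \<Longrightarrow>
    word_vanishes n (a @ u @ b) \<longleftrightarrow> word_vanishes n (a @ v @ b)"
proof (induction arbitrary: a b rule: braid_eq.induct)
  case (append u u' v v')
  have "u' \<in> braid_words n" "v \<in> braid_words n"
    using braid_eq_words[OF append.hyps(1)] braid_eq_words[OF append.hyps(2)] by blast+
  then have m: "v @ b \<in> braid_words n" "a @ u' \<in> braid_words n"
    using append.prems by (simp_all add: braid_words_def)
  show ?case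
    using append.IH(1)[OF append.prems(1) m(1)] append.IH(2)[OF m(2) append.prems(2)] by simp
next
  case (cancel i e)
  then show ?case using word_vanishes_cancel[of a n b i e] by simp
next
  case (commute i j)
  then show ?case using word_vanishes_commute[of a n b i j True True] by simp
next
  case (braid i)
  then show ?case using word_vanishes_braid[of a n b i] by simp
qed simp_all

lemma word_vanishes_cong: "braid_eq n u v \<Longrightarrow> word_vanishes n u \<longleftrightarrow> word_vanishes n v"
  using word_vanishes_block[of n u v "[]" "[]"] by (simp add: braid_words_def)

section \<open>Words without positive occurrences of a letter\<close>

text \<open>The primitive sits at the vertex \<open>s1\<close>, where \<open>t0\<close> alone is not
  oriented. There the circles of the strands \<open>i\<close> and \<open>i + 1\<close> are one, and
  \<Psi> labels every circle v_-. The edge at \<open>t0\<close> splits this circle, and v_- becomes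
  v_- on both parts, which is \<psi>. Any other edge changes a positive crossing; by assumption it
  belongs to another letter, so it merges two different circles labeled v_- and gives zero.\<close>

theorem negative_word_vanishes:
  assumes w: "w \<in> braid_words n" and i: "(i, False) \<in> set w" "(i, True) \<notin> set w"
  shows "word_vanishes n w"
proof -
  let ?G = "arcs n w"
  obtain t0 where t0: "t0 < length w" "w ! t0 = (i, False)"
    using i(1) by (auto simp: in_set_conv_nth)
  have ri: "i \<in> {1..n}" "Suc i \<in> {1..n}" using braid_word_nth[OF w t0(1)] by (auto simp: t0(2))
  define s1 where "s1 = negatives w - {t0}"
  have neg: "negatives w = insert t0 s1" "t0 \<notin> s1" "s1 \<subseteq> {..<length w}"
    using t0 by (auto simp: s1_def negatives_def)
  define \<Psi> where "\<Psi> = (\<Prod>q\<in>{1..n} - {Suc i}. var (0 :: nat, q))"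
  have o1: "oriented_at w s1 t \<longleftrightarrow> t \<noteq> t0" if "t < length w" for t
    using that t0 by (auto simp: oriented_at_def s1_def negatives_def)
  have col: "((0, p), (t, p)) \<in> equiv_cl (?G s)"
    if o: "\<And>t. t < length w \<Longrightarrow> t \<noteq> t0 \<Longrightarrow> oriented_at w s t" and "t \<le> length w" "p \<in> {1..n}" for s t p
  proof (cases "t \<le> t0")
    case True
    show ?thesis
    proof (rule column_run[where w = w and s = s, OF _ _ that(3)])
      fix u assume "0 \<le> u" "u < t"
      then show "level_arcs n w s u \<subseteq> ?G s \<and> oriented_at w s u"
        using True t0(1) by (intro conjI level_arcs_subset o) auto
    qed simp
  next
    case False
    have "((t, p), (length w, p)) \<in> equiv_cl (?G s)"
    proof (rule column_run[where w = w and s = s, OF that(2) _ that(3)])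
      fix u assume "t \<le> u" "u < length w"
      then show "level_arcs n w s u \<subseteq> ?G s \<and> oriented_at w s u"
        using False by (intro conjI level_arcs_subset o) auto
    qed
    from equiv_cl_sym[OF equiv_cl_trans[OF this closure_equiv[OF that(3)]]] show ?thesis .
  qed
  have cup: "((t0, i), (t0, Suc i)) \<in> equiv_cl (?G s1)"
  proof -
    have "level_arcs n w s1 t0 \<subseteq> ?G s1" by (rule level_arcs_subset[OF t0(1)])
    from level_turns(1)[OF this] show ?thesis using o1[OF t0(1)] by (simp add: t0(2))
  qed
  have col1: "((0, p), (t, p)) \<in> equiv_cl (?G s1)" if "t \<le> length w" "p \<in> {1..n}" for t p
    using o1 that by (intro col) auto
  have bottom: "((0, i), (0, Suc i)) \<in> equiv_cl (?G s1)"
    using equiv_cl_trans[OF equiv_cl_trans[OF col1[OF _ ri(1)] cup] equiv_cl_sym[OF col1[OF _ ri(2)]]] t0(1) by simp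
  define g where "g s = (if s = s1 then \<Psi> else 0)" for s
  have edge: "edge_sum ?G (mark_a w) (mark_b w) g (insert t s1) = scoeff (?G s1) (mark_a w t) (mark_b w t) * \<Psi>"
    if "t \<notin> s1" for t
  proof -
    have fin: "finite s1" using neg(3) by (rule finite_subset) simp
    have "g (insert t s1 - {t'}) = 0" if "t' \<in> s1" for t'
      using that \<open>t \<notin> s1\<close> by (auto simp: g_def)
    then have "(\<Sum>t'\<in>s1. scoeff (?G (insert t s1 - {t'})) (mark_a w t') (mark_b w t') * g (insert t s1 - {t'})) = 0"
      by (intro sum.neutral) simp
    moreover have "insert t s1 - {t} = s1" using that by auto
    ultimately show ?thesis
      unfolding edge_sum_def sum.insert[OF fin that] by (simp add: g_def)
  qed
  have *: "eqm (?G s) (edge_sum ?G (mark_a w) (mark_b w) g s) (if s = negatives w then psi_poly n else 0)"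
    if s: "s \<subseteq> {..<length w}" for s
  proof (cases "\<exists>t\<in>s. s - {t} = s1")
    case False
    then have "s \<noteq> negatives w" using neg by auto
    moreover have "edge_sum ?G (mark_a w) (mark_b w) g s = 0"
      using False unfolding edge_sum_def g_def by (intro sum.neutral) auto
    ultimately show ?thesis by simp
  next
    case True
    then obtain t where t: "t \<notin> s1" "s = insert t s1" "t < length w" using s by auto
    show ?thesis
    proof (cases "t = t0")
      case True
      then have sn: "s = negatives w" using t neg by simp
      have o: "oriented_at w s t" if "t < length w" for t
        using that by (auto simp: sn oriented_at_def negatives_def)
      have linked: "((t0, i), (Suc t0, Suc i)) \<in> equiv_cl (?G s1)"
        using equiv_cl_trans[OF cup equiv_cl_trans[OF equiv_cl_sym[OF col1[OF _ ri(2)]] col1[OF _ ri(2)]]] t0(1) by simp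
      have "\<Psi> = var (0, i) * (\<Prod>q\<in>{1..n} - {Suc i} - {i}. var (0, q))"
        unfolding \<Psi>_def using ri by (intro prod.remove) auto
      then have "var (0, i) * \<Psi> = (var (0, i) * var (0, i)) * (\<Prod>q\<in>{1..n} - {Suc i} - {i}. var (0, q))"
        by (simp only: mult.assoc)
      moreover have "eqm (?G s) ((var (0, i) * var (0, i)) * (\<Prod>q\<in>{1..n} - {Suc i} - {i}. var (0, q)))
          (0 * (\<Prod>q\<in>{1..n} - {Suc i} - {i}. var (0, q)))"
        by (intro eqm_mult eqm_square eqm_refl)
      ultimately have zero: "eqm (?G s) (var (0, i) * \<Psi>) 0" by simp
      have psi: "psi_poly n = var (0, Suc i) * \<Psi>"
        unfolding psi_poly_def \<Psi>_def using ri by (intro prod.remove) auto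
      have "scoeff (?G s1) (mark_a w t0) (mark_b w t0) = var (t0, i) + var (Suc t0, Suc i)"
        using linked by (simp add: scoeff_def t0(2))
      also have "eqm (?G s) \<dots> (var (0, i) + var (0, Suc i))"
        using t0(1) o by (intro eqm_add eqm_var equiv_cl_sym[OF col] ri) auto
      finally have "eqm (?G s) (scoeff (?G s1) (mark_a w t0) (mark_b w t0) * \<Psi>) ((var (0, i) + var (0, Suc i)) * \<Psi>)"
        by (rule eqm_mult) simp
      \<comment> \<open>The first product contains the square of \<open>var (0, i)\<close>; the
        second completes \<Psi> to the whole polynomial.\<close>
      also have "(var (0, i) + var (0, Suc i)) * \<Psi> = var (0, i) * \<Psi> + psi_poly n"
        by (simp only: distrib_right psi)
      also have "eqm (?G s) \<dots> (0 + psi_poly n)"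
        by (intro eqm_add zero eqm_refl)
      finally show ?thesis
        using edge[OF t(1)] by (simp add: True[symmetric] t(2)[symmetric] sn)
    next
      case False
      then have "t0 \<notin> s" using t(2) neg(2) by auto
      then have sn: "s \<noteq> negatives w" using neg by auto
      define j where "j = fst (w ! t)"
      have pos: "w ! t = (j, True)"
        using t False by (auto simp: j_def s1_def negatives_def prod_eq_iff)
      have "(j, True) \<in> set w" using t(3) pos nth_mem by metis
      then have ji: "j \<noteq> i" using i(2) by auto
      have rj: "j \<in> {1..n}" "Suc j \<in> {1..n}" using braid_word_nth[OF w t(3)] by (auto simp: j_def)
      \<comment> \<open>The point \<open>Suc i\<close> is missing from \<Psi> because it lies on the
        circle of \<open>i\<close>; \<rho> replaces it. As \<open>j\<close> differs from
        \<open>i\<close>, the points \<open>\<rho> j\<close> and \<open>\<rho> (Suc j)\<close> give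
        two different factors of \<Psi>, and these are joined after the change at
        \<open>t\<close>.\<close>
      define \<rho> where "\<rho> q = (if q = Suc i then i else q)" for q
      have rho: "((0, \<rho> q), (t, q)) \<in> equiv_cl (?G s1)" if "q \<in> {1..n}" for q
        using equiv_cl_trans[OF bottom col1[of t "Suc i"]] col1[OF _ that] t(3) that by (simp add: \<rho>_def)
      have rho_in: "\<rho> j \<in> {1..n} - {Suc i}" "\<rho> (Suc j) \<in> {1..n} - {Suc i} - {\<rho> j}"
        using rj ri ji by (auto simp: \<rho>_def)
      let ?R = "\<Prod>q\<in>{1..n} - {Suc i} - {\<rho> j} - {\<rho> (Suc j)}. var (0 :: nat, q)"
      have "\<Psi> = var (0, \<rho> j) * (var (0, \<rho> (Suc j)) * ?R)"
        unfolding \<Psi>_def prod.remove[OF finite_Diff[OF finite_atLeastAtMost] rho_in(1)]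
          prod.remove[OF finite_Diff[OF finite_Diff[OF finite_atLeastAtMost]] rho_in(2)] ..
      also have "eqm (?G s1) \<dots> (var (t, j) * (var (t, Suc j) * ?R))"
        by (intro eqm_mult eqm_var rho rj eqm_refl)
      finally have "eqm (?G s1) \<Psi> (var (t, j) * (var (t, Suc j) * ?R))" .
      moreover have "saddle (?G s1) (?G s) (mark_a w t) (mark_b w t)"
        using saddle_cube_arcs[OF w] neg(3) t unfolding saddle_cube_def by blast
      ultimately have "eqm (?G s) (scoeff (?G s1) (mark_a w t) (mark_b w t) * \<Psi>)
          (scoeff (?G s1) (mark_a w t) (mark_b w t) * (var (t, j) * (var (t, Suc j) * ?R)))"
        by (intro scoeff_eqm)
      also have "\<dots> = (var (t, j) * var (t, Suc j)) * (scoeff (?G s1) (mark_a w t) (mark_b w t) * ?R)"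
        by (simp only: mult_ac)
      also have "eqm (?G s) \<dots> (0 * (scoeff (?G s1) (mark_a w t) (mark_b w t) * ?R))"
      proof (rule eqm_mult[OF eqm_square' eqm_refl])
        have "\<not> oriented_at w s t" using t(2) pos by (simp add: oriented_at_def)
        with level_arcs_subset[OF t(3)] have "((t, fst (w ! t)), (t, Suc (fst (w ! t)))) \<in> equiv_cl (?G s)"
          by (rule level_turns(1))
        then show "((t, j), (t, Suc j)) \<in> equiv_cl (?G s)" by (simp add: pos)
      qed
      finally show ?thesis
        using edge[OF t(1)] sn by (simp add: t(2)[symmetric])
    qed
  qed
  show ?thesis
    unfolding word_vanishes_def vanishes_def by (intro exI[of _ g] allI impI *)
qed

lemma psi_trivial_negative:
  assumes "braid_eq n v w" "(i, False) \<in> set v" "(i, True) \<notin> set v"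
  shows "psi n w = \<one>\<^bsub>Kh n w\<^esub>"
proof (rule psi_trivial)
  show "w \<in> braid_words n" using braid_eq_words[OF assms(1)] by blast
  have "word_vanishes n v"
    using braid_eq_words[OF assms(1)] assms(2,3) by (intro negative_word_vanishes) auto
  then show "word_vanishes n w" using word_vanishes_cong[OF assms(1)] by blast
qed

theorem corollary1:
  fixes n :: nat and \<sigma> :: "braid_word set" and w w' :: braid_word
  assumes "n \<ge> 1"
    and "\<sigma> \<in> carrier (braid_group n)"
    and "w \<in> \<sigma>" and "psi n w \<noteq> \<one>\<^bsub>Kh n w\<^esub>"
    and "w' \<in> mirror_braid \<sigma>" and "psi n w' \<noteq> \<one>\<^bsub>Kh n w'\<^esub>"
  shows "\<sigma> = \<one>\<^bsub>braid_group n\<^esub>"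
proof -
  obtain u where u: "u \<in> braid_words n" "\<sigma> = braid_of n u"
    using assms(2) by (auto simp: braid_group_def)
  have uw: "braid_eq n u w"
    using assms(3) by (simp add: u(2) braid_of_def)
  have uw': "braid_eq n (mirror_word u) w'"
    using assms(5) unfolding u(2) mirror_braid_of by (simp add: braid_of_def)
  from braid_trivial_or_one_signed[OF u(1)] have "braid_eq n u []"
  proof
    assume "\<exists>v. braid_eq n u v \<and> one_signed v"
    then obtain v i e where v: "braid_eq n u v" and ie: "(i, e) \<in> set v" "(i, \<not> e) \<notin> set v"
      unfolding one_signed_def by blast
    show ?thesis
    \<comment> \<open>If \<open>e\<close> is positive, the mirror of \<open>v\<close> has the letter
      with negative sign only; otherwise \<open>v\<close> itself does.\<close>
    proof (cases e)
      case True
      have "braid_eq n (mirror_word v) w'"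
        by (rule braid_eq.trans[OF braid_eq.sym[OF braid_eq_mirror_word[OF v]] uw'])
      moreover have "(i, False) \<in> set (mirror_word v)" "(i, True) \<notin> set (mirror_word v)"
        using ie True by (force simp: mirror_word_def)+
      ultimately have "psi n w' = \<one>\<^bsub>Kh n w'\<^esub>" by (rule psi_trivial_negative)
      with assms(6) show ?thesis by contradiction
    next
      case False
      have "braid_eq n v w"
        by (rule braid_eq.trans[OF braid_eq.sym[OF v] uw])
      then have "psi n w = \<one>\<^bsub>Kh n w\<^esub>"
        using ie False by (intro psi_trivial_negative) simp_all
      with assms(4) show ?thesis by contradiction
    qed
  qed
  then have "braid_of n u = braid_of n []"
    unfolding braid_of_eq_iff[OF u(1)] .
  then show ?thesis
    by (simp add: u(2) braid_group_def)
qed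

end
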